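(* Let $F : M \to \Lambda$ be a nondegenerate Legendre immersion. The quartic differential $\mathcal{Q}_F$ is holomorphic if and only if either $F$ is $L$-minimal, in which case the quadratic differential $\mathcal{P}_F$ vanishes identically, or $F$ is locally (i.e. in a neighborhood of each point of $M$) the $T$-transform of an $L$-minimal isothermic immersion (an immersion which is both $L$-minimal and $L$-isothermic).
   Context: Minkowski space. $\mathbb{R}^4_1$ is $\mathbb{R}^4$ with $\langle v,w\rangle=-(v^1w^4+v^4w^1)+v^2w^2+v^3w^3=g_{ij}v^iw^j$, standard basis $\epsilon_1,\dots,\epsilon_4$ (declared positively oriented), and $\mathcal{L}^3_+=\{v\neq 0: \langle v,v\rangle=0,\ \langle v,\epsilon_1+\epsilon_4\rangle<0\}$. The Laguerre group $L=\mathbb{R}^4\rtimes G$, where $G$ is the group of $a\in \mathrm{GL}(4,\mathbb{R})$ preserving $\langle\,,\rangle$, with $\det a=1$ and $a\epsilon_1,a\epsilon_4\in\mathcal{L}^3_+$. An element of $L$ is identified with a Laguerre frame $(x;a_1,\dots,a_4)$: $x\in\mathbb{R}^4_1$ and a positively oriented basis with $\langle a_i,a_j\rangle=g_{ij}$, $a_1,a_4\in\mathcal{L}^3_+$. Laguerre space. $\Lambda$ is the set of isotropic lines $[x,v]=\{x+tv:t\in\mathbb{R}\}$, $x\in\mathbb{R}^4_1$, $v\in\mathcal{L}^3_+$; $L$ acts by $(x,a)\cdot[y,v]=[x+ay,av]$. $\Lambda$ is identified with $\mathbb{R}^3\times S^2$ via $(p,n)\mapsto[x(p),v(n)]$, $x(p)=\left(\tfrac{p^1}{\sqrt2},p^2,p^3,-\tfrac{p^1}{\sqrt2}\right)$,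 $v(n)=\left(\tfrac{1+n^1}{2},\tfrac{n^2}{\sqrt2},\tfrac{n^3}{\sqrt2},\tfrac{1-n^1}{2}\right)$. A Legendre immersion of a surface $M$ is an immersion $F=(f,n):M\to\Lambda\cong\mathbb{R}^3\times S^2$ with $df\cdot n=0$; it is always assumed that $dn\cdot dn>0$. $F$ is nondegenerate if $df\cdot dn$ and $dn\cdot dn$ are everywhere linearly independent. Two Legendre immersions $F:M\to\Lambda$, $F':M'\to\Lambda$ are Laguerre equivalent if $F'\circ\phi=A F$ for a diffeomorphism $\phi:M\to M'$ and some $A\in L$. Surfaces are connected. Middle frame. Along a nondegenerate $F$ there locally exists a middle frame field: a smooth map $A=(a_0;a_1,\dots,a_4)$ into $L$ with $F=[a_0,a_1]$ and, for 1-forms $\alpha^2_0,\alpha^3_0$ (linearly independent) and functions $p_1,p_2,p_3,q_1,q_2$, with $\alpha^1_1=2q_2\alpha^2_0-2q_1\alpha^3_0$: $da_0=\alpha^2_0a_2+\alpha^3_0a_3$, $da_1=\alpha^1_1a_1+\alpha^2_0a_2-\alpha^3_0a_3$, $da_2=(p_1\alpha^2_0+p_2\alpha^3_0)a_1+(q_1\alpha^2_0+q_2\alpha^3_0)a_3+\alpha^2_0a_4$, $da_3=(p_2\alpha^2_0+p_3\alpha^3_0)a_1-(q_1\alpha^2_0+q_2\alpha^3_0)a_2-\alpha^3_0a_4$, $da_4=(p_1\alpha^2_0+p_2\alpha^3_0)a_2+(p_2\alpha^2_0+p_3\alpha^3_0)a_3-\alpha^1_1a_4$. It is unique up to $(a_2,a_3)\mapsto(-a_2,-a_3)$,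 so $p_1,p_2,p_3$ are globally defined. $M$ is oriented so that $\alpha^2_0\wedge\alpha^3_0>0$ and is regarded as a Riemann surface for which $\varphi=\alpha^2_0+i\alpha^3_0$ is of type $(1,0)$. Define the global differentials $\mathcal{Q}_F=Q\varphi^4$, $Q=\tfrac12(p_1-p_3)-ip_2$, and $\mathcal{P}_F=P\varphi^2$, $P=p_1+p_3$. $L$-minimal: $F$ is $L$-minimal if $p_1+p_3\equiv0$ (equivalently, it is a critical point of $\int(H^2/K-1)\,dA$). $L$-isothermic: $F$ is $L$-isothermic if near each point there are coordinates that diagonalize both $(\alpha^2_0)^2+(\alpha^3_0)^2$ and $(\alpha^2_0)^2-(\alpha^3_0)^2$ and are isothermal for the first; equivalently $p_2\equiv0$. Then locally there are coordinates $z=x+iy$ (an isothermic chart) with $\alpha^2_0=e^u\,dx$, $\alpha^3_0=e^u\,dy$; the function $\Phi=e^u$ is the Blaschke potential. Two $L$-isothermic immersions (of the same domain, with common isothermic chart) that are not Laguerre equivalent are $T$-transforms of each other if they have the same Blaschke potential. *)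

theory Defs
  imports "HOL-Analysis.Analysis"
begin

section \<open>Smooth maps and smooth surfaces\<close>

text \<open>
  The derivatives are taken at, not within, points of \<open>S\<close>, so \<open>S\<close> is meant to be open.
\<close>

fun Ck_on :: "nat \<Rightarrow> 'a::real_normed_vector set \<Rightarrow> ('a \<Rightarrow> 'b::real_normed_vector) \<Rightarrow> bool" where
  "Ck_on 0 S f \<longleftrightarrow> continuous_on S f"
| "Ck_on (Suc k) S f \<longleftrightarrow>
     (\<forall>x\<in>S. f differentiable (at x)) \<and> (\<forall>v. Ck_on k S (\<lambda>x. frechet_derivative f (at x) v))"

definition smooth_on :: "'a::real_normed_vector set \<Rightarrow> ('a \<Rightarrow> 'b::real_normed_vector) \<Rightarrow> bool" where
  "smooth_on S f \<longleftrightarrow> (\<forall>k. Ck_on k S f)"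

text \<open>
  A chart \<open>(U, z)\<close> has values in \<open>\<complex> = \<real>\<^sup>2\<close>, with real coordinates \<open>x = Re z\<close> and \<open>y = Im z\<close>.
  Compatibility of charts is real smoothness, so an atlas carries no complex structure.
\<close>

type_synonym 'm chart = "'m set \<times> ('m \<Rightarrow> complex)"

definition is_chart :: "'m::topological_space chart \<Rightarrow> bool" where
  "is_chart = (\<lambda>(U, z). open U \<and> open (z ` U) \<and> homeomorphism U (z ` U) z (inv_into U z))"

definition compatible :: "'m chart \<Rightarrow> 'm chart \<Rightarrow> bool" where
  "compatible = (\<lambda>(U, z) (U', z').
     smooth_on (z ` (U \<inter> U')) (z' \<circ> inv_into U z) \<and>
     smooth_on (z' ` (U \<inter> U')) (z \<circ> inv_into U' z'))"

definition smooth_surface :: "'m::topological_space chart set \<Rightarrow> bool" where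
  "smooth_surface \<A> \<longleftrightarrow>
     (\<forall>c\<in>\<A>. is_chart c) \<and> (\<forall>c\<in>\<A>. \<forall>c'\<in>\<A>. compatible c c') \<and> (\<Union>c\<in>\<A>. fst c) = UNIV"

text \<open>The maximal atlas; in particular it is closed under restriction to open subsets.\<close>

definition charts :: "'m::topological_space chart set \<Rightarrow> 'm chart set" where
  "charts \<A> = {c. is_chart c \<and> (\<forall>c'\<in>\<A>. compatible c c')}"

definition smooth_fun_on ::
    "'m::topological_space chart set \<Rightarrow> 'm set \<Rightarrow> ('m \<Rightarrow> 'b::real_normed_vector) \<Rightarrow> bool" where
  "smooth_fun_on \<A> S g \<longleftrightarrow> (\<forall>(U, z)\<in>charts \<A>. smooth_on (z ` (U \<inter> S)) (g \<circ> inv_into U z))"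

definition smooth_map_on ::
    "'m::topological_space chart set \<Rightarrow> 'm set \<Rightarrow> 'n::topological_space chart set \<Rightarrow> ('m \<Rightarrow> 'n) \<Rightarrow> bool" where
  "smooth_map_on \<A> S \<A>' \<phi> \<longleftrightarrow>
     continuous_on S \<phi> \<and> (\<forall>(U, z)\<in>charts \<A>'. smooth_fun_on \<A> (S \<inter> \<phi> -` U) (z \<circ> \<phi>))"

definition diffeo ::
    "'m::topological_space chart set \<Rightarrow> 'm set \<Rightarrow> 'n::topological_space chart set \<Rightarrow> 'n set \<Rightarrow> ('m \<Rightarrow> 'n) \<Rightarrow> bool" where
  "diffeo \<A> S \<A>' S' \<phi> \<longleftrightarrow>
     bij_betw \<phi> S S' \<and> smooth_map_on \<A> S \<A>' \<phi> \<and> smooth_map_on \<A>' S' \<A> (inv_into S \<phi>)"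

text \<open>
  In the chart \<open>(U, z)\<close> a tangent vector at \<open>q \<in> U\<close> is represented by its coordinates \<open>w \<in> \<complex>\<close>,
  and a 1-form on \<open>U\<close> by a function \<open>\<alpha>\<close> for which \<open>\<alpha> q\<close> is linear.
  \<open>dif (U, z) g q w\<close> is \<open>dg\<close> at \<open>q\<close>, applied to the tangent vector with coordinates \<open>w\<close>.
\<close>

definition dif :: "'m chart \<Rightarrow> ('m \<Rightarrow> 'b::real_normed_vector) \<Rightarrow> 'm \<Rightarrow> complex \<Rightarrow> 'b" where
  "dif = (\<lambda>(U, z) g q w. frechet_derivative (g \<circ> inv_into U z) (at (z q)) w)"


section \<open>Laguerre geometry\<close>

definition mink :: "real^4 \<Rightarrow> real^4 \<Rightarrow> real" where
  "mink v w = - (v$1 * w$4 + v$4 * w$1) + v$2 * w$2 + v$3 * w$3"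

definition lightcone :: "(real^4) set" where
  "lightcone = {v. v \<noteq> 0 \<and> mink v v = 0 \<and> mink v (axis 1 1 + axis 4 1) < 0}"

text \<open>
  An element \<open>(x, a)\<close> of the group is identified with the frame \<open>(x; a\<^sub>1, \<dots>, a\<^sub>4)\<close> whose vectors
  are the columns of \<open>a\<close>.
\<close>

definition laguerre_group :: "((real^4) \<times> (real^4^4)) set" where
  "laguerre_group = {(x, a).
     (\<forall>v w. mink (a *v v) (a *v w) = mink v w) \<and> det a = 1 \<and>
     a *v axis 1 1 \<in> lightcone \<and> a *v axis 4 1 \<in> lightcone}"

definition isotropic_line :: "real^4 \<Rightarrow> real^4 \<Rightarrow> (real^4) set" where
  "isotropic_line x v = {x + t *\<^sub>R v | t. True}"

definition Laguerre_space :: "(real^4) set set" where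
  "Laguerre_space = {isotropic_line x v | x v. v \<in> lightcone}"

definition laguerre_act :: "(real^4) \<times> (real^4^4) \<Rightarrow> (real^4) set \<Rightarrow> (real^4) set" where
  "laguerre_act = (\<lambda>(x, a) l. (\<lambda>y. x + a *v y) ` l)"

lemma laguerre_act_isotropic_line:
  "laguerre_act (x, a) (isotropic_line y v) = isotropic_line (x + a *v y) (a *v v)"
  by (force simp: laguerre_act_def isotropic_line_def image_iff matrix_vector_right_distrib
        matrix_vector_mult_scaleR add.assoc)

definition pt_of :: "real^3 \<Rightarrow> real^4" where
  "pt_of p = vector [p$1 / sqrt 2, p$2, p$3, - p$1 / sqrt 2]"

definition dir_of :: "real^3 \<Rightarrow> real^4" where
  "dir_of n = vector [(1 + n$1) / 2, n$2 / sqrt 2, n$3 / sqrt 2, (1 - n$1) / 2]"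

text \<open>
  Maps into the Laguerre space are given as maps \<open>F = (f, n)\<close> into \<open>\<real>\<^sup>3 \<times> S\<^sup>2\<close>;
  \<open>lag_line (F q)\<close> is the corresponding isotropic line.
\<close>

definition lag_line :: "(real^3) \<times> (real^3) \<Rightarrow> (real^4) set" where
  "lag_line = (\<lambda>(p, n). isotropic_line (pt_of p) (dir_of n))"

lemma vec4_nth [simp]:
  "(vector [a, b, c, d] :: 'a::zero^4) $ 1 = a"
  "(vector [a, b, c, d] :: 'a::zero^4) $ 2 = b"
  "(vector [a, b, c, d] :: 'a::zero^4) $ 3 = c"
  "(vector [a, b, c, d] :: 'a::zero^4) $ 4 = d"
  by (simp_all add: vector_def)

lemma vec4_eq_iff: "(v :: 'a^4) = w \<longleftrightarrow> v$1 = w$1 \<and> v$2 = w$2 \<and> v$3 = w$3 \<and> v$4 = w$4"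
  by (auto simp: vec_eq_iff forall_4)

lemma lightcone_iff:
  "v \<in> lightcone \<longleftrightarrow> 2 * (v$1 * v$4) = (v$2)\<^sup>2 + (v$3)\<^sup>2 \<and> v$1 + v$4 > 0"
  by (auto simp: lightcone_def mink_def axis_def vec4_eq_iff power2_eq_square algebra_simps)

lemma isotropic_line_shift: "isotropic_line (x + t *\<^sub>R v) v = isotropic_line x v"
proof -
  have "x + t *\<^sub>R v + s *\<^sub>R v = x + (t + s) *\<^sub>R v" for s by (simp add: algebra_simps)
  moreover have "x + s *\<^sub>R v = x + t *\<^sub>R v + (s - t) *\<^sub>R v" for s by (simp add: algebra_simps)
  ultimately show ?thesis unfolding isotropic_line_def by blast
qed

lemma isotropic_line_scale: "c \<noteq> 0 \<Longrightarrow> isotropic_line x (c *\<^sub>R v) = isotropic_line x v"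
  unfolding isotropic_line_def
  by (auto, metis nonzero_divide_eq_eq)

lemma norm3_iff: "(n :: real^3) \<in> sphere 0 1 \<longleftrightarrow> (n$1)\<^sup>2 + (n$2)\<^sup>2 + (n$3)\<^sup>2 = 1"
  by (simp add: norm_vec_def L2_set_def sum_3)

lemma dir_of_lightcone: "n \<in> sphere 0 1 \<Longrightarrow> dir_of n \<in> lightcone"
  unfolding norm3_iff lightcone_iff dir_of_def
  by (simp add: power_divide flip: add_divide_distrib) (simp add: power2_eq_square algebra_simps)

theorem Laguerre_space_identification:
  "bij_betw lag_line (UNIV \<times> sphere 0 1) Laguerre_space"
proof (rule bij_betw_imageI)
  show "inj_on lag_line (UNIV \<times> sphere 0 1)"
  proof (rule inj_onI, clarify)
    fix p n p' n' :: "real^3"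
    assume n: "n \<in> sphere 0 1" "n' \<in> sphere 0 1" and eq: "lag_line (p, n) = lag_line (p', n')"
    have mem: "y \<in> lag_line (p, n) \<longleftrightarrow> (\<exists>t. y = pt_of p + t *\<^sub>R dir_of n)"
         "y \<in> lag_line (p', n') \<longleftrightarrow> (\<exists>t. y = pt_of p' + t *\<^sub>R dir_of n')" for y
      by (auto simp: lag_line_def isotropic_line_def)
    obtain s where s: "pt_of p = pt_of p' + s *\<^sub>R dir_of n'"
      using mem[of "pt_of p"] eq by (metis add.right_neutral scaleR_zero_left)
    have s0: "s = 0"
      using arg_cong[OF s, of "\<lambda>v. v$1 + v$4"] by (simp add: pt_of_def dir_of_def field_simps)
    obtain t where t: "pt_of p + dir_of n = pt_of p' + t *\<^sub>R dir_of n'"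
      using mem[of "pt_of p + dir_of n"] eq by (metis scaleR_one)
    have t1: "t = 1"
      using arg_cong[OF t, of "\<lambda>v. v$1 + v$4"] by (simp add: pt_of_def dir_of_def field_simps)
    have "pt_of p = pt_of p'" "dir_of n = dir_of n'" using s s0 t t1 by simp_all
    then show "p = p' \<and> n = n'"
      by (simp add: pt_of_def dir_of_def vec4_eq_iff vec_eq_iff forall_3)
  qed
  show "lag_line ` (UNIV \<times> sphere 0 1) = Laguerre_space"
  proof (intro equalityI subsetI)
    fix l assume "l \<in> lag_line ` (UNIV \<times> sphere 0 1)"
    then show "l \<in> Laguerre_space"
      using dir_of_lightcone by (fastforce simp: lag_line_def Laguerre_space_def)
  next
    fix l assume "l \<in> Laguerre_space"
    then obtain x v where v: "v \<in> lightcone" and l: "l = isotropic_line x v"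
      by (auto simp: Laguerre_space_def)
    define c where "c = v$1 + v$4"
    have c: "c > 0" and q: "2 * (v$1 * v$4) = (v$2)\<^sup>2 + (v$3)\<^sup>2"
      using v by (auto simp: lightcone_iff c_def)
    define n :: "real^3" where
      "n = vector [(v$1 - v$4) / c, sqrt 2 * v$2 / c, sqrt 2 * v$3 / c]"
    define y where "y = x + (- (x$1 + x$4) / c) *\<^sub>R v"
    define p :: "real^3" where "p = vector [sqrt 2 * y$1, y$2, y$3]"
    have "(v$1 - v$4)\<^sup>2 + 2 * (v$2)\<^sup>2 + 2 * (v$3)\<^sup>2 = c\<^sup>2"
      using q by (simp add: c_def power2_eq_square algebra_simps)
    then have n1: "n \<in> sphere 0 1"
      using c unfolding norm3_iff n_def
      by (simp add: power_divide power_mult_distrib flip: add_divide_distrib)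
    have d: "dir_of n = (1 / c) *\<^sub>R v"
      using c by (simp add: vec4_eq_iff dir_of_def n_def field_simps) (simp add: c_def algebra_simps)
    have "y$1 + y$4 = 0" using c by (simp add: y_def c_def field_simps)
    then have "pt_of p = y" by (simp add: vec4_eq_iff pt_of_def p_def)
    then have "lag_line (p, n) = l"
      using c by (simp add: lag_line_def d isotropic_line_scale l y_def isotropic_line_shift)
    then show "l \<in> lag_line ` (UNIV \<times> sphere 0 1)" using n1 by force
  qed
qed


section \<open>Legendre immersions\<close>

text \<open>
  An open subset \<open>S\<close> of a surface is itself a surface, so that all notions are defined for
  (the restriction to) an open domain \<open>S\<close>.
\<close>

definition legendre_immersion ::
    "'m::topological_space chart set \<Rightarrow> 'm set \<Rightarrow> ('m \<Rightarrow> (real^3) \<times> (real^3)) \<Rightarrow> bool" where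
  "legendre_immersion \<A> S F \<longleftrightarrow>
     F ` S \<subseteq> UNIV \<times> sphere 0 1 \<and> smooth_fun_on \<A> S F \<and>
     (\<forall>c\<in>charts \<A>. \<forall>q\<in>fst c \<inter> S.
        inj (dif c F q) \<and>
        (\<forall>w. dif c (fst \<circ> F) q w \<bullet> snd (F q) = 0) \<and>
        (\<forall>w. w \<noteq> 0 \<longrightarrow> dif c (snd \<circ> F) q w \<bullet> dif c (snd \<circ> F) q w > 0))"

text \<open>
  Two symmetric bilinear forms are linearly independent iff their quadratic forms are, so
  \<open>df \<cdot> dn\<close> and \<open>dn \<cdot> dn\<close> are represented by their quadratic forms.
\<close>

definition nondegenerate ::
    "'m::topological_space chart set \<Rightarrow> 'm set \<Rightarrow> ('m \<Rightarrow> (real^3) \<times> (real^3)) \<Rightarrow> bool" where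
  "nondegenerate \<A> S F \<longleftrightarrow>
     (\<forall>c\<in>charts \<A>. \<forall>q\<in>fst c \<inter> S. \<forall>r s.
        (\<forall>w. r * (dif c (fst \<circ> F) q w \<bullet> dif c (snd \<circ> F) q w) +
             s * (dif c (snd \<circ> F) q w \<bullet> dif c (snd \<circ> F) q w) = 0)
        \<longrightarrow> r = 0 \<and> s = 0)"

definition laguerre_equivalent ::
    "'m::topological_space chart set \<Rightarrow> 'm set \<Rightarrow> ('m \<Rightarrow> (real^3) \<times> (real^3)) \<Rightarrow>
     'n::topological_space chart set \<Rightarrow> 'n set \<Rightarrow> ('n \<Rightarrow> (real^3) \<times> (real^3)) \<Rightarrow> bool" where
  "laguerre_equivalent \<A> S F \<A>' S' F' \<longleftrightarrow>
     (\<exists>\<phi>. diffeo \<A> S \<A>' S' \<phi> \<and>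
       (\<exists>A\<in>laguerre_group. \<forall>q\<in>S. lag_line (F' (\<phi> q)) = laguerre_act A (lag_line (F q))))"


section \<open>Middle frames and the invariant differentials\<close>

text \<open>
  \<open>A\<close> is a middle frame field along \<open>F\<close> on the chart domain \<open>U\<close>. The 1-forms
  \<open>\<alpha>\<close>, \<open>\<beta>\<close>, \<open>\<gamma>\<close> are \<open>\<alpha>\<^sup>2\<^sub>0\<close>, \<open>\<alpha>\<^sup>3\<^sub>0\<close>, \<open>\<alpha>\<^sup>1\<^sub>1\<close>, and \<open>a i\<close> is the i-th vector of the frame.
\<close>

definition middle_frame ::
    "'m::topological_space chart set \<Rightarrow> 'm chart \<Rightarrow> ('m \<Rightarrow> (real^3) \<times> (real^3)) \<Rightarrow>
     ('m \<Rightarrow> (real^4) \<times> (real^4^4)) \<Rightarrow> ('m \<Rightarrow> complex \<Rightarrow> real) \<Rightarrow> ('m \<Rightarrow> complex \<Rightarrow> real) \<Rightarrow>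
     ('m \<Rightarrow> real) \<Rightarrow> ('m \<Rightarrow> real) \<Rightarrow> ('m \<Rightarrow> real) \<Rightarrow> ('m \<Rightarrow> real) \<Rightarrow> ('m \<Rightarrow> real) \<Rightarrow> bool" where
  "middle_frame \<A> c F A \<alpha> \<beta> p1 p2 p3 q1 q2 \<longleftrightarrow>
     c \<in> charts \<A> \<and> smooth_fun_on \<A> (fst c) A \<and>
     (let a0 = (\<lambda>q. fst (A q));
          a = (\<lambda>i q. column i (snd (A q)));
          \<gamma> = (\<lambda>q w. 2 * q2 q * \<alpha> q w - 2 * q1 q * \<beta> q w)
      in \<forall>q\<in>fst c.
        A q \<in> laguerre_group \<and>
        lag_line (F q) = isotropic_line (a0 q) (a 1 q) \<and>
        linear (\<alpha> q) \<and> linear (\<beta> q) \<and>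
        (\<forall>r s. (\<forall>w. r * \<alpha> q w + s * \<beta> q w = 0) \<longrightarrow> r = 0 \<and> s = 0) \<and>
        (\<forall>w.
          dif c a0 q w = \<alpha> q w *\<^sub>R a 2 q + \<beta> q w *\<^sub>R a 3 q \<and>
          dif c (a 1) q w = \<gamma> q w *\<^sub>R a 1 q + \<alpha> q w *\<^sub>R a 2 q - \<beta> q w *\<^sub>R a 3 q \<and>
          dif c (a 2) q w = (p1 q * \<alpha> q w + p2 q * \<beta> q w) *\<^sub>R a 1 q
                          + (q1 q * \<alpha> q w + q2 q * \<beta> q w) *\<^sub>R a 3 q + \<alpha> q w *\<^sub>R a 4 q \<and>
          dif c (a 3) q w = (p2 q * \<alpha> q w + p3 q * \<beta> q w) *\<^sub>R a 1 q
                          - (q1 q * \<alpha> q w + q2 q * \<beta> q w) *\<^sub>R a 2 q - \<beta> q w *\<^sub>R a 4 q \<and>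
          dif c (a 4) q w = (p1 q * \<alpha> q w + p2 q * \<beta> q w) *\<^sub>R a 2 q
                          + (p2 q * \<alpha> q w + p3 q * \<beta> q w) *\<^sub>R a 3 q - \<gamma> q w *\<^sub>R a 4 q))"

text \<open>
  \<open>middle_at \<A> F z q \<phi> r1 r2 r3\<close>: some middle frame field near \<open>q\<close> has at \<open>q\<close>, in terms of the
  coordinate \<open>z\<close>, the form \<open>\<phi> = \<alpha>\<^sup>2\<^sub>0 + \<i> \<alpha>\<^sup>3\<^sub>0\<close> and the invariants \<open>r1, r2, r3\<close>. For nondegenerate \<open>F\<close>
  the invariants are unique, and \<open>\<phi>\<close> is unique up to sign, which the even powers below cancel.
\<close>

definition middle_at ::
    "'m::topological_space chart set \<Rightarrow> ('m \<Rightarrow> (real^3) \<times> (real^3)) \<Rightarrow> ('m \<Rightarrow> complex) \<Rightarrow> 'm \<Rightarrow>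
     (complex \<Rightarrow> complex) \<Rightarrow> real \<Rightarrow> real \<Rightarrow> real \<Rightarrow> bool" where
  "middle_at \<A> F z q \<phi> r1 r2 r3 \<longleftrightarrow>
     (\<exists>V A \<alpha> \<beta> p1 p2 p3 q1 q2.
        q \<in> V \<and> middle_frame \<A> (V, z) F A \<alpha> \<beta> p1 p2 p3 q1 q2 \<and>
        \<phi> = (\<lambda>w. Complex (\<alpha> q w) (\<beta> q w)) \<and> r1 = p1 q \<and> r2 = p2 q \<and> r3 = p3 q)"

definition P_inv :: "'m::topological_space chart set \<Rightarrow> ('m \<Rightarrow> (real^3) \<times> (real^3)) \<Rightarrow> 'm \<Rightarrow> real" where
  "P_inv \<A> F q = (THE s. \<exists>z \<phi> r1 r2 r3. middle_at \<A> F z q \<phi> r1 r2 r3 \<and> s = r1 + r3)"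

definition Q_inv :: "'m::topological_space chart set \<Rightarrow> ('m \<Rightarrow> (real^3) \<times> (real^3)) \<Rightarrow> 'm \<Rightarrow> complex" where
  "Q_inv \<A> F q =
     (THE s. \<exists>z \<phi> r1 r2 r3. middle_at \<A> F z q \<phi> r1 r2 r3 \<and> s = Complex ((r1 - r3) / 2) (- r2))"

text \<open>
  The values of the differentials at \<open>q\<close> on the tangent vector with coordinates \<open>w\<close> in the
  coordinate \<open>z\<close>.
\<close>

definition Q_diff ::
    "'m::topological_space chart set \<Rightarrow> ('m \<Rightarrow> (real^3) \<times> (real^3)) \<Rightarrow> ('m \<Rightarrow> complex) \<Rightarrow> 'm \<Rightarrow> complex \<Rightarrow> complex" where
  "Q_diff \<A> F z q w =
     (THE s. \<exists>\<phi> r1 r2 r3. middle_at \<A> F z q \<phi> r1 r2 r3 \<and> s = Q_inv \<A> F q * \<phi> w ^ 4)"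

definition P_diff ::
    "'m::topological_space chart set \<Rightarrow> ('m \<Rightarrow> (real^3) \<times> (real^3)) \<Rightarrow> ('m \<Rightarrow> complex) \<Rightarrow> 'm \<Rightarrow> complex \<Rightarrow> complex" where
  "P_diff \<A> F z q w =
     (THE s. \<exists>\<phi> r1 r2 r3. middle_at \<A> F z q \<phi> r1 r2 r3 \<and> s = of_real (P_inv \<A> F q) * \<phi> w ^ 2)"

text \<open>
  The charts \<open>z\<close> of the Riemann surface are those for which \<open>\<phi>\<close> is of type \<open>(1,0)\<close>, i.e.
  \<open>\<phi> = l dz\<close>. This includes the orientation, since then \<open>\<alpha>\<^sup>2\<^sub>0 \<and> \<alpha>\<^sup>3\<^sub>0 = \<bar>l\<bar>\<^sup>2 dx \<and> dy\<close>.
\<close>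

definition complex_chart :: "'m::topological_space chart set \<Rightarrow> ('m \<Rightarrow> (real^3) \<times> (real^3)) \<Rightarrow> 'm chart \<Rightarrow> bool" where
  "complex_chart \<A> F = (\<lambda>(U, z). (U, z) \<in> charts \<A> \<and>
     (\<forall>q\<in>U. \<exists>\<phi> r1 r2 r3 l. middle_at \<A> F z q \<phi> r1 r2 r3 \<and> (\<forall>w. \<phi> w = l * w)))"

text \<open>
  In a complex chart \<open>z\<close> the quartic differential is \<open>h dz\<^sup>4\<close>, where \<open>h\<close> is its value on the
  coordinate vector \<open>w = 1\<close>.
\<close>

definition Q_holomorphic :: "'m::topological_space chart set \<Rightarrow> ('m \<Rightarrow> (real^3) \<times> (real^3)) \<Rightarrow> bool" where
  "Q_holomorphic \<A> F \<longleftrightarrow>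
     (\<forall>U z. complex_chart \<A> F (U, z) \<longrightarrow>
        (\<lambda>\<zeta>. Q_diff \<A> F z (inv_into U z \<zeta>) 1) holomorphic_on z ` U)"

definition P_vanishes :: "'m::topological_space chart set \<Rightarrow> ('m \<Rightarrow> (real^3) \<times> (real^3)) \<Rightarrow> bool" where
  "P_vanishes \<A> F \<longleftrightarrow> (\<forall>(U, z)\<in>charts \<A>. \<forall>q\<in>U. \<forall>w. P_diff \<A> F z q w = 0)"


section \<open>L-minimal and L-isothermic immersions, T-transforms\<close>

definition L_minimal :: "'m::topological_space chart set \<Rightarrow> 'm set \<Rightarrow> ('m \<Rightarrow> (real^3) \<times> (real^3)) \<Rightarrow> bool" where
  "L_minimal \<A> S F \<longleftrightarrow> (\<forall>q\<in>S. P_inv \<A> F q = 0)"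

definition diagonal_form :: "(complex \<Rightarrow> real) \<Rightarrow> bool" where
  "diagonal_form b \<longleftrightarrow> (\<exists>E G. \<forall>w. b w = E * (Re w)\<^sup>2 + G * (Im w)\<^sup>2)"

definition isothermal_form :: "(complex \<Rightarrow> real) \<Rightarrow> bool" where
  "isothermal_form b \<longleftrightarrow> (\<exists>E. \<forall>w. b w = E * ((Re w)\<^sup>2 + (Im w)\<^sup>2))"

definition L_isothermic :: "'m::topological_space chart set \<Rightarrow> 'm set \<Rightarrow> ('m \<Rightarrow> (real^3) \<times> (real^3)) \<Rightarrow> bool" where
  "L_isothermic \<A> S F \<longleftrightarrow>
     (\<forall>q\<in>S. \<exists>V z A \<alpha> \<beta> p1 p2 p3 q1 q2.
        q \<in> V \<and> V \<subseteq> S \<and> middle_frame \<A> (V, z) F A \<alpha> \<beta> p1 p2 p3 q1 q2 \<and>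
        (\<forall>r\<in>V. diagonal_form (\<lambda>w. (\<alpha> r w)\<^sup>2 + (\<beta> r w)\<^sup>2) \<and>
                diagonal_form (\<lambda>w. (\<alpha> r w)\<^sup>2 - (\<beta> r w)\<^sup>2) \<and>
                isothermal_form (\<lambda>w. (\<alpha> r w)\<^sup>2 + (\<beta> r w)\<^sup>2)))"

definition isothermic_chart ::
    "'m::topological_space chart set \<Rightarrow> ('m \<Rightarrow> (real^3) \<times> (real^3)) \<Rightarrow> 'm chart \<Rightarrow> ('m \<Rightarrow> real) \<Rightarrow> bool" where
  "isothermic_chart \<A> F c u \<longleftrightarrow>
     (\<exists>A \<alpha> \<beta> p1 p2 p3 q1 q2.
        middle_frame \<A> c F A \<alpha> \<beta> p1 p2 p3 q1 q2 \<and>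
        (\<forall>q\<in>fst c. \<forall>w. \<alpha> q w = exp (u q) * Re w \<and> \<beta> q w = exp (u q) * Im w))"

text \<open>The common Blaschke potential is \<open>e\<^sup>u\<close>.\<close>

definition T_transforms ::
    "'m::topological_space chart set \<Rightarrow> 'm set \<Rightarrow> ('m \<Rightarrow> (real^3) \<times> (real^3)) \<Rightarrow> ('m \<Rightarrow> (real^3) \<times> (real^3)) \<Rightarrow> bool" where
  "T_transforms \<A> S F F' \<longleftrightarrow>
     legendre_immersion \<A> S F \<and> nondegenerate \<A> S F \<and> L_isothermic \<A> S F \<and>
     legendre_immersion \<A> S F' \<and> nondegenerate \<A> S F' \<and> L_isothermic \<A> S F' \<and>
     \<not> laguerre_equivalent \<A> S F \<A> S F' \<and>
     (\<exists>z u. isothermic_chart \<A> F (S, z) u \<and> isothermic_chart \<A> F' (S, z) u)"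

definition locally_T_transform_of_L_minimal_isothermic ::
    "'m::topological_space chart set \<Rightarrow> ('m \<Rightarrow> (real^3) \<times> (real^3)) \<Rightarrow> bool" where
  "locally_T_transform_of_L_minimal_isothermic \<A> F \<longleftrightarrow>
     (\<forall>q. \<exists>S F'. q \<in> S \<and> open S \<and> connected S \<and>
        L_minimal \<A> S F' \<and> L_isothermic \<A> S F' \<and> T_transforms \<A> S F F')"

end

theory Submission
  imports Defs "HOL-Complex_Analysis.Conformal_Mappings"
begin

text \<open>
  Let \<open>z\<close> be a complex coordinate, \<open>\<phi> = l dz\<close>. The structure equations of a middle frame express
  \<open>\<partial>(Q l\<^sup>4)/\<partial>z*\<close> through \<open>\<partial>(P l\<^sup>2)/\<partial>z*\<close>, the star denoting conjugation, so that the quartic differential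
  is holomorphic iff the quadratic one is. As \<open>P\<close> is real, a holomorphic \<open>P l\<^sup>2\<close> vanishes identically or
  has no zeros. In the latter case a primitive of \<open>\<bar>P\<bar>\<^sup>1\<^sup>/\<^sup>2 l\<close> is an isothermic chart with Blaschke
  potential \<open>e\<^sup>u = \<bar>P\<bar>\<^sup>-\<^sup>1\<^sup>/\<^sup>2\<close>, in which the quartic differential is a multiple of \<open>e\<^sup>2\<^sup>u \<Delta>u dz\<^sup>4\<close>; it is real and
  holomorphic, hence \<open>e\<^sup>2\<^sup>u \<Delta>u\<close> is constant. This is Liouville's equation for \<open>- u\<close>. From its developing map, a
  quotient of solutions of a linear equation \<open>w'' = h w\<close> with holomorphic \<open>h\<close>, one obtains a
  null curve and an L-minimal isothermic immersion with the same potential; it is not Laguerre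
  equivalent to the given one, because \<open>P\<close> is an invariant. Conversely the potential
  determines \<open>Q\<close> of an isothermic immersion, so \<open>T\<close>-transforms have the same quartic differential.
\<close>

section \<open>Smooth functions\<close>

text \<open>All invariants are definite descriptions over middle frames, so nothing can be evaluated
  before local existence and uniqueness of such frames on the bare surface are known. Existence
  needs coordinates that are conformal for \<open>\<alpha>^2 + \<beta>^2\<close>. These come for
  free: up to a positive factor this form is the pull-back of the round metric by the Gauss map, so
  a stereographic coordinate of \<open>n\<close> is conformal, and no Beltrami equation has to be
  solved. In such a coordinate the null direction is, up to scale, N = psi psi^H with a holomorphic
  spinor psi = (\<open>w1\<close>, \<open>w2\<close>) of Wronskian 1. The Liouville step has the
  same shape, with both components of psi solving w'' = h w; one construction, from N and a base
  point \<open>a0\<close> to a middle frame, therefore serves both. With h = u_zz + (u_z)^2 the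
  identity N_zz = h N is exactly what makes 2 e^u (N_zbar - u_zbar N) holomorphic, and
  \<open>a0\<close> is the real part of a primitive of it. That this \<open>a0\<close> is harmonic
  is what kills P.\<close>

definition pd :: "'a::real_normed_vector \<Rightarrow> ('a \<Rightarrow> 'b::real_normed_vector) \<Rightarrow> 'a \<Rightarrow> 'b" where
  "pd v f x = frechet_derivative f (at x) v"

lemma has_derivative_cong_open:
  assumes "open S" "x \<in> S" "\<And>y. y \<in> S \<Longrightarrow> f y = g y"
  shows "(f has_derivative f') (at x) \<longleftrightarrow> (g has_derivative f') (at x)"
  using assms has_derivative_transform_within_open by metis

lemma differentiable_cong_open:
  assumes "open S" "x \<in> S" "\<And>y. y \<in> S \<Longrightarrow> f y = g y"
  shows "f differentiable (at x) \<longleftrightarrow> g differentiable (at x)"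
  unfolding differentiable_def using has_derivative_cong_open[OF assms] by simp

lemma pd_cong_open:
  assumes "open S" "x \<in> S" "\<And>y. y \<in> S \<Longrightarrow> f y = g y"
  shows "pd v f x = pd v g x"
  unfolding pd_def frechet_derivative_def using has_derivative_cong_open[OF assms] by simp

lemma pd_eq: "(f has_derivative f') (at x) \<Longrightarrow> pd v f x = f' v"
  unfolding pd_def using frechet_derivative_at by metis

lemma has_derivative_pd: "f differentiable (at x) \<Longrightarrow> (f has_derivative (\<lambda>v. pd v f x)) (at x)"
  unfolding pd_def using frechet_derivative_works by blast

lemma pd_linear: "f differentiable (at x) \<Longrightarrow> linear (\<lambda>v. pd v f x)"
  using has_derivative_pd has_derivative_linear by blast

lemma Ck_on_Suc: "Ck_on (Suc k) S f \<longleftrightarrow> (\<forall>x\<in>S. f differentiable (at x)) \<and> (\<forall>v. Ck_on k S (pd v f))"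
  by (simp add: pd_def[abs_def])

declare Ck_on.simps(2)[simp del] Ck_on_Suc[simp]

text \<open>Openness matters: the derivatives are taken at points, so they depend on a
  neighbourhood, and equality on an open set passes to derivatives of every order.\<close>

lemma Ck_on_cong:
  assumes "open S"
  shows "(\<And>x. x \<in> S \<Longrightarrow> f x = g x) \<Longrightarrow> Ck_on k S f \<longleftrightarrow> Ck_on k S g"
proof (induction k arbitrary: f g)
  case 0
  then show ?case by (simp cong: continuous_on_cong)
next
  case (Suc k)
  have "Ck_on k S (pd v f) \<longleftrightarrow> Ck_on k S (pd v g)" for v
    by (rule Suc.IH, rule pd_cong_open[OF assms]) (use Suc.prems in auto)
  moreover have "\<forall>x\<in>S. f differentiable (at x) \<longleftrightarrow> g differentiable (at x)"
    using differentiable_cong_open[OF assms] Suc.prems by blast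
  ultimately show ?case by (simp only: Ck_on_Suc) blast
qed

lemma Ck_on_subset: "Ck_on k S f \<Longrightarrow> T \<subseteq> S \<Longrightarrow> Ck_on k T f"
  by (induction k arbitrary: f) (auto intro: continuous_on_subset)

lemma Ck_on_local:
  "(\<And>x. x \<in> S \<Longrightarrow> \<exists>T. open T \<and> x \<in> T \<and> Ck_on k (S \<inter> T) f) \<Longrightarrow> Ck_on k S f"
proof (induction k arbitrary: f)
  case 0
  have "continuous (at x within S) f" if x: "x \<in> S" for x
  proof -
    obtain T where "open T" "x \<in> T" "continuous_on (S \<inter> T) f" using 0 x by auto
    then have "continuous (at x within (S \<inter> T)) f"
      using x by (simp add: continuous_on_eq_continuous_within)
    moreover have "at x within (S \<inter> T) = at x within S"
      using \<open>open T\<close> \<open>x \<in> T\<close> by (intro at_within_nhd[of x T]) auto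
    ultimately show ?thesis by simp
  qed
  then show ?case by (simp add: continuous_on_eq_continuous_within)
next
  case (Suc k)
  have "Ck_on k S (pd v f)" for v
  proof (rule Suc.IH)
    fix x assume "x \<in> S"
    then obtain T where "open T" "x \<in> T" "Ck_on (Suc k) (S \<inter> T) f" using Suc.prems by blast
    then show "\<exists>T. open T \<and> x \<in> T \<and> Ck_on k (S \<inter> T) (pd v f)" unfolding Ck_on_Suc by blast
  qed
  moreover have "\<forall>x\<in>S. f differentiable (at x)"
  proof
    fix x assume x: "x \<in> S"
    then obtain T where "x \<in> T" "Ck_on (Suc k) (S \<inter> T) f" using Suc.prems by blast
    then show "f differentiable (at x)" using x unfolding Ck_on_Suc by blast
  qed
  ultimately show ?case by simp
qed

lemma Ck_on_SucD: "Ck_on (Suc k) S f \<Longrightarrow> Ck_on k S f"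
proof (induction k arbitrary: f)
  case 0
  then show ?case
    by (simp add: continuous_at_imp_continuous_on differentiable_imp_continuous_within)
next
  case (Suc k)
  have "Ck_on k S (pd v f)" for v
    using Suc.prems Ck_on_Suc[of "Suc k" S f] by (intro Suc.IH) blast
  moreover have "\<forall>x\<in>S. f differentiable (at x)" using Suc.prems Ck_on_Suc[of "Suc k" S f] by blast
  ultimately show ?case using Ck_on_Suc[of k S f] by blast
qed

lemma Ck_on_const: "Ck_on k S (\<lambda>x. c)"
proof (induction k arbitrary: c)
  case (Suc k)
  have "pd v (\<lambda>x. c) = (\<lambda>x. 0)" for v :: 'a
    by (rule ext, rule pd_eq[of _ "\<lambda>v. 0"]) (rule has_derivative_const)
  then show ?case using Suc by simp
qed simp

lemma pd_bounded_linear: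
  assumes "bounded_linear L" "f differentiable (at x)"
  shows "pd v (\<lambda>x. L (f x)) x = L (pd v f x)"
  using pd_eq[OF bounded_linear.has_derivative[OF assms(1) has_derivative_pd[OF assms(2)]]] .

lemma pd_bounded_bilinear:
  assumes "bounded_bilinear B" "f differentiable (at x)" "g differentiable (at x)"
  shows "pd v (\<lambda>x. B (f x) (g x)) x = B (f x) (pd v g x) + B (pd v f x) (g x)"
  using pd_eq[OF bounded_bilinear.FDERIV[OF assms(1) has_derivative_pd[OF assms(2)] has_derivative_pd[OF assms(3)]]] .

lemma pd_add:
  assumes "f differentiable (at x)" "g differentiable (at x)"
  shows "pd v (\<lambda>x. f x + g x) x = pd v f x + pd v g x"
  using pd_eq[OF has_derivative_add[OF has_derivative_pd[OF assms(1)] has_derivative_pd[OF assms(2)]]] .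

lemma pd_const [simp]: "pd v (\<lambda>x. c) x = 0"
  by (rule pd_eq[of _ "\<lambda>v. 0"]) (rule has_derivative_const)

lemma Ck_on_add:
  assumes "open S"
  shows "Ck_on k S f \<Longrightarrow> Ck_on k S g \<Longrightarrow> Ck_on k S (\<lambda>x. f x + g x)"
proof (induction k arbitrary: f g)
  case 0
  then show ?case by (simp add: continuous_on_add)
next
  case (Suc k)
  have "Ck_on k S (pd v (\<lambda>x. f x + g x))" for v
    using Ck_on_cong[OF assms, of "pd v (\<lambda>x. f x + g x)" "\<lambda>x. pd v f x + pd v g x"] Suc pd_add
    by (simp add: pd_add)
  then show ?case using Suc by simp
qed

lemma Ck_on_sum:
  assumes "open S" "finite I" "\<And>i. i \<in> I \<Longrightarrow> Ck_on k S (f i)"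
  shows "Ck_on k S (\<lambda>x. \<Sum>i\<in>I. f i x)"
  using assms(2,3) by (induction I) (auto intro: Ck_on_const Ck_on_add[OF assms(1)])

lemma Ck_on_bounded_linear:
  assumes "open S" "bounded_linear L"
  shows "Ck_on k S f \<Longrightarrow> Ck_on k S (\<lambda>x. L (f x))"
proof (induction k arbitrary: f)
  case 0
  then show ?case using bounded_linear.continuous_on[OF assms(2)] by simp
next
  case (Suc k)
  have "Ck_on k S (pd v (\<lambda>x. L (f x)))" for v
    using Ck_on_cong[OF assms(1), of "pd v (\<lambda>x. L (f x))" "\<lambda>x. L (pd v f x)"] Suc
    by (simp add: pd_bounded_linear[OF assms(2)])
  moreover have "\<forall>x\<in>S. (\<lambda>x. L (f x)) differentiable (at x)"
    using Suc.prems bounded_linear.has_derivative[OF assms(2)] unfolding Ck_on_Suc differentiable_def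
    by blast
  ultimately show ?case by simp
qed

lemma Ck_on_bounded_bilinear:
  assumes "open S" "bounded_bilinear B"
  shows "Ck_on k S f \<Longrightarrow> Ck_on k S g \<Longrightarrow> Ck_on k S (\<lambda>x. B (f x) (g x))"
proof (induction k arbitrary: f g)
  case 0
  then show ?case using bounded_bilinear.continuous_on[OF assms(2)] by simp
next
  case (Suc k)
  have "Ck_on k S (pd v (\<lambda>x. B (f x) (g x)))" for v
  proof -
    have "Ck_on k S (\<lambda>x. B (f x) (pd v g x) + B (pd v f x) (g x))"
      using Suc.prems Ck_on_SucD[OF Suc.prems(1)] Ck_on_SucD[OF Suc.prems(2)]
      by (intro Ck_on_add[OF assms(1)] Suc.IH) simp_all
    then show ?thesis
      using Ck_on_cong[OF assms(1), of "pd v (\<lambda>x. B (f x) (g x))"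
          "\<lambda>x. B (f x) (pd v g x) + B (pd v f x) (g x)"] Suc.prems
      by (simp add: pd_bounded_bilinear[OF assms(2)])
  qed
  moreover have "\<forall>x\<in>S. (\<lambda>x. B (f x) (g x)) differentiable (at x)"
    using Suc.prems bounded_bilinear.FDERIV[OF assms(2)] unfolding Ck_on_Suc differentiable_def
    by blast
  ultimately show ?case by simp
qed

lemma pd_compose:
  fixes f :: "'a::real_normed_vector \<Rightarrow> 'b::euclidean_space"
  assumes "f differentiable (at x)" "g differentiable (at (f x))"
  shows "pd v (\<lambda>x. g (f x)) x = pd (pd v f x) g (f x)"
  using pd_eq[OF has_derivative_compose[OF has_derivative_pd[OF assms(1)] has_derivative_pd[OF assms(2)]]] .

lemma pd_expand:
  fixes g :: "'b::euclidean_space \<Rightarrow> 'c::real_normed_vector"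
  assumes "g differentiable (at y)"
  shows "pd w g y = (\<Sum>b\<in>Basis. (w \<bullet> b) *\<^sub>R pd b g y)"
proof -
  interpret linear "\<lambda>v. pd v g y" using pd_linear[OF assms] .
  have "pd w g y = pd (\<Sum>b\<in>Basis. (w \<bullet> b) *\<^sub>R b) g y" by (simp add: euclidean_representation)
  then show ?thesis by (simp add: sum scaleR)
qed

text \<open>Expanding the inner derivative in a basis turns the chain rule into a finite sum of
  products whose factors are \<open>pd b g\<close> composed with \<open>f\<close>. The induction
  therefore generalises over \<open>g\<close> only, while \<open>f\<close> merely loses one
  order.\<close>

lemma Ck_on_compose:
  fixes f :: "'a::real_normed_vector \<Rightarrow> 'b::euclidean_space"
  assumes "open S" "f ` S \<subseteq> T"
  shows "Ck_on k T g \<Longrightarrow> Ck_on k S f \<Longrightarrow> Ck_on k S (\<lambda>x. g (f x))"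
proof (induction k arbitrary: g)
  case 0
  then show ?case using assms(2) by (auto intro: continuous_on_compose2)
next
  case (Suc k)
  have dg: "g differentiable (at (f x))" if "x \<in> S" for x using Suc.prems assms(2) that by auto
  have "Ck_on k S (pd v (\<lambda>x. g (f x)))" for v
  proof -
    have "Ck_on k S (\<lambda>x. \<Sum>b\<in>Basis. (pd v f x \<bullet> b) *\<^sub>R pd b g (f x))"
    proof (intro Ck_on_sum[OF assms(1)] finite_Basis)
      fix b :: 'b
      have "Ck_on k S (\<lambda>x. pd v f x \<bullet> b)"
        by (rule Ck_on_bounded_linear[OF assms(1) bounded_linear_inner_left]) (use Suc.prems in simp)
      moreover have "Ck_on k S (\<lambda>x. pd b g (f x))"
        using Suc.IH[of "pd b g"] Suc.prems(1) Ck_on_SucD[OF Suc.prems(2)] by simp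
      ultimately show "Ck_on k S (\<lambda>x. (pd v f x \<bullet> b) *\<^sub>R pd b g (f x))"
        by (rule Ck_on_bounded_bilinear[OF assms(1) bounded_bilinear_scaleR])
    qed
    moreover have "pd v (\<lambda>x. g (f x)) x = (\<Sum>b\<in>Basis. (pd v f x \<bullet> b) *\<^sub>R pd b g (f x))" if "x \<in> S" for x
    proof -
      have "f differentiable (at x)" using Suc.prems(2) that by simp
      then show ?thesis using pd_compose dg[OF that] pd_expand[OF dg[OF that], of "pd v f x"] by metis
    qed
    ultimately show ?thesis by (subst Ck_on_cong[OF assms(1)])
  qed
  moreover have "\<forall>x\<in>S. (\<lambda>x. g (f x)) differentiable (at x)"
    using differentiable_chain_at[of f _ g] dg Suc.prems by (auto simp: o_def)
  ultimately show ?case by simp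
qed

lemma smooth_onD: "smooth_on S f \<Longrightarrow> x \<in> S \<Longrightarrow> f differentiable (at x)"
  unfolding smooth_on_def using Ck_on_Suc by blast

lemma smooth_on_pd: "smooth_on S f \<Longrightarrow> smooth_on S (pd v f)"
  unfolding smooth_on_def using Ck_on_Suc by blast

lemma smooth_on_continuous: "smooth_on S f \<Longrightarrow> continuous_on S f"
  unfolding smooth_on_def using Ck_on.simps(1) by blast

lemma smooth_on_pdI:
  assumes "\<And>x. x \<in> S \<Longrightarrow> f differentiable (at x)" "\<And>v. smooth_on S (pd v f)"
  shows "smooth_on S f"
  unfolding smooth_on_def
proof
  fix k
  have "Ck_on (Suc k) S f" using assms unfolding smooth_on_def Ck_on_Suc by blast
  then show "Ck_on k S f" by (rule Ck_on_SucD)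
qed

lemma smooth_on_cong: "open S \<Longrightarrow> (\<And>x. x \<in> S \<Longrightarrow> f x = g x) \<Longrightarrow> smooth_on S f \<longleftrightarrow> smooth_on S g"
  unfolding smooth_on_def using Ck_on_cong by blast

lemma smooth_on_subset: "smooth_on S f \<Longrightarrow> T \<subseteq> S \<Longrightarrow> smooth_on T f"
  unfolding smooth_on_def using Ck_on_subset by blast

lemma smooth_on_local:
  "(\<And>x. x \<in> S \<Longrightarrow> \<exists>T. open T \<and> x \<in> T \<and> smooth_on (S \<inter> T) f) \<Longrightarrow> smooth_on S f"
  unfolding smooth_on_def by (rule allI, rule Ck_on_local) blast

lemma smooth_on_const: "smooth_on S (\<lambda>x. c)"
  by (simp add: smooth_on_def Ck_on_const)

lemma smooth_on_add: "open S \<Longrightarrow> smooth_on S f \<Longrightarrow> smooth_on S g \<Longrightarrow> smooth_on S (\<lambda>x. f x + g x)"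
  by (simp add: smooth_on_def Ck_on_add)

lemma smooth_on_sum:
  "open S \<Longrightarrow> finite I \<Longrightarrow> (\<And>i. i \<in> I \<Longrightarrow> smooth_on S (f i)) \<Longrightarrow> smooth_on S (\<lambda>x. \<Sum>i\<in>I. f i x)"
  by (simp add: smooth_on_def Ck_on_sum)

lemma smooth_on_bounded_linear:
  "open S \<Longrightarrow> bounded_linear L \<Longrightarrow> smooth_on S f \<Longrightarrow> smooth_on S (\<lambda>x. L (f x))"
  by (simp add: smooth_on_def Ck_on_bounded_linear)

lemma smooth_on_bounded_bilinear:
  "open S \<Longrightarrow> bounded_bilinear B \<Longrightarrow> smooth_on S f \<Longrightarrow> smooth_on S g \<Longrightarrow> smooth_on S (\<lambda>x. B (f x) (g x))"
  by (simp add: smooth_on_def Ck_on_bounded_bilinear)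

lemma smooth_on_compose:
  fixes f :: "'a::real_normed_vector \<Rightarrow> 'b::euclidean_space"
  shows "open S \<Longrightarrow> f ` S \<subseteq> T \<Longrightarrow> smooth_on T g \<Longrightarrow> smooth_on S f \<Longrightarrow> smooth_on S (\<lambda>x. g (f x))"
  by (simp add: smooth_on_def Ck_on_compose)

lemma smooth_on_ident: "smooth_on S (\<lambda>x. x)"
proof (rule smooth_on_pdI)
  show "smooth_on S (pd v (\<lambda>x. x))" for v :: 'a
  proof -
    have "pd v (\<lambda>x. x) = (\<lambda>x. v)" by (rule ext, rule pd_eq, rule has_derivative_ident)
    then show ?thesis by (simp add: smooth_on_const)
  qed
qed simp

lemma smooth_on_uminus: "open S \<Longrightarrow> smooth_on S f \<Longrightarrow> smooth_on S (\<lambda>x. - f x)"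
  by (rule smooth_on_bounded_linear[OF _ bounded_linear_minus[OF bounded_linear_ident]])

lemma smooth_on_diff: "open S \<Longrightarrow> smooth_on S f \<Longrightarrow> smooth_on S g \<Longrightarrow> smooth_on S (\<lambda>x. f x - g x)"
  using smooth_on_add[of S f "\<lambda>x. - g x"] smooth_on_uminus[of S g] by simp

lemmas smooth_on_mult = smooth_on_bounded_bilinear[OF _ bounded_bilinear_mult]
lemmas smooth_on_scaleR = smooth_on_bounded_bilinear[OF _ bounded_bilinear_scaleR]
lemmas smooth_on_inner = smooth_on_bounded_bilinear[OF _ bounded_bilinear_inner]
lemmas smooth_on_nth = smooth_on_bounded_linear[OF _ bounded_linear_vec_nth]
lemmas smooth_on_Re = smooth_on_bounded_linear[OF _ bounded_linear_Re]
lemmas smooth_on_Im = smooth_on_bounded_linear[OF _ bounded_linear_Im]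
lemmas smooth_on_cnj = smooth_on_bounded_linear[OF _ bounded_linear_cnj]
lemmas smooth_on_of_real = smooth_on_bounded_linear[OF _ bounded_linear_of_real]
lemmas smooth_on_fst = smooth_on_bounded_linear[OF _ bounded_linear_fst]
lemmas smooth_on_snd = smooth_on_bounded_linear[OF _ bounded_linear_snd]

lemma smooth_on_power:
  fixes f :: "'a::real_normed_vector \<Rightarrow> 'b::real_normed_algebra_1"
  shows "open S \<Longrightarrow> smooth_on S f \<Longrightarrow> smooth_on S (\<lambda>x. f x ^ n)"
  by (induction n) (auto intro: smooth_on_const smooth_on_mult)

lemma smooth_on_componentwise:
  fixes f :: "'a::real_normed_vector \<Rightarrow> 'b::euclidean_space"
  assumes "open S" "\<And>b. b \<in> Basis \<Longrightarrow> smooth_on S (\<lambda>x. f x \<bullet> b)"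
  shows "smooth_on S f"
proof -
  have "smooth_on S (\<lambda>x. \<Sum>b\<in>Basis. (f x \<bullet> b) *\<^sub>R b)"
    using assms by (intro smooth_on_sum smooth_on_scaleR smooth_on_const) auto
  then show ?thesis by (simp add: euclidean_representation)
qed

lemma smooth_on_Pair:
  fixes f :: "'a::real_normed_vector \<Rightarrow> 'b::euclidean_space" and g :: "'a \<Rightarrow> 'c::euclidean_space"
  assumes "open S" "smooth_on S f" "smooth_on S g"
  shows "smooth_on S (\<lambda>x. (f x, g x))"
  using assms(1) by (rule smooth_on_componentwise)
    (auto simp: Basis_prod_def smooth_on_inner[OF assms(1,2) smooth_on_const]
      smooth_on_inner[OF assms(1,3) smooth_on_const])

lemma smooth_on_vec:
  fixes f :: "'a::real_normed_vector \<Rightarrow> ('b::euclidean_space)^'n"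
  assumes "open S" "\<And>i. smooth_on S (\<lambda>x. f x $ i)"
  shows "smooth_on S f"
  using assms(1) by (rule smooth_on_componentwise)
    (auto simp: Basis_vec_def inner_axis smooth_on_inner[OF assms(1) assms(2) smooth_on_const])

lemma smooth_on_Complex:
  assumes "open S" "smooth_on S f" "smooth_on S g"
  shows "smooth_on S (\<lambda>x. Complex (f x) (g x))"
  using assms(1) by (rule smooth_on_componentwise) (use assms in \<open>auto simp: Basis_complex_def inner_complex_def\<close>)

lemma pd_holomorphic:
  assumes "f holomorphic_on S" "open S" "x \<in> S"
  shows "pd v f x = deriv f x * v"
  using pd_eq[OF DERIV_deriv_iff_field_differentiable[THEN iffD2,
    OF holomorphic_on_imp_differentiable_at[OF assms], unfolded has_field_derivative_def]] .

lemma Ck_on_holomorphic: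
  assumes "open S"
  shows "f holomorphic_on S \<Longrightarrow> Ck_on k S f"
proof (induction k arbitrary: f)
  case 0
  then show ?case by (simp add: holomorphic_on_imp_continuous_on)
next
  case (Suc k)
  have "Ck_on k S (pd v f)" for v
  proof -
    have "(\<lambda>x. deriv f x * v) holomorphic_on S"
      by (intro holomorphic_intros holomorphic_deriv[OF Suc.prems assms])
    then have "Ck_on k S (\<lambda>x. deriv f x * v)" by (rule Suc.IH)
    then show ?thesis
      by (subst Ck_on_cong[OF assms, of "pd v f" "\<lambda>x. deriv f x * v"])
        (simp_all add: pd_holomorphic[OF Suc.prems assms])
  qed
  moreover have "\<forall>x\<in>S. f differentiable (at x)"
    using Suc.prems assms field_differentiable_imp_differentiable holomorphic_on_imp_differentiable_at by blast
  ultimately show ?case by simp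
qed

lemma smooth_on_holomorphic: "open S \<Longrightarrow> f holomorphic_on S \<Longrightarrow> smooth_on S f"
  by (simp add: smooth_on_def Ck_on_holomorphic)

lemma smooth_on_holomorphic_compose:
  "open S \<Longrightarrow> f ` S \<subseteq> T \<Longrightarrow> open T \<Longrightarrow> g holomorphic_on T \<Longrightarrow> smooth_on S f \<Longrightarrow> smooth_on S (\<lambda>x. g (f x))"
  using smooth_on_compose smooth_on_holomorphic by blast

text \<open>The derivative of a holomorphic function is again holomorphic, so smoothness of such
  functions is an induction that closes on itself. Reciprocal, exponential, logarithm and root on
  the reals inherit smoothness by passing through the complex plane.\<close>

lemma smooth_on_real_via_complex:
  fixes f :: "'a::real_normed_vector \<Rightarrow> real"
  assumes "open S" "smooth_on S f" "open T" "g holomorphic_on T"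
    and "\<And>x. x \<in> S \<Longrightarrow> complex_of_real (f x) \<in> T \<and> Re (g (complex_of_real (f x))) = h (f x)"
  shows "smooth_on S (\<lambda>x. h (f x))"
proof -
  have "smooth_on S (\<lambda>x. Re (g (complex_of_real (f x))))"
    by (rule smooth_on_Re[OF assms(1)], rule smooth_on_holomorphic_compose[OF assms(1) _ assms(3,4)])
      (use assms in \<open>auto intro: smooth_on_of_real\<close>)
  then show ?thesis using smooth_on_cong[OF assms(1), of "\<lambda>x. Re (g (complex_of_real (f x)))" "\<lambda>x. h (f x)"]
    assms(5) by simp
qed

lemma smooth_on_inverse:
  fixes f :: "'a::real_normed_vector \<Rightarrow> real"
  assumes "open S" "smooth_on S f" "\<And>x. x \<in> S \<Longrightarrow> f x \<noteq> 0"
  shows "smooth_on S (\<lambda>x. inverse (f x))"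
  by (rule smooth_on_real_via_complex[where T="-{0}" and g=inverse and f=f and h=inverse])
    (use assms in \<open>auto intro!: holomorphic_intros simp flip: of_real_inverse\<close>)

lemma smooth_on_divide:
  fixes f :: "'a::real_normed_vector \<Rightarrow> real"
  assumes "open S" "smooth_on S f" "smooth_on S g" "\<And>x. x \<in> S \<Longrightarrow> g x \<noteq> 0"
  shows "smooth_on S (\<lambda>x. f x / g x)"
  unfolding divide_inverse by (intro smooth_on_mult smooth_on_inverse assms)

lemma smooth_on_exp:
  fixes f :: "'a::real_normed_vector \<Rightarrow> real"
  assumes "open S" "smooth_on S f"
  shows "smooth_on S (\<lambda>x. exp (f x))"
  by (rule smooth_on_real_via_complex[where T=UNIV and g=exp and f=f and h=exp])
    (use assms in \<open>auto intro!: holomorphic_intros simp: Re_exp\<close>)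

lemma smooth_on_ln:
  fixes f :: "'a::real_normed_vector \<Rightarrow> real"
  assumes "open S" "smooth_on S f" "\<And>x. x \<in> S \<Longrightarrow> f x > 0"
  shows "smooth_on S (\<lambda>x. ln (f x))"
  by (rule smooth_on_real_via_complex[where T="-\<real>\<^sub>\<le>\<^sub>0" and g=Ln and f=f and h=ln])
    (use assms in \<open>force intro!: holomorphic_intros simp: Ln_of_real complex_nonpos_Reals_iff\<close>)+

lemma smooth_on_sqrt:
  fixes f :: "'a::real_normed_vector \<Rightarrow> real"
  assumes "open S" "smooth_on S f" "\<And>x. x \<in> S \<Longrightarrow> f x > 0"
  shows "smooth_on S (\<lambda>x. sqrt (f x))"
proof -
  have "sqrt (f x) = exp (ln (f x) * (1/2))" if "x \<in> S" for x
    using assms(3)[OF that] by (simp add: powr_half_sqrt[symmetric] powr_def)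
  moreover have "smooth_on S (\<lambda>x. exp (ln (f x) * (1/2)))"
    using assms by (intro smooth_on_exp smooth_on_mult smooth_on_ln smooth_on_const)
  ultimately show ?thesis by (subst smooth_on_cong[OF assms(1)])
qed

lemma smooth_on_norm:
  fixes f :: "'a::real_normed_vector \<Rightarrow> 'b::real_inner"
  assumes "open S" "smooth_on S f" "\<And>x. x \<in> S \<Longrightarrow> f x \<noteq> 0"
  shows "smooth_on S (\<lambda>x. norm (f x))"
  unfolding norm_eq_sqrt_inner using assms by (intro smooth_on_sqrt smooth_on_inner) auto

section \<open>Symmetry of second derivatives\<close>

lemma DERIV_line:
  fixes f :: "'a::real_normed_vector \<Rightarrow> real"
  assumes "f differentiable (at (p + s *\<^sub>R v))"
  shows "((\<lambda>s. f (p + s *\<^sub>R v)) has_real_derivative pd v f (p + s *\<^sub>R v)) (at s)"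
proof -
  have "((\<lambda>s. p + s *\<^sub>R v) has_derivative (\<lambda>h. h *\<^sub>R v)) (at s)"
    by (auto intro!: derivative_eq_intros)
  from has_derivative_compose[OF this has_derivative_pd[OF assms]]
  have "((\<lambda>s. f (p + s *\<^sub>R v)) has_derivative (\<lambda>h. pd (h *\<^sub>R v) f (p + s *\<^sub>R v))) (at s)" .
  moreover have "pd (h *\<^sub>R v) f (p + s *\<^sub>R v) = pd v f (p + s *\<^sub>R v) * h" for h
    using linear_scale[OF pd_linear[OF assms]] by simp
  ultimately show ?thesis by (simp add: has_field_derivative_def)
qed

text \<open>The mean value theorem is applied twice: to the difference in direction \<open>w\<close>
  as a function along \<open>v\<close>, and then to \<open>pd v f\<close> along
  \<open>w\<close>.\<close>

lemma second_difference:
  fixes f :: "'a::real_normed_vector \<Rightarrow> real"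
  assumes f: "smooth_on (ball x d) f" and h: "h > 0" "h * (norm v + norm w) < d"
  shows "\<exists>y. dist y x \<le> h * (norm v + norm w) \<and>
    f (x + h *\<^sub>R v + h *\<^sub>R w) - f (x + h *\<^sub>R v) - (f (x + h *\<^sub>R w) - f x) = h * h * pd w (pd v f) y"
proof -
  have ds: "dist (x + s *\<^sub>R v + t *\<^sub>R w) x \<le> h * (norm v + norm w)"
    if "0 \<le> s" "s \<le> h" "0 \<le> t" "t \<le> h" for s t
  proof -
    have "norm (s *\<^sub>R v + t *\<^sub>R w) \<le> s * norm v + t * norm w"
      using norm_triangle_ineq[of "s *\<^sub>R v" "t *\<^sub>R w"] that by simp
    also have "\<dots> \<le> h * norm v + h * norm w" using that by (intro add_mono mult_right_mono) auto
    finally show ?thesis by (simp add: dist_norm distrib_left add.assoc)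
  qed
  have inb: "x + s *\<^sub>R v + t *\<^sub>R w \<in> ball x d" if "0 \<le> s" "s \<le> h" "0 \<le> t" "t \<le> h" for s t
    using ds[OF that] h(2) by (simp add: dist_commute)
  define \<phi> where "\<phi> s = f (x + h *\<^sub>R w + s *\<^sub>R v) - f (x + s *\<^sub>R v)" for s
  have d1: "(\<phi> has_real_derivative (pd v f (x + h *\<^sub>R w + s *\<^sub>R v) - pd v f (x + s *\<^sub>R v))) (at s)"
    if "0 \<le> s" "s \<le> h" for s
    unfolding \<phi>_def
    using inb[OF that, of h] inb[OF that, of 0] h
    by (intro DERIV_diff DERIV_line smooth_onD[OF f]) (auto simp: algebra_simps)
  obtain s where s: "0 < s" "s < h"
    "\<phi> h - \<phi> 0 = (h - 0) * (pd v f (x + h *\<^sub>R w + s *\<^sub>R v) - pd v f (x + s *\<^sub>R v))"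
    using MVT2[of 0 h \<phi> "\<lambda>s. pd v f (x + h *\<^sub>R w + s *\<^sub>R v) - pd v f (x + s *\<^sub>R v)"] d1 h by blast
  have d2: "((\<lambda>t. pd v f (x + s *\<^sub>R v + t *\<^sub>R w)) has_real_derivative pd w (pd v f) (x + s *\<^sub>R v + t *\<^sub>R w)) (at t)"
    if "0 \<le> t" "t \<le> h" for t
    using inb[OF _ _ that, of s] s
    by (intro DERIV_line smooth_onD[OF smooth_on_pd[OF f]]) auto
  obtain t where t: "0 < t" "t < h"
    "pd v f (x + s *\<^sub>R v + h *\<^sub>R w) - pd v f (x + s *\<^sub>R v + 0 *\<^sub>R w) = (h - 0) * pd w (pd v f) (x + s *\<^sub>R v + t *\<^sub>R w)"
    using MVT2[of 0 h "\<lambda>t. pd v f (x + s *\<^sub>R v + t *\<^sub>R w)"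
        "\<lambda>t. pd w (pd v f) (x + s *\<^sub>R v + t *\<^sub>R w)"] d2 h by blast
  show ?thesis
  proof (intro exI[of _ "x + s *\<^sub>R v + t *\<^sub>R w"] conjI ds)
    show "f (x + h *\<^sub>R v + h *\<^sub>R w) - f (x + h *\<^sub>R v) - (f (x + h *\<^sub>R w) - f x) =
      h * h * pd w (pd v f) (x + s *\<^sub>R v + t *\<^sub>R w)"
      using s(3) t(3) by (simp add: \<phi>_def algebra_simps)
  qed (use s t in auto)
qed

text \<open>The second difference is symmetric in \<open>v\<close> and \<open>w\<close>, so both
  mixed derivatives agree at two points near \<open>x\<close>; continuity of both carries this to
  \<open>x\<close> itself.\<close>

lemma pd_commute_real:
  fixes f :: "'a::real_normed_vector \<Rightarrow> real"
  assumes f: "smooth_on D f" and D: "open D" "x \<in> D"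
  shows "pd v (pd w f) x = pd w (pd v f) x"
proof -
  have "\<bar>pd v (pd w f) x - pd w (pd v f) x\<bar> \<le> \<epsilon>" if e: "\<epsilon> > 0" for \<epsilon>
  proof -
    obtain d0 where d0: "d0 > 0" "ball x d0 \<subseteq> D" using D open_contains_ball by blast
    have ct: "continuous (at x) (pd v (pd w f))" for v w
      using smooth_on_continuous[OF smooth_on_pd[OF smooth_on_pd[OF f]]] D continuous_on_eq_continuous_at by blast
    obtain d1 where d1: "d1 > 0" "\<And>y. dist y x < d1 \<Longrightarrow> dist (pd v (pd w f) y) (pd v (pd w f) x) < \<epsilon>/2"
      using ct[of v w] e unfolding continuous_at_eps_delta by (meson half_gt_zero)
    obtain d2 where d2: "d2 > 0" "\<And>y. dist y x < d2 \<Longrightarrow> dist (pd w (pd v f) y) (pd w (pd v f) x) < \<epsilon>/2"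
      using ct[of w v] e unfolding continuous_at_eps_delta by (meson half_gt_zero)
    define d where "d = Min {d0, d1, d2}"
    have d: "d > 0" "d \<le> d0" "d \<le> d1" "d \<le> d2" using d0 d1 d2 by (auto simp: d_def)
    have fd: "smooth_on (ball x d) f"
      by (rule smooth_on_subset[OF f]) (use d d0 subset_ball[of d d0 x] in blast)
    \<comment> \<open>The summand 1 keeps the denominator positive when both directions
      vanish.\<close>
    define h where "h = d / (2 * (norm v + norm w + 1))"
    have nn: "norm v + norm w + 1 > 0" by (smt (verit) norm_ge_zero)
    have h: "h > 0" "h * (norm v + norm w) < d"
    proof -
      show "h > 0" using d nn by (simp add: h_def)
      have "h * (norm v + norm w) \<le> h * (norm v + norm w + 1)" using \<open>h > 0\<close> by simp
      also have "\<dots> = d / 2" using nn by (simp add: h_def field_simps)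
      finally show "h * (norm v + norm w) < d" using d by simp
    qed
    then have h': "h * (norm w + norm v) < d" by (simp add: add.commute)
    obtain y1 where y1: "dist y1 x < d"
      "f (x + h *\<^sub>R v + h *\<^sub>R w) - f (x + h *\<^sub>R v) - (f (x + h *\<^sub>R w) - f x) = h * h * pd w (pd v f) y1"
      using second_difference[OF fd h] h(2) by (meson order.strict_trans1)
    obtain y2 where y2: "dist y2 x < d"
      "f (x + h *\<^sub>R w + h *\<^sub>R v) - f (x + h *\<^sub>R w) - (f (x + h *\<^sub>R v) - f x) = h * h * pd v (pd w f) y2"
      using second_difference[OF fd h(1) h'] h' by (meson order.strict_trans1)
    have "h * h * pd v (pd w f) y2 = h * h * pd w (pd v f) y1"
      unfolding y1(2)[symmetric] y2(2)[symmetric] by (simp add: algebra_simps)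
    then have "pd v (pd w f) y2 = pd w (pd v f) y1" using h by simp
    moreover have "\<bar>pd v (pd w f) y2 - pd v (pd w f) x\<bar> < \<epsilon>/2" using d1(2)[of y2] y2(1) d by (simp add: dist_real_def)
    moreover have "\<bar>pd w (pd v f) y1 - pd w (pd v f) x\<bar> < \<epsilon>/2" using d2(2)[of y1] y1(1) d by (simp add: dist_real_def)
    ultimately show ?thesis by linarith
  qed
  then have "\<bar>pd v (pd w f) x - pd w (pd v f) x\<bar> \<le> 0" by (rule field_le_epsilon) simp
  then show ?thesis by simp
qed

lemma pd_commute:
  fixes f :: "'a::real_normed_vector \<Rightarrow> 'b::euclidean_space"
  assumes f: "smooth_on D f" and D: "open D" "x \<in> D"
  shows "pd v (pd w f) x = pd w (pd v f) x"
proof (rule euclidean_eqI)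
  fix b :: 'b
  have L: "bounded_linear (\<lambda>y. y \<bullet> b)" by (rule bounded_linear_inner_left)
  have *: "pd v (pd w (\<lambda>y. f y \<bullet> b)) x = pd v (pd w f) x \<bullet> b" for v w
  proof -
    have "pd v (pd w (\<lambda>y. f y \<bullet> b)) x = pd v (\<lambda>y. pd w f y \<bullet> b) x"
      by (rule pd_cong_open[OF D]) (rule pd_bounded_linear[OF L smooth_onD[OF f]])
    then show ?thesis using pd_bounded_linear[OF L smooth_onD[OF smooth_on_pd[OF f] D(2)]] by simp
  qed
  show "pd v (pd w f) x \<bullet> b = pd w (pd v f) x \<bullet> b"
    using pd_commute_real[OF smooth_on_inner[OF D(1) f smooth_on_const, of b] D] * by simp
qed

section \<open>Cauchy-Riemann equations and local inverses in the plane\<close>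

lemma pd_complex_expand:
  fixes f :: "complex \<Rightarrow> 'b::real_normed_vector"
  assumes "f differentiable (at \<zeta>)"
  shows "pd v f \<zeta> = Re v *\<^sub>R pd 1 f \<zeta> + Im v *\<^sub>R pd \<i> f \<zeta>"
proof -
  interpret linear "\<lambda>v. pd v f \<zeta>" using pd_linear[OF assms] .
  have "Re v *\<^sub>R 1 + Im v *\<^sub>R \<i> = v" by (simp add: complex_eq_iff)
  then have "pd v f \<zeta> = pd (Re v *\<^sub>R 1 + Im v *\<^sub>R \<i>) f \<zeta>" by simp
  then show ?thesis by (simp only: add scaleR)
qed

lemma holomorphic_on_CR:
  assumes "open D" "\<And>\<zeta>. \<zeta> \<in> D \<Longrightarrow> f differentiable (at \<zeta>)"
    and "\<And>\<zeta>. \<zeta> \<in> D \<Longrightarrow> pd \<i> f \<zeta> = \<i> * pd 1 f \<zeta>"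
  shows "f holomorphic_on D"
proof -
  have "(f has_field_derivative pd 1 f \<zeta>) (at \<zeta>)" if "\<zeta> \<in> D" for \<zeta>
  proof -
    have "pd v f \<zeta> = pd 1 f \<zeta> * v" for v
    proof -
      have "pd v f \<zeta> = of_real (Re v) * pd 1 f \<zeta> + of_real (Im v) * (\<i> * pd 1 f \<zeta>)"
        using pd_complex_expand[OF assms(2)[OF that], of v] assms(3)[OF that] by (simp add: scaleR_conv_of_real)
      also have "\<dots> = pd 1 f \<zeta> * (of_real (Re v) + \<i> * of_real (Im v))" by (simp only: algebra_simps)
      also have "of_real (Re v) + \<i> * of_real (Im v) = v" by (simp flip: complex_eq)
      finally show ?thesis .
    qed
    then have "(\<lambda>v. pd v f \<zeta>) = (*) (pd 1 f \<zeta>)" by (rule ext)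
    then show ?thesis using has_derivative_pd[OF assms(2)[OF that]] by (simp only: has_field_derivative_def)
  qed
  then show ?thesis using assms(1) holomorphic_on_open by blast
qed

lemma holomorphic_on_imp_CR:
  assumes "f holomorphic_on D" "open D" "\<zeta> \<in> D"
  shows "pd \<i> f \<zeta> = \<i> * pd 1 f \<zeta>"
  using pd_holomorphic[OF assms] by simp

text \<open>The imaginary part on the right is the Jacobian determinant: for complex p and q,
  \<open>Im (cnj p * q)\<close> is the determinant of the real matrix with columns p and q.\<close>

lemma inj_pd_iff:
  assumes "f differentiable (at \<zeta>)"
  shows "inj (\<lambda>v. pd v f \<zeta>) \<longleftrightarrow> Im (cnj (pd 1 f \<zeta>) * pd \<i> f \<zeta>) \<noteq> 0"
proof -
  define p q where "p = pd 1 f \<zeta>" and "q = pd \<i> f \<zeta>"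
  have e: "pd v f \<zeta> = Re v *\<^sub>R p + Im v *\<^sub>R q" for v
    unfolding p_def q_def by (rule pd_complex_expand[OF assms])
  have lin: "linear (\<lambda>v. pd v f \<zeta>)" by (rule pd_linear[OF assms])
  show ?thesis unfolding p_def[symmetric] q_def[symmetric]
  proof
    assume i: "inj (\<lambda>v. pd v f \<zeta>)"
    show "Im (cnj p * q) \<noteq> 0"
    proof
      assume J: "Im (cnj p * q) = 0"
      \<comment> \<open>A kernel vector: for parallel p and q the combination |q|^2 p - (p . q) q
        vanishes. If this vector is itself zero then q = 0, and \<open>\<i>\<close> lies in the
        kernel.\<close>
      define v where "v = Complex (Re (cnj q * q)) (- Re (cnj p * q))"
      have "pd v f \<zeta> = 0" using J unfolding e v_def by (simp add: complex_eq_iff algebra_simps)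
      then have v: "v = 0" using i linear_injective_0[OF lin] by blast
      then have "q = 0" by (simp add: v_def complex_eq_iff)
      then have "pd \<i> f \<zeta> = 0" by (simp add: q_def)
      then show False using i linear_injective_0[OF lin] by (metis complex_i_not_zero)
    qed
  next
    assume J: "Im (cnj p * q) \<noteq> 0"
    show "inj (\<lambda>v. pd v f \<zeta>)"
    proof (subst linear_injective_0[OF lin], intro allI impI)
      fix v assume "pd v f \<zeta> = 0"
      then have z: "Re v *\<^sub>R p + Im v *\<^sub>R q = 0" by (simp add: e)
      have "Im (cnj (Re v *\<^sub>R p + Im v *\<^sub>R q) * q) = Re v * Im (cnj p * q)"
        "Im (cnj p * (Re v *\<^sub>R p + Im v *\<^sub>R q)) = Im v * Im (cnj p * q)"
        by (simp_all add: algebra_simps)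
      then show "v = 0" using J unfolding z by (simp add: complex_eq_iff)
    qed
  qed
qed

text \<open>\<open>H w x\<close> is the inverse of the derivative of \<open>f\<close> at
  \<open>x\<close>, applied to \<open>w\<close> and written out by Cramer's rule, hence smooth in
  \<open>x\<close>. As the derivative of \<open>g\<close> is \<open>H w\<close> composed with
  \<open>g\<close>, each order of smoothness of \<open>g\<close> yields the next.\<close>

lemma smooth_on_inverse_map:
  fixes f g :: "complex \<Rightarrow> complex"
  assumes S: "open S" and T: "open T" and hom: "homeomorphism S T f g" and f: "smooth_on S f"
    and inj: "\<And>x. x \<in> S \<Longrightarrow> inj (\<lambda>v. pd v f x)"
  shows "smooth_on T g"
proof -
  define p q where "p = pd 1 f" and "q = pd \<i> f"
  define J where "J x = Im (cnj (p x) * q x)" for x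
  define H where "H w x = Complex (Im (cnj w * q x) / J x) (Im (cnj (p x) * w) / J x)" for w x
  have J: "J x \<noteq> 0" if "x \<in> S" for x
    using inj[OF that] inj_pd_iff[OF smooth_onD[OF f that]] by (simp add: J_def p_def q_def)
  have sp: "smooth_on S p" "smooth_on S q" using f by (auto simp: p_def q_def intro: smooth_on_pd)
  have sJ: "smooth_on S J" unfolding J_def
    by (rule smooth_on_Im[OF S smooth_on_mult[OF S smooth_on_cnj[OF S sp(1)] sp(2)]])
  have sH: "smooth_on S (H w)" for w
    unfolding H_def
    by (intro smooth_on_Complex[OF S] smooth_on_divide[OF S] smooth_on_Im[OF S] smooth_on_mult[OF S]
        smooth_on_cnj[OF S] sp smooth_on_const sJ J)
  have TS: "g ` T = S" "f ` S = T" "\<And>x. x \<in> S \<Longrightarrow> g (f x) = x" "\<And>y. y \<in> T \<Longrightarrow> f (g y) = y"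
    "continuous_on S f" "continuous_on T g"
    using hom by (auto simp: homeomorphism_def)
  have gd: "(g has_derivative (\<lambda>w. H w (g y))) (at y)" if y: "y \<in> T" for y
  proof -
    have x: "g y \<in> S" using TS y by auto
    note df = smooth_onD[OF f x]
    have comp: "H (pd v f (g y)) (g y) = v" for v
    proof -
      have e: "pd v f (g y) = Re v *\<^sub>R p (g y) + Im v *\<^sub>R q (g y)"
        unfolding p_def q_def by (rule pd_complex_expand[OF df])
      have "Im (cnj (pd v f (g y)) * q (g y)) = Re v * J (g y)"
        "Im (cnj (p (g y)) * pd v f (g y)) = Im v * J (g y)"
        unfolding e J_def by (simp_all add: algebra_simps)
      then show ?thesis using J[OF x] by (simp add: H_def complex_eq_iff)
    qed
    have "bounded_linear (\<lambda>w. H w (g y))"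
      unfolding linear_conv_bounded_linear[symmetric]
      by (rule linearI) (simp_all add: H_def complex_eq_iff algebra_simps add_divide_distrib diff_divide_distrib)
    moreover have "continuous (at y) g" using TS T y continuous_on_eq_continuous_at by blast
    ultimately show ?thesis
      using has_derivative_inverse_basic[OF has_derivative_pd[OF df] _ _ _ T y TS(4), of "\<lambda>w. H w (g y)"]
        comp by (auto simp: fun_eq_iff)
  qed
  have "Ck_on k T g" for k
  proof (induction k)
    case 0
    then show ?case using TS by simp
  next
    case (Suc k)
    have "Ck_on k T (pd w g)" for w
    proof -
      have "Ck_on k T (\<lambda>y. H w (g y))"
        by (rule Ck_on_compose[OF T _ _ Suc, of S]) (use TS sH in \<open>auto simp: smooth_on_def\<close>)
      then show ?thesis by (subst Ck_on_cong[OF T, of _ "\<lambda>y. H w (g y)"]) (auto simp: pd_eq[OF gd])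
    qed
    moreover have "\<forall>y\<in>T. g differentiable (at y)" using gd by (auto simp: differentiable_def)
    ultimately show ?case using Ck_on_Suc by blast
  qed
  then show ?thesis by (simp add: smooth_on_def)
qed

text \<open>The inverse function theorem asks for the derivative as a continuous map into bounded
  linear operators, hence \<open>Blinfun\<close>. The target is cut down to a ball so that charts
  built from it have convex image, on which holomorphic functions have primitives.\<close>

lemma local_diffeo:
  fixes f :: "complex \<Rightarrow> complex"
  assumes S: "open S" "x0 \<in> S" and f: "smooth_on S f" and inj: "inj (\<lambda>v. pd v f x0)"
  obtains U r g where "open U" "x0 \<in> U" "U \<subseteq> S" "r > 0" "homeomorphism U (ball (f x0) r) f g"
    "smooth_on (ball (f x0) r) g" "\<And>x. x \<in> U \<Longrightarrow> inj (\<lambda>v. pd v f x)"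
proof -
  define f' where "f' x = Blinfun (\<lambda>v. pd v f x)" for x
  have bl: "bounded_linear (\<lambda>v. pd v f x)" if "x \<in> S" for x
    using has_derivative_bounded_linear[OF has_derivative_pd[OF smooth_onD[OF f that]]] .
  have f': "blinfun_apply (f' x) = (\<lambda>v. pd v f x)" if "x \<in> S" for x
    unfolding f'_def by (rule bounded_linear_Blinfun_apply[OF bl[OF that]])
  have d: "(f has_derivative blinfun_apply (f' x)) (at x)" if "x \<in> S" for x
    using has_derivative_pd[OF smooth_onD[OF f that]] f'[OF that] by simp
  have c: "continuous_on S f'"
  proof (rule continuous_on_blinfun_componentwise)
    fix i :: complex
    show "continuous_on S (\<lambda>x. blinfun_apply (f' x) i)"
      using smooth_on_continuous[OF smooth_on_pd[OF f, of i]] f' by (simp cong: continuous_on_cong)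
  qed
  obtain h where h: "linear h" "h \<circ> (\<lambda>v. pd v f x0) = id"
    using linear_injective_left_inverse[OF pd_linear[OF smooth_onD[OF f S(2)]] inj] by blast
  have hb: "blinfun_apply (Blinfun h) = h"
    using h(1) by (simp add: bounded_linear_Blinfun_apply linear_conv_bounded_linear)
  have "Blinfun h o\<^sub>L f' x0 = id_blinfun"
    by (rule blinfun_eqI) (use h(2) hb f'[OF S(2)] in \<open>simp add: fun_eq_iff\<close>)
  from inverse_function_theorem[OF S(1) d c S(2) this]
  obtain U V g g' where UV: "open U" "U \<subseteq> S" "x0 \<in> U" "open V" "f x0 \<in> V" "homeomorphism U V f g"
    "\<And>y. y \<in> V \<Longrightarrow> bij (blinfun_apply (f' (g y)))" by metis
  obtain r where r: "r > 0" "ball (f x0) r \<subseteq> V" using UV open_contains_ball by blast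
  define B where "B = ball (f x0) r"
  have UVf: "f ` U = V" "g ` V = U" "\<And>x. x \<in> U \<Longrightarrow> g (f x) = x" "\<And>y. y \<in> V \<Longrightarrow> f (g y) = y"
    using UV(6) by (simp_all add: homeomorphism_def)
  have BV: "B \<subseteq> V" using r(2) by (simp add: B_def)
  have gB: "g ` B = U \<inter> f -` B"
  proof (intro equalityI subsetI)
    fix x assume "x \<in> g ` B"
    then show "x \<in> U \<inter> f -` B" using UVf BV by auto
  next
    fix x assume "x \<in> U \<inter> f -` B"
    then show "x \<in> g ` B" using UVf(3)[of x] by (auto intro: image_eqI[of x g "f x"])
  qed
  have h3: "homeomorphism (g ` B) B f g"
    by (rule homeomorphism_of_subsets[OF UV(6)]) (use gB BV UVf in \<open>auto simp: image_image subset_iff\<close>)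
  have "continuous_on U f" using UV(6) by (simp add: homeomorphism_def)
  then have oB: "open (g ` B)" unfolding gB using UV(1) by (simp add: B_def continuous_open_preimage)
  have gBU: "g ` B \<subseteq> U" using gB by blast
  have injB: "inj (\<lambda>v. pd v f x)" if "x \<in> g ` B" for x
  proof -
    have "x \<in> U" using that gBU by blast
    then have "f x \<in> V" "g (f x) = x" "x \<in> S" using UV by (auto simp: homeomorphism_def)
    then show ?thesis using UV(7)[of "f x"] f'[of x] by (simp add: bij_def)
  qed
  have sg: "smooth_on B g"
    by (rule smooth_on_inverse_map[OF oB _ h3 smooth_on_subset[OF f] injB]) (use gBU UV in \<open>auto simp: B_def\<close>)
  have "x0 \<in> g ` B" using UV r unfolding gB by (auto simp: B_def)
  then show thesis
    using that[of "g ` B" r g] oB gBU UV(2) r(1) h3 sg injB unfolding B_def by blast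
qed

section \<open>Charts\<close>

lemma is_chart_open_image:
  assumes "is_chart (U, z)" "open W" "W \<subseteq> U"
  shows "open (z ` W)"
proof -
  have h: "homeomorphism U (z ` U) z (inv_into U z)" "open (z ` U)" "open U"
    using assms(1) by (auto simp: is_chart_def)
  have "openin (top_of_set U) W" using assms(2,3) h(3) by (simp add: openin_open_eq)
  then have "openin (top_of_set (z ` U)) (z ` W)" using homeomorphism_imp_open_map[OF h(1)] by blast
  then show ?thesis using h(2) openin_open_eq by blast
qed

lemma is_chart_inj: "is_chart (U, z) \<Longrightarrow> inj_on z U"
  unfolding is_chart_def homeomorphism_def by (auto intro: inj_on_inverseI)

lemma is_chart_inv [simp]: "is_chart (U, z) \<Longrightarrow> q \<in> U \<Longrightarrow> inv_into U z (z q) = q"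
  by (rule inv_into_f_f[OF is_chart_inj])

lemma homeomorphism_inv_into:
  assumes "homeomorphism U V z g"
  shows "homeomorphism U (z ` U) z (inv_into U z)"
proof -
  have V: "z ` U = V" and i: "inj_on z U" and gz: "\<And>x. x \<in> U \<Longrightarrow> g (z x) = x"
    using assms by (auto simp: homeomorphism_def intro: inj_on_inverseI)
  have e: "inv_into U z y = g y" if "y \<in> V" for y
    using that V gz i by (auto simp: inv_into_f_f)
  show ?thesis
    using assms by (rule homeomorphism_cong) (use V e in auto)
qed

context
  fixes \<A> :: "'m::topological_space chart set"
  assumes surf: "smooth_surface \<A>"
begin

lemma chartsD: "(U, z) \<in> charts \<A> \<Longrightarrow> is_chart (U, z)"
  by (simp add: charts_def)

lemma charts_open: "(U, z) \<in> charts \<A> \<Longrightarrow> open U"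
  using chartsD by (auto simp: is_chart_def)

lemma charts_inv: "(U, z) \<in> charts \<A> \<Longrightarrow> q \<in> U \<Longrightarrow> inv_into U z (z q) = q"
  using chartsD by simp

lemma charts_open_image: "(U, z) \<in> charts \<A> \<Longrightarrow> open W \<Longrightarrow> W \<subseteq> U \<Longrightarrow> open (z ` W)"
  using chartsD is_chart_open_image by blast

text \<open>Charts of the maximal atlas are only known to be compatible with those of
  \<open>\<A>\<close>. Near each point the transition is factored through a chart of
  \<open>\<A>\<close>, and smoothness is local.\<close>

lemma transition_smooth:
  assumes c: "(U, z) \<in> charts \<A>" and c': "(U', z') \<in> charts \<A>"
  shows "smooth_on (z ` (U \<inter> U')) (\<lambda>\<zeta>. z' (inv_into U z \<zeta>))"
proof (rule smooth_on_local)
  fix \<zeta> assume "\<zeta> \<in> z ` (U \<inter> U')"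
  then obtain p where p: "p \<in> U" "p \<in> U'" "\<zeta> = z p" by auto
  have oU: "open U" "open U'" using c c' charts_open by auto
  obtain U0 z0 where c0: "(U0, z0) \<in> \<A>" "p \<in> U0"
    using surf unfolding smooth_surface_def by (metis (no_types, lifting) UN_E UNIV_I fst_conv surj_pair)
  have i0: "is_chart (U0, z0)" using surf c0 unfolding smooth_surface_def by blast
  have o0: "open U0" using i0 by (simp add: is_chart_def)
  have s1: "smooth_on (z ` (U \<inter> U0)) (z0 \<circ> inv_into U z)"
    using c c0 by (auto simp: charts_def compatible_def)
  have s2: "smooth_on (z0 ` (U' \<inter> U0)) (z' \<circ> inv_into U0 z0)"
    using c' c0 by (auto simp: charts_def compatible_def)
  define W where "W = U \<inter> U' \<inter> U0"
  have W: "open W" "W \<subseteq> U" "p \<in> W" using oU o0 p c0 by (auto simp: W_def)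
  have oT: "open (z ` W)" using charts_open_image[OF c] W by blast
  have inv: "inv_into U z (z x) = x" if "x \<in> U" for x using charts_inv[OF c that] .
  have "smooth_on (z ` W) (\<lambda>\<zeta>. (z' \<circ> inv_into U0 z0) ((z0 \<circ> inv_into U z) \<zeta>))"
    by (rule smooth_on_compose[OF oT _ s2 smooth_on_subset[OF s1]])
      (auto simp: W_def inv intro!: imageI)
  then have "smooth_on (z ` W) (\<lambda>\<zeta>. z' (inv_into U z \<zeta>))"
    by (subst smooth_on_cong[OF oT, of _ "\<lambda>\<zeta>. (z' \<circ> inv_into U0 z0) ((z0 \<circ> inv_into U z) \<zeta>)"])
      (auto simp: W_def inv is_chart_inv[OF i0])
  then have "smooth_on (z ` (U \<inter> U') \<inter> z ` W) (\<lambda>\<zeta>. z' (inv_into U z \<zeta>))"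
    by (rule smooth_on_subset) auto
  then show "\<exists>T. open T \<and> \<zeta> \<in> T \<and> smooth_on (z ` (U \<inter> U') \<inter> T) (\<lambda>\<zeta>. z' (inv_into U z \<zeta>))"
    using oT W p by blast
qed

lemma chartsI:
  assumes "is_chart (U, z)"
    and "\<And>U' z'. (U', z') \<in> charts \<A> \<Longrightarrow> smooth_on (z ` (U \<inter> U')) (\<lambda>\<zeta>. z' (inv_into U z \<zeta>))"
    and "\<And>U' z'. (U', z') \<in> charts \<A> \<Longrightarrow> smooth_on (z' ` (U \<inter> U')) (\<lambda>\<zeta>. z (inv_into U' z' \<zeta>))"
  shows "(U, z) \<in> charts \<A>"
proof -
  have "compatible (U, z) c'" if "c' \<in> \<A>" for c'
  proof -
    have "c' \<in> charts \<A>" using that surf unfolding smooth_surface_def charts_def by blast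
    then show ?thesis using assms(2,3) by (cases c') (simp add: compatible_def o_def)
  qed
  then show ?thesis using assms(1) by (simp add: charts_def)
qed

lemma charts_cover: "\<exists>U z. (U, z) \<in> charts \<A> \<and> q \<in> U"
proof -
  obtain c where "c \<in> \<A>" "q \<in> fst c" using surf unfolding smooth_surface_def by blast
  moreover have "c \<in> charts \<A>" using calculation surf unfolding smooth_surface_def charts_def by blast
  ultimately show ?thesis by (metis prod.collapse)
qed

text \<open>All new coordinates arise in this way: an old chart is restricted and followed by a
  diffeomorphism of plane domains.\<close>

lemma new_chart:
  assumes c: "(U, z) \<in> charts \<A>" and W: "open W" "W \<subseteq> U" and V: "open V"
    and h: "homeomorphism (z ` W) V T g" and T: "smooth_on (z ` W) T" and g: "smooth_on V g"
  shows "(W, T \<circ> z) \<in> charts \<A>" and "(T \<circ> z) ` W = V"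
    and "\<And>\<zeta>. \<zeta> \<in> V \<Longrightarrow> inv_into W (T \<circ> z) \<zeta> = inv_into U z (g \<zeta>)"
proof -
  have i: "is_chart (U, z)" using chartsD c .
  have inv: "inv_into U z (z x) = x" if "x \<in> U" for x using charts_inv[OF c that] .
  have TV: "T ` z ` W = V" "\<And>x. x \<in> z ` W \<Longrightarrow> g (T x) = x" "\<And>y. y \<in> V \<Longrightarrow> T (g y) = y" "g ` V = z ` W"
    using h by (auto simp: homeomorphism_def)
  have "homeomorphism U (z ` U) z (inv_into U z)" using i by (simp add: is_chart_def)
  then have "homeomorphism W (z ` W) z (inv_into U z)"
    by (rule homeomorphism_of_subsets) (use W in auto)
  then have h2: "homeomorphism W V (T \<circ> z) (inv_into U z \<circ> g)" using homeomorphism_compose h by blast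
  show im: "(T \<circ> z) ` W = V" using TV(1) by (simp add: image_image)
  have injT: "inj_on (T \<circ> z) W" using h2 by (auto simp: homeomorphism_def intro!: inj_on_inverseI)
  show inv2: "inv_into W (T \<circ> z) \<zeta> = inv_into U z (g \<zeta>)" if "\<zeta> \<in> V" for \<zeta>
  proof -
    have "\<zeta> \<in> (T \<circ> z) ` W" using that im by simp
    then obtain x where x: "x \<in> W" "\<zeta> = (T \<circ> z) x" by blast
    then show ?thesis using inv_into_f_f[OF injT x(1)] TV(2)[of "z x"] inv W by auto
  qed
  show "(W, T \<circ> z) \<in> charts \<A>"
  proof (rule chartsI)
    show "is_chart (W, T \<circ> z)"
      using homeomorphism_inv_into[OF h2] W V im by (simp add: is_chart_def)
  next
    fix U' z' assume c': "(U', z') \<in> charts \<A>"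
    have oU': "open U'" using charts_open c' by blast
    have sub: "z ` (W \<inter> U') \<subseteq> z ` (U \<inter> U')" using W by blast
    have oW: "open (z ` (W \<inter> U'))" using charts_open_image[OF c] W oU' by blast
    have eq: "(T \<circ> z) ` (W \<inter> U') = V \<inter> g -` (z ` (W \<inter> U'))"
    proof (intro equalityI subsetI)
      fix y assume "y \<in> (T \<circ> z) ` (W \<inter> U')"
      then obtain x where x: "x \<in> W" "x \<in> U'" "y = T (z x)" by auto
      then have "y \<in> V" "g y = z x" using TV(1) TV(2)[of "z x"] by auto
      then show "y \<in> V \<inter> g -` (z ` (W \<inter> U'))" using x by auto
    next
      fix y assume "y \<in> V \<inter> g -` (z ` (W \<inter> U'))"
      then obtain x where x: "y \<in> V" "x \<in> W" "x \<in> U'" "g y = z x" by auto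
      then have "y = T (z x)" using TV(3)[of y] by simp
      then show "y \<in> (T \<circ> z) ` (W \<inter> U')" using x by auto
    qed
    have cg: "continuous_on V g" using h by (simp add: homeomorphism_def)
    have o2: "open ((T \<circ> z) ` (W \<inter> U'))" unfolding eq by (rule continuous_open_preimage[OF cg V oW])
    have "smooth_on ((T \<circ> z) ` (W \<inter> U')) (\<lambda>\<zeta>. (\<lambda>\<zeta>. z' (inv_into U z \<zeta>)) (g \<zeta>))"
      by (rule smooth_on_compose[OF o2 _ transition_smooth[OF c c'] smooth_on_subset[OF g]])
        (use eq sub in auto)
    then show "smooth_on ((T \<circ> z) ` (W \<inter> U')) (\<lambda>\<zeta>. z' (inv_into W (T \<circ> z) \<zeta>))"
      by (subst smooth_on_cong[OF o2, of _ "\<lambda>\<zeta>. z' (inv_into U z (g \<zeta>))"]) (use eq inv2 in auto)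
    have o3: "open (z' ` (W \<inter> U'))" using charts_open_image[OF c'] W oU' by blast
    have inv': "inv_into U' z' (z' x) = x" if "x \<in> U'" for x using charts_inv[OF c' that] .
    have "smooth_on (z' ` (W \<inter> U')) (\<lambda>\<zeta>. T ((\<lambda>\<zeta>. z (inv_into U' z' \<zeta>)) \<zeta>))"
      by (rule smooth_on_compose[OF o3 _ T smooth_on_subset[OF transition_smooth[OF c' c]]])
        (use W inv' in auto)
    then show "smooth_on (z' ` (W \<inter> U')) (\<lambda>\<zeta>. (T \<circ> z) (inv_into U' z' \<zeta>))" by simp
  qed
qed

lemma chart_restrict:
  assumes "(U, z) \<in> charts \<A>" "open W" "W \<subseteq> U"
  shows "(W, z) \<in> charts \<A>"
  using new_chart(1)[OF assms charts_open_image[OF assms], of "\<lambda>x. x" "\<lambda>x. x"]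
  by (simp add: homeomorphism_ident smooth_on_ident o_def)

lemma smooth_fun_onD:
  "smooth_fun_on \<A> S g \<Longrightarrow> (U, z) \<in> charts \<A> \<Longrightarrow> smooth_on (z ` (U \<inter> S)) (\<lambda>\<zeta>. g (inv_into U z \<zeta>))"
  by (auto simp: smooth_fun_on_def o_def)

text \<open>Smoothness is demanded in every chart of the maximal atlas; one chart containing
  \<open>S\<close> decides it because transitions are smooth.\<close>

lemma smooth_fun_onI:
  assumes c: "(U, z) \<in> charts \<A>" and S: "open S" "S \<subseteq> U"
    and g: "smooth_on (z ` S) (\<lambda>\<zeta>. g (inv_into U z \<zeta>))"
  shows "smooth_fun_on \<A> S g"
  unfolding smooth_fun_on_def
proof clarify
  fix U' z' assume c': "(U', z') \<in> charts \<A>"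
  have o: "open (z' ` (U' \<inter> S))" using charts_open_image[OF c'] charts_open[OF c'] S by blast
  have inv': "inv_into U' z' (z' x) = x" if "x \<in> U'" for x using charts_inv[OF c' that] .
  have inv: "inv_into U z (z x) = x" if "x \<in> U" for x using charts_inv[OF c that] .
  have "smooth_on (z' ` (U' \<inter> S)) (\<lambda>\<zeta>. (\<lambda>\<zeta>. g (inv_into U z \<zeta>)) (z (inv_into U' z' \<zeta>)))"
    by (rule smooth_on_compose[OF o _ g smooth_on_subset[OF transition_smooth[OF c' c]]])
      (use S inv' in auto)
  then show "smooth_on (z' ` (U' \<inter> S)) (g \<circ> inv_into U' z')"
    by (subst smooth_on_cong[OF o, of _ "\<lambda>\<zeta>. g (inv_into U z (z (inv_into U' z' \<zeta>)))"])
      (use S inv' inv in \<open>auto simp: subset_iff\<close>)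
qed

text \<open>Change of coordinates for tangent vectors: coordinates in the first chart are sent to
  coordinates in the second.\<close>

definition trans_d :: "'m chart \<Rightarrow> 'm chart \<Rightarrow> 'm \<Rightarrow> complex \<Rightarrow> complex" where
  "trans_d = (\<lambda>(U', z') (U, z) q w. pd w (\<lambda>\<zeta>. z (inv_into U' z' \<zeta>)) (z' q))"

lemma dif_pd: "dif (U, z) g q w = pd w (\<lambda>\<zeta>. g (inv_into U z \<zeta>)) (z q)"
  by (simp add: dif_def pd_def o_def)

lemma trans_d_properties:
  assumes c: "(U, z) \<in> charts \<A>" and c': "(U', z') \<in> charts \<A>" and q: "q \<in> U" "q \<in> U'"
  shows "linear (trans_d (U', z') (U, z) q)" "inj (trans_d (U', z') (U, z) q)"
    "trans_d (U, z) (U', z') q (trans_d (U', z') (U, z) q w) = w"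
proof -
  have d: "(\<lambda>\<zeta>. z (inv_into U' z' \<zeta>)) differentiable (at (z' q))"
    by (rule smooth_onD[OF transition_smooth[OF c' c]]) (use q in auto)
  have d': "(\<lambda>\<zeta>. z' (inv_into U z \<zeta>)) differentiable (at (z q))"
    by (rule smooth_onD[OF transition_smooth[OF c c']]) (use q in auto)
  show "linear (trans_d (U', z') (U, z) q)" using pd_linear[OF d] by (simp add: trans_d_def)
  have inv': "inv_into U' z' (z' x) = x" if "x \<in> U'" for x using charts_inv[OF c' that] .
  have inv: "inv_into U z (z x) = x" if "x \<in> U" for x using charts_inv[OF c that] .
  have o: "open (z' ` (U' \<inter> U))"
    by (rule charts_open_image[OF c']) (use charts_open[OF c] charts_open[OF c'] in auto)
  show *: "trans_d (U, z) (U', z') q (trans_d (U', z') (U, z) q w) = w" for w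
  proof -
    have "pd w (\<lambda>\<zeta>. \<zeta>) (z' q) = pd w (\<lambda>\<zeta>. z' (inv_into U z (z (inv_into U' z' \<zeta>)))) (z' q)"
      by (rule pd_cong_open[OF o]) (use q inv inv' in auto)
    also have "\<dots> = trans_d (U, z) (U', z') q (trans_d (U', z') (U, z) q w)"
      using pd_compose[of "\<lambda>\<zeta>. z (inv_into U' z' \<zeta>)" "z' q" "\<lambda>\<zeta>. z' (inv_into U z \<zeta>)" w] d d' inv'[OF q(2)]
      by (simp add: trans_d_def)
    finally show ?thesis using pd_eq[OF has_derivative_ident, of w "z' q"] by simp
  qed
  show "inj (trans_d (U', z') (U, z) q)" by (rule inj_on_inverseI) (rule *)
qed

lemma dif_change:
  assumes c: "(U, z) \<in> charts \<A>" and c': "(U', z') \<in> charts \<A>" and q: "q \<in> U" "q \<in> U'"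
    and g: "(\<lambda>\<zeta>. g (inv_into U z \<zeta>)) differentiable (at (z q))"
  shows "dif (U', z') g q w = dif (U, z) g q (trans_d (U', z') (U, z) q w)"
proof -
  have d: "(\<lambda>\<zeta>. z (inv_into U' z' \<zeta>)) differentiable (at (z' q))"
    by (rule smooth_onD[OF transition_smooth[OF c' c]]) (use q in auto)
  have inv': "inv_into U' z' (z' x) = x" if "x \<in> U'" for x using charts_inv[OF c' that] .
  have inv: "inv_into U z (z x) = x" if "x \<in> U" for x using charts_inv[OF c that] .
  have o: "open (z' ` (U' \<inter> U))"
    by (rule charts_open_image[OF c']) (use charts_open[OF c] charts_open[OF c'] in auto)
  have "pd w (\<lambda>\<zeta>. g (inv_into U' z' \<zeta>)) (z' q) = pd w (\<lambda>\<zeta>. g (inv_into U z (z (inv_into U' z' \<zeta>)))) (z' q)"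
    by (rule pd_cong_open[OF o]) (use q inv inv' in auto)
  also have "\<dots> = dif (U, z) g q (trans_d (U', z') (U, z) q w)"
    using pd_compose[OF d, of "\<lambda>\<zeta>. g (inv_into U z \<zeta>)" w] g inv'[OF q(2)]
    by (simp add: trans_d_def dif_pd)
  finally show ?thesis by (simp add: dif_pd)
qed

end

section \<open>Middle frames in a coordinate domain\<close>

lemma bounded_bilinear_mink: "bounded_bilinear mink"
proof -
  have "bilinear mink"
    unfolding bilinear_def by (auto intro!: linearI simp: mink_def algebra_simps)
  then show ?thesis by (simp add: bilinear_conv_bounded_bilinear)
qed

interpretation mink: bounded_bilinear mink by (rule bounded_bilinear_mink)

lemmas mink_simps = mink.add_left mink.add_right mink.diff_left mink.diff_right
  mink.scaleR_left mink.scaleR_right mink.minus_left mink.minus_right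

lemma mink_commute: "mink v w = mink w v"
  by (simp add: mink_def algebra_simps)

lemmas smooth_on_mink = smooth_on_bounded_bilinear[OF _ bounded_bilinear_mink]
lemmas pd_mink = pd_bounded_bilinear[OF bounded_bilinear_mink]
lemmas pd_scaleR = pd_bounded_bilinear[OF bounded_bilinear_scaleR]
lemmas pd_mult = pd_bounded_bilinear[OF bounded_bilinear_mult]

lemma UNIV_four: "(UNIV :: 4 set) = {1, 2, 3, 4}"
  using exhaust_4 by auto

lemma det_4:
  fixes A :: "'a::comm_ring_1^4^4"
  shows "det A =
    A$1$1 * (A$2$2 * (A$3$3 * A$4$4 - A$3$4 * A$4$3) - A$2$3 * (A$3$2 * A$4$4 - A$3$4 * A$4$2) + A$2$4 * (A$3$2 * A$4$3 - A$3$3 * A$4$2))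
  - A$1$2 * (A$2$1 * (A$3$3 * A$4$4 - A$3$4 * A$4$3) - A$2$3 * (A$3$1 * A$4$4 - A$3$4 * A$4$1) + A$2$4 * (A$3$1 * A$4$3 - A$3$3 * A$4$1))
  + A$1$3 * (A$2$1 * (A$3$2 * A$4$4 - A$3$4 * A$4$2) - A$2$2 * (A$3$1 * A$4$4 - A$3$4 * A$4$1) + A$2$4 * (A$3$1 * A$4$2 - A$3$2 * A$4$1))
  - A$1$4 * (A$2$1 * (A$3$2 * A$4$3 - A$3$3 * A$4$2) - A$2$2 * (A$3$1 * A$4$3 - A$3$3 * A$4$1) + A$2$3 * (A$3$1 * A$4$2 - A$3$2 * A$4$1))"
proof -
  have f1: "finite {2::4, 3, 4}" "1 \<notin> {2::4, 3, 4}" by auto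
  have f2: "finite {3::4, 4}" "2 \<notin> {3::4, 4}" by auto
  have f3: "finite {4::4}" "3 \<notin> {4::4}" by auto
  show ?thesis
    unfolding det_def UNIV_four
    by (subst sum_over_permutations_insert[OF f1], subst sum_over_permutations_insert[OF f2],
        subst sum_over_permutations_insert[OF f3], simp only: permutes_sing,
        simp add: sign_swap_id permutation_swap_id sign_compose sign_id swap_id_eq permutation_compose,
        simp add: algebra_simps)
qed

text \<open>The Gram matrix \<open>g_ij\<close> of the standard basis, without the orientation and
  the time orientation, which enter separately through \<open>det\<close> and
  \<open>lightcone\<close>.\<close>

definition frame_rel :: "real^4 \<Rightarrow> real^4 \<Rightarrow> real^4 \<Rightarrow> real^4 \<Rightarrow> bool" where
  "frame_rel a b c d \<longleftrightarrow>
     mink a a = 0 \<and> mink a b = 0 \<and> mink a c = 0 \<and> mink a d = -1 \<and>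
     mink b b = 1 \<and> mink b c = 0 \<and> mink b d = 0 \<and> mink c c = 1 \<and> mink c d = 0 \<and> mink d d = 0"

lemma frame_relD:
  assumes "frame_rel a b c d"
  shows "mink a a = 0" "mink a b = 0" "mink a c = 0" "mink a d = -1"
    "mink b a = 0" "mink b b = 1" "mink b c = 0" "mink b d = 0"
    "mink c a = 0" "mink c b = 0" "mink c c = 1" "mink c d = 0"
    "mink d a = -1" "mink d b = 0" "mink d c = 0" "mink d d = 0"
  using assms by (auto simp: frame_rel_def mink_commute)

lemma matrix_vector_4: "(a :: real^4^4) *v v =
    v$1 *\<^sub>R column 1 a + v$2 *\<^sub>R column 2 a + v$3 *\<^sub>R column 3 a + v$4 *\<^sub>R column 4 a"
  by (simp add: matrix_mult_sum sum_4 scalar_mult_eq_scaleR)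

lemma laguerre_group_iff:
  "(x, a) \<in> laguerre_group \<longleftrightarrow>
     frame_rel (column 1 a) (column 2 a) (column 3 a) (column 4 a) \<and> det a = 1 \<and>
     column 1 a \<in> lightcone \<and> column 4 a \<in> lightcone"
proof -
  have "(\<forall>v w. mink (a *v v) (a *v w) = mink v w) \<longleftrightarrow>
    frame_rel (column 1 a) (column 2 a) (column 3 a) (column 4 a)"
  proof
    assume "\<forall>v w. mink (a *v v) (a *v w) = mink v w"
    then have *: "mink (column i a) (column j a) = mink (axis i 1) (axis j 1)" for i j
      by (metis matrix_vector_mult_basis)
    show "frame_rel (column 1 a) (column 2 a) (column 3 a) (column 4 a)"
      unfolding frame_rel_def * by (simp add: mink_def axis_def)
  next
    assume f: "frame_rel (column 1 a) (column 2 a) (column 3 a) (column 4 a)"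
    show "\<forall>v w. mink (a *v v) (a *v w) = mink v w"
      unfolding matrix_vector_4
      by (simp add: mink_simps frame_relD[OF f]) (simp add: mink_def algebra_simps)
  qed
  then show ?thesis by (simp add: laguerre_group_def matrix_vector_mult_basis)
qed

text \<open>The first and the last vector are null and pair to -1, so each one reads off the
  coefficient of the other with a sign. The columns span because the determinant is 1.\<close>

lemma frame_expand:
  assumes g: "(x, a) \<in> laguerre_group"
  shows "v = (- mink v (column 4 a)) *\<^sub>R column 1 a + mink v (column 2 a) *\<^sub>R column 2 a
    + mink v (column 3 a) *\<^sub>R column 3 a + (- mink v (column 1 a)) *\<^sub>R column 4 a"
proof -
  have f: "frame_rel (column 1 a) (column 2 a) (column 3 a) (column 4 a)" and "det a = 1"
    using g by (auto simp: laguerre_group_iff)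
  then have "invertible a" by (simp add: invertible_det_nz)
  then obtain b where "a ** b = mat 1" unfolding invertible_def by blast
  then have "v = a *v (b *v v)" by (simp add: matrix_vector_mul_assoc)
  then obtain c where c: "v = a *v c" by blast
  show ?thesis
    unfolding c matrix_vector_4 by (simp add: mink_simps frame_relD[OF f])
qed

text \<open>The coordinate form of \<open>middle_frame\<close>: the surface and the map
  \<open>F\<close> are left out, and differentials become partial derivatives on an open plane set.
  The condition that the frame lies over \<open>F\<close> is carried separately.\<close>

definition mframe ::
    "complex set \<Rightarrow> (complex \<Rightarrow> (real^4) \<times> (real^4^4)) \<Rightarrow> (complex \<Rightarrow> complex \<Rightarrow> real) \<Rightarrow>
     (complex \<Rightarrow> complex \<Rightarrow> real) \<Rightarrow> (complex \<Rightarrow> real) \<Rightarrow> (complex \<Rightarrow> real) \<Rightarrow> (complex \<Rightarrow> real) \<Rightarrow>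
     (complex \<Rightarrow> real) \<Rightarrow> (complex \<Rightarrow> real) \<Rightarrow> bool" where
  "mframe D A \<alpha> \<beta> p1 p2 p3 q1 q2 \<longleftrightarrow>
     open D \<and> smooth_on D A \<and>
     (let a0 = (\<lambda>q. fst (A q));
          a = (\<lambda>i q. column i (snd (A q)));
          \<gamma> = (\<lambda>q w. 2 * q2 q * \<alpha> q w - 2 * q1 q * \<beta> q w)
      in \<forall>q\<in>D.
        A q \<in> laguerre_group \<and>
        linear (\<alpha> q) \<and> linear (\<beta> q) \<and>
        (\<forall>r s. (\<forall>w. r * \<alpha> q w + s * \<beta> q w = 0) \<longrightarrow> r = 0 \<and> s = 0) \<and>
        (\<forall>w.
          pd w a0 q = \<alpha> q w *\<^sub>R a 2 q + \<beta> q w *\<^sub>R a 3 q \<and>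
          pd w (a 1) q = \<gamma> q w *\<^sub>R a 1 q + \<alpha> q w *\<^sub>R a 2 q - \<beta> q w *\<^sub>R a 3 q \<and>
          pd w (a 2) q = (p1 q * \<alpha> q w + p2 q * \<beta> q w) *\<^sub>R a 1 q
                          + (q1 q * \<alpha> q w + q2 q * \<beta> q w) *\<^sub>R a 3 q + \<alpha> q w *\<^sub>R a 4 q \<and>
          pd w (a 3) q = (p2 q * \<alpha> q w + p3 q * \<beta> q w) *\<^sub>R a 1 q
                          - (q1 q * \<alpha> q w + q2 q * \<beta> q w) *\<^sub>R a 2 q - \<beta> q w *\<^sub>R a 4 q \<and>
          pd w (a 4) q = (p1 q * \<alpha> q w + p2 q * \<beta> q w) *\<^sub>R a 2 q
                          + (p2 q * \<alpha> q w + p3 q * \<beta> q w) *\<^sub>R a 3 q - \<gamma> q w *\<^sub>R a 4 q))"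

lemma bounded_linear_column: "bounded_linear (\<lambda>a :: real^4^4. column i a)"
  by (rule linear_conv_bounded_linear[THEN iffD1])
    (auto intro!: linearI simp: column_def vec_eq_iff)

lemma linear_complex_expand:
  assumes "linear (f :: complex \<Rightarrow> real)"
  shows "f w = Re w * f 1 + Im w * f \<i>"
proof -
  have "w = Re w *\<^sub>R 1 + Im w *\<^sub>R \<i>" by (simp add: complex_eq_iff)
  then have "f w = f (Re w *\<^sub>R 1 + Im w *\<^sub>R \<i>)" by simp
  then show ?thesis by (simp only: linear_add[OF assms] linear_scale[OF assms] real_scaleR_def)
qed

text \<open>The frame is split into five vector functions, and the connection forms become
  parameters with defining equations; computations can then keep \<open>\<gamma>\<close>,
  \<open>\<pi>2\<close>, \<open>\<pi>3\<close>, \<open>\<omega>\<close> opaque and unfold only those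
  that matter.\<close>

locale coord_frame =
  fixes D :: "complex set" and a0 a1 a2 a3 a4 :: "complex \<Rightarrow> real^4"
    and \<alpha> \<beta> \<gamma> \<pi>2 \<pi>3 \<omega> :: "complex \<Rightarrow> complex \<Rightarrow> real" and p1 p2 p3 q1 q2 :: "complex \<Rightarrow> real"
  assumes oD: "open D"
    and sm: "smooth_on D a0" "smooth_on D a1" "smooth_on D a2" "smooth_on D a3" "smooth_on D a4"
    and rel: "\<And>\<zeta>. \<zeta> \<in> D \<Longrightarrow> frame_rel (a1 \<zeta>) (a2 \<zeta>) (a3 \<zeta>) (a4 \<zeta>)"
    and \<gamma>: "\<And>\<zeta> w. \<gamma> \<zeta> w = 2 * q2 \<zeta> * \<alpha> \<zeta> w - 2 * q1 \<zeta> * \<beta> \<zeta> w"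
    and \<pi>2: "\<And>\<zeta> w. \<pi>2 \<zeta> w = p1 \<zeta> * \<alpha> \<zeta> w + p2 \<zeta> * \<beta> \<zeta> w"
    and \<pi>3: "\<And>\<zeta> w. \<pi>3 \<zeta> w = p2 \<zeta> * \<alpha> \<zeta> w + p3 \<zeta> * \<beta> \<zeta> w"
    and \<omega>: "\<And>\<zeta> w. \<omega> \<zeta> w = q1 \<zeta> * \<alpha> \<zeta> w + q2 \<zeta> * \<beta> \<zeta> w"
    and lin: "\<And>\<zeta>. \<zeta> \<in> D \<Longrightarrow> linear (\<alpha> \<zeta>)" "\<And>\<zeta>. \<zeta> \<in> D \<Longrightarrow> linear (\<beta> \<zeta>)"
    and indep: "\<And>\<zeta> r s. \<zeta> \<in> D \<Longrightarrow> (\<forall>w. r * \<alpha> \<zeta> w + s * \<beta> \<zeta> w = 0) \<Longrightarrow> r = 0 \<and> s = 0"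
    and da0: "\<And>\<zeta> w. \<zeta> \<in> D \<Longrightarrow> pd w a0 \<zeta> = \<alpha> \<zeta> w *\<^sub>R a2 \<zeta> + \<beta> \<zeta> w *\<^sub>R a3 \<zeta>"
    and da1: "\<And>\<zeta> w. \<zeta> \<in> D \<Longrightarrow> pd w a1 \<zeta> = \<gamma> \<zeta> w *\<^sub>R a1 \<zeta> + \<alpha> \<zeta> w *\<^sub>R a2 \<zeta> - \<beta> \<zeta> w *\<^sub>R a3 \<zeta>"
    and da2: "\<And>\<zeta> w. \<zeta> \<in> D \<Longrightarrow> pd w a2 \<zeta> = \<pi>2 \<zeta> w *\<^sub>R a1 \<zeta> + \<omega> \<zeta> w *\<^sub>R a3 \<zeta> + \<alpha> \<zeta> w *\<^sub>R a4 \<zeta>"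
    and da3: "\<And>\<zeta> w. \<zeta> \<in> D \<Longrightarrow> pd w a3 \<zeta> = \<pi>3 \<zeta> w *\<^sub>R a1 \<zeta> - \<omega> \<zeta> w *\<^sub>R a2 \<zeta> - \<beta> \<zeta> w *\<^sub>R a4 \<zeta>"
    and da4: "\<And>\<zeta> w. \<zeta> \<in> D \<Longrightarrow> pd w a4 \<zeta> = \<pi>2 \<zeta> w *\<^sub>R a2 \<zeta> + \<pi>3 \<zeta> w *\<^sub>R a3 \<zeta> - \<gamma> \<zeta> w *\<^sub>R a4 \<zeta>"

lemma mframe_coord:
  assumes "mframe D A \<alpha> \<beta> p1 p2 p3 q1 q2"
  shows "coord_frame D (\<lambda>\<zeta>. fst (A \<zeta>)) (\<lambda>\<zeta>. column 1 (snd (A \<zeta>))) (\<lambda>\<zeta>. column 2 (snd (A \<zeta>)))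
    (\<lambda>\<zeta>. column 3 (snd (A \<zeta>))) (\<lambda>\<zeta>. column 4 (snd (A \<zeta>))) \<alpha> \<beta>
    (\<lambda>\<zeta> w. 2 * q2 \<zeta> * \<alpha> \<zeta> w - 2 * q1 \<zeta> * \<beta> \<zeta> w) (\<lambda>\<zeta> w. p1 \<zeta> * \<alpha> \<zeta> w + p2 \<zeta> * \<beta> \<zeta> w)
    (\<lambda>\<zeta> w. p2 \<zeta> * \<alpha> \<zeta> w + p3 \<zeta> * \<beta> \<zeta> w) (\<lambda>\<zeta> w. q1 \<zeta> * \<alpha> \<zeta> w + q2 \<zeta> * \<beta> \<zeta> w) p1 p2 p3 q1 q2"
proof -
  have o: "open D" and s: "smooth_on D A" using assms by (auto simp: mframe_def)
  have sc: "smooth_on D (\<lambda>\<zeta>. column i (snd (A \<zeta>)))" for i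
    by (rule smooth_on_bounded_linear[OF o bounded_linear_column smooth_on_snd[OF o s]])
  have r: "frame_rel (column 1 (snd (A \<zeta>))) (column 2 (snd (A \<zeta>))) (column 3 (snd (A \<zeta>))) (column 4 (snd (A \<zeta>)))"
    if "\<zeta> \<in> D" for \<zeta>
  proof -
    have "A \<zeta> \<in> laguerre_group" using assms that by (simp add: mframe_def Let_def)
    then show ?thesis using laguerre_group_iff[of "fst (A \<zeta>)" "snd (A \<zeta>)"] by simp
  qed
  note H = assms[unfolded mframe_def Let_def, THEN conjunct2, THEN conjunct2, rule_format]
  show ?thesis
  proof (rule coord_frame.intro)
    fix \<zeta> r s assume "\<zeta> \<in> D" "\<forall>w. r * \<alpha> \<zeta> w + s * \<beta> \<zeta> w = 0"
    then show "r = 0 \<and> s = 0" using H by blast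
  qed (rule o sc smooth_on_fst[OF o s] r refl
      H[THEN conjunct2, THEN conjunct1] H[THEN conjunct2, THEN conjunct2, THEN conjunct1]
      H[THEN conjunct2, THEN conjunct2, THEN conjunct2, THEN conjunct2, THEN spec, THEN conjunct1]
      H[THEN conjunct2, THEN conjunct2, THEN conjunct2, THEN conjunct2, THEN spec, THEN conjunct2, THEN conjunct1]
      H[THEN conjunct2, THEN conjunct2, THEN conjunct2, THEN conjunct2, THEN spec, THEN conjunct2, THEN conjunct2, THEN conjunct1]
      H[THEN conjunct2, THEN conjunct2, THEN conjunct2, THEN conjunct2, THEN spec, THEN conjunct2, THEN conjunct2, THEN conjunct2, THEN conjunct1]
      H[THEN conjunct2, THEN conjunct2, THEN conjunct2, THEN conjunct2, THEN spec, THEN conjunct2, THEN conjunct2, THEN conjunct2, THEN conjunct2]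
      ; assumption)+
qed

locale middle_coord_frame =
  fixes D :: "complex set" and A :: "complex \<Rightarrow> (real^4) \<times> (real^4^4)"
    and \<alpha> \<beta> :: "complex \<Rightarrow> complex \<Rightarrow> real" and p1 p2 p3 q1 q2 :: "complex \<Rightarrow> real"
  assumes mframe: "mframe D A \<alpha> \<beta> p1 p2 p3 q1 q2"

sublocale middle_coord_frame \<subseteq> coord_frame D "\<lambda>\<zeta>. fst (A \<zeta>)" "\<lambda>\<zeta>. column 1 (snd (A \<zeta>))"
    "\<lambda>\<zeta>. column 2 (snd (A \<zeta>))" "\<lambda>\<zeta>. column 3 (snd (A \<zeta>))" "\<lambda>\<zeta>. column 4 (snd (A \<zeta>))" \<alpha> \<beta>
    "\<lambda>\<zeta> w. 2 * q2 \<zeta> * \<alpha> \<zeta> w - 2 * q1 \<zeta> * \<beta> \<zeta> w" "\<lambda>\<zeta> w. p1 \<zeta> * \<alpha> \<zeta> w + p2 \<zeta> * \<beta> \<zeta> w"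
    "\<lambda>\<zeta> w. p2 \<zeta> * \<alpha> \<zeta> w + p3 \<zeta> * \<beta> \<zeta> w" "\<lambda>\<zeta> w. q1 \<zeta> * \<alpha> \<zeta> w + q2 \<zeta> * \<beta> \<zeta> w" p1 p2 p3 q1 q2
  by (rule mframe_coord[OF mframe])

text \<open>The exterior derivative of the 1-form \<open>\<langle>db, a\<rangle>\<close> is \<open>- \<langle>db \<and> da\<rangle>\<close>.\<close>

lemma d_mink:
  fixes a b :: "complex \<Rightarrow> real^4"
  assumes "open D" "\<zeta> \<in> D" and b: "smooth_on D b" and a: "smooth_on D a"
  shows "pd 1 (\<lambda>\<zeta>. mink (pd \<i> b \<zeta>) (a \<zeta>)) \<zeta> - pd \<i> (\<lambda>\<zeta>. mink (pd 1 b \<zeta>) (a \<zeta>)) \<zeta>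
    = mink (pd \<i> b \<zeta>) (pd 1 a \<zeta>) - mink (pd 1 b \<zeta>) (pd \<i> a \<zeta>)"
proof -
  have "pd v (\<lambda>\<zeta>. mink (pd w b \<zeta>) (a \<zeta>)) \<zeta> = mink (pd w b \<zeta>) (pd v a \<zeta>) + mink (pd v (pd w b) \<zeta>) (a \<zeta>)" for v w
    using assms by (intro pd_mink smooth_onD[of D]) (auto intro: smooth_on_pd)
  then show ?thesis using pd_commute[OF b assms(1,2), of 1 \<i>] by simp
qed

context coord_frame
begin

text \<open>No smoothness of the forms or coefficients is assumed. Written as pairings of frame
  vectors with derivatives of frame vectors, the forms become smooth, and their exterior derivatives
  can be computed from \<open>d_mink\<close>.\<close>

lemma forms:
  assumes "\<zeta> \<in> D"
  shows "\<alpha> \<zeta> w = mink (pd w a0 \<zeta>) (a2 \<zeta>)" "\<beta> \<zeta> w = mink (pd w a0 \<zeta>) (a3 \<zeta>)"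
    "\<gamma> \<zeta> w = - mink (pd w a1 \<zeta>) (a4 \<zeta>)" "\<pi>2 \<zeta> w = - mink (pd w a2 \<zeta>) (a4 \<zeta>)"
    "\<pi>3 \<zeta> w = - mink (pd w a3 \<zeta>) (a4 \<zeta>)" "\<omega> \<zeta> w = mink (pd w a2 \<zeta>) (a3 \<zeta>)"
  using assms by (simp_all add: da0 da1 da2 da3 mink_simps frame_relD[OF rel])

lemma smooth_form:
  assumes "\<And>\<zeta>. \<zeta> \<in> D \<Longrightarrow> f \<zeta> w = c * mink (pd w b \<zeta>) (a \<zeta>)" "smooth_on D b" "smooth_on D a"
  shows "smooth_on D (\<lambda>\<zeta>. f \<zeta> w)"
proof -
  have "smooth_on D (\<lambda>\<zeta>. c * mink (pd w b \<zeta>) (a \<zeta>))"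
    by (intro smooth_on_mult[OF oD] smooth_on_const smooth_on_mink[OF oD] smooth_on_pd assms)
  then show ?thesis using assms(1) by (subst smooth_on_cong[OF oD]) auto
qed

lemma smooth_forms:
  "smooth_on D (\<lambda>\<zeta>. \<alpha> \<zeta> w)" "smooth_on D (\<lambda>\<zeta>. \<beta> \<zeta> w)" "smooth_on D (\<lambda>\<zeta>. \<gamma> \<zeta> w)"
  "smooth_on D (\<lambda>\<zeta>. \<pi>2 \<zeta> w)" "smooth_on D (\<lambda>\<zeta>. \<pi>3 \<zeta> w)" "smooth_on D (\<lambda>\<zeta>. \<omega> \<zeta> w)"
  by (rule smooth_form[of \<alpha> w 1 a0 a2] smooth_form[of \<beta> w 1 a0 a3] smooth_form[of \<gamma> w "-1" a1 a4]
      smooth_form[of \<pi>2 w "-1" a2 a4] smooth_form[of \<pi>3 w "-1" a3 a4] smooth_form[of \<omega> w 1 a2 a3];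
      simp add: forms sm)+

lemma d_form:
  assumes f: "\<And>\<zeta> w. \<zeta> \<in> D \<Longrightarrow> f \<zeta> w = c * mink (pd w b \<zeta>) (a \<zeta>)"
    and s: "smooth_on D b" "smooth_on D a" and z: "\<zeta> \<in> D"
  shows "pd 1 (\<lambda>\<zeta>. f \<zeta> \<i>) \<zeta> - pd \<i> (\<lambda>\<zeta>. f \<zeta> 1) \<zeta>
    = c * (mink (pd \<i> b \<zeta>) (pd 1 a \<zeta>) - mink (pd 1 b \<zeta>) (pd \<i> a \<zeta>))"
proof -
  have "pd v (\<lambda>\<zeta>. f \<zeta> w) \<zeta> = c * pd v (\<lambda>\<zeta>. mink (pd w b \<zeta>) (a \<zeta>)) \<zeta>" for v w
  proof -
    have "pd v (\<lambda>\<zeta>. f \<zeta> w) \<zeta> = pd v (\<lambda>\<zeta>. c * mink (pd w b \<zeta>) (a \<zeta>)) \<zeta>"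
      by (rule pd_cong_open[OF oD z]) (rule f)
    also have "\<dots> = c * pd v (\<lambda>\<zeta>. mink (pd w b \<zeta>) (a \<zeta>)) \<zeta>"
      by (rule pd_bounded_linear[OF bounded_linear_mult_right])
        (rule smooth_onD[OF smooth_on_mink[OF oD smooth_on_pd[OF s(1)] s(2)] z])
    finally show ?thesis .
  qed
  then show ?thesis using d_mink[OF oD z s] by (simp only: right_diff_distrib[symmetric])
qed

text \<open>The coefficient of \<open>\<alpha>\<close> wedge \<open>\<beta>\<close> against dx wedge
  dy.\<close>

definition J :: "complex \<Rightarrow> real" where "J \<zeta> = \<alpha> \<zeta> 1 * \<beta> \<zeta> \<i> - \<alpha> \<zeta> \<i> * \<beta> \<zeta> 1"

text \<open>The Maurer-Cartan equations, evaluated on the coordinate vectors 1 and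
  \<open>\<i>\<close>. The first two determine the connection, the next two give
  \<open>p2 = 0\<close> and the Laplace equation in isothermic coordinates, and the last two are the
  Codazzi-type equations that link the quartic to the quadratic differential.\<close>

lemma structure_equations:
  assumes z: "\<zeta> \<in> D"
  shows "pd 1 (\<lambda>\<zeta>. \<alpha> \<zeta> \<i>) \<zeta> - pd \<i> (\<lambda>\<zeta>. \<alpha> \<zeta> 1) \<zeta> = q1 \<zeta> * J \<zeta>"
    and "pd 1 (\<lambda>\<zeta>. \<beta> \<zeta> \<i>) \<zeta> - pd \<i> (\<lambda>\<zeta>. \<beta> \<zeta> 1) \<zeta> = q2 \<zeta> * J \<zeta>"
    and "pd 1 (\<lambda>\<zeta>. \<gamma> \<zeta> \<i>) \<zeta> - pd \<i> (\<lambda>\<zeta>. \<gamma> \<zeta> 1) \<zeta> = 2 * p2 \<zeta> * J \<zeta>"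
    and "pd 1 (\<lambda>\<zeta>. \<omega> \<zeta> \<i>) \<zeta> - pd \<i> (\<lambda>\<zeta>. \<omega> \<zeta> 1) \<zeta> = (p3 \<zeta> - p1 \<zeta>) * J \<zeta>"
    and "pd 1 (\<lambda>\<zeta>. \<pi>2 \<zeta> \<i>) \<zeta> - pd \<i> (\<lambda>\<zeta>. \<pi>2 \<zeta> 1) \<zeta> =
      \<pi>2 \<zeta> 1 * \<gamma> \<zeta> \<i> - \<pi>2 \<zeta> \<i> * \<gamma> \<zeta> 1 + \<omega> \<zeta> 1 * \<pi>3 \<zeta> \<i> - \<omega> \<zeta> \<i> * \<pi>3 \<zeta> 1"
    and "pd 1 (\<lambda>\<zeta>. \<pi>3 \<zeta> \<i>) \<zeta> - pd \<i> (\<lambda>\<zeta>. \<pi>3 \<zeta> 1) \<zeta> =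
      \<pi>3 \<zeta> 1 * \<gamma> \<zeta> \<i> - \<pi>3 \<zeta> \<i> * \<gamma> \<zeta> 1 - \<omega> \<zeta> 1 * \<pi>2 \<zeta> \<i> + \<omega> \<zeta> \<i> * \<pi>2 \<zeta> 1"
proof -
  note S = da0[OF z] da1[OF z] da2[OF z] da3[OF z] da4[OF z] mink_simps frame_relD[OF rel[OF z]]
  show "pd 1 (\<lambda>\<zeta>. \<alpha> \<zeta> \<i>) \<zeta> - pd \<i> (\<lambda>\<zeta>. \<alpha> \<zeta> 1) \<zeta> = q1 \<zeta> * J \<zeta>"
    by (subst d_form[of \<alpha> 1 a0 a2]) (simp_all add: forms(1) sm z, simp add: S \<omega> J_def algebra_simps)
  show "pd 1 (\<lambda>\<zeta>. \<beta> \<zeta> \<i>) \<zeta> - pd \<i> (\<lambda>\<zeta>. \<beta> \<zeta> 1) \<zeta> = q2 \<zeta> * J \<zeta>"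
    by (subst d_form[of \<beta> 1 a0 a3]) (simp_all add: forms(2) sm z, simp add: S \<omega> J_def algebra_simps)
  show "pd 1 (\<lambda>\<zeta>. \<gamma> \<zeta> \<i>) \<zeta> - pd \<i> (\<lambda>\<zeta>. \<gamma> \<zeta> 1) \<zeta> = 2 * p2 \<zeta> * J \<zeta>"
    by (subst d_form[of \<gamma> "-1" a1 a4]) (simp_all add: forms(3) sm z, simp add: S \<pi>2 \<pi>3 J_def algebra_simps)
  show "pd 1 (\<lambda>\<zeta>. \<omega> \<zeta> \<i>) \<zeta> - pd \<i> (\<lambda>\<zeta>. \<omega> \<zeta> 1) \<zeta> = (p3 \<zeta> - p1 \<zeta>) * J \<zeta>"
    by (subst d_form[of \<omega> 1 a2 a3]) (simp_all add: forms(6) sm z, simp add: S \<pi>2 \<pi>3 J_def algebra_simps)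
  show "pd 1 (\<lambda>\<zeta>. \<pi>2 \<zeta> \<i>) \<zeta> - pd \<i> (\<lambda>\<zeta>. \<pi>2 \<zeta> 1) \<zeta> =
      \<pi>2 \<zeta> 1 * \<gamma> \<zeta> \<i> - \<pi>2 \<zeta> \<i> * \<gamma> \<zeta> 1 + \<omega> \<zeta> 1 * \<pi>3 \<zeta> \<i> - \<omega> \<zeta> \<i> * \<pi>3 \<zeta> 1"
    by (subst d_form[of \<pi>2 "-1" a2 a4]) (simp_all add: forms(4) sm z, simp add: S algebra_simps)
  show "pd 1 (\<lambda>\<zeta>. \<pi>3 \<zeta> \<i>) \<zeta> - pd \<i> (\<lambda>\<zeta>. \<pi>3 \<zeta> 1) \<zeta> =
      \<pi>3 \<zeta> 1 * \<gamma> \<zeta> \<i> - \<pi>3 \<zeta> \<i> * \<gamma> \<zeta> 1 - \<omega> \<zeta> 1 * \<pi>2 \<zeta> \<i> + \<omega> \<zeta> \<i> * \<pi>2 \<zeta> 1"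
    by (subst d_form[of \<pi>3 "-1" a3 a4]) (simp_all add: forms(5) sm z, simp add: S algebra_simps)
qed

lemma J_nz:
  assumes z: "\<zeta> \<in> D"
  shows "J \<zeta> \<noteq> 0"
proof
  assume J: "J \<zeta> = 0"
  have e: "\<alpha> \<zeta> w = Re w * \<alpha> \<zeta> 1 + Im w * \<alpha> \<zeta> \<i>" "\<beta> \<zeta> w = Re w * \<beta> \<zeta> 1 + Im w * \<beta> \<zeta> \<i>" for w
    using linear_complex_expand lin[OF z] by blast+
  have "\<beta> \<zeta> 1 * \<alpha> \<zeta> w + (- \<alpha> \<zeta> 1) * \<beta> \<zeta> w = 0" "\<beta> \<zeta> \<i> * \<alpha> \<zeta> w + (- \<alpha> \<zeta> \<i>) * \<beta> \<zeta> w = 0" for w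
  proof -
    have "\<beta> \<zeta> 1 * \<alpha> \<zeta> w + (- \<alpha> \<zeta> 1) * \<beta> \<zeta> w = - (Im w) * J \<zeta>" "\<beta> \<zeta> \<i> * \<alpha> \<zeta> w + (- \<alpha> \<zeta> \<i>) * \<beta> \<zeta> w = Re w * J \<zeta>"
      unfolding e[of w] J_def by (simp_all add: algebra_simps)
    then show "\<beta> \<zeta> 1 * \<alpha> \<zeta> w + (- \<alpha> \<zeta> 1) * \<beta> \<zeta> w = 0" "\<beta> \<zeta> \<i> * \<alpha> \<zeta> w + (- \<alpha> \<zeta> \<i>) * \<beta> \<zeta> w = 0"
      using J by auto
  qed
  then have "\<beta> \<zeta> 1 = 0" "\<alpha> \<zeta> 1 = 0" "\<beta> \<zeta> \<i> = 0" "\<alpha> \<zeta> \<i> = 0"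
    using indep[OF z, of "\<beta> \<zeta> 1" "- \<alpha> \<zeta> 1"] indep[OF z, of "\<beta> \<zeta> \<i>" "- \<alpha> \<zeta> \<i>"] by auto
  then have "1 * \<alpha> \<zeta> w + 1 * \<beta> \<zeta> w = 0" for w using e[of w] by simp
  then show False using indep[OF z, of 1 1] by simp
qed

lemma dual_basis:
  assumes z: "\<zeta> \<in> D"
  obtains e1 e2 where "\<alpha> \<zeta> e1 = 1" "\<beta> \<zeta> e1 = 0" "\<alpha> \<zeta> e2 = 0" "\<beta> \<zeta> e2 = 1"
    "\<And>w. w = \<alpha> \<zeta> w *\<^sub>R e1 + \<beta> \<zeta> w *\<^sub>R e2"
proof -
  note J = J_nz[OF z]
  have e: "\<alpha> \<zeta> w = Re w * \<alpha> \<zeta> 1 + Im w * \<alpha> \<zeta> \<i>" "\<beta> \<zeta> w = Re w * \<beta> \<zeta> 1 + Im w * \<beta> \<zeta> \<i>" for w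
    using linear_complex_expand lin[OF z] by blast+
  define e1 where "e1 = (1 / J \<zeta>) *\<^sub>R Complex (\<beta> \<zeta> \<i>) (- \<beta> \<zeta> 1)"
  define e2 where "e2 = (1 / J \<zeta>) *\<^sub>R Complex (- \<alpha> \<zeta> \<i>) (\<alpha> \<zeta> 1)"
  have "J \<zeta> *\<^sub>R w = J \<zeta> *\<^sub>R (\<alpha> \<zeta> w *\<^sub>R e1 + \<beta> \<zeta> w *\<^sub>R e2)" for w
    using J unfolding e1_def e2_def scaleR_add_right e[of w]
    by (simp add: complex_eq_iff) (simp add: J_def algebra_simps)
  then have "w = \<alpha> \<zeta> w *\<^sub>R e1 + \<beta> \<zeta> w *\<^sub>R e2" for w using J real_vector.scale_left_imp_eq by blast
  moreover have "\<alpha> \<zeta> e1 = 1" "\<beta> \<zeta> e1 = 0" "\<alpha> \<zeta> e2 = 0" "\<beta> \<zeta> e2 = 1"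
  proof -
    have e': "\<alpha> \<zeta> (c *\<^sub>R Complex x y) = c * (x * \<alpha> \<zeta> 1 + y * \<alpha> \<zeta> \<i>)"
      "\<beta> \<zeta> (c *\<^sub>R Complex x y) = c * (x * \<beta> \<zeta> 1 + y * \<beta> \<zeta> \<i>)" for c x y
      using e[of "c *\<^sub>R Complex x y"] by (simp_all add: algebra_simps)
    show "\<alpha> \<zeta> e1 = 1" "\<beta> \<zeta> e1 = 0" "\<alpha> \<zeta> e2 = 0" "\<beta> \<zeta> e2 = 1"
      using J unfolding e1_def e2_def e' by (simp_all add: J_def field_simps)
  qed
  ultimately show thesis using that by blast
qed

end

section \<open>Uniqueness of middle frames\<close>

lemma isotropic_line_eqD:
  assumes v: "v \<in> lightcone" and w: "w \<in> lightcone" and eq: "isotropic_line x v = isotropic_line y w"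
  obtains s t where "s > 0" "w = s *\<^sub>R v" "y = x + t *\<^sub>R v"
proof -
  have mem: "p \<in> isotropic_line x v \<longleftrightarrow> (\<exists>t. p = x + t *\<^sub>R v)" for p x v
    by (auto simp: isotropic_line_def)
  have "y \<in> isotropic_line y w" "y + w \<in> isotropic_line y w"
    using mem[of y y w] mem[of "y + w" y w] by (metis add.right_neutral scaleR_zero_left, metis scaleR_one)
  then obtain t t' where t: "y = x + t *\<^sub>R v" "y + w = x + t' *\<^sub>R v" unfolding eq[symmetric] mem by blast
  then have w': "w = (t' - t) *\<^sub>R v" by (simp add: algebra_simps)
  have "w$1 + w$4 > 0" "v$1 + v$4 > 0" using v w by (auto simp: lightcone_iff)
  moreover have "w$1 + w$4 = (t' - t) * (v$1 + v$4)" unfolding w' by (simp add: algebra_simps)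
  ultimately have "t' - t > 0" by (simp add: zero_less_mult_iff)
  then show thesis using that w' t(1) by blast
qed

text \<open>Here \<open>a\<close>, \<open>c\<close> are the values of the new
  \<open>\<alpha>\<close>, \<open>\<beta>\<close> on the first vector of the old dual basis and
  \<open>b\<close>, \<open>d\<close> those on the second; the equations compare two quadratic forms
  on these vectors and their sum. Mixed terms cancel, and since the second form has eigenvalues 1
  and -1 relative to the first in both frames, neither a scale nor a shift can survive.\<close>

lemma adapted_scale:
  fixes a b c d s t :: real
  assumes "s > 0"
    and "a\<^sup>2 + c\<^sup>2 = s\<^sup>2" "a\<^sup>2 - c\<^sup>2 = s + s * t"
    and "b\<^sup>2 + d\<^sup>2 = s\<^sup>2" "b\<^sup>2 - d\<^sup>2 = - s + s * t"
    and "(a + b)\<^sup>2 + (c + d)\<^sup>2 = 2 * s\<^sup>2" "(a + b)\<^sup>2 - (c + d)\<^sup>2 = 2 * (s * t)"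
  shows "s = 1" "t = 0" "b = 0" "c = 0" "a * a = 1" "d * d = 1"
proof -
  have "a\<^sup>2 + b\<^sup>2 + 2 * (a * b) + (c\<^sup>2 + d\<^sup>2 + 2 * (c * d)) = 2 * s\<^sup>2"
    "a\<^sup>2 + b\<^sup>2 + 2 * (a * b) - (c\<^sup>2 + d\<^sup>2 + 2 * (c * d)) = 2 * (s * t)"
    using assms(6,7) by (simp_all add: power2_sum algebra_simps)
  then have ab: "a * b = 0" and cd: "c * d = 0" using assms by linarith+
  have "a\<^sup>2 - b\<^sup>2 = s" "d\<^sup>2 - c\<^sup>2 = s" using assms by linarith+
  then have "a \<noteq> 0" "d \<noteq> 0" using \<open>s > 0\<close> by (auto simp: power2_eq_square) (smt (verit) zero_le_square)+
  then show b: "b = 0" and c: "c = 0" using ab cd by auto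
  have "s\<^sup>2 = s" "s * t = 0" using assms b c by auto
  then show s: "s = 1" and t: "t = 0" using \<open>s > 0\<close> by (auto simp: power2_eq_square)
  show "a * a = 1" "d * d = 1" using assms s t b c by (auto simp: power2_eq_square)
qed

lemma mframe_group:
  assumes "mframe D A \<alpha> \<beta> p1 p2 p3 q1 q2" "\<zeta> \<in> D"
  shows "A \<zeta> \<in> laguerre_group"
  using assms(1)[unfolded mframe_def Let_def, THEN conjunct2, THEN conjunct2, rule_format, OF assms(2)] by blast

text \<open>Frames over the same line differ a priori by a scaling \<open>s\<close> of the null
  direction and a shift \<open>t\<close> of the base point. The forms
  \<open>\<alpha>^2 + \<beta>^2\<close> and \<open>\<alpha>^2 - \<beta>^2\<close> are the pairings
  of da1 with itself and of da0 with da1, and comparing them forces \<open>s = 1\<close>,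
  \<open>t = 0\<close>. The rest is a sign.\<close>

lemma mframe_unique:
  assumes A: "mframe D A \<alpha> \<beta> p1 p2 p3 q1 q2" and B: "mframe D B \<alpha>' \<beta>' p1' p2' p3' q1' q2'"
    and line: "\<And>\<zeta>. \<zeta> \<in> D \<Longrightarrow> isotropic_line (fst (A \<zeta>)) (column 1 (snd (A \<zeta>)))
      = isotropic_line (fst (B \<zeta>)) (column 1 (snd (B \<zeta>)))"
    and z: "\<zeta> \<in> D"
  obtains \<sigma> where "\<sigma> * \<sigma> = 1" "\<And>w. \<alpha>' \<zeta> w = \<sigma> * \<alpha> \<zeta> w" "\<And>w. \<beta>' \<zeta> w = \<sigma> * \<beta> \<zeta> w"
    "p1' \<zeta> = p1 \<zeta>" "p2' \<zeta> = p2 \<zeta>" "p3' \<zeta> = p3 \<zeta>"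
proof -
  define a0 b0 where "a0 \<zeta> = fst (A \<zeta>)" and "b0 \<zeta> = fst (B \<zeta>)" for \<zeta>
  define a1 a2 a3 a4 where "a1 \<zeta> = column 1 (snd (A \<zeta>))" and "a2 \<zeta> = column 2 (snd (A \<zeta>))"
    and "a3 \<zeta> = column 3 (snd (A \<zeta>))" and "a4 \<zeta> = column 4 (snd (A \<zeta>))" for \<zeta>
  define b1 b2 b3 b4 where "b1 \<zeta> = column 1 (snd (B \<zeta>))" and "b2 \<zeta> = column 2 (snd (B \<zeta>))"
    and "b3 \<zeta> = column 3 (snd (B \<zeta>))" and "b4 \<zeta> = column 4 (snd (B \<zeta>))" for \<zeta>
  interpret F: coord_frame D a0 a1 a2 a3 a4 \<alpha> \<beta> "\<lambda>\<zeta> w. 2 * q2 \<zeta> * \<alpha> \<zeta> w - 2 * q1 \<zeta> * \<beta> \<zeta> w"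
    "\<lambda>\<zeta> w. p1 \<zeta> * \<alpha> \<zeta> w + p2 \<zeta> * \<beta> \<zeta> w" "\<lambda>\<zeta> w. p2 \<zeta> * \<alpha> \<zeta> w + p3 \<zeta> * \<beta> \<zeta> w"
    "\<lambda>\<zeta> w. q1 \<zeta> * \<alpha> \<zeta> w + q2 \<zeta> * \<beta> \<zeta> w" p1 p2 p3 q1 q2
    using mframe_coord[OF A] unfolding a0_def[abs_def] a1_def[abs_def] a2_def[abs_def] a3_def[abs_def] a4_def[abs_def] .
  interpret G: coord_frame D b0 b1 b2 b3 b4 \<alpha>' \<beta>' "\<lambda>\<zeta> w. 2 * q2' \<zeta> * \<alpha>' \<zeta> w - 2 * q1' \<zeta> * \<beta>' \<zeta> w"
    "\<lambda>\<zeta> w. p1' \<zeta> * \<alpha>' \<zeta> w + p2' \<zeta> * \<beta>' \<zeta> w" "\<lambda>\<zeta> w. p2' \<zeta> * \<alpha>' \<zeta> w + p3' \<zeta> * \<beta>' \<zeta> w"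
    "\<lambda>\<zeta> w. q1' \<zeta> * \<alpha>' \<zeta> w + q2' \<zeta> * \<beta>' \<zeta> w" p1' p2' p3' q1' q2'
    using mframe_coord[OF B] unfolding b0_def[abs_def] b1_def[abs_def] b2_def[abs_def] b3_def[abs_def] b4_def[abs_def] .
  have grp: "(fst (A \<xi>), snd (A \<xi>)) \<in> laguerre_group" "(fst (B \<xi>), snd (B \<xi>)) \<in> laguerre_group" if "\<xi> \<in> D" for \<xi>
    using mframe_group[OF A that] mframe_group[OF B that] by simp_all
  have lc: "a1 \<xi> \<in> lightcone" "b1 \<xi> \<in> lightcone" "det (snd (A \<xi>)) = 1" "det (snd (B \<xi>)) = 1" if "\<xi> \<in> D" for \<xi>
    using grp[OF that] unfolding laguerre_group_iff a1_def b1_def by auto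
  \<comment> \<open>Expressing both factors by pairings with \<open>a4\<close> makes their
    smoothness evident.\<close>
  define s t where "s \<xi> = - mink (b1 \<xi>) (a4 \<xi>)" and "t \<xi> = - mink (b0 \<xi> - a0 \<xi>) (a4 \<xi>)" for \<xi>
  have st: "s \<xi> > 0" "b1 \<xi> = s \<xi> *\<^sub>R a1 \<xi>" "b0 \<xi> = a0 \<xi> + t \<xi> *\<^sub>R a1 \<xi>" if x: "\<xi> \<in> D" for \<xi>
  proof -
    obtain s' t' where *: "s' > 0" "b1 \<xi> = s' *\<^sub>R a1 \<xi>" "b0 \<xi> = a0 \<xi> + t' *\<^sub>R a1 \<xi>"
      using isotropic_line_eqD[OF lc(1,2)[OF x], of "a0 \<xi>" "b0 \<xi>"] line[OF x]
      unfolding a0_def b0_def a1_def b1_def by metis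
    have "s \<xi> = s'" "t \<xi> = t'"
      unfolding s_def t_def using * by (simp_all add: mink_simps frame_relD[OF F.rel[OF x]])
    then show "s \<xi> > 0" "b1 \<xi> = s \<xi> *\<^sub>R a1 \<xi>" "b0 \<xi> = a0 \<xi> + t \<xi> *\<^sub>R a1 \<xi>" using * by auto
  qed
  have sms: "smooth_on D s" "smooth_on D t" unfolding s_def t_def
    by (intro smooth_on_uminus[OF F.oD] smooth_on_mink[OF F.oD] smooth_on_diff[OF F.oD] F.sm G.sm)+
  have db1: "pd w b1 \<xi> = s \<xi> *\<^sub>R pd w a1 \<xi> + pd w s \<xi> *\<^sub>R a1 \<xi>" if x: "\<xi> \<in> D" for \<xi> w
  proof -
    have "pd w b1 \<xi> = pd w (\<lambda>\<xi>. s \<xi> *\<^sub>R a1 \<xi>) \<xi>" by (rule pd_cong_open[OF F.oD x]) (rule st)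
    then show ?thesis
      by (simp add: pd_scaleR[OF smooth_onD[OF sms(1) x] smooth_onD[OF F.sm(2) x]])
  qed
  have db0: "pd w b0 \<xi> = pd w a0 \<xi> + (t \<xi> *\<^sub>R pd w a1 \<xi> + pd w t \<xi> *\<^sub>R a1 \<xi>)" if x: "\<xi> \<in> D" for \<xi> w
  proof -
    have "pd w b0 \<xi> = pd w (\<lambda>\<xi>. a0 \<xi> + t \<xi> *\<^sub>R a1 \<xi>) \<xi>" by (rule pd_cong_open[OF F.oD x]) (rule st)
    also have "\<dots> = pd w a0 \<xi> + pd w (\<lambda>\<xi>. t \<xi> *\<^sub>R a1 \<xi>) \<xi>"
      by (intro pd_add smooth_onD[OF _ x] F.sm smooth_on_scaleR[OF F.oD] sms)
    finally show ?thesis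
      by (simp add: pd_scaleR[OF smooth_onD[OF sms(2) x] smooth_onD[OF F.sm(2) x]])
  qed
  have E1: "(\<alpha>' \<xi> w)\<^sup>2 + (\<beta>' \<xi> w)\<^sup>2 = (s \<xi>)\<^sup>2 * ((\<alpha> \<xi> w)\<^sup>2 + (\<beta> \<xi> w)\<^sup>2)" if x: "\<xi> \<in> D" for \<xi> w
  proof -
    have "(\<alpha>' \<xi> w)\<^sup>2 + (\<beta>' \<xi> w)\<^sup>2 = mink (pd w b1 \<xi>) (pd w b1 \<xi>)"
      unfolding G.da1[OF x] by (simp add: mink_simps frame_relD[OF G.rel[OF x]] power2_eq_square)
    also have "\<dots> = (s \<xi>)\<^sup>2 * ((\<alpha> \<xi> w)\<^sup>2 + (\<beta> \<xi> w)\<^sup>2)"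
      unfolding db1[OF x] F.da1[OF x]
      by (simp add: mink_simps frame_relD[OF F.rel[OF x]] power2_eq_square algebra_simps)
    finally show ?thesis .
  qed
  have E2: "(\<alpha>' \<xi> w)\<^sup>2 - (\<beta>' \<xi> w)\<^sup>2 =
      s \<xi> * ((\<alpha> \<xi> w)\<^sup>2 - (\<beta> \<xi> w)\<^sup>2) + s \<xi> * t \<xi> * ((\<alpha> \<xi> w)\<^sup>2 + (\<beta> \<xi> w)\<^sup>2)" if x: "\<xi> \<in> D" for \<xi> w
  proof -
    have "(\<alpha>' \<xi> w)\<^sup>2 - (\<beta>' \<xi> w)\<^sup>2 = mink (pd w b0 \<xi>) (pd w b1 \<xi>)"
      unfolding G.da1[OF x] G.da0[OF x] by (simp add: mink_simps frame_relD[OF G.rel[OF x]] power2_eq_square)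
    also have "\<dots> = s \<xi> * ((\<alpha> \<xi> w)\<^sup>2 - (\<beta> \<xi> w)\<^sup>2) + s \<xi> * t \<xi> * ((\<alpha> \<xi> w)\<^sup>2 + (\<beta> \<xi> w)\<^sup>2)"
      unfolding db1[OF x] db0[OF x] F.da1[OF x] F.da0[OF x]
      by (simp add: mink_simps frame_relD[OF F.rel[OF x]] power2_eq_square algebra_simps)
    finally show ?thesis .
  qed
  have key: "\<exists>\<sigma> \<tau>. s \<xi> = 1 \<and> t \<xi> = 0 \<and> \<sigma> * \<sigma> = 1 \<and> \<tau> * \<tau> = 1 \<and>
      (\<forall>w. \<alpha>' \<xi> w = \<sigma> * \<alpha> \<xi> w \<and> \<beta>' \<xi> w = \<tau> * \<beta> \<xi> w)" if x: "\<xi> \<in> D" for \<xi>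
  proof -
    obtain e1 e2 where e: "\<alpha> \<xi> e1 = 1" "\<beta> \<xi> e1 = 0" "\<alpha> \<xi> e2 = 0" "\<beta> \<xi> e2 = 1"
      and ex: "\<And>w. w = \<alpha> \<xi> w *\<^sub>R e1 + \<beta> \<xi> w *\<^sub>R e2" using F.dual_basis[OF x] by blast
    note l = linear_add[OF F.lin(1)[OF x]] linear_add[OF F.lin(2)[OF x]]
      linear_add[OF G.lin(1)[OF x]] linear_add[OF G.lin(2)[OF x]]
    \<comment> \<open>A quadratic form in the plane is determined by its values on
      \<open>e1\<close>, \<open>e2\<close> and \<open>e1 + e2\<close>.\<close>
    have as: "(\<alpha>' \<xi> e1)\<^sup>2 + (\<beta>' \<xi> e1)\<^sup>2 = (s \<xi>)\<^sup>2" "(\<alpha>' \<xi> e1)\<^sup>2 - (\<beta>' \<xi> e1)\<^sup>2 = s \<xi> + s \<xi> * t \<xi>"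
      "(\<alpha>' \<xi> e2)\<^sup>2 + (\<beta>' \<xi> e2)\<^sup>2 = (s \<xi>)\<^sup>2" "(\<alpha>' \<xi> e2)\<^sup>2 - (\<beta>' \<xi> e2)\<^sup>2 = - s \<xi> + s \<xi> * t \<xi>"
      "(\<alpha>' \<xi> e1 + \<alpha>' \<xi> e2)\<^sup>2 + (\<beta>' \<xi> e1 + \<beta>' \<xi> e2)\<^sup>2 = 2 * (s \<xi>)\<^sup>2"
      "(\<alpha>' \<xi> e1 + \<alpha>' \<xi> e2)\<^sup>2 - (\<beta>' \<xi> e1 + \<beta>' \<xi> e2)\<^sup>2 = 2 * (s \<xi> * t \<xi>)"
      using E1[OF x, of e1] E2[OF x, of e1] E1[OF x, of e2] E2[OF x, of e2]
        E1[OF x, of "e1 + e2"] E2[OF x, of "e1 + e2"] by (simp_all add: e l)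
    note ad = adapted_scale[OF st(1)[OF x] as]
    have "\<alpha>' \<xi> w = \<alpha>' \<xi> e1 * \<alpha> \<xi> w \<and> \<beta>' \<xi> w = \<beta>' \<xi> e2 * \<beta> \<xi> w" for w
    proof -
      have "\<alpha>' \<xi> w = \<alpha>' \<xi> (\<alpha> \<xi> w *\<^sub>R e1 + \<beta> \<xi> w *\<^sub>R e2)" "\<beta>' \<xi> w = \<beta>' \<xi> (\<alpha> \<xi> w *\<^sub>R e1 + \<beta> \<xi> w *\<^sub>R e2)"
        using ex[of w] by simp_all
      then show ?thesis
        unfolding l linear_scale[OF G.lin(1)[OF x]] linear_scale[OF G.lin(2)[OF x]] using ad(3,4) by simp
    qed
    then show ?thesis using ad by blast
  qed
  have a1b1: "b1 \<xi> = a1 \<xi>" "b0 \<xi> = a0 \<xi>" if x: "\<xi> \<in> D" for \<xi>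
    using st[OF x] key[OF x] by auto
  have st': "\<exists>\<sigma>. \<sigma> * \<sigma> = 1 \<and> (\<forall>w. \<alpha>' \<xi> w = \<sigma> * \<alpha> \<xi> w \<and> \<beta>' \<xi> w = \<sigma> * \<beta> \<xi> w) \<and>
      b2 \<xi> = \<sigma> *\<^sub>R a2 \<xi> \<and> b3 \<xi> = \<sigma> *\<^sub>R a3 \<xi> \<and> b4 \<xi> = a4 \<xi>" if x: "\<xi> \<in> D" for \<xi>
  proof -
    obtain \<sigma> \<tau> where k: "\<sigma> * \<sigma> = 1" "\<tau> * \<tau> = 1" "\<And>w. \<alpha>' \<xi> w = \<sigma> * \<alpha> \<xi> w" "\<And>w. \<beta>' \<xi> w = \<tau> * \<beta> \<xi> w"
      using key[OF x] by blast
    obtain e1 e2 where e: "\<alpha> \<xi> e1 = 1" "\<beta> \<xi> e1 = 0" "\<alpha> \<xi> e2 = 0" "\<beta> \<xi> e2 = 1"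
      using F.dual_basis[OF x] by blast
    have "pd w b0 \<xi> = pd w a0 \<xi>" for w by (rule pd_cong_open[OF F.oD x]) (rule a1b1)
    then have "\<alpha> \<xi> w *\<^sub>R a2 \<xi> + \<beta> \<xi> w *\<^sub>R a3 \<xi> = (\<sigma> * \<alpha> \<xi> w) *\<^sub>R b2 \<xi> + (\<tau> * \<beta> \<xi> w) *\<^sub>R b3 \<xi>" for w
      using G.da0[OF x, of w] F.da0[OF x, of w] k by metis
    from this[of e1] this[of e2] have ab: "a2 \<xi> = \<sigma> *\<^sub>R b2 \<xi>" "a3 \<xi> = \<tau> *\<^sub>R b3 \<xi>" by (simp_all add: e)
    have "\<sigma> *\<^sub>R a2 \<xi> = (\<sigma> * \<sigma>) *\<^sub>R b2 \<xi>" "\<tau> *\<^sub>R a3 \<xi> = (\<tau> * \<tau>) *\<^sub>R b3 \<xi>" unfolding ab by simp_all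
    then have ba: "b2 \<xi> = \<sigma> *\<^sub>R a2 \<xi>" "b3 \<xi> = \<tau> *\<^sub>R a3 \<xi>" using k by simp_all
    define c where "c = - mink (b4 \<xi>) (a4 \<xi>)"
    have "mink (b4 \<xi>) (a1 \<xi>) = -1"
      using frame_relD(13)[OF G.rel[OF x]] a1b1(1)[OF x] by simp
    moreover have "mink (b4 \<xi>) (a2 \<xi>) = 0" "mink (b4 \<xi>) (a3 \<xi>) = 0"
      unfolding ab by (simp_all add: mink_simps frame_relD[OF G.rel[OF x]])
    moreover have "b4 \<xi> = (- mink (b4 \<xi>) (a4 \<xi>)) *\<^sub>R a1 \<xi> + mink (b4 \<xi>) (a2 \<xi>) *\<^sub>R a2 \<xi>
      + mink (b4 \<xi>) (a3 \<xi>) *\<^sub>R a3 \<xi> + (- mink (b4 \<xi>) (a1 \<xi>)) *\<^sub>R a4 \<xi>"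
      using frame_expand[OF grp(1)[OF x], of "b4 \<xi>"] unfolding a1_def a2_def a3_def a4_def .
    ultimately have b4: "b4 \<xi> = c *\<^sub>R a1 \<xi> + a4 \<xi>" by (simp add: c_def)
    \<comment> \<open>The last vector is determined up to a multiple of \<open>a1\<close> by its
      pairings with the first three; being null fixes the multiple.\<close>
    have "mink (b4 \<xi>) (b4 \<xi>) = - 2 * c"
      unfolding b4 by (simp add: mink_simps frame_relD[OF F.rel[OF x]])
    then have "c = 0" using frame_relD(16)[OF G.rel[OF x]] by simp
    then have b4: "b4 \<xi> = a4 \<xi>" using b4 by simp
    have c1: "snd (B \<xi>) $ j $ 1 = snd (A \<xi>) $ j $ 1" and c4: "snd (B \<xi>) $ j $ 4 = snd (A \<xi>) $ j $ 4"
      and c2: "snd (B \<xi>) $ j $ 2 = \<sigma> * snd (A \<xi>) $ j $ 2" and c3: "snd (B \<xi>) $ j $ 3 = \<tau> * snd (A \<xi>) $ j $ 3" for j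
      using arg_cong[OF a1b1(1)[OF x], of "\<lambda>v. v $ j"] arg_cong[OF b4, of "\<lambda>v. v $ j"]
        arg_cong[OF ba(1), of "\<lambda>v. v $ j"] arg_cong[OF ba(2), of "\<lambda>v. v $ j"]
      by (simp_all add: a1_def b1_def a2_def b2_def a3_def b3_def a4_def b4_def column_def)
    \<comment> \<open>Orientation is what couples the two signs: both determinants are 1.\<close>
    have "det (snd (B \<xi>)) = \<sigma> * \<tau> * det (snd (A \<xi>))"
      unfolding det_4 c1 c2 c3 c4 by (simp only: algebra_simps)
    then have "\<sigma> * \<tau> = 1" using lc[OF x] by simp
    then have "\<tau> = \<sigma>" using k by (metis mult.assoc mult.commute mult.right_neutral)
    then show ?thesis using k ba b4 by blast
  qed
  obtain \<sigma> where \<sigma>: "\<sigma> * \<sigma> = 1" "\<And>w. \<alpha>' \<zeta> w = \<sigma> * \<alpha> \<zeta> w" "\<And>w. \<beta>' \<zeta> w = \<sigma> * \<beta> \<zeta> w"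
    "b2 \<zeta> = \<sigma> *\<^sub>R a2 \<zeta>" "b3 \<zeta> = \<sigma> *\<^sub>R a3 \<zeta>" using st'[OF z] by blast
  obtain e1 e2 where e: "\<alpha> \<zeta> e1 = 1" "\<beta> \<zeta> e1 = 0" "\<alpha> \<zeta> e2 = 0" "\<beta> \<zeta> e2 = 1"
    using F.dual_basis[OF z] by blast
  \<comment> \<open>The last frame vectors coincide on all of \<open>D\<close>, so their derivatives
    do too; the coefficients \<open>p1\<close>, \<open>p2\<close>, \<open>p3\<close> are read off
    from them by pairing with the second and third vectors, and the sign enters twice.\<close>
  have d4: "pd w b4 \<zeta> = pd w a4 \<zeta>" for w by (rule pd_cong_open[OF F.oD z]) (use st' in blast)
  have "p1 \<zeta> * \<alpha> \<zeta> w + p2 \<zeta> * \<beta> \<zeta> w = mink (pd w a4 \<zeta>) (a2 \<zeta>)"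
    "p2 \<zeta> * \<alpha> \<zeta> w + p3 \<zeta> * \<beta> \<zeta> w = mink (pd w a4 \<zeta>) (a3 \<zeta>)" for w
    unfolding F.da4[OF z] by (simp_all add: mink_simps frame_relD[OF F.rel[OF z]])
  moreover have "\<sigma> * (p1' \<zeta> * \<alpha>' \<zeta> w + p2' \<zeta> * \<beta>' \<zeta> w) = \<sigma> * \<sigma> * mink (pd w b4 \<zeta>) (a2 \<zeta>)"
    "\<sigma> * (p2' \<zeta> * \<alpha>' \<zeta> w + p3' \<zeta> * \<beta>' \<zeta> w) = \<sigma> * \<sigma> * mink (pd w b4 \<zeta>) (a3 \<zeta>)" for w
  proof -
    have "p1' \<zeta> * \<alpha>' \<zeta> w + p2' \<zeta> * \<beta>' \<zeta> w = mink (pd w b4 \<zeta>) (b2 \<zeta>)"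
      "p2' \<zeta> * \<alpha>' \<zeta> w + p3' \<zeta> * \<beta>' \<zeta> w = mink (pd w b4 \<zeta>) (b3 \<zeta>)"
      unfolding G.da4[OF z] by (simp_all add: mink_simps frame_relD[OF G.rel[OF z]])
    then show "\<sigma> * (p1' \<zeta> * \<alpha>' \<zeta> w + p2' \<zeta> * \<beta>' \<zeta> w) = \<sigma> * \<sigma> * mink (pd w b4 \<zeta>) (a2 \<zeta>)"
      "\<sigma> * (p2' \<zeta> * \<alpha>' \<zeta> w + p3' \<zeta> * \<beta>' \<zeta> w) = \<sigma> * \<sigma> * mink (pd w b4 \<zeta>) (a3 \<zeta>)"
      unfolding \<sigma>(4,5) by (simp_all add: mink_simps)
  qed
  ultimately have "\<sigma> * (p1' \<zeta> * (\<sigma> * \<alpha> \<zeta> w) + p2' \<zeta> * (\<sigma> * \<beta> \<zeta> w)) = p1 \<zeta> * \<alpha> \<zeta> w + p2 \<zeta> * \<beta> \<zeta> w"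
    "\<sigma> * (p2' \<zeta> * (\<sigma> * \<alpha> \<zeta> w) + p3' \<zeta> * (\<sigma> * \<beta> \<zeta> w)) = p2 \<zeta> * \<alpha> \<zeta> w + p3 \<zeta> * \<beta> \<zeta> w" for w
    unfolding \<sigma>(1-3) d4 by simp_all
  from this[of e1] this[of e2]
  have "p1' \<zeta> * (\<sigma> * \<sigma>) = p1 \<zeta>" "p2' \<zeta> * (\<sigma> * \<sigma>) = p2 \<zeta>" "p3' \<zeta> * (\<sigma> * \<sigma>) = p3 \<zeta>" 
    by (simp_all add: e algebra_simps)
  then show thesis using that \<sigma>(1-3) by simp
qed

section \<open>Conformal and isothermic coordinates\<close>

lemma pd_power:
  fixes f :: "'a::real_normed_vector \<Rightarrow> 'b::real_normed_field"
  assumes "f differentiable (at x)"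
  shows "pd v (\<lambda>x. f x ^ n) x = of_nat n * pd v f x * f x ^ (n - 1)"
  using pd_eq[OF has_derivative_power[OF has_derivative_pd[OF assms]]] .

lemma pd_diff:
  assumes "f differentiable (at x)" "g differentiable (at x)"
  shows "pd v (\<lambda>x. f x - g x) x = pd v f x - pd v g x"
  using pd_eq[OF has_derivative_diff[OF has_derivative_pd[OF assms(1)] has_derivative_pd[OF assms(2)]]] .

context coord_frame
begin

definition Q where "Q \<zeta> = Complex ((p1 \<zeta> - p3 \<zeta>) / 2) (- p2 \<zeta>)"
definition P where "P \<zeta> = p1 \<zeta> + p3 \<zeta>"

context
  fixes l :: "complex \<Rightarrow> complex"
  assumes conf: "\<And>\<zeta> w. \<zeta> \<in> D \<Longrightarrow> \<alpha> \<zeta> w = Re (l \<zeta> * w)" "\<And>\<zeta> w. \<zeta> \<in> D \<Longrightarrow> \<beta> \<zeta> w = Im (l \<zeta> * w)"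
begin

lemma smooth_l: "smooth_on D l"
proof -
  have "smooth_on D (\<lambda>\<zeta>. Complex (\<alpha> \<zeta> 1) (\<beta> \<zeta> 1))"
    by (intro smooth_on_Complex oD smooth_forms)
  then show ?thesis by (subst smooth_on_cong[OF oD, of l "\<lambda>\<zeta>. Complex (\<alpha> \<zeta> 1) (\<beta> \<zeta> 1)"]) (simp_all add: conf)
qed

lemma J_conf: "\<zeta> \<in> D \<Longrightarrow> J \<zeta> = (Re (l \<zeta>))\<^sup>2 + (Im (l \<zeta>))\<^sup>2"
  by (simp add: J_def conf power2_eq_square)

lemma l_nz: "\<zeta> \<in> D \<Longrightarrow> l \<zeta> \<noteq> 0"
  using J_nz J_conf by fastforce

lemma smooth_p: "smooth_on D p1" "smooth_on D p2" "smooth_on D p3"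
proof -
  define j where "j \<zeta> = (Re (l \<zeta>))\<^sup>2 + (Im (l \<zeta>))\<^sup>2" for \<zeta>
  have j: "j \<zeta> \<noteq> 0" if "\<zeta> \<in> D" for \<zeta> using J_nz[OF that] J_conf[OF that] by (simp add: j_def)
  have e: "p1 \<zeta> = (Re (l \<zeta>) * \<pi>2 \<zeta> 1 - Im (l \<zeta>) * \<pi>2 \<zeta> \<i>) / j \<zeta>"
    "p2 \<zeta> = (Im (l \<zeta>) * \<pi>2 \<zeta> 1 + Re (l \<zeta>) * \<pi>2 \<zeta> \<i>) / j \<zeta>"
    "p3 \<zeta> = (Im (l \<zeta>) * \<pi>3 \<zeta> 1 + Re (l \<zeta>) * \<pi>3 \<zeta> \<i>) / j \<zeta>" if "\<zeta> \<in> D" for \<zeta>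
    using j[OF that] that
    by (simp_all add: eq_divide_eq \<pi>2 \<pi>3 conf) (simp_all add: j_def power2_eq_square algebra_simps)
  have sj: "smooth_on D j" unfolding j_def
    by (intro smooth_on_add[OF oD] smooth_on_power[OF oD] smooth_on_Re[OF oD] smooth_on_Im[OF oD] smooth_l)
  note I = smooth_on_divide[OF oD _ sj j] smooth_on_add[OF oD] smooth_on_diff[OF oD] smooth_on_mult[OF oD]
    smooth_on_Re[OF oD smooth_l] smooth_on_Im[OF oD smooth_l] smooth_forms
  show "smooth_on D p1" by (subst smooth_on_cong[OF oD e(1)], assumption, intro I)
  show "smooth_on D p2" by (subst smooth_on_cong[OF oD e(2)], assumption, intro I)
  show "smooth_on D p3" by (subst smooth_on_cong[OF oD e(3)], assumption, intro I)
qed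

lemma smooth_PQ: "smooth_on D P" "smooth_on D Q"
proof -
  show "smooth_on D P" unfolding P_def by (intro smooth_on_add oD smooth_p)
  have "smooth_on D (\<lambda>\<zeta>. Complex ((p1 \<zeta> - p3 \<zeta>) * (1 / 2)) (- p2 \<zeta>))"
    by (intro smooth_on_Complex oD smooth_on_mult smooth_on_diff smooth_p smooth_on_const smooth_on_uminus)
  then show "smooth_on D Q" unfolding Q_def by simp
qed

text \<open>The first two structure equations combined, d \<phi> = (q1 + i q2) \<alpha> wedge
  \<beta> for \<phi> = l dz. The left side is 2i times the derivative of \<open>l\<close> with
  respect to the conjugate coordinate.\<close>

lemma d_l:
  assumes z: "\<zeta> \<in> D"
  shows "\<i> * pd 1 l \<zeta> - pd \<i> l \<zeta> = Complex (q1 \<zeta>) (q2 \<zeta>) * (l \<zeta> * cnj (l \<zeta>))"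
proof -
  have "pd v (\<lambda>\<zeta>. \<alpha> \<zeta> w) \<zeta> = Re (pd v l \<zeta> * w)" "pd v (\<lambda>\<zeta>. \<beta> \<zeta> w) \<zeta> = Im (pd v l \<zeta> * w)" for v w
  proof -
    have b: "bounded_linear (\<lambda>x. Re (x * w))" "bounded_linear (\<lambda>x. Im (x * w))"
      by (intro bounded_linear_compose[OF bounded_linear_Re] bounded_linear_compose[OF bounded_linear_Im]
          bounded_linear_mult_left)+
    have "pd v (\<lambda>\<zeta>. \<alpha> \<zeta> w) \<zeta> = pd v (\<lambda>\<zeta>. Re (l \<zeta> * w)) \<zeta>" "pd v (\<lambda>\<zeta>. \<beta> \<zeta> w) \<zeta> = pd v (\<lambda>\<zeta>. Im (l \<zeta> * w)) \<zeta>"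
      by (rule pd_cong_open[OF oD z]; simp add: conf)+
    then show "pd v (\<lambda>\<zeta>. \<alpha> \<zeta> w) \<zeta> = Re (pd v l \<zeta> * w)" "pd v (\<lambda>\<zeta>. \<beta> \<zeta> w) \<zeta> = Im (pd v l \<zeta> * w)"
      using pd_bounded_linear[OF b(1) smooth_onD[OF smooth_l z]] pd_bounded_linear[OF b(2) smooth_onD[OF smooth_l z]]
      by simp_all
  qed
  then show ?thesis
    using structure_equations(1,2)[OF z] J_conf[OF z]
    by (simp add: complex_eq_iff power2_eq_square)
qed

text \<open>In the conformal coordinate this reads
  \<open>\<partial>(Q l\<^sup>4)/\<partial>\<zeta>* = l\<^sup>3 / (2 l*) \<cdot> (\<partial>(P l\<^sup>2)/\<partial>\<zeta>*)*\<close>, the star denoting conjugation.\<close>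

lemma Q_CR_iff_P_CR:
  assumes z: "\<zeta> \<in> D"
  shows "cnj (l \<zeta>) * (\<i> * pd 1 (\<lambda>\<zeta>. Q \<zeta> * l \<zeta> ^ 4) \<zeta> - pd \<i> (\<lambda>\<zeta>. Q \<zeta> * l \<zeta> ^ 4) \<zeta>) =
    l \<zeta> ^ 3 / 2 * cnj (pd \<i> (\<lambda>\<zeta>. of_real (P \<zeta>) * l \<zeta> ^ 2) \<zeta> - \<i> * pd 1 (\<lambda>\<zeta>. of_real (P \<zeta>) * l \<zeta> ^ 2) \<zeta>)"
proof -
  define m where "m = cnj (l \<zeta>)"
  define L where "L = l \<zeta>"
  define q where "q = Q \<zeta>"
  define p where "p = complex_of_real (P \<zeta>)"
  define lx where "lx v = pd v l \<zeta>" for v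
  define mx where "mx v = cnj (pd v l \<zeta>)" for v
  define qx where "qx v = pd v Q \<zeta>" for v
  define px where "px v = complex_of_real (pd v P \<zeta>)" for v
  note dl = smooth_onD[OF smooth_l z] and dQ = smooth_onD[OF smooth_PQ(2) z] and dP = smooth_onD[OF smooth_PQ(1) z]
  have doP: "(\<lambda>\<zeta>. complex_of_real (P \<zeta>)) differentiable (at \<zeta>)"
    by (rule smooth_onD[OF smooth_on_of_real[OF oD smooth_PQ(1)] z])
  have poP: "pd v (\<lambda>\<zeta>. complex_of_real (P \<zeta>)) \<zeta> = px v" for v
    unfolding px_def by (rule pd_bounded_linear[OF bounded_linear_of_real dP])
  have dpow: "(\<lambda>\<zeta>. l \<zeta> ^ n) differentiable (at \<zeta>)" for n
    by (rule smooth_onD[OF smooth_on_power[OF oD smooth_l] z])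
  have ph: "pd v (\<lambda>\<zeta>. Q \<zeta> * l \<zeta> ^ 4) \<zeta> = q * (4 * lx v * L ^ 3) + qx v * L ^ 4" for v
    using pd_mult[OF dQ dpow[of 4], of v] pd_power[OF dl, of v 4] by (simp add: q_def lx_def L_def qx_def)
  have pg: "pd v (\<lambda>\<zeta>. of_real (P \<zeta>) * l \<zeta> ^ 2) \<zeta> = p * (2 * lx v * L) + px v * L ^ 2" for v
    using pd_mult[OF doP dpow[of 2], of v] pd_power[OF dl, of v 2] poP[of v] by (simp add: p_def lx_def L_def)
  \<comment> \<open>The complex 1-form \<pi>2 - i \<pi>3, which equals Q \<phi> + (P/2) conj \<phi>.
    Its exterior derivative is computed twice: from this expression by the product rule, and from
    the structure equations.\<close>
  define Pi where "Pi w \<zeta> = complex_of_real (\<pi>2 \<zeta> w) - \<i> * complex_of_real (\<pi>3 \<zeta> w)" for w \<zeta>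
  have Pi: "Pi w \<xi> = Q \<xi> * (l \<xi> * w) + of_real (P \<xi>) * cnj (l \<xi> * w) * (1/2)" if "\<xi> \<in> D" for w \<xi>
    unfolding Pi_def \<pi>2 \<pi>3 conf[OF that] Q_def P_def by (simp add: complex_eq_iff field_simps)
  have dPi: "pd v (Pi w) \<zeta> = complex_of_real (pd v (\<lambda>\<zeta>. \<pi>2 \<zeta> w) \<zeta>) - \<i> * complex_of_real (pd v (\<lambda>\<zeta>. \<pi>3 \<zeta> w) \<zeta>)" for v w
  proof -
    note s = smooth_on_of_real[OF oD smooth_forms(4)[of w]] smooth_on_of_real[OF oD smooth_forms(5)[of w]]
    have "pd v (Pi w) \<zeta> = pd v (\<lambda>\<zeta>. complex_of_real (\<pi>2 \<zeta> w)) \<zeta> - pd v (\<lambda>\<zeta>. \<i> * complex_of_real (\<pi>3 \<zeta> w)) \<zeta>"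
      unfolding Pi_def
      by (intro pd_diff smooth_onD[OF s(1) z] smooth_onD[OF smooth_on_mult[OF oD smooth_on_const s(2)] z])
    also have "pd v (\<lambda>\<zeta>. complex_of_real (\<pi>2 \<zeta> w)) \<zeta> = of_real (pd v (\<lambda>\<zeta>. \<pi>2 \<zeta> w) \<zeta>)"
      by (rule pd_bounded_linear[OF bounded_linear_of_real smooth_onD[OF smooth_forms(4) z]])
    also have "pd v (\<lambda>\<zeta>. \<i> * complex_of_real (\<pi>3 \<zeta> w)) \<zeta> = \<i> * pd v (\<lambda>\<zeta>. complex_of_real (\<pi>3 \<zeta> w)) \<zeta>"
      by (rule pd_bounded_linear[OF bounded_linear_mult_right smooth_onD[OF s(2) z]])
    also have "pd v (\<lambda>\<zeta>. complex_of_real (\<pi>3 \<zeta> w)) \<zeta> = of_real (pd v (\<lambda>\<zeta>. \<pi>3 \<zeta> w) \<zeta>)"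
      by (rule pd_bounded_linear[OF bounded_linear_of_real smooth_onD[OF smooth_forms(5) z]])
    finally show ?thesis .
  qed
  have dPi': "pd v (Pi w) \<zeta> = (qx v * L + q * lx v) * w + (px v * m + p * mx v) * cnj w / 2" for v w
  proof -
    have b1: "bounded_linear (\<lambda>x. x * w)" by (rule bounded_linear_mult_left)
    have b2: "bounded_linear (\<lambda>x. cnj (x * w))" by (rule bounded_linear_compose[OF bounded_linear_cnj b1])
    have b3: "bounded_linear (\<lambda>x::complex. x * (1/2))" by (rule bounded_linear_mult_left)
    have s1: "smooth_on D (\<lambda>\<xi>. l \<xi> * w)" by (rule smooth_on_bounded_linear[OF oD b1 smooth_l])
    have s2: "smooth_on D (\<lambda>\<xi>. cnj (l \<xi> * w))" by (rule smooth_on_bounded_linear[OF oD b2 smooth_l])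
    note s3 = smooth_on_mult[OF oD smooth_on_of_real[OF oD smooth_PQ(1)] s2]
    have "pd v (Pi w) \<zeta> = pd v (\<lambda>\<xi>. Q \<xi> * (l \<xi> * w) + of_real (P \<xi>) * cnj (l \<xi> * w) * (1/2)) \<zeta>"
      by (rule pd_cong_open[OF oD z]) (rule Pi)
    also have "\<dots> = pd v (\<lambda>\<xi>. Q \<xi> * (l \<xi> * w)) \<zeta> + pd v (\<lambda>\<xi>. of_real (P \<xi>) * cnj (l \<xi> * w) * (1/2)) \<zeta>"
      by (intro pd_add smooth_onD[OF _ z] smooth_on_mult[OF oD smooth_PQ(2) s1] smooth_on_bounded_linear[OF oD b3 s3])
    also have "pd v (\<lambda>\<xi>. Q \<xi> * (l \<xi> * w)) \<zeta> = q * (lx v * w) + qx v * (L * w)"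
      using pd_mult[OF dQ smooth_onD[OF s1 z], of v] pd_bounded_linear[OF b1 dl, of v]
      by (simp add: q_def lx_def qx_def L_def)
    also have "pd v (\<lambda>\<xi>. of_real (P \<xi>) * cnj (l \<xi> * w) * (1/2)) \<zeta> = (p * cnj (lx v * w) + px v * cnj (L * w)) * (1/2)"
      using pd_bounded_linear[OF b3 smooth_onD[OF s3 z], of v] pd_mult[OF doP smooth_onD[OF s2 z], of v]
        pd_bounded_linear[OF b2 dl, of v] poP[of v]
      by (simp add: p_def lx_def L_def)
    finally show ?thesis by (simp add: mx_def lx_def m_def L_def algebra_simps)
  qed
  have k1: "\<i> * lx 1 - lx \<i> = Complex (q1 \<zeta>) (q2 \<zeta>) * (L * m)"
    using d_l[OF z] by (simp add: lx_def L_def m_def)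
  have k2: "- \<i> * mx 1 - mx \<i> = cnj (Complex (q1 \<zeta>) (q2 \<zeta>)) * (L * m)"
    using arg_cong[OF k1, of cnj] by (simp add: lx_def mx_def L_def m_def mult.commute)
  \<comment> \<open>The value from the last two structure equations. The connection terms are
    grouped so that \<open>k1\<close> and \<open>k2\<close> replace them by derivatives of
    \<open>l\<close> and of its conjugate.\<close>
  have E: "pd 1 (Pi \<i>) \<zeta> - pd \<i> (Pi 1) \<zeta> =
      - 3 * q * (Complex (q1 \<zeta>) (q2 \<zeta>) * (L * m)) - p / 2 * (cnj (Complex (q1 \<zeta>) (q2 \<zeta>)) * (L * m))"
  proof -
    have "pd 1 (Pi \<i>) \<zeta> - pd \<i> (Pi 1) \<zeta> =
      complex_of_real (pd 1 (\<lambda>\<zeta>. \<pi>2 \<zeta> \<i>) \<zeta> - pd \<i> (\<lambda>\<zeta>. \<pi>2 \<zeta> 1) \<zeta>)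
      - \<i> * complex_of_real (pd 1 (\<lambda>\<zeta>. \<pi>3 \<zeta> \<i>) \<zeta> - pd \<i> (\<lambda>\<zeta>. \<pi>3 \<zeta> 1) \<zeta>)"
      unfolding dPi by (simp add: algebra_simps)
    also have "\<dots> = - 3 * q * (Complex (q1 \<zeta>) (q2 \<zeta>) * (L * m)) - p / 2 * (cnj (Complex (q1 \<zeta>) (q2 \<zeta>)) * (L * m))"
      unfolding structure_equations(5,6)[OF z] unfolding \<gamma> \<pi>2 \<pi>3 \<omega> conf[OF z] q_def p_def Q_def P_def L_def m_def
      by (simp add: complex_eq_iff field_simps)
    finally show ?thesis .
  qed
  have "(qx 1 * L + q * lx 1) * \<i> - (px 1 * m + p * mx 1) * \<i> / 2
      - ((qx \<i> * L + q * lx \<i>) + (px \<i> * m + p * mx \<i>) / 2) =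
      - 3 * q * (\<i> * lx 1 - lx \<i>) - p / 2 * (- \<i> * mx 1 - mx \<i>)"
    using E unfolding dPi' k1[symmetric] k2[symmetric] complex_cnj_i complex_cnj_one by algebra
  then have "2 * (\<i> * (qx 1 * L) - qx \<i> * L + 4 * q * (\<i> * lx 1 - lx \<i>)) =
      \<i> * px 1 * m + px \<i> * m + 2 * p * (\<i> * mx 1 + mx \<i>)"
    by algebra
  \<comment> \<open>The factor supplies the powers of \<open>l\<close> that turn both sides into
    derivatives of Q l^4 and P l^2.\<close>
  then have "m * L ^ 3 * (2 * (\<i> * (qx 1 * L) - qx \<i> * L + 4 * q * (\<i> * lx 1 - lx \<i>))) =
      m * L ^ 3 * (\<i> * px 1 * m + px \<i> * m + 2 * p * (\<i> * mx 1 + mx \<i>))" by simp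
  moreover have "cnj (px v) = px v" "cnj (lx v) = mx v" "cnj p = p" "cnj L = m" for v
    by (simp_all add: px_def lx_def mx_def p_def L_def m_def)
  ultimately show ?thesis
    unfolding ph pg L_def[symmetric] m_def[symmetric]
    by (simp add: field_simps power2_eq_square power3_eq_cube power4_eq_xxxx)
qed

end

context
  fixes u :: "complex \<Rightarrow> real"
  assumes iso: "\<And>\<zeta> w. \<zeta> \<in> D \<Longrightarrow> \<alpha> \<zeta> w = exp (u \<zeta>) * Re w" "\<And>\<zeta> w. \<zeta> \<in> D \<Longrightarrow> \<beta> \<zeta> w = exp (u \<zeta>) * Im w"
begin

lemma smooth_u: "smooth_on D u"
proof -
  have "smooth_on D (\<lambda>\<zeta>. ln (\<alpha> \<zeta> 1))" by (intro smooth_on_ln oD smooth_forms) (simp add: iso)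
  then show ?thesis by (subst smooth_on_cong[OF oD, of u "\<lambda>\<zeta>. ln (\<alpha> \<zeta> 1)"]) (simp_all add: iso)
qed

lemma isothermic_q:
  assumes z: "\<zeta> \<in> D"
  shows "q1 \<zeta> * exp (u \<zeta>) = - pd \<i> u \<zeta>" "q2 \<zeta> * exp (u \<zeta>) = pd 1 u \<zeta>"
proof -
  have e: "pd v (\<lambda>\<zeta>. exp (u \<zeta>)) \<zeta> = exp (u \<zeta>) * pd v u \<zeta>" for v
    using pd_eq[OF has_derivative_exp[OF has_derivative_pd[OF smooth_onD[OF smooth_u z]]]] by (simp add: mult.commute)
  have c: "pd v (\<lambda>\<zeta>. \<alpha> \<zeta> w) \<zeta> = Re w * (exp (u \<zeta>) * pd v u \<zeta>)" "pd v (\<lambda>\<zeta>. \<beta> \<zeta> w) \<zeta> = Im w * (exp (u \<zeta>) * pd v u \<zeta>)" for v w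
  proof -
    have d: "(\<lambda>\<zeta>. exp (u \<zeta>)) differentiable (at \<zeta>)" by (rule smooth_onD[OF smooth_on_exp[OF oD smooth_u] z])
    have "pd v (\<lambda>\<zeta>. \<alpha> \<zeta> w) \<zeta> = pd v (\<lambda>\<zeta>. Re w * exp (u \<zeta>)) \<zeta>" "pd v (\<lambda>\<zeta>. \<beta> \<zeta> w) \<zeta> = pd v (\<lambda>\<zeta>. Im w * exp (u \<zeta>)) \<zeta>"
      by (rule pd_cong_open[OF oD z]; simp add: iso)+
    then show "pd v (\<lambda>\<zeta>. \<alpha> \<zeta> w) \<zeta> = Re w * (exp (u \<zeta>) * pd v u \<zeta>)" "pd v (\<lambda>\<zeta>. \<beta> \<zeta> w) \<zeta> = Im w * (exp (u \<zeta>) * pd v u \<zeta>)"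
      using pd_bounded_linear[OF bounded_linear_mult_right d] e by simp_all
  qed
  have J: "J \<zeta> = exp (u \<zeta>) * exp (u \<zeta>)" by (simp add: J_def iso z)
  have "exp (u \<zeta>) * (q1 \<zeta> * exp (u \<zeta>)) = exp (u \<zeta>) * (- pd \<i> u \<zeta>)"
    "exp (u \<zeta>) * (q2 \<zeta> * exp (u \<zeta>)) = exp (u \<zeta>) * pd 1 u \<zeta>"
    using structure_equations(1,2)[OF z] unfolding c J by (simp_all add: algebra_simps)
  then show "q1 \<zeta> * exp (u \<zeta>) = - pd \<i> u \<zeta>" "q2 \<zeta> * exp (u \<zeta>) = pd 1 u \<zeta>"
    by (simp_all only: mult_cancel_left) simp_all
qed

text \<open>In other words, \<gamma> = 2 du, and \<omega> is the Hodge dual of du. Closedness of the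
  first gives \<open>p2 = 0\<close>; the exterior derivative of the second is the Laplacian of
  \<open>u\<close>.\<close>

lemma isothermic_forms:
  assumes z: "\<zeta> \<in> D"
  shows "\<gamma> \<zeta> 1 = 2 * pd 1 u \<zeta>" "\<gamma> \<zeta> \<i> = 2 * pd \<i> u \<zeta>" "\<omega> \<zeta> 1 = - pd \<i> u \<zeta>" "\<omega> \<zeta> \<i> = pd 1 u \<zeta>"
  using isothermic_q[OF z] by (simp_all add: \<gamma> \<omega> iso z)

lemma isothermic_p2: "\<zeta> \<in> D \<Longrightarrow> p2 \<zeta> = 0"
proof -
  assume z: "\<zeta> \<in> D"
  have c: "pd v (\<lambda>\<zeta>. \<gamma> \<zeta> 1) \<zeta> = 2 * pd v (pd 1 u) \<zeta>" "pd v (\<lambda>\<zeta>. \<gamma> \<zeta> \<i>) \<zeta> = 2 * pd v (pd \<i> u) \<zeta>" for v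
  proof -
    have "pd v (\<lambda>\<zeta>. \<gamma> \<zeta> 1) \<zeta> = pd v (\<lambda>\<zeta>. 2 * pd 1 u \<zeta>) \<zeta>" "pd v (\<lambda>\<zeta>. \<gamma> \<zeta> \<i>) \<zeta> = pd v (\<lambda>\<zeta>. 2 * pd \<i> u \<zeta>) \<zeta>"
      by (rule pd_cong_open[OF oD z]; simp add: isothermic_forms)+
    then show "pd v (\<lambda>\<zeta>. \<gamma> \<zeta> 1) \<zeta> = 2 * pd v (pd 1 u) \<zeta>" "pd v (\<lambda>\<zeta>. \<gamma> \<zeta> \<i>) \<zeta> = 2 * pd v (pd \<i> u) \<zeta>"
      using pd_bounded_linear[OF bounded_linear_mult_right smooth_onD[OF smooth_on_pd[OF smooth_u] z]] by simp_all
  qed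
  show ?thesis
    using structure_equations(3)[OF z] J_nz[OF z] pd_commute[OF smooth_u oD z, of 1 \<i>] unfolding c by simp
qed

text \<open>Together with \<open>p2 = 0\<close> this recovers Q from the Blaschke potential alone,
  and leaves P free; this is the freedom in a T-transform.\<close>

lemma isothermic_laplacian:
  assumes z: "\<zeta> \<in> D"
  shows "pd 1 (pd 1 u) \<zeta> + pd \<i> (pd \<i> u) \<zeta> = (p3 \<zeta> - p1 \<zeta>) * (exp (u \<zeta>))\<^sup>2"
proof -
  have c: "pd v (\<lambda>\<zeta>. \<omega> \<zeta> 1) \<zeta> = - pd v (pd \<i> u) \<zeta>" "pd v (\<lambda>\<zeta>. \<omega> \<zeta> \<i>) \<zeta> = pd v (pd 1 u) \<zeta>" for v
  proof -
    have "pd v (\<lambda>\<zeta>. \<omega> \<zeta> 1) \<zeta> = pd v (\<lambda>\<zeta>. - pd \<i> u \<zeta>) \<zeta>" "pd v (\<lambda>\<zeta>. \<omega> \<zeta> \<i>) \<zeta> = pd v (\<lambda>\<zeta>. pd 1 u \<zeta>) \<zeta>"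
      by (rule pd_cong_open[OF oD z]; simp add: isothermic_forms)+
    then show "pd v (\<lambda>\<zeta>. \<omega> \<zeta> 1) \<zeta> = - pd v (pd \<i> u) \<zeta>" "pd v (\<lambda>\<zeta>. \<omega> \<zeta> \<i>) \<zeta> = pd v (pd 1 u) \<zeta>"
      using pd_bounded_linear[OF bounded_linear_minus[OF bounded_linear_ident] smooth_onD[OF smooth_on_pd[OF smooth_u] z]]
      by simp_all
  qed
  have J: "J \<zeta> = (exp (u \<zeta>))\<^sup>2" by (simp add: J_def iso z power2_eq_square)
  show ?thesis using structure_equations(4)[OF z] unfolding c J by simp
qed

end

end

section \<open>Construction of middle frames\<close>

lemma cramer2:
  fixes a b c d x y :: real
  assumes "a * d - b * c \<noteq> 0"
  defines "J \<equiv> a * d - b * c"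
  shows "(x * d - y * c) / J * a + (a * y - b * x) / J * c = x"
    and "(x * d - y * c) / J * b + (a * y - b * x) / J * d = y"
proof -
  have "(x * d - y * c) * a + (a * y - b * x) * c = x * J" "(x * d - y * c) * b + (a * y - b * x) * d = y * J"
    by (simp_all add: J_def algebra_simps)
  moreover have "s / J * v + t / J * w = (s * v + t * w) / J" for s t v w :: real
    by (simp add: add_divide_distrib)
  ultimately show "(x * d - y * c) / J * a + (a * y - b * x) / J * c = x"
    "(x * d - y * c) / J * b + (a * y - b * x) / J * d = y"
    using assms(1) by (simp_all add: J_def)
qed

text \<open>The remaining structure equations of a middle frame follow from \<open>d\<^sup>2 = 0\<close> and Cartan's lemma.\<close>

lemma mframe_of_adapted:
  assumes D: "open D" and sA: "smooth_on D A" and grp: "\<And>\<zeta>. \<zeta> \<in> D \<Longrightarrow> A \<zeta> \<in> laguerre_group"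
    and lnz: "\<And>\<zeta>. \<zeta> \<in> D \<Longrightarrow> l \<zeta> \<noteq> 0"
  defines "\<alpha> \<equiv> \<lambda>\<zeta> w. Re (l \<zeta> * w)" and "\<beta> \<equiv> \<lambda>\<zeta> w. Im (l \<zeta> * w)"
    and "a0 \<equiv> \<lambda>\<zeta>. fst (A \<zeta>)" and "a1 \<equiv> \<lambda>\<zeta>. column 1 (snd (A \<zeta>))" and "a2 \<equiv> \<lambda>\<zeta>. column 2 (snd (A \<zeta>))"
    and "a3 \<equiv> \<lambda>\<zeta>. column 3 (snd (A \<zeta>))" and "a4 \<equiv> \<lambda>\<zeta>. column 4 (snd (A \<zeta>))"
  assumes da0: "\<And>\<zeta> w. \<zeta> \<in> D \<Longrightarrow> pd w a0 \<zeta> = \<alpha> \<zeta> w *\<^sub>R a2 \<zeta> + \<beta> \<zeta> w *\<^sub>R a3 \<zeta>"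
    and da1: "\<And>\<zeta> w. \<zeta> \<in> D \<Longrightarrow> mink (pd w a1 \<zeta>) (a2 \<zeta>) = \<alpha> \<zeta> w"
      "\<And>\<zeta> w. \<zeta> \<in> D \<Longrightarrow> mink (pd w a1 \<zeta>) (a3 \<zeta>) = - \<beta> \<zeta> w"
  shows "\<exists>p1 p2 p3 q1 q2. mframe D A \<alpha> \<beta> p1 p2 p3 q1 q2"
proof -
  have sm0: "smooth_on D a0" unfolding a0_def by (rule smooth_on_fst[OF D sA])
  have sm: "smooth_on D a1" "smooth_on D a2" "smooth_on D a3" "smooth_on D a4"
    unfolding a1_def a2_def a3_def a4_def
    by (rule smooth_on_bounded_linear[OF D bounded_linear_column smooth_on_snd[OF D sA]])+
  have grp': "(fst (A \<zeta>), snd (A \<zeta>)) \<in> laguerre_group" if "\<zeta> \<in> D" for \<zeta> using grp[OF that] by simp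
  have rel: "frame_rel (a1 \<zeta>) (a2 \<zeta>) (a3 \<zeta>) (a4 \<zeta>)" if "\<zeta> \<in> D" for \<zeta>
    using grp'[OF that] unfolding laguerre_group_iff a1_def a2_def a3_def a4_def by blast
  have ex: "v = (- mink v (a4 \<zeta>)) *\<^sub>R a1 \<zeta> + mink v (a2 \<zeta>) *\<^sub>R a2 \<zeta>
    + mink v (a3 \<zeta>) *\<^sub>R a3 \<zeta> + (- mink v (a1 \<zeta>)) *\<^sub>R a4 \<zeta>" if "\<zeta> \<in> D" for v \<zeta>
    using frame_expand[OF grp'[OF that]] unfolding a1_def a2_def a3_def a4_def .
  \<comment> \<open>Differentiating the constant Gram entries: the matrix of connection forms is
    antisymmetric with respect to the Minkowski product. This halves the unknown forms.\<close>
  have dc: "mink (pd w f \<zeta>) (g \<zeta>) = - mink (pd w g \<zeta>) (f \<zeta>)"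
    if "\<And>\<zeta>. \<zeta> \<in> D \<Longrightarrow> mink (f \<zeta>) (g \<zeta>) = c" "smooth_on D f" "smooth_on D g" "\<zeta> \<in> D" for f g c w \<zeta>
  proof -
    have "pd w (\<lambda>\<zeta>. mink (f \<zeta>) (g \<zeta>)) \<zeta> = pd w (\<lambda>\<zeta>. c) \<zeta>" by (rule pd_cong_open[OF D that(4)]) (rule that(1))
    then show ?thesis
      using pd_mink[OF smooth_onD[OF that(2,4)] smooth_onD[OF that(3,4)], of w] mink_commute[of "f \<zeta>" "pd w g \<zeta>"] by simp
  qed
  define \<gamma> \<pi>2 \<pi>3 \<omega> where "\<gamma> \<zeta> w = - mink (pd w a1 \<zeta>) (a4 \<zeta>)" and "\<pi>2 \<zeta> w = - mink (pd w a2 \<zeta>) (a4 \<zeta>)"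
    and "\<pi>3 \<zeta> w = - mink (pd w a3 \<zeta>) (a4 \<zeta>)" and "\<omega> \<zeta> w = mink (pd w a2 \<zeta>) (a3 \<zeta>)" for \<zeta> w
  have d1: "pd w a1 \<zeta> = \<gamma> \<zeta> w *\<^sub>R a1 \<zeta> + \<alpha> \<zeta> w *\<^sub>R a2 \<zeta> - \<beta> \<zeta> w *\<^sub>R a3 \<zeta>" if z: "\<zeta> \<in> D" for \<zeta> w
    using ex[OF z, of "pd w a1 \<zeta>"] dc[of a1 a1 0 \<zeta> w] z frame_relD[OF rel] sm da1[OF z, of w]
    by (simp add: \<gamma>_def)
  have d2: "pd w a2 \<zeta> = \<pi>2 \<zeta> w *\<^sub>R a1 \<zeta> + \<omega> \<zeta> w *\<^sub>R a3 \<zeta> + \<alpha> \<zeta> w *\<^sub>R a4 \<zeta>" if z: "\<zeta> \<in> D" for \<zeta> w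
    using ex[OF z, of "pd w a2 \<zeta>"] dc[of a2 a2 1 \<zeta> w] dc[of a2 a1 0 \<zeta> w] z frame_relD[OF rel] sm da1[OF z, of w]
    by (simp add: \<pi>2_def \<omega>_def)
  have d3: "pd w a3 \<zeta> = \<pi>3 \<zeta> w *\<^sub>R a1 \<zeta> - \<omega> \<zeta> w *\<^sub>R a2 \<zeta> - \<beta> \<zeta> w *\<^sub>R a4 \<zeta>" if z: "\<zeta> \<in> D" for \<zeta> w
    using ex[OF z, of "pd w a3 \<zeta>"] dc[of a3 a3 1 \<zeta> w] dc[of a3 a1 0 \<zeta> w] dc[of a3 a2 0 \<zeta> w] z
      frame_relD[OF rel] sm da1[OF z, of w]
    by (simp add: \<pi>3_def \<omega>_def)
  have d4: "pd w a4 \<zeta> = \<pi>2 \<zeta> w *\<^sub>R a2 \<zeta> + \<pi>3 \<zeta> w *\<^sub>R a3 \<zeta> - \<gamma> \<zeta> w *\<^sub>R a4 \<zeta>" if z: "\<zeta> \<in> D" for \<zeta> w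
    using ex[OF z, of "pd w a4 \<zeta>"] dc[of a4 a4 0 \<zeta> w] dc[of a4 a1 "-1" \<zeta> w] dc[of a4 a2 0 \<zeta> w] dc[of a4 a3 0 \<zeta> w] z
      frame_relD[OF rel] sm
    by (simp add: \<pi>2_def \<pi>3_def \<gamma>_def)
  have lin: "linear (\<alpha> \<zeta>)" "linear (\<beta> \<zeta>)" for \<zeta>
    by (auto intro!: linearI simp: \<alpha>_def \<beta>_def algebra_simps)
  have lin2: "linear (\<gamma> \<zeta>)" "linear (\<pi>2 \<zeta>)" "linear (\<pi>3 \<zeta>)" "linear (\<omega> \<zeta>)" if "\<zeta> \<in> D" for \<zeta>
  proof -
    have L: "linear (\<lambda>w. mink (pd w f \<zeta>) v)" "linear (\<lambda>w. - mink (pd w f \<zeta>) v)" if "smooth_on D f" for f v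
      using linear_compose[OF pd_linear[OF smooth_onD[OF that \<open>\<zeta> \<in> D\<close>]] bounded_linear.linear[OF mink.bounded_linear_left]]
      by (simp_all add: o_def linear_compose_neg)
    show "linear (\<gamma> \<zeta>)" "linear (\<pi>2 \<zeta>)" "linear (\<pi>3 \<zeta>)" "linear (\<omega> \<zeta>)"
      unfolding \<gamma>_def[abs_def] \<pi>2_def[abs_def] \<pi>3_def[abs_def] \<omega>_def[abs_def] using L sm by simp_all
  qed
  define J where "J \<zeta> = \<alpha> \<zeta> 1 * \<beta> \<zeta> \<i> - \<alpha> \<zeta> \<i> * \<beta> \<zeta> 1" for \<zeta>
  have J: "J \<zeta> \<noteq> 0" if "\<zeta> \<in> D" for \<zeta>
  proof -
    have "J \<zeta> = (Re (l \<zeta>))\<^sup>2 + (Im (l \<zeta>))\<^sup>2" by (simp add: J_def \<alpha>_def \<beta>_def power2_eq_square)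
    then show ?thesis using lnz[OF that] by (simp add: complex_eq_iff sum_power2_eq_zero_iff)
  qed
  define X Y where "X \<zeta> = \<beta> \<zeta> \<i> * \<omega> \<zeta> 1 - \<beta> \<zeta> 1 * \<omega> \<zeta> \<i>" and "Y \<zeta> = \<alpha> \<zeta> 1 * \<omega> \<zeta> \<i> - \<alpha> \<zeta> \<i> * \<omega> \<zeta> 1" for \<zeta>
  define q1 q2 where "q1 \<zeta> = X \<zeta> / J \<zeta>" and "q2 \<zeta> = Y \<zeta> / J \<zeta>" for \<zeta>
  define p1 p2 p3 where "p1 \<zeta> = (\<pi>2 \<zeta> 1 * \<beta> \<zeta> \<i> - \<pi>2 \<zeta> \<i> * \<beta> \<zeta> 1) / J \<zeta>"
    and "p2 \<zeta> = (\<alpha> \<zeta> 1 * \<pi>2 \<zeta> \<i> - \<alpha> \<zeta> \<i> * \<pi>2 \<zeta> 1) / J \<zeta>"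
    and "p3 \<zeta> = (\<alpha> \<zeta> 1 * \<pi>3 \<zeta> \<i> - \<alpha> \<zeta> \<i> * \<pi>3 \<zeta> 1) / J \<zeta>" for \<zeta>
  have conn: "\<gamma> \<zeta> w = 2 * q2 \<zeta> * \<alpha> \<zeta> w - 2 * q1 \<zeta> * \<beta> \<zeta> w \<and> \<pi>2 \<zeta> w = p1 \<zeta> * \<alpha> \<zeta> w + p2 \<zeta> * \<beta> \<zeta> w
     \<and> \<pi>3 \<zeta> w = p2 \<zeta> * \<alpha> \<zeta> w + p3 \<zeta> * \<beta> \<zeta> w \<and> \<omega> \<zeta> w = q1 \<zeta> * \<alpha> \<zeta> w + q2 \<zeta> * \<beta> \<zeta> w" if z: "\<zeta> \<in> D" for \<zeta> w
  proof -
    note S = da0[OF z] d1[OF z] d2[OF z] d3[OF z] d4[OF z] mink_simps frame_relD[OF rel[OF z]]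
    define da where "da = pd 1 (\<lambda>\<zeta>. \<alpha> \<zeta> \<i>) \<zeta> - pd \<i> (\<lambda>\<zeta>. \<alpha> \<zeta> 1) \<zeta>"
    define db where "db = pd 1 (\<lambda>\<zeta>. \<beta> \<zeta> \<i>) \<zeta> - pd \<i> (\<lambda>\<zeta>. \<beta> \<zeta> 1) \<zeta>"
    have f02: "mink (pd w a0 \<zeta>) (a2 \<zeta>) = \<alpha> \<zeta> w" "mink (pd w a0 \<zeta>) (a3 \<zeta>) = \<beta> \<zeta> w" "mink (pd w a0 \<zeta>) (a4 \<zeta>) = 0" if "\<zeta> \<in> D" for w \<zeta>
      using that by (simp_all add: da0 mink_simps frame_relD[OF rel])
    have m: "pd v (\<lambda>\<zeta>. - \<beta> \<zeta> w) \<zeta> = - pd v (\<lambda>\<zeta>. \<beta> \<zeta> w) \<zeta>" for v w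
    proof -
      have "smooth_on D (\<lambda>\<zeta>. \<beta> \<zeta> w)"
        by (subst smooth_on_cong[OF D, of _ "\<lambda>\<zeta>. mink (pd w a0 \<zeta>) (a3 \<zeta>)"])
          (auto simp: f02 intro: smooth_on_mink[OF D smooth_on_pd[OF sm0] sm(3)])
      then show ?thesis
        using pd_bounded_linear[OF bounded_linear_minus[OF bounded_linear_ident] smooth_onD[OF _ z]] by blast
    qed
    have pdc: "pd v (\<lambda>\<zeta>. mink (pd w a0 \<zeta>) (a2 \<zeta>)) \<zeta> = pd v (\<lambda>\<zeta>. \<alpha> \<zeta> w) \<zeta>"
      "pd v (\<lambda>\<zeta>. mink (pd w a0 \<zeta>) (a3 \<zeta>)) \<zeta> = pd v (\<lambda>\<zeta>. \<beta> \<zeta> w) \<zeta>"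
      "pd v (\<lambda>\<zeta>. mink (pd w a0 \<zeta>) (a4 \<zeta>)) \<zeta> = pd v (\<lambda>\<zeta>. 0 :: real) \<zeta>"
      "pd v (\<lambda>\<zeta>. mink (pd w a1 \<zeta>) (a2 \<zeta>)) \<zeta> = pd v (\<lambda>\<zeta>. \<alpha> \<zeta> w) \<zeta>"
      "pd v (\<lambda>\<zeta>. mink (pd w a1 \<zeta>) (a3 \<zeta>)) \<zeta> = pd v (\<lambda>\<zeta>. - \<beta> \<zeta> w) \<zeta>" for v w
      by (rule pd_cong_open[OF D z]; simp add: f02 da1)+
    \<comment> \<open>\<open>da\<close> and \<open>db\<close> are the exterior derivatives of
      \<open>\<alpha>\<close> and \<open>\<beta>\<close>. Each is computed twice, from d(da0) = 0
      and from d(da1) = 0, paired with the second and third frame vector. Equating the results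
      expresses \<gamma> through \<omega>.\<close>
    have e1: "da = X \<zeta>"
      using d_mink[OF D z sm0 sm(2)] unfolding pdc da_def[symmetric] X_def by (simp add: S algebra_simps)
    have e2: "db = Y \<zeta>"
      using d_mink[OF D z sm0 sm(3)] unfolding pdc db_def[symmetric] Y_def by (simp add: S algebra_simps)
    \<comment> \<open>This is \<alpha> wedge \<pi>2 + \<beta> wedge \<pi>3 = 0. By Cartan's lemma
      \<pi>2 and \<pi>3 share the cross coefficient \<open>p2\<close>.\<close>
    have e3: "\<alpha> \<zeta> \<i> * \<pi>2 \<zeta> 1 + \<beta> \<zeta> \<i> * \<pi>3 \<zeta> 1 = \<alpha> \<zeta> 1 * \<pi>2 \<zeta> \<i> + \<beta> \<zeta> 1 * \<pi>3 \<zeta> \<i>"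
      using d_mink[OF D z sm0 sm(4)] unfolding pdc by (simp add: S mult.commute)
    have e4: "da = \<gamma> \<zeta> 1 * \<alpha> \<zeta> \<i> - \<gamma> \<zeta> \<i> * \<alpha> \<zeta> 1 - X \<zeta>"
      using d_mink[OF D z sm(1) sm(2)] unfolding pdc da_def[symmetric] X_def by (simp add: S algebra_simps)
    have e5: "- db = \<gamma> \<zeta> \<i> * \<beta> \<zeta> 1 - \<gamma> \<zeta> 1 * \<beta> \<zeta> \<i> + Y \<zeta>"
      using d_mink[OF D z sm(1) sm(3)] unfolding pdc m Y_def db_def by (simp add: S algebra_simps)
    have g: "2 * X \<zeta> = \<gamma> \<zeta> 1 * \<alpha> \<zeta> \<i> - \<gamma> \<zeta> \<i> * \<alpha> \<zeta> 1" "2 * Y \<zeta> = \<gamma> \<zeta> 1 * \<beta> \<zeta> \<i> - \<gamma> \<zeta> \<i> * \<beta> \<zeta> 1"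
      using e1 e2 e4 e5 by linarith+
    have Jz: "\<alpha> \<zeta> 1 * \<beta> \<zeta> \<i> - \<alpha> \<zeta> \<i> * \<beta> \<zeta> 1 \<noteq> 0" using J[OF z] by (simp add: J_def)
    note C = cramer2[OF Jz, folded J_def]
    have p2': "p2 \<zeta> = (\<pi>3 \<zeta> 1 * \<beta> \<zeta> \<i> - \<pi>3 \<zeta> \<i> * \<beta> \<zeta> 1) / J \<zeta>"
      unfolding p2_def using e3 by (simp add: algebra_simps)
    have q: "q1 \<zeta> = (\<omega> \<zeta> 1 * \<beta> \<zeta> \<i> - \<omega> \<zeta> \<i> * \<beta> \<zeta> 1) / J \<zeta>" "q2 \<zeta> = (\<alpha> \<zeta> 1 * \<omega> \<zeta> \<i> - \<alpha> \<zeta> \<i> * \<omega> \<zeta> 1) / J \<zeta>"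
      unfolding q1_def q2_def X_def Y_def by (simp_all add: mult.commute)
    have q': "2 * q2 \<zeta> = (\<gamma> \<zeta> 1 * \<beta> \<zeta> \<i> - \<gamma> \<zeta> \<i> * \<beta> \<zeta> 1) / J \<zeta>" "- 2 * q1 \<zeta> = (\<alpha> \<zeta> 1 * \<gamma> \<zeta> \<i> - \<alpha> \<zeta> \<i> * \<gamma> \<zeta> 1) / J \<zeta>"
    proof -
      have g': "- 2 * X \<zeta> = \<alpha> \<zeta> 1 * \<gamma> \<zeta> \<i> - \<alpha> \<zeta> \<i> * \<gamma> \<zeta> 1" using g(1) by (simp add: algebra_simps)
      show "2 * q2 \<zeta> = (\<gamma> \<zeta> 1 * \<beta> \<zeta> \<i> - \<gamma> \<zeta> \<i> * \<beta> \<zeta> 1) / J \<zeta>" "- 2 * q1 \<zeta> = (\<alpha> \<zeta> 1 * \<gamma> \<zeta> \<i> - \<alpha> \<zeta> \<i> * \<gamma> \<zeta> 1) / J \<zeta>"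
        unfolding q1_def q2_def times_divide_eq_right g g' by (rule refl)+
    qed
    have at: "\<gamma> \<zeta> w = 2 * q2 \<zeta> * \<alpha> \<zeta> w - 2 * q1 \<zeta> * \<beta> \<zeta> w \<and> \<pi>2 \<zeta> w = p1 \<zeta> * \<alpha> \<zeta> w + p2 \<zeta> * \<beta> \<zeta> w
     \<and> \<pi>3 \<zeta> w = p2 \<zeta> * \<alpha> \<zeta> w + p3 \<zeta> * \<beta> \<zeta> w \<and> \<omega> \<zeta> w = q1 \<zeta> * \<alpha> \<zeta> w + q2 \<zeta> * \<beta> \<zeta> w" if "w = 1 \<or> w = \<i>" for w
    proof (intro conjI)
      have "\<gamma> \<zeta> w = 2 * q2 \<zeta> * \<alpha> \<zeta> w + (- 2 * q1 \<zeta>) * \<beta> \<zeta> w" unfolding q' using that C by auto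
      then show "\<gamma> \<zeta> w = 2 * q2 \<zeta> * \<alpha> \<zeta> w - 2 * q1 \<zeta> * \<beta> \<zeta> w" by simp
      show "\<pi>2 \<zeta> w = p1 \<zeta> * \<alpha> \<zeta> w + p2 \<zeta> * \<beta> \<zeta> w" unfolding p1_def p2_def using that C by auto
      show "\<pi>3 \<zeta> w = p2 \<zeta> * \<alpha> \<zeta> w + p3 \<zeta> * \<beta> \<zeta> w" unfolding p2' p3_def using that C by auto
      show "\<omega> \<zeta> w = q1 \<zeta> * \<alpha> \<zeta> w + q2 \<zeta> * \<beta> \<zeta> w" unfolding q using that C by auto
    qed
    have a: "\<gamma> \<zeta> 1 = 2 * q2 \<zeta> * \<alpha> \<zeta> 1 - 2 * q1 \<zeta> * \<beta> \<zeta> 1" "\<pi>2 \<zeta> 1 = p1 \<zeta> * \<alpha> \<zeta> 1 + p2 \<zeta> * \<beta> \<zeta> 1"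
      "\<pi>3 \<zeta> 1 = p2 \<zeta> * \<alpha> \<zeta> 1 + p3 \<zeta> * \<beta> \<zeta> 1" "\<omega> \<zeta> 1 = q1 \<zeta> * \<alpha> \<zeta> 1 + q2 \<zeta> * \<beta> \<zeta> 1"
      "\<gamma> \<zeta> \<i> = 2 * q2 \<zeta> * \<alpha> \<zeta> \<i> - 2 * q1 \<zeta> * \<beta> \<zeta> \<i>" "\<pi>2 \<zeta> \<i> = p1 \<zeta> * \<alpha> \<zeta> \<i> + p2 \<zeta> * \<beta> \<zeta> \<i>"
      "\<pi>3 \<zeta> \<i> = p2 \<zeta> * \<alpha> \<zeta> \<i> + p3 \<zeta> * \<beta> \<zeta> \<i>" "\<omega> \<zeta> \<i> = q1 \<zeta> * \<alpha> \<zeta> \<i> + q2 \<zeta> * \<beta> \<zeta> \<i>"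
      using at[of 1] at[of \<i>] by simp_all
    note L = linear_complex_expand[of _ w]
    show ?thesis
      unfolding L[OF lin2(1)[OF z]] L[OF lin2(2)[OF z]] L[OF lin2(3)[OF z]] L[OF lin2(4)[OF z]] L[OF lin(1)[of \<zeta>]] L[OF lin(2)[of \<zeta>]]
      unfolding a by (simp add: algebra_simps)
  qed
  have ind: "r = 0 \<and> s = 0" if z: "\<zeta> \<in> D" and h: "\<forall>w. r * \<alpha> \<zeta> w + s * \<beta> \<zeta> w = 0" for \<zeta> r s
  proof -
    have h': "r * \<alpha> \<zeta> 1 + s * \<beta> \<zeta> 1 = 0" "r * \<alpha> \<zeta> \<i> + s * \<beta> \<zeta> \<i> = 0" using h by auto
    have "r * J \<zeta> = (r * \<alpha> \<zeta> 1 + s * \<beta> \<zeta> 1) * \<beta> \<zeta> \<i> - (r * \<alpha> \<zeta> \<i> + s * \<beta> \<zeta> \<i>) * \<beta> \<zeta> 1"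
      "s * J \<zeta> = (r * \<alpha> \<zeta> \<i> + s * \<beta> \<zeta> \<i>) * \<alpha> \<zeta> 1 - (r * \<alpha> \<zeta> 1 + s * \<beta> \<zeta> 1) * \<alpha> \<zeta> \<i>"
      by (simp_all add: J_def algebra_simps)
    then have "r * J \<zeta> = 0" "s * J \<zeta> = 0" unfolding h' by simp_all
    then show ?thesis using J[OF z] by simp
  qed
  have "mframe D A \<alpha> \<beta> p1 p2 p3 q1 q2"
    unfolding mframe_def Let_def
  proof (intro conjI ballI allI impI)
    fix \<zeta> w assume z: "\<zeta> \<in> D"
    note cn = conn[OF z, of w]
    show "pd w (\<lambda>\<zeta>. fst (A \<zeta>)) \<zeta> = \<alpha> \<zeta> w *\<^sub>R column 2 (snd (A \<zeta>)) + \<beta> \<zeta> w *\<^sub>R column 3 (snd (A \<zeta>))"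
      using da0[OF z] unfolding a0_def a2_def a3_def .
    show "pd w (\<lambda>\<zeta>. column 1 (snd (A \<zeta>))) \<zeta> =
      (2 * q2 \<zeta> * \<alpha> \<zeta> w - 2 * q1 \<zeta> * \<beta> \<zeta> w) *\<^sub>R column 1 (snd (A \<zeta>)) +
      \<alpha> \<zeta> w *\<^sub>R column 2 (snd (A \<zeta>)) - \<beta> \<zeta> w *\<^sub>R column 3 (snd (A \<zeta>))"
      using d1[OF z, of w] cn unfolding a1_def a2_def a3_def by simp
    show "pd w (\<lambda>\<zeta>. column 2 (snd (A \<zeta>))) \<zeta> =
      (p1 \<zeta> * \<alpha> \<zeta> w + p2 \<zeta> * \<beta> \<zeta> w) *\<^sub>R column 1 (snd (A \<zeta>)) +
      (q1 \<zeta> * \<alpha> \<zeta> w + q2 \<zeta> * \<beta> \<zeta> w) *\<^sub>R column 3 (snd (A \<zeta>)) + \<alpha> \<zeta> w *\<^sub>R column 4 (snd (A \<zeta>))"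
      using d2[OF z, of w] cn unfolding a1_def a2_def a3_def a4_def by simp
    show "pd w (\<lambda>\<zeta>. column 3 (snd (A \<zeta>))) \<zeta> =
      (p2 \<zeta> * \<alpha> \<zeta> w + p3 \<zeta> * \<beta> \<zeta> w) *\<^sub>R column 1 (snd (A \<zeta>)) -
      (q1 \<zeta> * \<alpha> \<zeta> w + q2 \<zeta> * \<beta> \<zeta> w) *\<^sub>R column 2 (snd (A \<zeta>)) - \<beta> \<zeta> w *\<^sub>R column 4 (snd (A \<zeta>))"
      using d3[OF z, of w] cn unfolding a1_def a2_def a3_def a4_def by simp
    show "pd w (\<lambda>\<zeta>. column 4 (snd (A \<zeta>))) \<zeta> =
      (p1 \<zeta> * \<alpha> \<zeta> w + p2 \<zeta> * \<beta> \<zeta> w) *\<^sub>R column 2 (snd (A \<zeta>)) +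
      (p2 \<zeta> * \<alpha> \<zeta> w + p3 \<zeta> * \<beta> \<zeta> w) *\<^sub>R column 3 (snd (A \<zeta>)) -
      (2 * q2 \<zeta> * \<alpha> \<zeta> w - 2 * q1 \<zeta> * \<beta> \<zeta> w) *\<^sub>R column 4 (snd (A \<zeta>))"
      using d4[OF z, of w] cn unfolding a1_def a2_def a3_def a4_def by simp
  next
    fix \<zeta> r s assume "\<zeta> \<in> D" "\<forall>w. r * \<alpha> \<zeta> w + s * \<beta> \<zeta> w = 0"
    then show "r = 0" "s = 0" using ind by blast+
  qed (use D sA grp lin in auto)
  then show ?thesis by blast
qed

text \<open>\<open>null_polar a b c d\<close> is, up to a factor 2 in the first coordinate, the Hermitian matrix \<open>\<eta>\<xi>\<^sup>* + \<xi>\<eta>\<^sup>*\<close> for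
  \<open>\<eta> = (a, b)\<close> and \<open>\<xi> = (c, d)\<close>; the Minkowski norm is a multiple of the determinant.\<close>

definition null_polar :: "complex \<Rightarrow> complex \<Rightarrow> complex \<Rightarrow> complex \<Rightarrow> real^4" where
  "null_polar a b c d = vector [Re (a * cnj c), Re (c * cnj b + a * cnj d), Im (c * cnj b + a * cnj d), 2 * Re (b * cnj d)]"

text \<open>The Hermitian square psi psi^H of the spinor psi = (a, b); the first coordinate is
  halved because the light cone reads 2 v1 v4 = v2^2 + v3^2.\<close>

definition null_lift :: "complex \<Rightarrow> complex \<Rightarrow> real^4" where
  "null_lift a b = vector [Re (a * cnj a) / 2, Re (a * cnj b), Im (a * cnj b), Re (b * cnj b)]"

text \<open>With W = c b - a d each pairing is 0, |W|^2 or -|W|^2, as expected of a polarised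
  determinant. Scaling the second spinor by \<open>v\<close> corresponds to differentiating in
  direction \<open>v\<close>; 1 and \<open>\<i>\<close> give the two coordinate derivatives.\<close>

lemma null_lift_rel:
  assumes W: "c * b - a * d = 1"
  shows "mink (null_lift a b) (null_lift a b) = 0"
    "mink (null_lift a b) (null_polar a b (c * v) (d * v)) = 0"
    "mink (null_lift a b) (null_polar c d c d) = -1"
    "mink (null_polar a b c d) (null_polar a b c d) = 1"
    "mink (null_polar a b c d) (null_polar a b (c * \<i>) (d * \<i>)) = 0"
    "mink (null_polar a b (c * \<i>) (d * \<i>)) (null_polar a b (c * \<i>) (d * \<i>)) = 1"
    "mink (null_polar a b (c * v) (d * v)) (null_polar c d c d) = 0"
    "mink (null_polar c d c d) (null_polar c d c d) = 0"
proof -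
  define W where "W = c * b - a * d"
  have n: "(Re W)\<^sup>2 + (Im W)\<^sup>2 = 1" using assms by (simp add: W_def)
  show "mink (null_lift a b) (null_lift a b) = 0"
    "mink (null_lift a b) (null_polar a b (c * v) (d * v)) = 0"
    "mink (null_polar a b c d) (null_polar a b (c * \<i>) (d * \<i>)) = 0"
    "mink (null_polar a b (c * v) (d * v)) (null_polar c d c d) = 0"
    "mink (null_polar c d c d) (null_polar c d c d) = 0"
    unfolding mink_def null_lift_def null_polar_def vec4_nth by (simp_all, algebra+)
  have "mink (null_lift a b) (null_polar c d c d) = - ((Re W)\<^sup>2 + (Im W)\<^sup>2)"
    "mink (null_polar a b c d) (null_polar a b c d) = (Re W)\<^sup>2 + (Im W)\<^sup>2"
    "mink (null_polar a b (c * \<i>) (d * \<i>)) (null_polar a b (c * \<i>) (d * \<i>)) = (Re W)\<^sup>2 + (Im W)\<^sup>2"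
    unfolding mink_def null_lift_def null_polar_def vec4_nth W_def by (simp_all, algebra+)
  then show "mink (null_lift a b) (null_polar c d c d) = -1"
    "mink (null_polar a b c d) (null_polar a b c d) = 1"
    "mink (null_polar a b (c * \<i>) (d * \<i>)) (null_polar a b (c * \<i>) (d * \<i>)) = 1"
    using n by simp_all
qed

definition cols :: "real^4 \<Rightarrow> real^4 \<Rightarrow> real^4 \<Rightarrow> real^4 \<Rightarrow> real^4^4" where
  "cols a b c d = (\<chi> i j. if j = 1 then a$i else if j = 2 then b$i else if j = 3 then c$i else d$i)"

lemma column_cols [simp]:
  "column 1 (cols a b c d) = a" "column 2 (cols a b c d) = b" "column 3 (cols a b c d) = c" "column 4 (cols a b c d) = d"
  by (simp_all add: column_def cols_def vec_eq_iff)

lemma smooth_on_cols: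
  assumes "open D" "smooth_on D a" "smooth_on D b" "smooth_on D c" "smooth_on D d"
  shows "smooth_on D (\<lambda>\<zeta>. cols (a \<zeta>) (b \<zeta>) (c \<zeta>) (d \<zeta>))"
proof (rule smooth_on_vec[OF assms(1)], rule smooth_on_vec[OF assms(1)])
  fix i j :: 4
  show "smooth_on D (\<lambda>\<zeta>. cols (a \<zeta>) (b \<zeta>) (c \<zeta>) (d \<zeta>) $ i $ j)"
    using exhaust_4[of j] assms by (auto simp: cols_def intro: smooth_on_nth)
qed

text \<open>The determinant is -|W|^4. The negative sign shows that the coordinate derivatives of N
  come in the wrong orientation; the minus sign before \<beta> in the equation for da1 compensates
  it.\<close>

lemma det_null_lift:
  assumes W: "c * b - a * d = 1"
  shows "det (cols (null_lift a b) (null_polar a b c d) (null_polar a b (c * \<i>) (d * \<i>)) (null_polar c d c d)) = -1"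
proof -
  define W where "W = c * b - a * d"
  have "det (cols (null_lift a b) (null_polar a b c d) (null_polar a b (c * \<i>) (d * \<i>)) (null_polar c d c d))
    = - ((Re W)\<^sup>2 + (Im W)\<^sup>2)\<^sup>2"
    unfolding det_4 cols_def null_lift_def null_polar_def vec4_nth W_def
    by (simp, algebra)
  then show ?thesis using W by (simp add: W_def)
qed

lemma bounded_bilinear_nth_pd:
  fixes f :: "complex \<Rightarrow> real^4"
  assumes "f differentiable (at \<zeta>)"
  shows "pd v f \<zeta> $ i = pd v (\<lambda>\<zeta>. f \<zeta> $ i) \<zeta>"
  using pd_bounded_linear[OF bounded_linear_vec_nth assms] by simp

lemma smooth_on_null_lift:
  fixes w1 w2 :: "complex \<Rightarrow> complex"
  assumes D: "open D" and w: "smooth_on D w1" "smooth_on D w2"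
  shows "smooth_on D (\<lambda>\<zeta>. null_lift (w1 \<zeta>) (w2 \<zeta>))"
proof (rule smooth_on_vec[OF D])
  fix i :: 4
  have s: "smooth_on D (\<lambda>\<zeta>. a \<zeta> * cnj (b \<zeta>))" if "smooth_on D a" "smooth_on D b" for a b :: "complex \<Rightarrow> complex"
    by (rule smooth_on_mult[OF D that(1) smooth_on_cnj[OF D that(2)]])
  have "smooth_on D (\<lambda>\<zeta>. Re (w1 \<zeta> * cnj (w1 \<zeta>)) * (1/2))" "smooth_on D (\<lambda>\<zeta>. Re (w1 \<zeta> * cnj (w2 \<zeta>)))"
    "smooth_on D (\<lambda>\<zeta>. Im (w1 \<zeta> * cnj (w2 \<zeta>)))" "smooth_on D (\<lambda>\<zeta>. Re (w2 \<zeta> * cnj (w2 \<zeta>)))"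
    by (rule smooth_on_mult[OF D smooth_on_Re[OF D s[OF w(1) w(1)]] smooth_on_const] smooth_on_Re[OF D s[OF w(1) w(2)]]
        smooth_on_Im[OF D s[OF w(1) w(2)]] smooth_on_Re[OF D s[OF w(2) w(2)]])+
  then show "smooth_on D (\<lambda>\<zeta>. null_lift (w1 \<zeta>) (w2 \<zeta>) $ i)"
    using exhaust_4[of i] unfolding null_lift_def by (elim disjE) simp_all
qed

text \<open>For a holomorphic spinor the product rule for psi psi^H gives the polar form of psi and
  psi' v.\<close>

lemma pd_null_lift:
  assumes D: "open D" "\<zeta> \<in> D" and w: "w1 holomorphic_on D" "w2 holomorphic_on D"
  shows "pd v (\<lambda>\<zeta>. null_lift (w1 \<zeta>) (w2 \<zeta>)) \<zeta> = null_polar (w1 \<zeta>) (w2 \<zeta>) (deriv w1 \<zeta> * v) (deriv w2 \<zeta> * v)"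
proof -
  have sw: "smooth_on D w1" "smooth_on D w2" using w D smooth_on_holomorphic by auto
  have d: "pd v (\<lambda>\<zeta>. a \<zeta> * cnj (b \<zeta>)) \<zeta> = a \<zeta> * cnj (deriv b \<zeta> * v) + deriv a \<zeta> * v * cnj (b \<zeta>)"
    "(\<lambda>\<zeta>. a \<zeta> * cnj (b \<zeta>)) differentiable (at \<zeta>)"
    if "a holomorphic_on D" "b holomorphic_on D" for a b :: "complex \<Rightarrow> complex"
  proof -
    have da: "a differentiable (at \<zeta>)" "b differentiable (at \<zeta>)"
      using smooth_onD[OF smooth_on_holomorphic[OF D(1)] D(2)] that by auto
    have dc: "(\<lambda>\<zeta>. cnj (b \<zeta>)) differentiable (at \<zeta>)"
      using smooth_onD[OF smooth_on_cnj[OF D(1) smooth_on_holomorphic[OF D(1) that(2)]] D(2)] .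
    show "pd v (\<lambda>\<zeta>. a \<zeta> * cnj (b \<zeta>)) \<zeta> = a \<zeta> * cnj (deriv b \<zeta> * v) + deriv a \<zeta> * v * cnj (b \<zeta>)"
      using pd_mult[OF da(1) dc, of v] pd_bounded_linear[OF bounded_linear_cnj da(2), of v]
        pd_holomorphic[OF that(1) D] pd_holomorphic[OF that(2) D] by simp
    show "(\<lambda>\<zeta>. a \<zeta> * cnj (b \<zeta>)) differentiable (at \<zeta>)"
      by (rule smooth_onD[OF smooth_on_mult[OF D(1) smooth_on_holomorphic[OF D(1) that(1)]
            smooth_on_cnj[OF D(1) smooth_on_holomorphic[OF D(1) that(2)]]] D(2)])
  qed
  have R: "pd v (\<lambda>\<zeta>. Re (a \<zeta> * cnj (b \<zeta>))) \<zeta> = Re (a \<zeta> * cnj (deriv b \<zeta> * v) + deriv a \<zeta> * v * cnj (b \<zeta>))"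
    "pd v (\<lambda>\<zeta>. Im (a \<zeta> * cnj (b \<zeta>))) \<zeta> = Im (a \<zeta> * cnj (deriv b \<zeta> * v) + deriv a \<zeta> * v * cnj (b \<zeta>))"
    "pd v (\<lambda>\<zeta>. Re (a \<zeta> * cnj (b \<zeta>)) / 2) \<zeta> = Re (a \<zeta> * cnj (deriv b \<zeta> * v) + deriv a \<zeta> * v * cnj (b \<zeta>)) / 2"
    if "a holomorphic_on D" "b holomorphic_on D" for a b :: "complex \<Rightarrow> complex"
  proof -
    have b2: "bounded_linear (\<lambda>x. Re x / 2)"
      using bounded_linear_compose[OF bounded_linear_mult_left[of "1/2"] bounded_linear_Re] by simp
    show "pd v (\<lambda>\<zeta>. Re (a \<zeta> * cnj (b \<zeta>))) \<zeta> = Re (a \<zeta> * cnj (deriv b \<zeta> * v) + deriv a \<zeta> * v * cnj (b \<zeta>))"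
      "pd v (\<lambda>\<zeta>. Im (a \<zeta> * cnj (b \<zeta>))) \<zeta> = Im (a \<zeta> * cnj (deriv b \<zeta> * v) + deriv a \<zeta> * v * cnj (b \<zeta>))"
      "pd v (\<lambda>\<zeta>. Re (a \<zeta> * cnj (b \<zeta>)) / 2) \<zeta> = Re (a \<zeta> * cnj (deriv b \<zeta> * v) + deriv a \<zeta> * v * cnj (b \<zeta>)) / 2"
      unfolding d(1)[OF that, symmetric]
      by (rule pd_bounded_linear[OF bounded_linear_Re d(2)[OF that]] pd_bounded_linear[OF bounded_linear_Im d(2)[OF that]]
          pd_bounded_linear[OF b2 d(2)[OF that]])+
  qed
  have n: "pd v (\<lambda>\<zeta>. null_lift (w1 \<zeta>) (w2 \<zeta>)) \<zeta> $ i = pd v (\<lambda>\<zeta>. null_lift (w1 \<zeta>) (w2 \<zeta>) $ i) \<zeta>" for i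
    by (rule bounded_bilinear_nth_pd[OF smooth_onD[OF smooth_on_null_lift[OF D(1) sw] D(2)]])
  show ?thesis
    unfolding vec4_eq_iff n
    unfolding null_lift_def null_polar_def vec4_nth R[OF w(1) w(1)] R[OF w(1) w(2)] R[OF w(2) w(2)]
    by (simp add: field_simps)
qed

lemma lightcone_scale: "v \<in> lightcone \<Longrightarrow> s > 0 \<Longrightarrow> s *\<^sub>R v \<in> lightcone"
proof -
  assume v: "v \<in> lightcone" and s: "s > 0"
  have "mink (s *\<^sub>R v) (s *\<^sub>R v) = s * s * mink v v" by (simp add: mink_simps)
  moreover have "mink (s *\<^sub>R v) e = s * mink v e" for e by (simp add: mink_simps)
  ultimately show ?thesis using v s by (auto simp: lightcone_def mult_pos_neg)
qed

lemma null_lift_lightcone: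
  assumes "a \<noteq> 0 \<or> b \<noteq> 0"
  shows "null_lift a b \<in> lightcone"
proof -
  have "(Re a)\<^sup>2 + (Im a)\<^sup>2 \<ge> 0" "(Re b)\<^sup>2 + (Im b)\<^sup>2 \<ge> 0" by auto
  moreover have "(Re a)\<^sup>2 + (Im a)\<^sup>2 > 0 \<or> (Re b)\<^sup>2 + (Im b)\<^sup>2 > 0"
    using assms by (auto simp: complex_eq_iff sum_power2_gt_zero_iff)
  ultimately have "((Re a)\<^sup>2 + (Im a)\<^sup>2) / 2 + ((Re b)\<^sup>2 + (Im b)\<^sup>2) > 0"
    by (auto intro: add_pos_nonneg add_nonneg_pos)
  then show ?thesis
    unfolding lightcone_iff null_lift_def vec4_nth
    by (simp add: power2_eq_square algebra_simps)
qed

lemma null_polar_diag: "null_polar c d c d = 2 *\<^sub>R null_lift c d"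
  by (simp add: vec4_eq_iff null_polar_def null_lift_def)

text \<open>The reversed Cauchy-Schwarz inequality: a backward null vector pairs nonnegatively with
  a forward one.\<close>

lemma lightcone_of_pairing:
  assumes v: "v \<in> lightcone" and w: "mink w w = 0" "mink v w < 0"
  shows "w \<in> lightcone"
proof -
  have v': "2 * (v$1 * v$4) = (v$2)\<^sup>2 + (v$3)\<^sup>2" "v$1 + v$4 > 0" using v by (auto simp: lightcone_iff)
  have w': "2 * (w$1 * w$4) = (w$2)\<^sup>2 + (w$3)\<^sup>2" using w(1) by (simp add: mink_def power2_eq_square)
  have nn: "v$1 * v$4 \<ge> 0" "w$1 * w$4 \<ge> 0" using v'(1) w' by (smt (verit) zero_le_power2)+
  have vp: "v$1 \<ge> 0" "v$4 \<ge> 0" using nn(1) v'(2) by (smt (verit) mult_nonneg_nonneg mult_pos_neg mult_neg_pos)+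
  have "w$1 + w$4 > 0"
  proof (rule ccontr)
    assume "\<not> w$1 + w$4 > 0"
    then have wn: "w$1 \<le> 0" "w$4 \<le> 0" using nn(2) by (smt (verit) mult_pos_neg mult_neg_pos)+
    define X where "X = v$1 * w$4 + v$4 * w$1"
    have X: "X \<le> 0" unfolding X_def using vp wn by (simp add: add_nonpos_nonpos mult_nonneg_nonpos)
    \<comment> \<open>Cauchy-Schwarz for the two spatial coordinates, with Lagrange's identity
      supplying the remainder; nullity then rewrites the bound through the other coordinates, and
      the inequality of arithmetic and geometric means bounds it by \<open>X\<close>
      squared.\<close>
    have "(v$2 * w$2 + v$3 * w$3)\<^sup>2 \<le> ((v$2)\<^sup>2 + (v$3)\<^sup>2) * ((w$2)\<^sup>2 + (w$3)\<^sup>2)"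
    proof -
      have "((v$2)\<^sup>2 + (v$3)\<^sup>2) * ((w$2)\<^sup>2 + (w$3)\<^sup>2) - (v$2 * w$2 + v$3 * w$3)\<^sup>2 = (v$2 * w$3 - v$3 * w$2)\<^sup>2"
        by (simp add: power2_eq_square algebra_simps)
      then show ?thesis by (smt (verit) zero_le_power2)
    qed
    also have "\<dots> = 4 * ((v$1 * w$4) * (v$4 * w$1))" unfolding v'(1)[symmetric] w'[symmetric] by simp
    also have "\<dots> = X\<^sup>2 - (v$1 * w$4 - v$4 * w$1)\<^sup>2" by (simp add: X_def power2_eq_square algebra_simps)
    also have "\<dots> \<le> (- X)\<^sup>2" by simp
    finally have "\<bar>v$2 * w$2 + v$3 * w$3\<bar> \<le> - X" using X abs_le_square_iff[of _ "- X"] by simp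
    then show False using w(2) by (simp add: mink_def X_def)
  qed
  then show ?thesis using w' by (simp add: lightcone_iff)
qed

section \<open>From a null lift to a middle frame\<close>

lemma cols_mult: "M ** cols a b c d = cols (M *v a) (M *v b) (M *v c) (M *v d)"
  by (simp add: vec_eq_iff matrix_matrix_mult_def matrix_vector_mult_def cols_def)

text \<open>The pointwise algebra: \<open>n\<close>, \<open>n1\<close>, \<open>n2\<close> stand for
  N and its coordinate derivatives, \<open>x\<close>, \<open>y\<close> for those of the base point,
  and A + iB = l, s = |l|. The vectors \<open>a2\<close>, \<open>a3\<close> undo the rotation by l.
  They differ from the rotated derivatives \<open>e2\<close>, \<open>e3\<close> of N by multiples
  \<open>k2\<close>, \<open>k3\<close> of \<open>n\<close>, so \<open>a4\<close> is obtained from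
  \<open>n4\<close> by the matching null rotation; the coefficient (k2^2 + k3^2)/2 is the one that
  keeps it null.\<close>

lemma adapted_frame:
  fixes n n1 n2 n4 x y c :: "real^4" and s A B :: real
  assumes rel: "frame_rel n n1 n2 n4" and det: "det (cols n n1 n2 n4) = -1"
    and lc: "n \<in> lightcone" "n4 \<in> lightcone" and s: "s > 0" "s * s = A * A + B * B"
    and x: "mink x n = 0" "s * mink x n1 = A * A - B * B" "s * mink x n2 = - 2 * A * B"
    and y: "mink y n = 0" "s * mink y n1 = - 2 * A * B" "s * mink y n2 = B * B - A * A"
  defines "a2 \<equiv> (1 / (s * s)) *\<^sub>R (A *\<^sub>R x - B *\<^sub>R y)" and "a3 \<equiv> (1 / (s * s)) *\<^sub>R (B *\<^sub>R x + A *\<^sub>R y)"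
  defines "k2 \<equiv> - mink a2 n4" and "k3 \<equiv> - mink a3 n4"
  defines "e2 \<equiv> (1 / s) *\<^sub>R (A *\<^sub>R n1 - B *\<^sub>R n2)" and "e3 \<equiv> (- 1 / s) *\<^sub>R (B *\<^sub>R n1 + A *\<^sub>R n2)"
  defines "a4 \<equiv> (1 / s) *\<^sub>R (n4 + k2 *\<^sub>R e2 + k3 *\<^sub>R e3 + ((k2 * k2 + k3 * k3) / 2) *\<^sub>R n)"
  shows "(c, cols (s *\<^sub>R n) a2 a3 a4) \<in> laguerre_group"
    and "mink n1 a2 = A / s" "mink n2 a2 = - B / s" "mink n1 a3 = - B / s" "mink n2 a3 = - A / s" "mink n a2 = 0" "mink n a3 = 0"
    and "x = A *\<^sub>R a2 + B *\<^sub>R a3" "y = - B *\<^sub>R a2 + A *\<^sub>R a3"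
proof -
  have s0: "s \<noteq> 0" using s by simp
  define M where "M = cols n n1 n2 n4"
  have Mv: "M *v v = v$1 *\<^sub>R n + v$2 *\<^sub>R n1 + v$3 *\<^sub>R n2 + v$4 *\<^sub>R n4" for v
    by (simp add: M_def matrix_vector_4)
  note R = frame_relD[OF rel]
  \<comment> \<open>Determinants in coordinates with respect to the basis \<open>M\<close>. The
    block in \<open>A\<close> and \<open>B\<close> is a reflection, so it contributes -1 and cancels
    the determinant -1 of \<open>M\<close>.\<close>
  have detC: "det (cols (vector [p, 0, 0, 0]) (vector [k, A / s, - B / s, 0]) (vector [k', - B / s, - A / s, 0]) (vector [u1, u2, u3, u4]) :: real^4^4)
    = - (p * u4)" for p k k' u1 u2 u3 u4
  proof -
    have "det (cols (vector [p, 0, 0, 0]) (vector [k, A / s, - B / s, 0]) (vector [k', - B / s, - A / s, 0]) (vector [u1, u2, u3, u4]) :: real^4^4)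
      = - (p * u4) * ((A * A + B * B) / (s * s))"
      unfolding det_4 cols_def by (simp add: add_divide_distrib algebra_simps)
    then show ?thesis using s0 s(2)[symmetric] by simp
  qed
  have re: "frame_rel n e2 e3 n4"
  proof -
    have "mink e2 e2 = (1 / s) * (1 / s) * (A * A + B * B)" "mink e3 e3 = (1 / s) * (1 / s) * (A * A + B * B)"
      using s0 by (simp_all add: e2_def e3_def mink_simps R) (simp_all add: field_simps)
    then have "mink e2 e2 = 1" "mink e3 e3 = 1" using s0 by (simp_all flip: s(2))
    moreover have "mink e2 e3 = 0" "mink n e2 = 0" "mink n e3 = 0" "mink e2 n4 = 0" "mink e3 n4 = 0"
      by (simp_all add: e2_def e3_def mink_simps R)
    ultimately show ?thesis by (simp add: frame_rel_def R)
  qed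
  note RE = frame_relD[OF re]
  have g0: "(0, cols n e2 e3 n4) \<in> laguerre_group"
  proof -
    have "cols n e2 e3 n4 = M ** cols (vector [1, 0, 0, 0]) (vector [0, A / s, - B / s, 0]) (vector [0, - B / s, - A / s, 0]) (vector [0, 0, 0, 1])"
      unfolding cols_mult Mv by (simp add: e2_def e3_def algebra_simps)
    then have "det (cols n e2 e3 n4) = 1" using det detC[of 1 0 0 0 0 0 1] by (simp add: det_mul M_def)
    then show ?thesis using re lc by (simp add: laguerre_group_iff)
  qed
  have ss: "1 / (s * s) * (1 / s) * (1 / s) * (s * s * (s * s)) = 1" using s0 by simp
  have m: "mink x n1 = (A * A - B * B) / s" "mink x n2 = - 2 * A * B / s" "mink y n1 = - 2 * A * B / s" "mink y n2 = (B * B - A * A) / s"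
    using x(2,3) y(2,3) s0 by (simp_all add: field_simps)
  have sq: "s * s * (s * s) = (A * A + B * B) * (A * A + B * B)" using s(2) by simp
  have d2: "mink a2 e2 = 1" "mink a3 e3 = 1" "mink a2 e3 = 0" "mink a3 e2 = 0"
  proof -
    have "mink a2 e2 = (A * A + B * B) * (A * A + B * B) / (s * s * (s * s))"
      "mink a3 e3 = (A * A + B * B) * (A * A + B * B) / (s * s * (s * s))"
      unfolding a2_def a3_def e2_def e3_def by (simp_all add: mink_simps m add_divide_distrib diff_divide_distrib algebra_simps)
    then show "mink a2 e2 = 1" "mink a3 e3 = 1" using s0 by (simp_all flip: sq)
    show "mink a2 e3 = 0" "mink a3 e2 = 0"
      unfolding a2_def a3_def e2_def e3_def by (simp_all add: mink_simps m add_divide_distrib diff_divide_distrib algebra_simps)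
  qed
  have n0: "mink a2 n = 0" "mink a3 n = 0" unfolding a2_def a3_def by (simp_all add: mink_simps x y)
  have A2: "a2 = e2 + k2 *\<^sub>R n" and A3: "a3 = e3 + k3 *\<^sub>R n"
    using frame_expand[OF g0, of a2] frame_expand[OF g0, of a3] d2 n0 by (simp_all add: k2_def k3_def)
  have fr: "frame_rel (s *\<^sub>R n) a2 a3 a4"
    unfolding A2 A3 a4_def using s0 by (simp add: frame_rel_def mink_simps RE) (simp add: algebra_simps add_divide_distrib diff_divide_distrib)
  have dt: "det (cols (s *\<^sub>R n) a2 a3 a4) = 1"
  proof -
    have "cols (s *\<^sub>R n) a2 a3 a4 = M ** cols (vector [s, 0, 0, 0]) (vector [k2, A / s, - B / s, 0]) (vector [k3, - B / s, - A / s, 0])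
       (vector [(k2 * k2 + k3 * k3) / 2 / s, (k2 * A - k3 * B) / s / s, (- k2 * B - k3 * A) / s / s, 1 / s])"
      unfolding cols_mult Mv A2 A3 a4_def
      by (simp add: e2_def e3_def scaleR_add_right scaleR_diff_right scaleR_add_left scaleR_diff_left add_divide_distrib diff_divide_distrib)
        (simp add: algebra_simps)
    then show ?thesis using det detC[of s k2 k3] s0 by (simp add: det_mul M_def)
  qed
  have l1: "s *\<^sub>R n \<in> lightcone" using lightcone_scale lc s by blast
  have "a4 \<in> lightcone" by (rule lightcone_of_pairing[OF l1]) (simp_all add: frame_relD[OF fr])
  then show "(c, cols (s *\<^sub>R n) a2 a3 a4) \<in> laguerre_group" using fr dt l1 by (simp add: laguerre_group_iff)
  show "mink n1 a2 = A / s" "mink n2 a2 = - B / s" "mink n1 a3 = - B / s" "mink n2 a3 = - A / s"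
    unfolding A2 A3 e2_def e3_def by (simp_all add: mink_simps R)
  show "mink n a2 = 0" "mink n a3 = 0" using n0 by (simp_all add: mink_commute)
  have e: "(s * s) *\<^sub>R a2 = A *\<^sub>R x - B *\<^sub>R y" "(s * s) *\<^sub>R a3 = B *\<^sub>R x + A *\<^sub>R y"
    using s0 by (simp_all add: a2_def a3_def)
  have "(s * s) *\<^sub>R (A *\<^sub>R a2 + B *\<^sub>R a3) = A *\<^sub>R ((s * s) *\<^sub>R a2) + B *\<^sub>R ((s * s) *\<^sub>R a3)"
    "(s * s) *\<^sub>R (- B *\<^sub>R a2 + A *\<^sub>R a3) = - B *\<^sub>R ((s * s) *\<^sub>R a2) + A *\<^sub>R ((s * s) *\<^sub>R a3)"
    by (simp_all add: algebra_simps)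
  then have "(s * s) *\<^sub>R (A *\<^sub>R a2 + B *\<^sub>R a3) = (A * A + B * B) *\<^sub>R x" "(s * s) *\<^sub>R (- B *\<^sub>R a2 + A *\<^sub>R a3) = (A * A + B * B) *\<^sub>R y"
    unfolding e by (simp_all add: algebra_simps)
  then show "x = A *\<^sub>R a2 + B *\<^sub>R a3" "y = - B *\<^sub>R a2 + A *\<^sub>R a3"
    unfolding s(2)[symmetric] using s0 by simp_all
qed

text \<open>With \<open>a1\<close> = |l| N the hypotheses \<open>II\<close> say that the pairing of
  da0 with da1 is Re(l^2 dz^2), which is \<alpha>^2 - \<beta>^2 for \<phi> = l dz. They are the
  second-order condition that distinguishes a middle frame among all frames over the line.\<close>

lemma middle_frame_of_null_lift:
  assumes D: "open D" and w: "w1 holomorphic_on D" "w2 holomorphic_on D"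
    and W: "\<And>\<zeta>. \<zeta> \<in> D \<Longrightarrow> deriv w1 \<zeta> * w2 \<zeta> - w1 \<zeta> * deriv w2 \<zeta> = 1"
    and l: "smooth_on D l" "\<And>\<zeta>. \<zeta> \<in> D \<Longrightarrow> l \<zeta> \<noteq> 0" and a0: "smooth_on D a0"
  defines "N \<equiv> \<lambda>\<zeta>. null_lift (w1 \<zeta>) (w2 \<zeta>)"
  assumes ort: "\<And>\<zeta> w. \<zeta> \<in> D \<Longrightarrow> mink (pd w a0 \<zeta>) (N \<zeta>) = 0"
    and II: "\<And>\<zeta>. \<zeta> \<in> D \<Longrightarrow> norm (l \<zeta>) * mink (pd 1 a0 \<zeta>) (pd 1 N \<zeta>) = Re ((l \<zeta>)\<^sup>2)"
      "\<And>\<zeta>. \<zeta> \<in> D \<Longrightarrow> norm (l \<zeta>) * mink (pd 1 a0 \<zeta>) (pd \<i> N \<zeta>) = - Im ((l \<zeta>)\<^sup>2)"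
      "\<And>\<zeta>. \<zeta> \<in> D \<Longrightarrow> norm (l \<zeta>) * mink (pd \<i> a0 \<zeta>) (pd 1 N \<zeta>) = - Im ((l \<zeta>)\<^sup>2)"
      "\<And>\<zeta>. \<zeta> \<in> D \<Longrightarrow> norm (l \<zeta>) * mink (pd \<i> a0 \<zeta>) (pd \<i> N \<zeta>) = - Re ((l \<zeta>)\<^sup>2)"
  obtains A p1 p2 p3 q1 q2 where "mframe D A (\<lambda>\<zeta> w. Re (l \<zeta> * w)) (\<lambda>\<zeta> w. Im (l \<zeta> * w)) p1 p2 p3 q1 q2"
    "\<And>\<zeta>. fst (A \<zeta>) = a0 \<zeta>" "\<And>\<zeta>. column 1 (snd (A \<zeta>)) = norm (l \<zeta>) *\<^sub>R N \<zeta>"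
    "\<And>\<zeta>. column 2 (snd (A \<zeta>)) = (1 / (norm (l \<zeta>) * norm (l \<zeta>))) *\<^sub>R (Re (l \<zeta>) *\<^sub>R pd 1 a0 \<zeta> - Im (l \<zeta>) *\<^sub>R pd \<i> a0 \<zeta>)"
    "\<And>\<zeta>. column 3 (snd (A \<zeta>)) = (1 / (norm (l \<zeta>) * norm (l \<zeta>))) *\<^sub>R (Im (l \<zeta>) *\<^sub>R pd 1 a0 \<zeta> + Re (l \<zeta>) *\<^sub>R pd \<i> a0 \<zeta>)"
proof -
  define s where "s \<zeta> = norm (l \<zeta>)" for \<zeta>
  define a2 where "a2 \<zeta> = (1 / (s \<zeta> * s \<zeta>)) *\<^sub>R (Re (l \<zeta>) *\<^sub>R pd 1 a0 \<zeta> - Im (l \<zeta>) *\<^sub>R pd \<i> a0 \<zeta>)" for \<zeta>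
  define a3 where "a3 \<zeta> = (1 / (s \<zeta> * s \<zeta>)) *\<^sub>R (Im (l \<zeta>) *\<^sub>R pd 1 a0 \<zeta> + Re (l \<zeta>) *\<^sub>R pd \<i> a0 \<zeta>)" for \<zeta>
  define n4 where "n4 \<zeta> = 2 *\<^sub>R null_lift (deriv w1 \<zeta>) (deriv w2 \<zeta>)" for \<zeta>
  define k2 where "k2 \<zeta> = - mink (a2 \<zeta>) (n4 \<zeta>)" for \<zeta>
  define k3 where "k3 \<zeta> = - mink (a3 \<zeta>) (n4 \<zeta>)" for \<zeta>
  define e2 where "e2 \<zeta> = (1 / s \<zeta>) *\<^sub>R (Re (l \<zeta>) *\<^sub>R pd 1 N \<zeta> - Im (l \<zeta>) *\<^sub>R pd \<i> N \<zeta>)" for \<zeta>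
  define e3 where "e3 \<zeta> = (- 1 / s \<zeta>) *\<^sub>R (Im (l \<zeta>) *\<^sub>R pd 1 N \<zeta> + Re (l \<zeta>) *\<^sub>R pd \<i> N \<zeta>)" for \<zeta>
  define a4 where "a4 \<zeta> = (1 / s \<zeta>) *\<^sub>R (n4 \<zeta> + k2 \<zeta> *\<^sub>R e2 \<zeta> + k3 \<zeta> *\<^sub>R e3 \<zeta> + ((k2 \<zeta> * k2 \<zeta> + k3 \<zeta> * k3 \<zeta>) / 2) *\<^sub>R N \<zeta>)" for \<zeta>
  define A where "A \<zeta> = (a0 \<zeta>, cols (s \<zeta> *\<^sub>R N \<zeta>) (a2 \<zeta>) (a3 \<zeta>) (a4 \<zeta>))" for \<zeta>
  have sw: "smooth_on D w1" "smooth_on D w2" using w D smooth_on_holomorphic by auto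
  have sdw: "smooth_on D (deriv w1)" "smooth_on D (deriv w2)"
    using w D smooth_on_holomorphic holomorphic_deriv by auto
  have sN: "smooth_on D N" unfolding N_def by (rule smooth_on_null_lift[OF D sw])
  have ss: "smooth_on D s" unfolding s_def by (rule smooth_on_norm[OF D l])
  have snz: "s \<zeta> > 0" if "\<zeta> \<in> D" for \<zeta> using l(2)[OF that] by (simp add: s_def)
  have snz': "s \<zeta> \<noteq> 0" "s \<zeta> * s \<zeta> \<noteq> 0" if "\<zeta> \<in> D" for \<zeta> using snz[OF that] by auto
  note I = smooth_on_scaleR[OF D] smooth_on_divide[OF D] smooth_on_mult[OF D] smooth_on_add[OF D] smooth_on_diff[OF D]
    smooth_on_const smooth_on_Re[OF D l(1)] smooth_on_Im[OF D l(1)] smooth_on_pd[OF a0] smooth_on_pd[OF sN] ss sN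
    smooth_on_uminus[OF D] smooth_on_mink[OF D]
  have sa: "smooth_on D a2" "smooth_on D a3" unfolding a2_def a3_def by (intro I snz'; assumption)+
  have sn4: "smooth_on D n4" unfolding n4_def by (intro I smooth_on_null_lift[OF D] sdw)
  have sk: "smooth_on D k2" "smooth_on D k3" unfolding k2_def k3_def by (intro I sa sn4)+
  have se: "smooth_on D e2" "smooth_on D e3" unfolding e2_def e3_def by (intro I snz'; assumption)+
  have sa4: "smooth_on D a4" unfolding a4_def
    by (intro smooth_on_scaleR[OF D] smooth_on_divide[OF D] smooth_on_mult[OF D] smooth_on_add[OF D]
        smooth_on_const ss sN sn4 sk se snz'; simp)
  have sA: "smooth_on D A" unfolding A_def
    by (intro smooth_on_Pair[OF D] smooth_on_cols[OF D] a0 sa sa4 smooth_on_scaleR[OF D] ss sN)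
  have pdN: "pd v N \<zeta> = null_polar (w1 \<zeta>) (w2 \<zeta>) (deriv w1 \<zeta> * v) (deriv w2 \<zeta> * v)" if "\<zeta> \<in> D" for v \<zeta>
    unfolding N_def by (rule pd_null_lift[OF D that w])
  have sl: "s \<zeta> * s \<zeta> = Re (l \<zeta>) * Re (l \<zeta>) + Im (l \<zeta>) * Im (l \<zeta>)" for \<zeta>
    unfolding s_def cmod_def by (simp add: power2_eq_square)
  have fr: "frame_rel (N \<zeta>) (pd 1 N \<zeta>) (pd \<i> N \<zeta>) (n4 \<zeta>)" "det (cols (N \<zeta>) (pd 1 N \<zeta>) (pd \<i> N \<zeta>) (n4 \<zeta>)) = -1"
    "N \<zeta> \<in> lightcone" "n4 \<zeta> \<in> lightcone" if z: "\<zeta> \<in> D" for \<zeta>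
  proof -
    note W' = W[OF z]
    show "frame_rel (N \<zeta>) (pd 1 N \<zeta>) (pd \<i> N \<zeta>) (n4 \<zeta>)"
      unfolding frame_rel_def pdN[OF z]
      unfolding n4_def null_polar_diag[symmetric] N_def
      using null_lift_rel[OF W'] null_lift_rel(2,7)[OF W', of 1] null_lift_rel(2,7)[OF W', of \<i>] by simp
    show "det (cols (N \<zeta>) (pd 1 N \<zeta>) (pd \<i> N \<zeta>) (n4 \<zeta>)) = -1"
      unfolding pdN[OF z]
      unfolding n4_def null_polar_diag[symmetric] N_def using det_null_lift[OF W'] by simp
    show "N \<zeta> \<in> lightcone" unfolding N_def by (rule null_lift_lightcone) (use W' in auto)
    show "n4 \<zeta> \<in> lightcone" unfolding n4_def
      by (rule lightcone_scale[OF null_lift_lightcone]) (use W' in auto)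
  qed
  have AF: "(c, cols (s \<zeta> *\<^sub>R N \<zeta>) (a2 \<zeta>) (a3 \<zeta>) (a4 \<zeta>)) \<in> laguerre_group"
    "mink (pd 1 N \<zeta>) (a2 \<zeta>) = Re (l \<zeta>) / s \<zeta>" "mink (pd \<i> N \<zeta>) (a2 \<zeta>) = - Im (l \<zeta>) / s \<zeta>"
    "mink (pd 1 N \<zeta>) (a3 \<zeta>) = - Im (l \<zeta>) / s \<zeta>" "mink (pd \<i> N \<zeta>) (a3 \<zeta>) = - Re (l \<zeta>) / s \<zeta>"
    "mink (N \<zeta>) (a2 \<zeta>) = 0" "mink (N \<zeta>) (a3 \<zeta>) = 0"
    "pd 1 a0 \<zeta> = Re (l \<zeta>) *\<^sub>R a2 \<zeta> + Im (l \<zeta>) *\<^sub>R a3 \<zeta>" "pd \<i> a0 \<zeta> = - Im (l \<zeta>) *\<^sub>R a2 \<zeta> + Re (l \<zeta>) *\<^sub>R a3 \<zeta>"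
    if z: "\<zeta> \<in> D" for c \<zeta>
  proof -
    have c: "s \<zeta> * mink (pd 1 a0 \<zeta>) (pd 1 N \<zeta>) = Re (l \<zeta>) * Re (l \<zeta>) - Im (l \<zeta>) * Im (l \<zeta>)"
      "s \<zeta> * mink (pd 1 a0 \<zeta>) (pd \<i> N \<zeta>) = - 2 * Re (l \<zeta>) * Im (l \<zeta>)"
      "s \<zeta> * mink (pd \<i> a0 \<zeta>) (pd 1 N \<zeta>) = - 2 * Re (l \<zeta>) * Im (l \<zeta>)"
      "s \<zeta> * mink (pd \<i> a0 \<zeta>) (pd \<i> N \<zeta>) = Im (l \<zeta>) * Im (l \<zeta>) - Re (l \<zeta>) * Re (l \<zeta>)"
      unfolding s_def II[OF z] by (simp_all add: power2_eq_square)
    note af = adapted_frame[OF fr[OF z] snz[OF z] sl ort[OF z, of 1] c(1,2) ort[OF z, of \<i>] c(3,4),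
      folded a2_def a3_def, folded k2_def k3_def e2_def e3_def, folded a4_def]
    show "(c, cols (s \<zeta> *\<^sub>R N \<zeta>) (a2 \<zeta>) (a3 \<zeta>) (a4 \<zeta>)) \<in> laguerre_group"
      "mink (pd 1 N \<zeta>) (a2 \<zeta>) = Re (l \<zeta>) / s \<zeta>" "mink (pd \<i> N \<zeta>) (a2 \<zeta>) = - Im (l \<zeta>) / s \<zeta>"
      "mink (pd 1 N \<zeta>) (a3 \<zeta>) = - Im (l \<zeta>) / s \<zeta>" "mink (pd \<i> N \<zeta>) (a3 \<zeta>) = - Re (l \<zeta>) / s \<zeta>"
      "mink (N \<zeta>) (a2 \<zeta>) = 0" "mink (N \<zeta>) (a3 \<zeta>) = 0"
      "pd 1 a0 \<zeta> = Re (l \<zeta>) *\<^sub>R a2 \<zeta> + Im (l \<zeta>) *\<^sub>R a3 \<zeta>" "pd \<i> a0 \<zeta> = - Im (l \<zeta>) *\<^sub>R a2 \<zeta> + Re (l \<zeta>) *\<^sub>R a3 \<zeta>"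
      by (rule af)+
  qed
  have cl: "column 1 (snd (A \<zeta>)) = s \<zeta> *\<^sub>R N \<zeta>" "column 2 (snd (A \<zeta>)) = a2 \<zeta>" "column 3 (snd (A \<zeta>)) = a3 \<zeta>"
    "fst (A \<zeta>) = a0 \<zeta>" for \<zeta> by (simp_all add: A_def)
  \<comment> \<open>Against vectors orthogonal to N the derivative of the scale factor drops
    out.\<close>
  have d1: "mink (pd v (\<lambda>\<zeta>. s \<zeta> *\<^sub>R N \<zeta>) \<zeta>) a = s \<zeta> * (Re v * mink (pd 1 N \<zeta>) a + Im v * mink (pd \<i> N \<zeta>) a)"
    if z: "\<zeta> \<in> D" and a: "mink (N \<zeta>) a = 0" for v \<zeta> a
    using pd_scaleR[OF smooth_onD[OF ss z] smooth_onD[OF sN z], of v] pd_complex_expand[OF smooth_onD[OF sN z], of v] a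
    by (simp add: mink_simps)
  have "\<exists>p1 p2 p3 q1 q2. mframe D A (\<lambda>\<zeta> w. Re (l \<zeta> * w)) (\<lambda>\<zeta> w. Im (l \<zeta> * w)) p1 p2 p3 q1 q2"
  proof (rule mframe_of_adapted[OF D sA])
    show "A \<zeta> \<in> laguerre_group" if "\<zeta> \<in> D" for \<zeta> unfolding A_def using AF(1)[OF that] .
    show "l \<zeta> \<noteq> 0" if "\<zeta> \<in> D" for \<zeta> using l(2) that .
  next
    fix \<zeta> w assume z: "\<zeta> \<in> D"
    show "pd w (\<lambda>\<zeta>. fst (A \<zeta>)) \<zeta> = Re (l \<zeta> * w) *\<^sub>R column 2 (snd (A \<zeta>)) + Im (l \<zeta> * w) *\<^sub>R column 3 (snd (A \<zeta>))"
      unfolding cl pd_complex_expand[OF smooth_onD[OF a0 z], of w]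
      by (subst AF(8)[OF z], subst AF(9)[OF z]) (simp add: algebra_simps)
    show "mink (pd w (\<lambda>\<zeta>. column 1 (snd (A \<zeta>))) \<zeta>) (column 2 (snd (A \<zeta>))) = Re (l \<zeta> * w)"
      "mink (pd w (\<lambda>\<zeta>. column 1 (snd (A \<zeta>))) \<zeta>) (column 3 (snd (A \<zeta>))) = - Im (l \<zeta> * w)"
      unfolding cl d1[OF z AF(6)[OF z]] d1[OF z AF(7)[OF z]] AF(2-5)[OF z] using snz'[OF z] by (simp_all add: field_simps)
  qed
  then show thesis using that cl unfolding s_def a2_def a3_def by blast
qed

section \<open>Pull-back of frames and the action of the Laguerre group\<close>

lemma mframeI:
  assumes "open D" "smooth_on D A"
    and "\<And>q. q \<in> D \<Longrightarrow> A q \<in> laguerre_group" "\<And>q. q \<in> D \<Longrightarrow> linear (\<alpha> q)" "\<And>q. q \<in> D \<Longrightarrow> linear (\<beta> q)"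
    and "\<And>q r s. q \<in> D \<Longrightarrow> (\<forall>w. r * \<alpha> q w + s * \<beta> q w = 0) \<Longrightarrow> r = 0 \<and> s = 0"
    and "\<And>q w. q \<in> D \<Longrightarrow> pd w (\<lambda>q. fst (A q)) q = \<alpha> q w *\<^sub>R column 2 (snd (A q)) + \<beta> q w *\<^sub>R column 3 (snd (A q))"
    and "\<And>q w. q \<in> D \<Longrightarrow> pd w (\<lambda>q. column 1 (snd (A q))) q = (2 * q2 q * \<alpha> q w - 2 * q1 q * \<beta> q w) *\<^sub>R column 1 (snd (A q))
        + \<alpha> q w *\<^sub>R column 2 (snd (A q)) - \<beta> q w *\<^sub>R column 3 (snd (A q))"
    and "\<And>q w. q \<in> D \<Longrightarrow> pd w (\<lambda>q. column 2 (snd (A q))) q = (p1 q * \<alpha> q w + p2 q * \<beta> q w) *\<^sub>R column 1 (snd (A q))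
        + (q1 q * \<alpha> q w + q2 q * \<beta> q w) *\<^sub>R column 3 (snd (A q)) + \<alpha> q w *\<^sub>R column 4 (snd (A q))"
    and "\<And>q w. q \<in> D \<Longrightarrow> pd w (\<lambda>q. column 3 (snd (A q))) q = (p2 q * \<alpha> q w + p3 q * \<beta> q w) *\<^sub>R column 1 (snd (A q))
        - (q1 q * \<alpha> q w + q2 q * \<beta> q w) *\<^sub>R column 2 (snd (A q)) - \<beta> q w *\<^sub>R column 4 (snd (A q))"
    and "\<And>q w. q \<in> D \<Longrightarrow> pd w (\<lambda>q. column 4 (snd (A q))) q = (p1 q * \<alpha> q w + p2 q * \<beta> q w) *\<^sub>R column 2 (snd (A q))
        + (p2 q * \<alpha> q w + p3 q * \<beta> q w) *\<^sub>R column 3 (snd (A q)) - (2 * q2 q * \<alpha> q w - 2 * q1 q * \<beta> q w) *\<^sub>R column 4 (snd (A q))"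
  shows "mframe D A \<alpha> \<beta> p1 p2 p3 q1 q2"
  unfolding mframe_def Let_def by (intro conjI ballI allI impI; (rule assms(1-5,7-11) | (drule assms(6), assumption, blast)); assumption?)

lemma mframe_cong:
  assumes "open D" and H: "\<And>q. q \<in> D \<Longrightarrow> A1 q = A2 q \<and> a1 q = a2 q \<and> b1 q = b2 q \<and> x1 q = u1 q
      \<and> x2 q = u2 q \<and> x3 q = u3 q \<and> y1 q = v1 q \<and> y2 q = v2 q"
  shows "mframe D A1 a1 b1 x1 x2 x3 y1 y2 \<longleftrightarrow> mframe D A2 a2 b2 u1 u2 u3 v1 v2"
proof -
  have s: "smooth_on D A1 \<longleftrightarrow> smooth_on D A2" by (rule smooth_on_cong[OF assms(1)]) (use H in auto)
  have p: "pd w (\<lambda>\<zeta>. f (A1 \<zeta>)) q = pd w (\<lambda>\<zeta>. f (A2 \<zeta>)) q" if "q \<in> D" for w q and f :: "_ \<Rightarrow> real^4"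
    by (rule pd_cong_open[OF assms(1) that]) (use H in auto)
  show ?thesis unfolding mframe_def Let_def s
    using H p[of _ _ fst] p[of _ _ "\<lambda>a. column 1 (snd a)"] p[of _ _ "\<lambda>a. column 2 (snd a)"]
      p[of _ _ "\<lambda>a. column 3 (snd a)"] p[of _ _ "\<lambda>a. column 4 (snd a)"]
    by (simp cong: ball_cong)
qed

text \<open>The structure equations are identities between forms and survive pull-back. Injectivity
  of the derivative serves to keep the two forms independent.\<close>

lemma mframe_pullback:
  assumes A: "mframe D A \<alpha> \<beta> p1 p2 p3 q1 q2" and D': "open D'" and \<theta>: "smooth_on D' \<theta>" "\<theta> ` D' \<subseteq> D"
    and inj: "\<And>\<zeta>. \<zeta> \<in> D' \<Longrightarrow> inj (\<lambda>w. pd w \<theta> \<zeta>)"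
  shows "mframe D' (\<lambda>\<zeta>. A (\<theta> \<zeta>)) (\<lambda>\<zeta> w. \<alpha> (\<theta> \<zeta>) (pd w \<theta> \<zeta>)) (\<lambda>\<zeta> w. \<beta> (\<theta> \<zeta>) (pd w \<theta> \<zeta>))
    (\<lambda>\<zeta>. p1 (\<theta> \<zeta>)) (\<lambda>\<zeta>. p2 (\<theta> \<zeta>)) (\<lambda>\<zeta>. p3 (\<theta> \<zeta>)) (\<lambda>\<zeta>. q1 (\<theta> \<zeta>)) (\<lambda>\<zeta>. q2 (\<theta> \<zeta>))"
proof -
  interpret F: middle_coord_frame D A \<alpha> \<beta> p1 p2 p3 q1 q2
    by (rule middle_coord_frame.intro[OF A])
  have sA: "smooth_on D A" using A by (simp add: mframe_def)
  have im: "\<theta> \<zeta> \<in> D" if "\<zeta> \<in> D'" for \<zeta> using \<theta>(2) that by blast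
  have c: "pd w (\<lambda>\<zeta>. f (\<theta> \<zeta>)) \<zeta> = pd (pd w \<theta> \<zeta>) f (\<theta> \<zeta>)" if "smooth_on D f" "\<zeta> \<in> D'" for f :: "complex \<Rightarrow> real^4" and w \<zeta>
    by (rule pd_compose[OF smooth_onD[OF \<theta>(1) that(2)] smooth_onD[OF that(1) im[OF that(2)]]])
  show ?thesis
  proof (rule mframeI)
    show "smooth_on D' (\<lambda>\<zeta>. A (\<theta> \<zeta>))" by (rule smooth_on_compose[OF D' \<theta>(2) sA \<theta>(1)])
  next
    fix \<zeta> assume z: "\<zeta> \<in> D'"
    show "A (\<theta> \<zeta>) \<in> laguerre_group" by (rule mframe_group[OF A im[OF z]])
    have l: "linear (\<lambda>w. pd w \<theta> \<zeta>)" by (rule pd_linear[OF smooth_onD[OF \<theta>(1) z]])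
    show "linear (\<lambda>w. \<alpha> (\<theta> \<zeta>) (pd w \<theta> \<zeta>))" "linear (\<lambda>w. \<beta> (\<theta> \<zeta>) (pd w \<theta> \<zeta>))"
      using linear_compose[OF l F.lin(1)[OF im[OF z]]] linear_compose[OF l F.lin(2)[OF im[OF z]]] by (simp_all add: o_def)
    show "r = 0 \<and> s = 0" if h: "\<forall>w. r * \<alpha> (\<theta> \<zeta>) (pd w \<theta> \<zeta>) + s * \<beta> (\<theta> \<zeta>) (pd w \<theta> \<zeta>) = 0" for r s
    proof (rule F.indep[OF im[OF z]], rule allI)
      fix v
      have "surj (\<lambda>w. pd w \<theta> \<zeta>)" by (rule linear_injective_imp_surjective[OF l inj[OF z]]) simp
      then obtain w where "v = pd w \<theta> \<zeta>" by (metis surjE)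
      then show "r * \<alpha> (\<theta> \<zeta>) v + s * \<beta> (\<theta> \<zeta>) v = 0" using h by blast
    qed
  qed (rule D' | (subst c[OF F.sm(1)] c[OF F.sm(2)] c[OF F.sm(3)] c[OF F.sm(4)] c[OF F.sm(5)], assumption,
      (rule F.da0 F.da1 F.da2 F.da3 F.da4), erule im))+
qed

lemma lightcone_pair_neg:
  assumes "v \<in> lightcone"
  shows "mink v (axis 1 1) < 0 \<or> mink v (axis 4 1) < 0"
  using assms by (auto simp: lightcone_def mink_simps)

text \<open>A forward null vector pairs negatively with the first or the last basis vector. The
  pairing is preserved and the images of both basis vectors are forward, so
  \<open>lightcone_of_pairing\<close> applies.\<close>

lemma laguerre_group_lightcone:
  assumes g: "(x, b) \<in> laguerre_group" and v: "v \<in> lightcone"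
  shows "b *v v \<in> lightcone"
proof -
  have p: "mink (b *v u) (b *v w) = mink u w" for u w using g by (simp add: laguerre_group_def)
  have e: "b *v axis 1 1 \<in> lightcone" "b *v axis 4 1 \<in> lightcone" using g by (auto simp: laguerre_group_def)
  have n: "mink (b *v v) (b *v v) = 0" using v by (simp add: p lightcone_def)
  have "mink (b *v axis 1 1) (b *v v) < 0 \<or> mink (b *v axis 4 1) (b *v v) < 0"
    using lightcone_pair_neg[OF v] unfolding p by (simp add: mink_commute)
  then show ?thesis using lightcone_of_pairing[OF e(1) n] lightcone_of_pairing[OF e(2) n] by blast
qed

lemma column_matrix_mult: "column i (b ** M) = b *v column i M"
  by (simp add: vec_eq_iff column_def matrix_matrix_mult_def matrix_vector_mult_def)

lemma laguerre_group_mult: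
  assumes g: "(x, b) \<in> laguerre_group" and h: "(y, M) \<in> laguerre_group"
  shows "(c, b ** M) \<in> laguerre_group"
proof -
  have p: "mink (b *v u) (b *v w) = mink u w" for u w using g by (simp add: laguerre_group_def)
  have d: "det b = 1" using g by (simp add: laguerre_group_def)
  show ?thesis
    using h laguerre_group_lightcone[OF g]
    unfolding laguerre_group_iff column_matrix_mult frame_rel_def p by (simp add: det_mul d)
qed

text \<open>Multiplication by a constant matrix commutes with differentiation, so a Laguerre
  transformation leaves all forms and coefficients of the frame unchanged. This is the invariance of
  P and Q.\<close>

lemma mframe_action:
  assumes g: "(x, b) \<in> laguerre_group" and A: "mframe D A \<alpha> \<beta> p1 p2 p3 q1 q2"
  shows "mframe D (\<lambda>\<zeta>. (x + b *v fst (A \<zeta>), b ** snd (A \<zeta>))) \<alpha> \<beta> p1 p2 p3 q1 q2"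
proof -
  interpret F: middle_coord_frame D A \<alpha> \<beta> p1 p2 p3 q1 q2
    by (rule middle_coord_frame.intro[OF A])
  have bl: "bounded_linear (\<lambda>v. b *v v)" by (rule linear_conv_bounded_linear[THEN iffD1, OF matrix_vector_mul_linear])
  have bl2: "bounded_linear (\<lambda>M. b ** M)"
    by (rule linear_conv_bounded_linear[THEN iffD1])
      (auto intro!: linearI simp: vec_eq_iff matrix_matrix_mult_def distrib_left sum.distrib sum_distrib_left mult.left_commute)
  have sA: "smooth_on D A" using A by (simp add: mframe_def)
  have c: "pd w (\<lambda>\<zeta>. b *v f \<zeta>) \<zeta> = b *v pd w f \<zeta>" if "smooth_on D f" "\<zeta> \<in> D" for f w \<zeta>
    by (rule pd_bounded_linear[OF bl smooth_onD[OF that]])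
  note L = matrix_vector_right_distrib matrix_vector_mult_diff_distrib matrix_vector_mult_scaleR
  show ?thesis
  proof (rule mframeI)
    show "smooth_on D (\<lambda>\<zeta>. (x + b *v fst (A \<zeta>), b ** snd (A \<zeta>)))"
      by (intro smooth_on_Pair[OF F.oD] smooth_on_add[OF F.oD] smooth_on_const
          smooth_on_bounded_linear[OF F.oD bl] smooth_on_bounded_linear[OF F.oD bl2] smooth_on_fst[OF F.oD sA] smooth_on_snd[OF F.oD sA])
  next
    fix \<zeta> assume z: "\<zeta> \<in> D"
    show "(x + b *v fst (A \<zeta>), b ** snd (A \<zeta>)) \<in> laguerre_group"
      by (rule laguerre_group_mult[OF g, of "fst (A \<zeta>)" "snd (A \<zeta>)"]) (use mframe_group[OF A z] in simp)
    show "r = 0 \<and> s = 0" if "\<forall>w. r * \<alpha> \<zeta> w + s * \<beta> \<zeta> w = 0" for r s by (rule F.indep[OF z that])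
    have "pd w (\<lambda>\<zeta>. x + b *v fst (A \<zeta>)) \<zeta> = b *v pd w (\<lambda>\<zeta>. fst (A \<zeta>)) \<zeta>" for w
      using pd_add[OF _ smooth_onD[OF smooth_on_bounded_linear[OF F.oD bl F.sm(1)] z], of "\<lambda>\<zeta>. x" w] c[OF F.sm(1) z] by simp
    then show "pd w (\<lambda>q. fst (x + b *v fst (A q), b ** snd (A q))) \<zeta> =
       \<alpha> \<zeta> w *\<^sub>R column 2 (snd (x + b *v fst (A \<zeta>), b ** snd (A \<zeta>))) + \<beta> \<zeta> w *\<^sub>R column 3 (snd (x + b *v fst (A \<zeta>), b ** snd (A \<zeta>)))" for w
      by (simp add: F.da0[OF z] column_matrix_mult L)
  qed (use F.oD F.lin in \<open>simp_all add: column_matrix_mult c[OF F.sm(2)] c[OF F.sm(3)] c[OF F.sm(4)] c[OF F.sm(5)]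
      F.da1 F.da2 F.da3 F.da4 L\<close>)
qed

section \<open>Middle frames on the surface and evaluation of the invariants\<close>

context
  fixes \<A> :: "'m::topological_space chart set"
  assumes surf: "smooth_surface \<A>"
begin

lemma smooth_fun_on_subset: "smooth_fun_on \<A> S g \<Longrightarrow> T \<subseteq> S \<Longrightarrow> smooth_fun_on \<A> T g"
  unfolding smooth_fun_on_def by (fastforce intro: smooth_on_subset)

text \<open>The dictionary between the surface and the plane: all analysis is done on the right-hand
  side.\<close>

lemma middle_frame_iff:
  assumes c: "(U, z) \<in> charts \<A>"
  shows "middle_frame \<A> (U, z) F A \<alpha> \<beta> p1 p2 p3 q1 q2 \<longleftrightarrow>
    mframe (z ` U) (\<lambda>\<zeta>. A (inv_into U z \<zeta>)) (\<lambda>\<zeta>. \<alpha> (inv_into U z \<zeta>)) (\<lambda>\<zeta>. \<beta> (inv_into U z \<zeta>))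
      (\<lambda>\<zeta>. p1 (inv_into U z \<zeta>)) (\<lambda>\<zeta>. p2 (inv_into U z \<zeta>)) (\<lambda>\<zeta>. p3 (inv_into U z \<zeta>))
      (\<lambda>\<zeta>. q1 (inv_into U z \<zeta>)) (\<lambda>\<zeta>. q2 (inv_into U z \<zeta>)) \<and>
    (\<forall>q\<in>U. lag_line (F q) = isotropic_line (fst (A q)) (column 1 (snd (A q))))" (is "?L \<longleftrightarrow> ?R")
proof -
  have oU: "open U" using charts_open[OF surf c] .
  have oz: "open (z ` U)" using charts_open_image[OF surf c oU] by simp
  have inv: "inv_into U z (z q) = q" if "q \<in> U" for q using charts_inv[OF surf c that] .
  have sm: "smooth_fun_on \<A> U A \<longleftrightarrow> smooth_on (z ` U) (\<lambda>\<zeta>. A (inv_into U z \<zeta>))"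
    using smooth_fun_onD[OF surf _ c, of U A] smooth_fun_onI[OF surf c oU, of A] by auto
  have b: "(\<forall>\<zeta>\<in>z ` U. T \<zeta>) \<longleftrightarrow> (\<forall>q\<in>U. T (z q))" for T by blast
  show ?thesis
    unfolding middle_frame_def mframe_def Let_def b fst_conv sm dif_pd[OF surf]
    using c oz by (simp add: inv cong: ball_cong) blast
qed

lemma middle_frame_charts: "middle_frame \<A> c F A \<alpha> \<beta> p1 p2 p3 q1 q2 \<Longrightarrow> c \<in> charts \<A>"
  by (simp add: middle_frame_def)

lemma middle_frame_change:
  assumes m: "middle_frame \<A> (U', z') F A \<alpha> \<beta> p1 p2 p3 q1 q2" and c: "(U, z) \<in> charts \<A>" and sub: "U \<subseteq> U'"
  shows "middle_frame \<A> (U, z) F A (\<lambda>q w. \<alpha> q (trans_d (U, z) (U', z') q w)) (\<lambda>q w. \<beta> q (trans_d (U, z) (U', z') q w)) p1 p2 p3 q1 q2"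
proof -
  have c': "(U', z') \<in> charts \<A>" using middle_frame_charts[OF m] .
  note m' = m[unfolded middle_frame_iff[OF c']]
  define \<theta> where "\<theta> \<zeta> = z' (inv_into U z \<zeta>)" for \<zeta>
  have oU: "open U" using charts_open[OF surf c] .
  have oz: "open (z ` U)" using charts_open_image[OF surf c oU] by simp
  have inv: "inv_into U z (z q) = q" if "q \<in> U" for q using charts_inv[OF surf c that] .
  have inv': "inv_into U' z' (z' q) = q" if "q \<in> U'" for q using charts_inv[OF surf c' that] .
  have UU: "U \<inter> U' = U" using sub by blast
  have s: "smooth_on (z ` U) \<theta>" using transition_smooth[OF surf c c'] unfolding UU \<theta>_def .
  have \<theta>q: "\<theta> (z q) = z' q" if "q \<in> U" for q using inv[OF that] by (simp add: \<theta>_def)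
  have im: "\<theta> ` z ` U \<subseteq> z' ` U'" using \<theta>q sub by auto
  have td: "pd w \<theta> (z q) = trans_d (U, z) (U', z') q w" for q w
    unfolding \<theta>_def trans_d_def[OF surf] by simp
  have inj: "inj (\<lambda>w. pd w \<theta> \<zeta>)" if zU: "\<zeta> \<in> z ` U" for \<zeta>
  proof -
    obtain q where "q \<in> U" "\<zeta> = z q" using zU by blast
    then show ?thesis using trans_d_properties(2)[OF surf c' c, of q] sub td by auto
  qed
  have e: "inv_into U' z' (\<theta> (z q)) = inv_into U z (z q)" if "q \<in> U" for q
    using that sub inv inv' \<theta>q by auto
  have M: "mframe (z ` U) (\<lambda>\<zeta>. A (inv_into U' z' (\<theta> \<zeta>))) (\<lambda>\<zeta> w. \<alpha> (inv_into U' z' (\<theta> \<zeta>)) (pd w \<theta> \<zeta>)) (\<lambda>\<zeta> w. \<beta> (inv_into U' z' (\<theta> \<zeta>)) (pd w \<theta> \<zeta>))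
    (\<lambda>\<zeta>. p1 (inv_into U' z' (\<theta> \<zeta>))) (\<lambda>\<zeta>. p2 (inv_into U' z' (\<theta> \<zeta>))) (\<lambda>\<zeta>. p3 (inv_into U' z' (\<theta> \<zeta>))) (\<lambda>\<zeta>. q1 (inv_into U' z' (\<theta> \<zeta>))) (\<lambda>\<zeta>. q2 (inv_into U' z' (\<theta> \<zeta>)))"
    by (rule mframe_pullback[OF conjunct1[OF m'] oz s im inj])
  show ?thesis
    unfolding middle_frame_iff[OF c]
  proof
    show "\<forall>q\<in>U. lag_line (F q) = isotropic_line (fst (A q)) (column 1 (snd (A q)))" using m' sub by blast
    show "mframe (z ` U) (\<lambda>\<zeta>. A (inv_into U z \<zeta>)) (\<lambda>\<zeta> w. \<alpha> (inv_into U z \<zeta>) (trans_d (U, z) (U', z') (inv_into U z \<zeta>) w))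
     (\<lambda>\<zeta> w. \<beta> (inv_into U z \<zeta>) (trans_d (U, z) (U', z') (inv_into U z \<zeta>) w)) (\<lambda>\<zeta>. p1 (inv_into U z \<zeta>)) (\<lambda>\<zeta>. p2 (inv_into U z \<zeta>))
     (\<lambda>\<zeta>. p3 (inv_into U z \<zeta>)) (\<lambda>\<zeta>. q1 (inv_into U z \<zeta>)) (\<lambda>\<zeta>. q2 (inv_into U z \<zeta>))"
      by (rule mframe_cong[THEN iffD1, OF oz _ M]) (auto simp: e inv td)
  qed
qed

lemma trans_d_same:
  assumes c: "(U, z) \<in> charts \<A>" and c': "(U', z) \<in> charts \<A>" and q: "q \<in> U"
  shows "trans_d (U, z) (U', z) q w = w"
proof -
  have oz: "open (z ` U)" using charts_open_image[OF surf c charts_open[OF surf c]] by simp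
  have "pd w (\<lambda>\<zeta>. z (inv_into U z \<zeta>)) (z q) = pd w (\<lambda>\<zeta>. \<zeta>) (z q)"
    by (rule pd_cong_open[OF oz]) (use q charts_inv[OF surf c] in auto)
  then show ?thesis unfolding trans_d_def[OF surf] using pd_eq[OF has_derivative_ident, of w "z q"] by simp
qed

lemma middle_frame_restrict:
  assumes m: "middle_frame \<A> (U', z) F A \<alpha> \<beta> p1 p2 p3 q1 q2" and U: "open U" "U \<subseteq> U'"
  shows "middle_frame \<A> (U, z) F A (\<lambda>q w. \<alpha> q (trans_d (U, z) (U', z) q w)) (\<lambda>q w. \<beta> q (trans_d (U, z) (U', z) q w)) p1 p2 p3 q1 q2"
  using middle_frame_change[OF m chart_restrict[OF surf middle_frame_charts[OF m] U] U(2)] .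

text \<open>Both frames are moved to the coordinate \<open>z\<close> on the overlap, where
  \<open>mframe_unique\<close> applies. \<open>trans_d\<close> converts the argument, because the
  second pair of forms is expressed in \<open>z'\<close>.\<close>

lemma middle_frame_unique:
  assumes m: "middle_frame \<A> (U, z) F A \<alpha> \<beta> p1 p2 p3 q1 q2"
    and m': "middle_frame \<A> (U', z') F' A' \<alpha>' \<beta>' p1' p2' p3' q1' q2'"
    and q: "q \<in> U" "q \<in> U'" and eq: "\<And>q. q \<in> U \<Longrightarrow> q \<in> U' \<Longrightarrow> lag_line (F q) = lag_line (F' q)"
  shows "p1' q = p1 q" "p2' q = p2 q" "p3' q = p3 q"
    "\<exists>\<sigma>. \<sigma> * \<sigma> = 1 \<and> (\<forall>w. \<alpha>' q (trans_d (U, z) (U', z') q w) = \<sigma> * \<alpha> q w \<and> \<beta>' q (trans_d (U, z) (U', z') q w) = \<sigma> * \<beta> q w)"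
proof -
  define V where "V = U \<inter> U'"
  have c: "(U, z) \<in> charts \<A>" "(U', z') \<in> charts \<A>" using m m' middle_frame_charts by auto
  have oV: "open V" "V \<subseteq> U" "V \<subseteq> U'" using charts_open[OF surf c(1)] charts_open[OF surf c(2)] by (auto simp: V_def)
  have cV: "(V, z) \<in> charts \<A>" by (rule chart_restrict[OF surf c(1) oV(1,2)])
  have qV: "q \<in> V" using q by (simp add: V_def)
  note n = middle_frame_change[OF m cV oV(2), unfolded middle_frame_iff[OF cV]]
  note n' = middle_frame_change[OF m' cV oV(3), unfolded middle_frame_iff[OF cV]]
  have inv: "inv_into V z (z q) = q" if "q \<in> V" for q using charts_inv[OF surf cV that] .
  have ln: "isotropic_line (fst (A (inv_into V z \<zeta>))) (column 1 (snd (A (inv_into V z \<zeta>)))) =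
      isotropic_line (fst (A' (inv_into V z \<zeta>))) (column 1 (snd (A' (inv_into V z \<zeta>))))" if zV: "\<zeta> \<in> z ` V" for \<zeta>
  proof -
    obtain x where x: "x \<in> V" "\<zeta> = z x" using zV by blast
    then have "lag_line (F x) = lag_line (F' x)" using eq by (simp add: V_def)
    then show ?thesis using n n' x inv by simp
  qed
  have zq: "z q \<in> z ` V" using qV by blast
  have t: "trans_d (V, z) (U, z) q w = w" "trans_d (V, z) (U', z') q w = trans_d (U, z) (U', z') q w" for w
  proof -
    show "trans_d (V, z) (U, z) q w = w" by (rule trans_d_same[OF cV c(1) qV])
    have oz: "open (z ` V)" using charts_open_image[OF surf cV oV(1)] by simp
    show "trans_d (V, z) (U', z') q w = trans_d (U, z) (U', z') q w"
      unfolding trans_d_def[OF surf] prod.case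
      by (rule pd_cong_open[OF oz zq]) (use inv charts_inv[OF surf c(1)] oV in auto)
  qed
  from mframe_unique[OF conjunct1[OF n] conjunct1[OF n'] ln zq]
  obtain \<sigma> where "\<sigma> * \<sigma> = 1" "\<And>w. \<alpha>' q (trans_d (U, z) (U', z') q w) = \<sigma> * \<alpha> q w"
    "\<And>w. \<beta>' q (trans_d (U, z) (U', z') q w) = \<sigma> * \<beta> q w" "p1' q = p1 q" "p2' q = p2 q" "p3' q = p3 q"
    unfolding inv[OF qV] t by metis
  then show "p1' q = p1 q" "p2' q = p2 q" "p3' q = p3 q"
    "\<exists>\<sigma>. \<sigma> * \<sigma> = 1 \<and> (\<forall>w. \<alpha>' q (trans_d (U, z) (U', z') q w) = \<sigma> * \<alpha> q w \<and> \<beta>' q (trans_d (U, z) (U', z') q w) = \<sigma> * \<beta> q w)"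
    by blast+
qed

lemma middle_frame_unique_same:
  assumes m: "middle_frame \<A> (U, z) F A \<alpha> \<beta> p1 p2 p3 q1 q2"
    and m': "middle_frame \<A> (U', z) F' A' \<alpha>' \<beta>' p1' p2' p3' q1' q2'"
    and q: "q \<in> U" "q \<in> U'" and eq: "\<And>q. q \<in> U \<Longrightarrow> q \<in> U' \<Longrightarrow> lag_line (F q) = lag_line (F' q)"
  obtains \<sigma> where "\<sigma> = 1 \<or> \<sigma> = - 1" "\<And>w. Complex (\<alpha>' q w) (\<beta>' q w) = of_real \<sigma> * Complex (\<alpha> q w) (\<beta> q w)"
proof -
  have c: "(U, z) \<in> charts \<A>" "(U', z) \<in> charts \<A>" using m m' middle_frame_charts by auto
  obtain \<sigma> where s: "\<sigma> * \<sigma> = 1" "\<And>w. \<alpha>' q w = \<sigma> * \<alpha> q w" "\<And>w. \<beta>' q w = \<sigma> * \<beta> q w"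
    using middle_frame_unique(4)[OF assms] unfolding trans_d_same[OF c q(1)] by blast
  have "\<sigma> = 1 \<or> \<sigma> = - 1" using s(1) by (simp add: square_eq_1_iff)
  then show thesis using that s by (simp add: complex_eq_iff)
qed

text \<open>Uniqueness makes the definite descriptions meaningful. From here on invariants and
  differentials may be computed from any single middle frame at the point.\<close>

lemma invariants_eval:
  assumes m: "middle_frame \<A> (V, z) F A \<alpha> \<beta> p1 p2 p3 q1 q2" and q: "q \<in> V"
  shows "P_inv \<A> F q = p1 q + p3 q" "Q_inv \<A> F q = Complex ((p1 q - p3 q) / 2) (- p2 q)"
    "Q_diff \<A> F z q w = Complex ((p1 q - p3 q) / 2) (- p2 q) * Complex (\<alpha> q w) (\<beta> q w) ^ 4"
    "P_diff \<A> F z q w = of_real (p1 q + p3 q) * Complex (\<alpha> q w) (\<beta> q w) ^ 2"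
proof -
  have ma: "middle_at \<A> F z q (\<lambda>w. Complex (\<alpha> q w) (\<beta> q w)) (p1 q) (p2 q) (p3 q)"
    unfolding middle_at_def using m q by blast
  have un: "r1 = p1 q \<and> r2 = p2 q \<and> r3 = p3 q" if "middle_at \<A> F z' q \<phi> r1 r2 r3" for z' \<phi> r1 r2 r3
  proof -
    obtain V' A' \<alpha>' \<beta>' p1' p2' p3' q1' q2' where h: "q \<in> V'" "middle_frame \<A> (V', z') F A' \<alpha>' \<beta>' p1' p2' p3' q1' q2'"
      "r1 = p1' q" "r2 = p2' q" "r3 = p3' q" using \<open>middle_at \<A> F z' q \<phi> r1 r2 r3\<close> unfolding middle_at_def by blast
    show ?thesis using middle_frame_unique(1-3)[OF m h(2) q h(1)] h by simp
  qed
  have un4: "\<phi> w ^ 4 = Complex (\<alpha> q w) (\<beta> q w) ^ 4 \<and> \<phi> w ^ 2 = Complex (\<alpha> q w) (\<beta> q w) ^ 2" if m2: "middle_at \<A> F z q \<phi> r1 r2 r3" for \<phi> r1 r2 r3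
  proof -
    obtain V' A' \<alpha>' \<beta>' p1' p2' p3' q1' q2' where h: "q \<in> V'" "middle_frame \<A> (V', z) F A' \<alpha>' \<beta>' p1' p2' p3' q1' q2'"
      "\<phi> = (\<lambda>w. Complex (\<alpha>' q w) (\<beta>' q w))" using m2 unfolding middle_at_def by blast
    obtain \<sigma> where s: "\<sigma> = 1 \<or> \<sigma> = - 1" "\<And>w. Complex (\<alpha>' q w) (\<beta>' q w) = of_real \<sigma> * Complex (\<alpha> q w) (\<beta> q w)"
      using middle_frame_unique_same[OF m h(2) q h(1)] by blast
    then show ?thesis using h(3) by auto
  qed
  show P: "P_inv \<A> F q = p1 q + p3 q"
    unfolding P_inv_def by (rule the_equality) (use ma un in blast)+
  show Q: "Q_inv \<A> F q = Complex ((p1 q - p3 q) / 2) (- p2 q)"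
    unfolding Q_inv_def by (rule the_equality) (use ma un in blast)+
  show "Q_diff \<A> F z q w = Complex ((p1 q - p3 q) / 2) (- p2 q) * Complex (\<alpha> q w) (\<beta> q w) ^ 4"
    unfolding Q_diff_def Q
  proof (rule the_equality)
    show "\<exists>\<phi> r1 r2 r3. middle_at \<A> F z q \<phi> r1 r2 r3 \<and>
      Complex ((p1 q - p3 q) / 2) (- p2 q) * Complex (\<alpha> q w) (\<beta> q w) ^ 4 = Complex ((p1 q - p3 q) / 2) (- p2 q) * \<phi> w ^ 4"
      using ma by blast
  qed (use un4 in metis)
  show "P_diff \<A> F z q w = of_real (p1 q + p3 q) * Complex (\<alpha> q w) (\<beta> q w) ^ 2"
    unfolding P_diff_def P
  proof (rule the_equality)
    show "\<exists>\<phi> r1 r2 r3. middle_at \<A> F z q \<phi> r1 r2 r3 \<and>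
      of_real (p1 q + p3 q) * Complex (\<alpha> q w) (\<beta> q w) ^ 2 = of_real (p1 q + p3 q) * \<phi> w ^ 2"
      using ma by blast
  qed (use un4 in metis)
qed

end

section \<open>Legendre immersions versus frames\<close>

definition ldir :: "real^3 \<Rightarrow> real^4" where
  "ldir n = vector [n$1 / 2, n$2 / sqrt 2, n$3 / sqrt 2, - n$1 / 2]"

lemma bounded_linear_pt_of: "bounded_linear pt_of"
  by (rule linear_conv_bounded_linear[THEN iffD1])
    (auto intro!: linearI simp: pt_of_def vec4_eq_iff add_divide_distrib diff_divide_distrib)

lemma bounded_linear_ldir: "bounded_linear ldir"
  by (rule linear_conv_bounded_linear[THEN iffD1])
    (auto intro!: linearI simp: ldir_def vec4_eq_iff add_divide_distrib diff_divide_distrib)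

text \<open>\<open>dir_of\<close> is affine and \<open>ldir\<close> is its linear part, hence its
  derivative.\<close>

lemma dir_of_ldir: "dir_of n = vector [1/2, 0, 0, 1/2] + ldir n"
  by (simp add: dir_of_def ldir_def vec4_eq_iff add_divide_distrib diff_divide_distrib)

text \<open>The identification preserves the relevant products up to constants: the contact
  condition, df . dn and dn . dn become pairings in Minkowski space.\<close>

lemma mink_pt_dir:
  "mink (pt_of p) (dir_of n) = (p \<bullet> n) / sqrt 2" "mink (pt_of p) (ldir m) = (p \<bullet> m) / sqrt 2"
  "mink (ldir m) (ldir m) = (m \<bullet> m) / 2"
  by (simp_all add: mink_def pt_of_def dir_of_def ldir_def inner_vec_def sum_3 field_simps)

lemma smooth_on_dir_of: "open D \<Longrightarrow> smooth_on D n \<Longrightarrow> smooth_on D (\<lambda>\<zeta>. dir_of (n \<zeta>))"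
  unfolding dir_of_ldir by (intro smooth_on_add smooth_on_const smooth_on_bounded_linear[OF _ bounded_linear_ldir])

lemma pd_dir_of:
  assumes "open D" "smooth_on D n" "\<zeta> \<in> D"
  shows "pd w (\<lambda>\<zeta>. dir_of (n \<zeta>)) \<zeta> = ldir (pd w n \<zeta>)"
  unfolding dir_of_ldir
  using pd_add[OF _ smooth_onD[OF smooth_on_bounded_linear[OF assms(1) bounded_linear_ldir assms(2)] assms(3)], of "\<lambda>\<zeta>. vector [1/2, 0, 0, 1/2]" w]
    pd_bounded_linear[OF bounded_linear_ldir smooth_onD[OF assms(2,3)], of w] by simp

text \<open>The direction is a positive multiple \<open>c\<close> of \<open>a1\<close> and the point
  is \<open>a0\<close> shifted by \<open>t\<close> along it. Hence dn . dn is a positive multiple of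
  \<alpha>^2 + \<beta>^2, and df . dn is a nonzero multiple of \<alpha>^2 - \<beta>^2 plus a
  multiple of the former; these are positive definite and independent.\<close>

lemma legendre_of_mframe:
  assumes A: "mframe D A \<alpha> \<beta> p1 p2 p3 q1 q2" and f: "smooth_on D f" and n: "smooth_on D n"
    and sph: "\<And>\<zeta>. \<zeta> \<in> D \<Longrightarrow> n \<zeta> \<in> sphere 0 1"
    and line: "\<And>\<zeta>. \<zeta> \<in> D \<Longrightarrow> isotropic_line (pt_of (f \<zeta>)) (dir_of (n \<zeta>)) = isotropic_line (fst (A \<zeta>)) (column 1 (snd (A \<zeta>)))"
    and z: "\<zeta> \<in> D"
  shows "pd w f \<zeta> \<bullet> n \<zeta> = 0" "w \<noteq> 0 \<Longrightarrow> pd w n \<zeta> \<bullet> pd w n \<zeta> > 0"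
    "\<forall>w. r * (pd w f \<zeta> \<bullet> pd w n \<zeta>) + s * (pd w n \<zeta> \<bullet> pd w n \<zeta>) = 0 \<Longrightarrow> r = 0 \<and> s = 0"
proof -
  define a0 a1 a2 a3 a4 where "a0 \<zeta> = fst (A \<zeta>)" and "a1 \<zeta> = column 1 (snd (A \<zeta>))" and "a2 \<zeta> = column 2 (snd (A \<zeta>))"
    and "a3 \<zeta> = column 3 (snd (A \<zeta>))" and "a4 \<zeta> = column 4 (snd (A \<zeta>))" for \<zeta>
  interpret F: coord_frame D a0 a1 a2 a3 a4 \<alpha> \<beta> "\<lambda>\<zeta> w. 2 * q2 \<zeta> * \<alpha> \<zeta> w - 2 * q1 \<zeta> * \<beta> \<zeta> w"
    "\<lambda>\<zeta> w. p1 \<zeta> * \<alpha> \<zeta> w + p2 \<zeta> * \<beta> \<zeta> w" "\<lambda>\<zeta> w. p2 \<zeta> * \<alpha> \<zeta> w + p3 \<zeta> * \<beta> \<zeta> w"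
    "\<lambda>\<zeta> w. q1 \<zeta> * \<alpha> \<zeta> w + q2 \<zeta> * \<beta> \<zeta> w" p1 p2 p3 q1 q2
    using mframe_coord[OF A] unfolding a0_def[abs_def] a1_def[abs_def] a2_def[abs_def] a3_def[abs_def] a4_def[abs_def] .
  note D = F.oD
  define x v where "x \<zeta> = pt_of (f \<zeta>)" and "v \<zeta> = dir_of (n \<zeta>)" for \<zeta>
  have sx: "smooth_on D x" "smooth_on D v" unfolding x_def v_def
    by (rule smooth_on_bounded_linear[OF D bounded_linear_pt_of f] smooth_on_dir_of[OF D n])+
  define c t where "c \<zeta> = - mink (v \<zeta>) (a4 \<zeta>)" and "t \<zeta> = - mink (x \<zeta> - a0 \<zeta>) (a4 \<zeta>)" for \<zeta>
  have ct: "c \<xi> > 0" "v \<xi> = c \<xi> *\<^sub>R a1 \<xi>" "x \<xi> = a0 \<xi> + t \<xi> *\<^sub>R a1 \<xi>" if y: "\<xi> \<in> D" for \<xi>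
  proof -
    have "(fst (A \<xi>), snd (A \<xi>)) \<in> laguerre_group" using mframe_group[OF A y] by simp
    then have "a1 \<xi> \<in> lightcone" unfolding laguerre_group_iff a1_def by blast
    moreover have "v \<xi> \<in> lightcone" unfolding v_def by (rule dir_of_lightcone[OF sph[OF y]])
    ultimately obtain c' t' where *: "c' > 0" "v \<xi> = c' *\<^sub>R a1 \<xi>" "x \<xi> = a0 \<xi> + t' *\<^sub>R a1 \<xi>"
      using isotropic_line_eqD[of "a1 \<xi>" "v \<xi>" "a0 \<xi>" "x \<xi>"] line[OF y]
      unfolding a0_def a1_def x_def v_def by metis
    have "c \<xi> = c'" "t \<xi> = t'" unfolding c_def t_def using * by (simp_all add: mink_simps frame_relD[OF F.rel[OF y]])
    then show "c \<xi> > 0" "v \<xi> = c \<xi> *\<^sub>R a1 \<xi>" "x \<xi> = a0 \<xi> + t \<xi> *\<^sub>R a1 \<xi>" using * by auto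
  qed
  have sct: "smooth_on D c" "smooth_on D t" unfolding c_def t_def
    by (intro smooth_on_uminus[OF D] smooth_on_mink[OF D] smooth_on_diff[OF D] F.sm sx)+
  have dv: "ldir (pd w n \<zeta>) = c \<zeta> *\<^sub>R pd w a1 \<zeta> + pd w c \<zeta> *\<^sub>R a1 \<zeta>" for w
  proof -
    have "pd w v \<zeta> = pd w (\<lambda>\<xi>. c \<xi> *\<^sub>R a1 \<xi>) \<zeta>" by (rule pd_cong_open[OF D z]) (rule ct)
    then show ?thesis using pd_dir_of[OF D n z, of w]
      by (simp add: pd_scaleR[OF smooth_onD[OF sct(1) z] smooth_onD[OF F.sm(2) z]] v_def[abs_def])
  qed
  have dx: "pt_of (pd w f \<zeta>) = pd w a0 \<zeta> + (t \<zeta> *\<^sub>R pd w a1 \<zeta> + pd w t \<zeta> *\<^sub>R a1 \<zeta>)" for w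
  proof -
    have "pd w x \<zeta> = pd w (\<lambda>\<xi>. a0 \<xi> + t \<xi> *\<^sub>R a1 \<xi>) \<zeta>" by (rule pd_cong_open[OF D z]) (rule ct)
    also have "\<dots> = pd w a0 \<zeta> + pd w (\<lambda>\<xi>. t \<xi> *\<^sub>R a1 \<xi>) \<zeta>"
      by (intro pd_add smooth_onD[OF _ z] F.sm smooth_on_scaleR[OF D] sct)
    finally show ?thesis using pd_bounded_linear[OF bounded_linear_pt_of smooth_onD[OF f z], of w]
      by (simp add: pd_scaleR[OF smooth_onD[OF sct(2) z] smooth_onD[OF F.sm(2) z]] x_def[abs_def])
  qed
  note R = mink_simps frame_relD[OF F.rel[OF z]] F.da0[OF z] F.da1[OF z]
  have e1: "(pd w f \<zeta> \<bullet> n \<zeta>) / sqrt 2 = 0" for w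
    unfolding mink_pt_dir(1)[symmetric] unfolding dx v_def[symmetric] ct(2)[OF z] by (simp add: R)
  then show "pd w f \<zeta> \<bullet> n \<zeta> = 0" by simp
  have e2: "(pd w n \<zeta> \<bullet> pd w n \<zeta>) / 2 = c \<zeta> * c \<zeta> * ((\<alpha> \<zeta> w)\<^sup>2 + (\<beta> \<zeta> w)\<^sup>2)" for w
    unfolding mink_pt_dir(3)[symmetric] unfolding dv by (simp add: R power2_eq_square algebra_simps)
  have e3: "(pd w f \<zeta> \<bullet> pd w n \<zeta>) / sqrt 2 = c \<zeta> * ((\<alpha> \<zeta> w)\<^sup>2 - (\<beta> \<zeta> w)\<^sup>2) + c \<zeta> * t \<zeta> * ((\<alpha> \<zeta> w)\<^sup>2 + (\<beta> \<zeta> w)\<^sup>2)" for w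
    unfolding mink_pt_dir(2)[symmetric] unfolding dv dx by (simp add: R power2_eq_square algebra_simps)
  obtain b1 b2 where b: "\<alpha> \<zeta> b1 = 1" "\<beta> \<zeta> b1 = 0" "\<alpha> \<zeta> b2 = 0" "\<beta> \<zeta> b2 = 1"
    "\<And>w. w = \<alpha> \<zeta> w *\<^sub>R b1 + \<beta> \<zeta> w *\<^sub>R b2" using F.dual_basis[OF z] by blast
  have cz: "c \<zeta> > 0" by (rule ct(1)[OF z])
  show "pd w n \<zeta> \<bullet> pd w n \<zeta> > 0" if w: "w \<noteq> 0"
  proof -
    have "\<alpha> \<zeta> w \<noteq> 0 \<or> \<beta> \<zeta> w \<noteq> 0" using b(5)[of w] w by (metis add.right_neutral scaleR_zero_left)
    then have "(\<alpha> \<zeta> w)\<^sup>2 + (\<beta> \<zeta> w)\<^sup>2 > 0" by (simp add: sum_power2_gt_zero_iff)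
    then have "c \<zeta> * c \<zeta> * ((\<alpha> \<zeta> w)\<^sup>2 + (\<beta> \<zeta> w)\<^sup>2) > 0" using cz by simp
    then show ?thesis using e2[of w] by linarith
  qed
  assume H: "\<forall>w. r * (pd w f \<zeta> \<bullet> pd w n \<zeta>) + s * (pd w n \<zeta> \<bullet> pd w n \<zeta>) = 0"
  define R where "R = r * sqrt 2 * c \<zeta>"
  define S where "S = s * 2 * c \<zeta> * c \<zeta>"
  have "R * (((\<alpha> \<zeta> w)\<^sup>2 - (\<beta> \<zeta> w)\<^sup>2) + t \<zeta> * ((\<alpha> \<zeta> w)\<^sup>2 + (\<beta> \<zeta> w)\<^sup>2)) + S * ((\<alpha> \<zeta> w)\<^sup>2 + (\<beta> \<zeta> w)\<^sup>2) = 0" for w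
  proof -
    have "pd w n \<zeta> \<bullet> pd w n \<zeta> = 2 * (c \<zeta> * c \<zeta> * ((\<alpha> \<zeta> w)\<^sup>2 + (\<beta> \<zeta> w)\<^sup>2))" using e2[of w] by linarith
    moreover have "pd w f \<zeta> \<bullet> pd w n \<zeta> = sqrt 2 * (c \<zeta> * ((\<alpha> \<zeta> w)\<^sup>2 - (\<beta> \<zeta> w)\<^sup>2) + c \<zeta> * t \<zeta> * ((\<alpha> \<zeta> w)\<^sup>2 + (\<beta> \<zeta> w)\<^sup>2))"
      unfolding e3[of w, symmetric] by simp
    moreover have "R * (a - b + t \<zeta> * (a + b)) + S * (a + b) = r * (sqrt 2 * (c \<zeta> * (a - b) + c \<zeta> * t \<zeta> * (a + b))) + s * (2 * (c \<zeta> * c \<zeta> * (a + b)))" for a b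
      by (simp add: R_def S_def algebra_simps)
    ultimately show ?thesis using H[rule_format, of w] by simp
  qed
  from this[of b1] this[of b2] have "R * (1 + t \<zeta>) + S = 0" "R * (- 1 + t \<zeta>) + S = 0" by (simp_all add: b)
  then have "R = 0" "S = 0" by (simp_all add: algebra_simps)
  then show "r = 0 \<and> s = 0" using cz by (simp add: R_def S_def)
qed

text \<open>The pointwise surjectivity of the identification with the set of isotropic lines, done
  with formulas that are smooth in a parameter. It turns a frame into an actual map into
  point-normal pairs.\<close>

lemma realise_line:
  fixes x v :: "complex \<Rightarrow> real^4"
  assumes D: "open D" and x: "smooth_on D x" and v: "smooth_on D v" and lc: "\<And>\<zeta>. \<zeta> \<in> D \<Longrightarrow> v \<zeta> \<in> lightcone"
  obtains f n where "smooth_on D f" "smooth_on D n" "\<And>\<zeta>. \<zeta> \<in> D \<Longrightarrow> n \<zeta> \<in> sphere 0 1"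
    "\<And>\<zeta>. \<zeta> \<in> D \<Longrightarrow> isotropic_line (pt_of (f \<zeta>)) (dir_of (n \<zeta>)) = isotropic_line (x \<zeta>) (v \<zeta>)"
proof -
  define c where "c \<zeta> = v \<zeta> $ 1 + v \<zeta> $ 4" for \<zeta>
  define n :: "complex \<Rightarrow> real^3" where "n \<zeta> = vector [(v \<zeta>$1 - v \<zeta>$4) / c \<zeta>, sqrt 2 * v \<zeta>$2 / c \<zeta>, sqrt 2 * v \<zeta>$3 / c \<zeta>]" for \<zeta>
  define y where "y \<zeta> = x \<zeta> + (- (x \<zeta>$1 + x \<zeta>$4) / c \<zeta>) *\<^sub>R v \<zeta>" for \<zeta>
  define p :: "complex \<Rightarrow> real^3" where "p \<zeta> = vector [sqrt 2 * y \<zeta>$1, y \<zeta>$2, y \<zeta>$3]" for \<zeta>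
  have c: "c \<zeta> > 0" and q: "2 * (v \<zeta>$1 * v \<zeta>$4) = (v \<zeta>$2)\<^sup>2 + (v \<zeta>$3)\<^sup>2" if "\<zeta> \<in> D" for \<zeta>
    using lc[OF that] by (auto simp: lightcone_iff c_def)
  have cn: "c \<zeta> \<noteq> 0" if "\<zeta> \<in> D" for \<zeta> using c[OF that] by simp
  have sv: "smooth_on D (\<lambda>\<zeta>. v \<zeta> $ i)" "smooth_on D (\<lambda>\<zeta>. x \<zeta> $ i)" for i by (intro smooth_on_nth D x v)+
  have sc: "smooth_on D c" unfolding c_def by (intro smooth_on_add D sv)
  have sy: "smooth_on D y" unfolding y_def
    by (intro smooth_on_add[OF D] smooth_on_scaleR[OF D] smooth_on_divide[OF D] smooth_on_uminus[OF D] sv sc cn x v)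
  have syi: "smooth_on D (\<lambda>\<zeta>. y \<zeta> $ i)" for i by (rule smooth_on_nth[OF D sy])
  have v3: "smooth_on D (\<lambda>\<zeta>. vector [a \<zeta>, b \<zeta>, d \<zeta>] :: real^3)" if "smooth_on D a" "smooth_on D b" "smooth_on D d" for a b d
  proof (rule smooth_on_vec[OF D])
    fix i :: 3
    show "smooth_on D (\<lambda>\<zeta>. (vector [a \<zeta>, b \<zeta>, d \<zeta>] :: real^3) $ i)" using exhaust_3[of i] that by auto
  qed
  have sn: "smooth_on D n" unfolding n_def
    by (intro v3 smooth_on_divide[OF D] smooth_on_mult[OF D] smooth_on_diff[OF D] smooth_on_const sv sc cn)
  have sp: "smooth_on D p" unfolding p_def by (intro v3 smooth_on_mult[OF D] smooth_on_const syi)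
  have n1: "n \<zeta> \<in> sphere 0 1" if z: "\<zeta> \<in> D" for \<zeta>
  proof -
    have "(v \<zeta>$1 - v \<zeta>$4)\<^sup>2 + 2 * (v \<zeta>$2)\<^sup>2 + 2 * (v \<zeta>$3)\<^sup>2 = (c \<zeta>)\<^sup>2"
      using q[OF z] by (simp add: c_def power2_eq_square algebra_simps)
    then show ?thesis
      using cn[OF z] unfolding norm3_iff n_def
      by (simp add: power_divide power_mult_distrib flip: add_divide_distrib)
  qed
  have "isotropic_line (pt_of (p \<zeta>)) (dir_of (n \<zeta>)) = isotropic_line (x \<zeta>) (v \<zeta>)" if z: "\<zeta> \<in> D" for \<zeta>
  proof -
    have d: "dir_of (n \<zeta>) = (1 / c \<zeta>) *\<^sub>R v \<zeta>"
      using cn[OF z] by (simp add: vec4_eq_iff dir_of_def n_def field_simps) (simp add: c_def algebra_simps)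
    have "y \<zeta>$1 + y \<zeta>$4 = 0" using cn[OF z] by (simp add: y_def c_def field_simps)
    then have "pt_of (p \<zeta>) = y \<zeta>" by (simp add: vec4_eq_iff pt_of_def p_def)
    then show ?thesis using cn[OF z] by (simp add: d isotropic_line_scale y_def isotropic_line_shift)
  qed
  then show thesis using that sp sn n1 by blast
qed

text \<open>T is a stereographic coordinate of the Gauss map, a local diffeomorphism because dn . dn
  > 0. The two cases are the two projections that cover the sphere; in both the spinor is polynomial
  with Wronskian 1, so that the orientation is the same.\<close>

lemma gauss_coordinate:
  assumes D: "open D" and n: "smooth_on D n" and sph: "\<And>\<zeta>. \<zeta> \<in> D \<Longrightarrow> n \<zeta> \<in> sphere 0 1"
    and imm: "\<And>\<zeta> w. \<zeta> \<in> D \<Longrightarrow> w \<noteq> 0 \<Longrightarrow> pd w n \<zeta> \<bullet> pd w n \<zeta> > 0" and z0: "\<zeta>0 \<in> D"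
  obtains W T c w1 w2 where "open W" "\<zeta>0 \<in> W" "W \<subseteq> D" "smooth_on W (T :: complex \<Rightarrow> complex)" "smooth_on W c"
    "w1 holomorphic_on UNIV" "w2 holomorphic_on UNIV" "\<And>\<zeta>. deriv w1 \<zeta> * w2 \<zeta> - w1 \<zeta> * deriv w2 \<zeta> = 1"
    "\<And>\<zeta>. \<zeta> \<in> W \<Longrightarrow> c \<zeta> \<noteq> 0 \<and> dir_of (n \<zeta>) = c \<zeta> *\<^sub>R null_lift (w1 (T \<zeta>)) (w2 (T \<zeta>))"
    "\<And>\<zeta>. \<zeta> \<in> W \<Longrightarrow> inj (\<lambda>v. pd v T \<zeta>)"
proof -
  define v where "v \<zeta> = dir_of (n \<zeta>)" for \<zeta>
  have sv: "smooth_on D v" unfolding v_def by (rule smooth_on_dir_of[OF D n])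
  have svi: "smooth_on D (\<lambda>\<zeta>. v \<zeta> $ i)" for i by (rule smooth_on_nth[OF D sv])
  have lc: "2 * (v \<zeta>$1 * v \<zeta>$4) = (v \<zeta>$2)\<^sup>2 + (v \<zeta>$3)\<^sup>2" "v \<zeta>$1 + v \<zeta>$4 > 0" if "\<zeta> \<in> D" for \<zeta>
    using dir_of_lightcone[OF sph[OF that]] by (auto simp: lightcone_iff v_def)
  \<comment> \<open>If the derivative of T kills \<open>u\<close>, then along \<open>u\<close> the
    direction vector changes only by a multiple of the null vector N, so dn . dn vanishes on
    \<open>u\<close>.\<close>
  have inj: "inj (\<lambda>v. pd v T \<zeta>)"
    if W: "open W" "W \<subseteq> D" and T: "smooth_on W (T :: complex \<Rightarrow> complex)" and c: "smooth_on W c" and w: "w1 holomorphic_on UNIV" "w2 holomorphic_on UNIV"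
      and e: "\<And>\<zeta>. \<zeta> \<in> W \<Longrightarrow> c \<zeta> \<noteq> 0 \<and> v \<zeta> = c \<zeta> *\<^sub>R null_lift (w1 (T \<zeta>)) (w2 (T \<zeta>))" and z: "\<zeta> \<in> W"
    for W T c w1 w2 \<zeta>
  proof (subst linear_injective_0[OF pd_linear[OF smooth_onD[OF T z]]], intro allI impI, rule ccontr)
    fix u assume u: "pd u T \<zeta> = 0" "u \<noteq> 0"
    define N where "N \<zeta> = null_lift (w1 \<zeta>) (w2 \<zeta>)" for \<zeta>
    have sN: "smooth_on UNIV N" unfolding N_def using w by (intro smooth_on_null_lift smooth_on_holomorphic) auto
    have sNT: "smooth_on W (\<lambda>\<zeta>. N (T \<zeta>))" by (rule smooth_on_compose[OF W(1) _ sN T]) simp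
    have "pd u (\<lambda>\<zeta>. N (T \<zeta>)) \<zeta> = pd (pd u T \<zeta>) N (T \<zeta>)"
      by (rule pd_compose[OF smooth_onD[OF T z] smooth_onD[OF sN UNIV_I]])
    also have "\<dots> = 0" unfolding u(1) using linear_0[OF pd_linear[OF smooth_onD[OF sN UNIV_I]]] .
    finally have N0: "pd u (\<lambda>\<zeta>. N (T \<zeta>)) \<zeta> = 0" .
    have "pd u v \<zeta> = pd u (\<lambda>\<zeta>. c \<zeta> *\<^sub>R N (T \<zeta>)) \<zeta>"
      by (rule pd_cong_open[OF W(1) z]) (use e in \<open>auto simp: N_def\<close>)
    also have "\<dots> = pd u c \<zeta> *\<^sub>R N (T \<zeta>)"
      using pd_scaleR[OF smooth_onD[OF c z] smooth_onD[OF sNT z], of u] N0 by simp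
    finally have "ldir (pd u n \<zeta>) = pd u c \<zeta> *\<^sub>R N (T \<zeta>)"
      using pd_dir_of[OF D n, of \<zeta> u] z W by (auto simp: v_def[abs_def])
    moreover have "mink (N (T \<zeta>)) (N (T \<zeta>)) = 0"
      by (simp add: N_def mink_def null_lift_def) (simp add: power2_eq_square algebra_simps)
    ultimately have "mink (ldir (pd u n \<zeta>)) (ldir (pd u n \<zeta>)) = 0" by (simp add: mink_simps)
    then have "pd u n \<zeta> \<bullet> pd u n \<zeta> = 0" unfolding mink_pt_dir by simp
    then show False using imm[of \<zeta> u] u z W by auto
  qed
  have op: "open {\<zeta> \<in> D. v \<zeta> $ i \<noteq> 0}" for i
  proof -
    have "open (D \<inter> (\<lambda>\<zeta>. v \<zeta> $ i) -` (- {0}))"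
      by (rule continuous_open_preimage[OF smooth_on_continuous[OF svi] D]) auto
    then show ?thesis by (simp add: Int_def vimage_def)
  qed
  show thesis
  proof (cases "v \<zeta>0 $ 4 = 0")
    case False
    define W where "W = {\<zeta> \<in> D. v \<zeta> $ 4 \<noteq> 0}"
    define T where "T \<zeta> = Complex (v \<zeta> $ 2 / v \<zeta> $ 4) (v \<zeta> $ 3 / v \<zeta> $ 4)" for \<zeta>
    have oW: "open W" "W \<subseteq> D" using op by (auto simp: W_def)
    have s: "smooth_on W (\<lambda>\<zeta>. v \<zeta> $ i)" for i by (rule smooth_on_subset[OF svi oW(2)])
    have sT: "smooth_on W T" unfolding T_def
      by (intro smooth_on_Complex oW smooth_on_divide s) (auto simp: W_def)
    have e: "v \<zeta> $ 4 \<noteq> 0 \<and> v \<zeta> = (v \<zeta> $ 4) *\<^sub>R null_lift (T \<zeta>) 1" if "\<zeta> \<in> W" for \<zeta>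
    proof -
      have nz: "v \<zeta> $ 4 \<noteq> 0" using that by (simp add: W_def)
      moreover have "v \<zeta> $ 1 = ((v \<zeta>$2)\<^sup>2 + (v \<zeta>$3)\<^sup>2) / (2 * v \<zeta> $ 4)"
        using lc(1)[of \<zeta>] that nz oW by (auto simp: field_simps)
      ultimately show ?thesis
        by (simp add: vec4_eq_iff null_lift_def T_def power2_eq_square add_divide_distrib) (simp add: field_simps)
    qed
    show thesis
    proof (rule that[of W T "\<lambda>\<zeta>. v \<zeta> $ 4" "\<lambda>\<zeta>. \<zeta>" "\<lambda>\<zeta>. 1"])
      show "inj (\<lambda>v. pd v T \<zeta>)" if "\<zeta> \<in> W" for \<zeta>
        by (rule inj[OF oW sT s _ _ e that]) (auto intro: holomorphic_intros)
      show "\<zeta>0 \<in> W" using False z0 by (simp add: W_def)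
    qed (use oW sT s e in \<open>auto simp: v_def\<close>)
  next
    case True
    define W where "W = {\<zeta> \<in> D. v \<zeta> $ 1 \<noteq> 0}"
    \<comment> \<open>This is -1/T for the T of the other case. Pairing it with the constant -1 in
      the spinor (-1, T) keeps the Wronskian equal to 1.\<close>
    define T where "T \<zeta> = Complex (- v \<zeta> $ 2 / (2 * v \<zeta> $ 1)) (v \<zeta> $ 3 / (2 * v \<zeta> $ 1))" for \<zeta>
    have oW: "open W" "W \<subseteq> D" using op by (auto simp: W_def)
    have s: "smooth_on W (\<lambda>\<zeta>. v \<zeta> $ i)" for i by (rule smooth_on_subset[OF svi oW(2)])
    have s2: "smooth_on W (\<lambda>\<zeta>. 2 * v \<zeta> $ 1)" by (intro smooth_on_mult oW smooth_on_const s)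
    have sT: "smooth_on W T" unfolding T_def
      by (intro smooth_on_Complex oW smooth_on_divide s s2 smooth_on_uminus) (auto simp: W_def)
    have e: "2 * v \<zeta> $ 1 \<noteq> 0 \<and> v \<zeta> = (2 * v \<zeta> $ 1) *\<^sub>R null_lift (- 1) (T \<zeta>)" if "\<zeta> \<in> W" for \<zeta>
    proof -
      have nz: "v \<zeta> $ 1 \<noteq> 0" using that by (simp add: W_def)
      moreover have "v \<zeta> $ 4 = ((v \<zeta>$2)\<^sup>2 + (v \<zeta>$3)\<^sup>2) / (2 * v \<zeta> $ 1)"
        using lc(1)[of \<zeta>] that nz oW by (auto simp: field_simps)
      ultimately show ?thesis
        by (simp add: vec4_eq_iff null_lift_def T_def power2_eq_square add_divide_distrib) (simp add: field_simps)
    qed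
    show thesis
    proof (rule that[of W T "\<lambda>\<zeta>. 2 * v \<zeta> $ 1" "\<lambda>\<zeta>. - 1" "\<lambda>\<zeta>. \<zeta>"])
      show "inj (\<lambda>v. pd v T \<zeta>)" if "\<zeta> \<in> W" for \<zeta>
        by (rule inj[OF oW sT s2 _ _ e that]) (auto intro: holomorphic_intros)
      show "\<zeta>0 \<in> W" using True z0 lc(2)[OF z0] by (simp add: W_def)
    qed (use oW sT s2 e in \<open>auto simp: v_def\<close>)
  qed
qed

text \<open>In a Gauss coordinate the first quadratic form is standard up to scale. What remains is
  to move the base point along the line until the second form is trace-free, and to take a square
  root of its coefficient.\<close>

lemma frame_of_gauss_coordinate:
  assumes r: "r > 0" and f: "smooth_on (ball \<zeta>0 r) f" and n: "smooth_on (ball \<zeta>0 r) n"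
    and leg: "\<And>\<zeta> w. \<zeta> \<in> ball \<zeta>0 r \<Longrightarrow> pd w f \<zeta> \<bullet> n \<zeta> = 0"
    and nd: "\<And>\<zeta> r' s. \<zeta> \<in> ball \<zeta>0 r \<Longrightarrow> \<forall>w. r' * (pd w f \<zeta> \<bullet> pd w n \<zeta>) + s * (pd w n \<zeta> \<bullet> pd w n \<zeta>) = 0 \<Longrightarrow> r' = 0 \<and> s = 0"
    and w: "w1 holomorphic_on ball \<zeta>0 r" "w2 holomorphic_on ball \<zeta>0 r"
    and W: "\<And>\<zeta>. \<zeta> \<in> ball \<zeta>0 r \<Longrightarrow> deriv w1 \<zeta> * w2 \<zeta> - w1 \<zeta> * deriv w2 \<zeta> = 1"
    and c: "smooth_on (ball \<zeta>0 r) c" "\<And>\<zeta>. \<zeta> \<in> ball \<zeta>0 r \<Longrightarrow> c \<zeta> \<noteq> 0 \<and> dir_of (n \<zeta>) = c \<zeta> *\<^sub>R null_lift (w1 \<zeta>) (w2 \<zeta>)"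
  obtains r' l A p1 p2 p3 q1 q2 where "r' > 0" "r' \<le> r"
    "mframe (ball \<zeta>0 r') A (\<lambda>\<zeta> w. Re (l \<zeta> * w)) (\<lambda>\<zeta> w. Im (l \<zeta> * w)) p1 p2 p3 q1 q2"
    "\<And>\<zeta>. \<zeta> \<in> ball \<zeta>0 r' \<Longrightarrow> isotropic_line (pt_of (f \<zeta>)) (dir_of (n \<zeta>)) = isotropic_line (fst (A \<zeta>)) (column 1 (snd (A \<zeta>)))"
proof -
  define B where "B = ball \<zeta>0 r"
  have oB: "open B" by (simp add: B_def)
  note [folded B_def] = f n c and leg' = leg[folded B_def] and nd' = nd[folded B_def] and W' = W[folded B_def]
    and w' = w[folded B_def] and c' = c[folded B_def] and f' = f[folded B_def] and n' = n[folded B_def]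
  define x where "x \<zeta> = pt_of (f \<zeta>)" for \<zeta>
  define N where "N \<zeta> = null_lift (w1 \<zeta>) (w2 \<zeta>)" for \<zeta>
  have sx: "smooth_on B x" unfolding x_def by (rule smooth_on_bounded_linear[OF oB bounded_linear_pt_of f'])
  have sN: "smooth_on B N" unfolding N_def
    by (rule smooth_on_null_lift[OF oB]) (use w' oB smooth_on_holomorphic in auto)
  have pdx: "pd w x \<zeta> = pt_of (pd w f \<zeta>)" if "\<zeta> \<in> B" for w \<zeta>
    unfolding x_def by (rule pd_bounded_linear[OF bounded_linear_pt_of smooth_onD[OF f' that]])
  have xN: "mink (pd w x \<zeta>) (N \<zeta>) = 0" if z: "\<zeta> \<in> B" for w \<zeta>
  proof -
    have "c \<zeta> * mink (pd w x \<zeta>) (N \<zeta>) = (pd w f \<zeta> \<bullet> n \<zeta>) / sqrt 2"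
      unfolding mink_pt_dir(1)[symmetric] using c'(2)[OF z] by (simp add: pdx[OF z] N_def mink_simps)
    then show ?thesis using leg'[OF z] c'(2)[OF z] by simp
  qed
  have pdN: "pd v N \<zeta> = null_polar (w1 \<zeta>) (w2 \<zeta>) (deriv w1 \<zeta> * v) (deriv w2 \<zeta> * v)" if "\<zeta> \<in> B" for v \<zeta>
    unfolding N_def by (rule pd_null_lift[OF oB that w'])
  have NN: "mink (N \<zeta>) (N \<zeta>) = 0" "mink (N \<zeta>) (pd v N \<zeta>) = 0" "mink (pd v N \<zeta>) (N \<zeta>) = 0" "mink (pd 1 N \<zeta>) (pd 1 N \<zeta>) = 1" "mink (pd 1 N \<zeta>) (pd \<i> N \<zeta>) = 0"
    "mink (pd \<i> N \<zeta>) (pd 1 N \<zeta>) = 0" "mink (pd \<i> N \<zeta>) (pd \<i> N \<zeta>) = 1" if z: "\<zeta> \<in> B" for v \<zeta>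
    unfolding pdN[OF z] unfolding N_def using null_lift_rel[OF W'[OF z]] by (simp_all add: mink_commute)
  define h where "h v w \<zeta> = mink (pd v x \<zeta>) (pd w N \<zeta>)" for v w \<zeta>
  have sh: "smooth_on B (h v w)" for v w unfolding h_def by (intro smooth_on_mink oB smooth_on_pd sx sN)
  \<comment> \<open>The tangency condition says that the form \<open>mink\<close> dx N is zero; its
    exterior derivative vanishes, which is the symmetry of the second form.\<close>
  have hs: "h \<i> 1 \<zeta> = h 1 \<i> \<zeta>" if z: "\<zeta> \<in> B" for \<zeta>
  proof -
    have "pd v (\<lambda>\<zeta>. mink (pd w x \<zeta>) (N \<zeta>)) \<zeta> = pd v (\<lambda>\<zeta>. 0 :: real) \<zeta>" for v w
      by (rule pd_cong_open[OF oB z]) (rule xN)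
    then show ?thesis using d_mink[OF oB z sx sN] by (simp add: h_def)
  qed
  \<comment> \<open>Minus half the trace: the derivatives of N are orthonormal, so shifting by
    \<open>t\<close> along N adds \<open>t\<close> to both diagonal entries.\<close>
  define t where "t \<zeta> = - (h 1 1 \<zeta> + h \<i> \<i> \<zeta>) * (1/2)" for \<zeta>
  have st: "smooth_on B t" unfolding t_def by (intro smooth_on_mult smooth_on_uminus smooth_on_add oB sh smooth_on_const)
  define a0 where "a0 \<zeta> = x \<zeta> + t \<zeta> *\<^sub>R N \<zeta>" for \<zeta>
  have sa0: "smooth_on B a0" unfolding a0_def by (intro smooth_on_add smooth_on_scaleR oB sx st sN)
  have pda0: "pd w a0 \<zeta> = pd w x \<zeta> + (t \<zeta> *\<^sub>R pd w N \<zeta> + pd w t \<zeta> *\<^sub>R N \<zeta>)" if z: "\<zeta> \<in> B" for w \<zeta>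
    unfolding a0_def using pd_add[OF smooth_onD[OF sx z] smooth_onD[OF smooth_on_scaleR[OF oB st sN] z], of w]
      pd_scaleR[OF smooth_onD[OF st z] smooth_onD[OF sN z], of w] by simp
  have a0N: "mink (pd w a0 \<zeta>) (N \<zeta>) = 0" if z: "\<zeta> \<in> B" for w \<zeta>
    by (simp add: pda0[OF z] mink_simps xN[OF z] NN[OF z])
  have a0h: "mink (pd v a0 \<zeta>) (pd w N \<zeta>) = h v w \<zeta> + t \<zeta> * mink (pd v N \<zeta>) (pd w N \<zeta>)" if z: "\<zeta> \<in> B" for v w \<zeta>
    by (simp add: pda0[OF z] mink_simps NN[OF z] h_def)
  \<comment> \<open>The trace-free part is the real part of H dz^2.\<close>
  define H where "H \<zeta> = Complex ((h 1 1 \<zeta> - h \<i> \<i> \<zeta>) * (1/2)) (- h 1 \<i> \<zeta>)" for \<zeta>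
  have sH: "smooth_on B H" unfolding H_def
    by (intro smooth_on_Complex smooth_on_mult smooth_on_uminus smooth_on_diff oB sh smooth_on_const)
  \<comment> \<open>A zero of H would make df . dn a multiple of dn . dn at that point, against
    nondegeneracy.\<close>
  have Hnz: "H \<zeta> \<noteq> 0" if z: "\<zeta> \<in> B" for \<zeta>
  proof
    assume "H \<zeta> = 0"
    then have h0: "h 1 1 \<zeta> = - t \<zeta>" "h \<i> \<i> \<zeta> = - t \<zeta>" "h 1 \<i> \<zeta> = 0" "h \<i> 1 \<zeta> = 0"
      using hs[OF z] by (simp_all add: H_def complex_eq_iff t_def)
    have ex: "pd w g \<zeta> = Re w *\<^sub>R pd 1 g \<zeta> + Im w *\<^sub>R pd \<i> g \<zeta>" if "smooth_on B g" for g :: "complex \<Rightarrow> real^4" and w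
      by (rule pd_complex_expand[OF smooth_onD[OF that z]])
    have m: "mink (pd w x \<zeta>) (pd w N \<zeta>) = - t \<zeta> * ((Re w)\<^sup>2 + (Im w)\<^sup>2)" for w
      unfolding ex[OF sx, of w] ex[OF sN, of w] using h0[unfolded h_def]
      by (simp add: mink_simps power2_eq_square algebra_simps)
    have m2: "mink (pd w N \<zeta>) (pd w N \<zeta>) = (Re w)\<^sup>2 + (Im w)\<^sup>2" for w
      unfolding ex[OF sN, of w] by (simp add: mink_simps NN[OF z] power2_eq_square)
    have dn: "ldir (pd w n \<zeta>) = c \<zeta> *\<^sub>R pd w N \<zeta> + pd w c \<zeta> *\<^sub>R N \<zeta>" for w
    proof -
      have "pd w (\<lambda>\<zeta>. dir_of (n \<zeta>)) \<zeta> = pd w (\<lambda>\<zeta>. c \<zeta> *\<^sub>R N \<zeta>) \<zeta>"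
        by (rule pd_cong_open[OF oB z]) (use c'(2) in \<open>simp add: N_def\<close>)
      then show ?thesis using pd_dir_of[OF oB n' z, of w] pd_scaleR[OF smooth_onD[OF c'(1) z] smooth_onD[OF sN z], of w] by simp
    qed
    have e1: "(pd w f \<zeta> \<bullet> pd w n \<zeta>) / sqrt 2 = - c \<zeta> * t \<zeta> * ((Re w)\<^sup>2 + (Im w)\<^sup>2)" for w
      unfolding mink_pt_dir(2)[symmetric] dn pdx[OF z, symmetric] by (simp add: mink_simps m xN[OF z])
    have e2: "(pd w n \<zeta> \<bullet> pd w n \<zeta>) / 2 = c \<zeta> * c \<zeta> * ((Re w)\<^sup>2 + (Im w)\<^sup>2)" for w
      unfolding mink_pt_dir(3)[symmetric] dn by (simp add: mink_simps m2 NN[OF z])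
    have "\<forall>w. (sqrt 2 * c \<zeta>) * (pd w f \<zeta> \<bullet> pd w n \<zeta>) + t \<zeta> * (pd w n \<zeta> \<bullet> pd w n \<zeta>) = 0"
    proof
      fix w
      have a: "pd w f \<zeta> \<bullet> pd w n \<zeta> = sqrt 2 * (- c \<zeta> * t \<zeta> * ((Re w)\<^sup>2 + (Im w)\<^sup>2))" unfolding e1[symmetric] by simp
      have b: "pd w n \<zeta> \<bullet> pd w n \<zeta> = 2 * (c \<zeta> * c \<zeta> * ((Re w)\<^sup>2 + (Im w)\<^sup>2))" unfolding e2[symmetric] by simp
      have e: "sqrt 2 * c \<zeta> * (sqrt 2 * (- c \<zeta> * t \<zeta> * X)) + t \<zeta> * (2 * (c \<zeta> * c \<zeta> * X)) = 0" for X :: real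
      proof -
        have "sqrt 2 * c \<zeta> * (sqrt 2 * (- c \<zeta> * t \<zeta> * X)) = (sqrt 2 * sqrt 2) * (- c \<zeta> * c \<zeta> * t \<zeta> * X)" by (simp only: mult_ac)
        then show ?thesis by simp
      qed
      show "(sqrt 2 * c \<zeta>) * (pd w f \<zeta> \<bullet> pd w n \<zeta>) + t \<zeta> * (pd w n \<zeta> \<bullet> pd w n \<zeta>) = 0"
        unfolding a b by (rule e)
    qed
    then have "sqrt 2 * c \<zeta> = 0" using nd'[OF z] by blast
    then show False using c'(2)[OF z] by simp
  qed
  have z0: "\<zeta>0 \<in> B" using r by (simp add: B_def)
  define H0 where "H0 = H \<zeta>0"
  have H0: "H0 \<noteq> 0" using Hnz[OF z0] by (simp add: H0_def)
  have "continuous (at \<zeta>0) H" using smooth_on_continuous[OF sH] oB z0 continuous_on_eq_continuous_at by blast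
  then obtain d where d: "d > 0" "\<And>\<zeta>. dist \<zeta> \<zeta>0 < d \<Longrightarrow> dist (H \<zeta>) H0 < norm H0"
    unfolding continuous_at_eps_delta H0_def[symmetric] using H0 by (meson zero_less_norm_iff)
  define r' where "r' = min r d"
  have r': "r' > 0" "r' \<le> r" using r d by (auto simp: r'_def)
  define B' where "B' = ball \<zeta>0 r'"
  have B': "open B'" "B' \<subseteq> B" using r' by (auto simp: B'_def B_def)
  have Re0: "Re (H \<zeta> / H0) > 0" if "\<zeta> \<in> B'" for \<zeta>
  proof -
    have "dist (H \<zeta>) H0 < norm H0" using that d(2)[of \<zeta>] by (simp add: B'_def r'_def dist_commute)
    then have "norm (H \<zeta> / H0 - 1) < 1" using H0 by (simp add: dist_norm norm_divide diff_divide_distrib[symmetric] field_simps flip: diff_divide_eq_iff)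
    then show ?thesis using abs_Re_le_cmod[of "H \<zeta> / H0 - 1"] by simp
  qed
  \<comment> \<open>The frame requires |l| H = l^2, so |l| = |H| and l is sqrt |H| times a root of
    H. Dividing by the central value \<open>H0\<close> keeps the argument of \<open>csqrt\<close>
    away from the branch cut on the smaller ball.\<close>
  define l where "l \<zeta> = complex_of_real (sqrt (norm (H \<zeta>))) * (csqrt H0 * csqrt (H \<zeta> / H0))" for \<zeta>
  have lsq: "(l \<zeta>)\<^sup>2 = complex_of_real (norm (H \<zeta>)) * H \<zeta>" for \<zeta>
    using H0 by (simp add: l_def power_mult_distrib flip: of_real_power)
  have ln: "norm (l \<zeta>) = norm (H \<zeta>)" for \<zeta>
  proof -
    have "norm ((l \<zeta>)\<^sup>2) = norm (H \<zeta>) * norm (H \<zeta>)" unfolding lsq by (simp add: norm_mult)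
    then have "(norm (l \<zeta>))\<^sup>2 = (norm (H \<zeta>))\<^sup>2" by (simp add: norm_power power2_eq_square norm_mult)
    then show ?thesis by (simp add: power2_eq_iff_nonneg)
  qed
  have sH': "smooth_on B' H" by (rule smooth_on_subset[OF sH B'(2)])
  have sHd: "smooth_on B' (\<lambda>\<zeta>. H \<zeta> / H0)" unfolding divide_inverse by (intro smooth_on_mult B' sH' smooth_on_const)
  have sl: "smooth_on B' l" unfolding l_def
  proof (intro smooth_on_mult B' smooth_on_of_real smooth_on_sqrt smooth_on_norm sH' smooth_on_const)
    show "smooth_on B' (\<lambda>\<zeta>. csqrt (H \<zeta> / H0))"
      by (rule smooth_on_holomorphic_compose[OF B'(1) _ _ _ sHd, where T = "-\<real>\<^sub>\<le>\<^sub>0"])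
        (use Re0 in \<open>auto intro!: holomorphic_intros simp: complex_nonpos_Reals_iff\<close>, fastforce)
  qed (use Hnz B' in auto)
  have lnz: "l \<zeta> \<noteq> 0" if "\<zeta> \<in> B'" for \<zeta> using ln[of \<zeta>] Hnz[of \<zeta>] B' that by auto
  have sub: "\<zeta> \<in> B" if "\<zeta> \<in> B'" for \<zeta> using that B' by blast
  obtain A p1 p2 p3 q1 q2 where A: "mframe B' A (\<lambda>\<zeta> w. Re (l \<zeta> * w)) (\<lambda>\<zeta> w. Im (l \<zeta> * w)) p1 p2 p3 q1 q2"
    "\<And>\<zeta>. fst (A \<zeta>) = a0 \<zeta>" "\<And>\<zeta>. column 1 (snd (A \<zeta>)) = norm (l \<zeta>) *\<^sub>R N \<zeta>"
  proof (rule middle_frame_of_null_lift[of B' w1 w2 l a0, folded N_def[abs_def]])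
    show "w1 holomorphic_on B'" "w2 holomorphic_on B'" using w' B' holomorphic_on_subset by blast+
    show "smooth_on B' a0" by (rule smooth_on_subset[OF sa0 B'(2)])
    show "norm (l \<zeta>) * mink (pd 1 a0 \<zeta>) (pd 1 N \<zeta>) = Re ((l \<zeta>)\<^sup>2)"
      "norm (l \<zeta>) * mink (pd 1 a0 \<zeta>) (pd \<i> N \<zeta>) = - Im ((l \<zeta>)\<^sup>2)"
      "norm (l \<zeta>) * mink (pd \<i> a0 \<zeta>) (pd 1 N \<zeta>) = - Im ((l \<zeta>)\<^sup>2)"
      "norm (l \<zeta>) * mink (pd \<i> a0 \<zeta>) (pd \<i> N \<zeta>) = - Re ((l \<zeta>)\<^sup>2)" if "\<zeta> \<in> B'" for \<zeta>
      unfolding lsq ln a0h[OF sub[OF that]] NN[OF sub[OF that]] hs[OF sub[OF that]]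
      by (simp_all add: H_def t_def algebra_simps)
  qed (use B' W' sl lnz sub a0N in \<open>auto simp: N_def\<close>)
  have "isotropic_line (pt_of (f \<zeta>)) (dir_of (n \<zeta>)) = isotropic_line (fst (A \<zeta>)) (column 1 (snd (A \<zeta>)))" if z: "\<zeta> \<in> B'" for \<zeta>
    using c'(2)[OF sub[OF z]] lnz[OF z]
    by (simp add: A a0_def x_def N_def isotropic_line_scale isotropic_line_shift)
  then show thesis using that r' A(1) unfolding B'_def by blast
qed

section \<open>Liouville's equation\<close>

text \<open>Picard iteration in the complex domain: the terms are
  \<open>e (Suc n) = I (I (h * e n))\<close> with \<open>I\<close> the primitive vanishing at the
  centre. The radius depends only on \<open>h\<close>, so two solutions with different initial
  values share it.\<close>

lemma linear_ode_solution:
  fixes h :: "complex \<Rightarrow> complex"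
  assumes h: "h holomorphic_on ball \<zeta>0 r" and r: "r > 0"
  obtains R where "R > 0" "R \<le> r"
    "\<And>a b. \<exists>w w'. w \<zeta>0 = a \<and> w' \<zeta>0 = b \<and> (\<forall>\<zeta>\<in>ball \<zeta>0 R. (w has_field_derivative w' \<zeta>) (at \<zeta>) \<and>
       (w' has_field_derivative h \<zeta> * w \<zeta>) (at \<zeta>))"
proof -
  have "compact (h ` cball \<zeta>0 (r/2))"
    by (rule compact_continuous_image[OF continuous_on_subset[OF holomorphic_on_imp_continuous_on[OF h]]]) (use r in auto)
  then have "bounded (h ` cball \<zeta>0 (r/2))" by (rule compact_imp_bounded)
  then obtain M0 where M0': "\<forall>y\<in>h ` cball \<zeta>0 (r/2). norm y \<le> M0" unfolding bounded_iff by blast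
  have M0: "norm (h \<zeta>) \<le> M0" if "\<zeta> \<in> cball \<zeta>0 (r/2)" for \<zeta> using M0' that by blast
  define M where "M = max M0 1"
  have M: "M \<ge> 1" "\<And>\<zeta>. \<zeta> \<in> cball \<zeta>0 (r/2) \<Longrightarrow> norm (h \<zeta>) \<le> M" using M0 by (auto simp: M_def le_max_iff_disj)
  \<comment> \<open>The bound r/2 keeps \<open>h\<close> bounded on a compact ball. The bound 1/(2M)
    makes the two integrations of each step contract by at least 1/2; as M is at least 1, it also
    gives R at most 1/2.\<close>
  define R where "R = min (r/2) (1 / (2 * M))"
  have R: "R > 0" "R \<le> r/2" "R \<le> r" "M * R \<le> 1/2" "R \<le> 1/2"
  proof -
    show "R > 0" "R \<le> r/2" "R \<le> r" using r M by (auto simp: R_def)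
    have "R \<le> 1 / (2 * M)" by (simp add: R_def)
    then show "M * R \<le> 1/2" using M by (simp add: field_simps)
    have "1 / (2 * M) \<le> 1/2" using M by (simp add: field_simps)
    then show "R \<le> 1/2" using \<open>R \<le> 1 / (2 * M)\<close> by linarith
  qed
  define B where "B = ball \<zeta>0 R"
  have B: "open B" "convex B" "\<zeta>0 \<in> B" "B \<subseteq> cball \<zeta>0 (r/2)" "B \<subseteq> ball \<zeta>0 r" using R by (auto simp: B_def)
  have hB: "h holomorphic_on B" by (rule holomorphic_on_subset[OF h B(5)])
  \<comment> \<open>Choosing the primitive by \<open>SOME\<close> makes integration a total
    operator, as the recursion needs; it is meaningful on holomorphic functions only.\<close>
  define I where "I f = (SOME F. F \<zeta>0 = 0 \<and> (\<forall>\<zeta>\<in>B. (F has_field_derivative f \<zeta>) (at \<zeta>)))" for f :: "complex \<Rightarrow> complex"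
  have I: "I f \<zeta>0 = 0 \<and> (\<forall>\<zeta>\<in>B. (I f has_field_derivative f \<zeta>) (at \<zeta>))" if fh: "f holomorphic_on B" for f
  proof -
    obtain F where F: "\<And>\<zeta>. \<zeta> \<in> B \<Longrightarrow> (F has_field_derivative f \<zeta>) (at \<zeta> within B)"
      using holomorphic_convex_primitive'[OF B(2,1) fh] by blast
    have F': "(F has_field_derivative f \<zeta>) (at \<zeta>)" if "\<zeta> \<in> B" for \<zeta>
      using F[OF that] at_within_open[OF that B(1)] by simp
    have "((\<lambda>\<zeta>. F \<zeta> - F \<zeta>0) has_field_derivative f \<zeta>) (at \<zeta>)" if "\<zeta> \<in> B" for \<zeta>
      using DERIV_diff[OF F'[OF that] DERIV_const, of "F \<zeta>0"] by simp
    then have "\<exists>F. F \<zeta>0 = 0 \<and> (\<forall>\<zeta>\<in>B. (F has_field_derivative f \<zeta>) (at \<zeta>))"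
      by (intro exI[of _ "\<lambda>\<zeta>. F \<zeta> - F \<zeta>0"]) auto
    then show ?thesis unfolding I_def by (rule someI_ex)
  qed
  have Ihol: "I f holomorphic_on B" if "f holomorphic_on B" for f
    using I[OF that] B(1) holomorphic_on_open by blast
  have Ib: "norm (I f \<zeta>) \<le> C * R" if f: "f holomorphic_on B" and C: "\<And>\<zeta>. \<zeta> \<in> B \<Longrightarrow> norm (f \<zeta>) \<le> C" and z: "\<zeta> \<in> B" for f C \<zeta>
  proof -
    have "C \<ge> 0" using C[OF B(3)] norm_ge_zero order_trans by blast
    have "norm (I f \<zeta> - I f \<zeta>0) \<le> C * norm (\<zeta> - \<zeta>0)"
      by (rule field_differentiable_bound[OF B(2) _ C z B(3)]) (use I[OF f] has_field_derivative_at_within in blast)+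
    also have "\<dots> \<le> C * R" using z \<open>C \<ge> 0\<close> by (intro mult_left_mono) (auto simp: B_def dist_norm norm_minus_commute)
    finally show ?thesis using I[OF f] by simp
  qed
  have sol: "\<exists>w w'. w \<zeta>0 = a \<and> w' \<zeta>0 = b \<and> (\<forall>\<zeta>\<in>B. (w has_field_derivative w' \<zeta>) (at \<zeta>) \<and>
       (w' has_field_derivative h \<zeta> * w \<zeta>) (at \<zeta>))" for a b
  proof -
    define e where "e = rec_nat (\<lambda>\<zeta>. a + b * (\<zeta> - \<zeta>0)) (\<lambda>n f. I (I (\<lambda>\<zeta>. h \<zeta> * f \<zeta>)))"
    have e0: "e 0 = (\<lambda>\<zeta>. a + b * (\<zeta> - \<zeta>0))" and eS: "e (Suc n) = I (I (\<lambda>\<zeta>. h \<zeta> * e n \<zeta>))" for n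
      by (simp_all add: e_def)
    define e' where "e' n = (case n of 0 \<Rightarrow> (\<lambda>\<zeta>. b) | Suc k \<Rightarrow> I (\<lambda>\<zeta>. h \<zeta> * e k \<zeta>))" for n
    \<comment> \<open>Termwise second derivatives. The initial term is affine and contributes 0, so
      the series is shifted by one: its sum is \<open>h\<close> times the sum of the
      \<open>e n\<close>.\<close>
    define e'' where "e'' n = (case n of 0 \<Rightarrow> (\<lambda>\<zeta>. 0) | Suc k \<Rightarrow> (\<lambda>\<zeta>. h \<zeta> * e k \<zeta>))" for n
    have eh: "e n holomorphic_on B" for n
    proof (induction n)
      case 0
      then show ?case unfolding e0 by (intro holomorphic_intros)
    next
      case (Suc n)
      then show ?case unfolding eS by (intro Ihol holomorphic_on_mult hB)
    qed
    have heh: "(\<lambda>\<zeta>. h \<zeta> * e n \<zeta>) holomorphic_on B" for n by (intro holomorphic_on_mult hB eh)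
    define C where "C = norm a + norm b * R"
    have C: "C \<ge> 0" using R by (simp add: C_def)
    have eb: "\<zeta> \<in> B \<Longrightarrow> norm (e n \<zeta>) \<le> C * (1/2)^n" for n \<zeta>
    proof (induction n arbitrary: \<zeta>)
      case 0
      have "norm (b * (\<zeta> - \<zeta>0)) \<le> norm b * R" unfolding norm_mult
        using 0 by (intro mult_left_mono) (auto simp: B_def dist_norm norm_minus_commute)
      then show ?case unfolding e0 C_def using norm_triangle_ineq[of a "b * (\<zeta> - \<zeta>0)"] by simp
    next
      case (Suc n)
      have "norm (h \<zeta> * e n \<zeta>) \<le> M * (C * (1/2)^n)" if "\<zeta> \<in> B" for \<zeta>
        unfolding norm_mult using Suc.IH[OF that] M(2)[of \<zeta>] B(4) that M(1) by (intro mult_mono) auto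
      from Ib[OF heh this] have "norm (I (\<lambda>\<zeta>. h \<zeta> * e n \<zeta>) \<zeta>) \<le> M * (C * (1/2)^n) * R" if "\<zeta> \<in> B" for \<zeta> using that by blast
      from Ib[OF Ihol[OF heh] this Suc.prems] have "norm (e (Suc n) \<zeta>) \<le> M * (C * (1/2)^n) * R * R" unfolding eS .
      also have "\<dots> = (C * (1/2)^n) * ((M * R) * R)" by simp
      also have "\<dots> \<le> (C * (1/2)^n) * ((1/2) * 1)" using R C M by (intro mult_left_mono mult_mono) auto
      finally show ?case by simp
    qed
    have eb': "norm (e' n \<zeta>) \<le> (norm b + C) * (1/2)^n" if z: "\<zeta> \<in> B" for n \<zeta>
    proof (cases n)
      case 0
      then show ?thesis using C by (simp add: e'_def)
    next
      case (Suc k)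
      have "norm (h \<zeta> * e k \<zeta>) \<le> M * (C * (1/2)^k)" if "\<zeta> \<in> B" for \<zeta>
        unfolding norm_mult using eb[OF that] M(2)[of \<zeta>] B(4) that M(1) by (intro mult_mono) auto
      from Ib[OF heh this z] have "norm (I (\<lambda>\<zeta>. h \<zeta> * e k \<zeta>) \<zeta>) \<le> M * (C * (1/2)^k) * R" .
      also have "\<dots> = (C * (1/2)^k) * (M * R)" by simp
      also have "\<dots> \<le> (C * (1/2)^k) * (1/2)" using R C by (intro mult_left_mono) auto
      also have "\<dots> \<le> (norm b + C) * (1/2)^n" using Suc by (simp add: distrib_right)
      finally show ?thesis using Suc by (simp add: e'_def)
    qed
    have de: "(e n has_field_derivative e' n \<zeta>) (at \<zeta>)" if z: "\<zeta> \<in> B" for n \<zeta>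
    proof (cases n)
      case 0
      show ?thesis unfolding 0 e0 e'_def by (auto intro!: derivative_eq_intros)
    next
      case (Suc k)
      then show ?thesis using I[OF Ihol[OF heh]] z by (simp add: eS e'_def)
    qed
    have de': "(e' n has_field_derivative e'' n \<zeta>) (at \<zeta>)" if z: "\<zeta> \<in> B" for n \<zeta>
    proof (cases n)
      case 0
      show ?thesis unfolding 0 e'_def e''_def by simp
    next
      case (Suc k)
      then show ?thesis using I[OF heh] z by (simp add: e'_def e''_def)
    qed
    have sum: "summable (\<lambda>n. K * (1/2)^n :: real)" for K by (intro summable_mult summable_geometric) simp
    obtain g g' where g: "\<And>\<zeta>. \<zeta> \<in> B \<Longrightarrow> (\<lambda>n. e n \<zeta>) sums g \<zeta> \<and> (\<lambda>n. e' n \<zeta>) sums g' \<zeta> \<and> (g has_field_derivative g' \<zeta>) (at \<zeta>)"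
    proof -
      have ev: "\<forall>\<^sub>F n in sequentially. \<forall>x\<in>B. norm (e n x) \<le> C * (1/2)^n" using eb by (intro always_eventually) blast
      obtain g g' where "\<forall>\<zeta>\<in>B. (\<lambda>n. e n \<zeta>) sums g \<zeta> \<and> (\<lambda>n. e' n \<zeta>) sums g' \<zeta> \<and> (g has_field_derivative g' \<zeta>) (at \<zeta>)"
        by (rule series_and_derivative_comparison[OF B(1) sum[of C] de ev])
      then show thesis using that by blast
    qed
    \<comment> \<open>Termwise differentiation is applied once more, to the series of first
      derivatives; \<open>kg\<close> then identifies its sum with the derivative of
      \<open>g\<close>.\<close>
    obtain k k' where k: "\<And>\<zeta>. \<zeta> \<in> B \<Longrightarrow> (\<lambda>n. e' n \<zeta>) sums k \<zeta> \<and> (\<lambda>n. e'' n \<zeta>) sums k' \<zeta> \<and> (k has_field_derivative k' \<zeta>) (at \<zeta>)"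
    proof -
      have ev: "\<forall>\<^sub>F n in sequentially. \<forall>x\<in>B. norm (e' n x) \<le> (norm b + C) * (1/2)^n" using eb' by (intro always_eventually) blast
      obtain k k' where "\<forall>\<zeta>\<in>B. (\<lambda>n. e' n \<zeta>) sums k \<zeta> \<and> (\<lambda>n. e'' n \<zeta>) sums k' \<zeta> \<and> (k has_field_derivative k' \<zeta>) (at \<zeta>)"
        by (rule series_and_derivative_comparison[OF B(1) sum[of "norm b + C"] de' ev])
      then show thesis using that by blast
    qed
    have kg: "k \<zeta> = g' \<zeta>" if "\<zeta> \<in> B" for \<zeta> using g[OF that] k[OF that] sums_unique2 by blast
    have k': "k' \<zeta> = h \<zeta> * g \<zeta>" if z: "\<zeta> \<in> B" for \<zeta>
    proof -
      have "(\<lambda>n. h \<zeta> * e n \<zeta>) sums (h \<zeta> * g \<zeta>)" using g[OF z] sums_mult by blast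
      then have "(\<lambda>n. e'' (Suc n) \<zeta>) sums (h \<zeta> * g \<zeta>)" by (simp add: e''_def)
      then have "(\<lambda>n. e'' n \<zeta>) sums (h \<zeta> * g \<zeta> + e'' 0 \<zeta>)" by (rule sums_Suc)
      then show ?thesis using k[OF z] sums_unique2 by (fastforce simp: e''_def)
    qed
    have at0: "e (Suc n) \<zeta>0 = 0" "e' (Suc n) \<zeta>0 = 0" for n
      using I[OF Ihol[OF heh]] I[OF heh] by (simp_all add: eS e'_def)
    have "(\<lambda>n. e n \<zeta>0) sums (0 + e 0 \<zeta>0)" "(\<lambda>n. e' n \<zeta>0) sums (0 + e' 0 \<zeta>0)"
      by (rule sums_Suc; simp add: at0)+
    then have "g \<zeta>0 = a" "k \<zeta>0 = b" using g[OF B(3)] k[OF B(3)] sums_unique2 by (fastforce simp: e0 e'_def)+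
    then show ?thesis using g k kg k' by - (rule exI[of _ g], rule exI[of _ k], auto)
  qed
  show thesis by (rule that[OF R(1,3)]) (use sol in \<open>simp add: B_def\<close>)
qed

section \<open>The Schwarzian coefficient and the immersion with prescribed potential\<close>

lemma pd_uminus:
  assumes "f differentiable (at x)"
  shows "pd v (\<lambda>x. - f x) x = - pd v f x"
  by (rule pd_bounded_linear[OF bounded_linear_minus[OF bounded_linear_ident] assms])

text \<open>The solutions of \<open>w'' = h w\<close>, with \<open>h\<close> as below, give the developing map of the metric
  \<open>e\<^sup>-\<^sup>2\<^sup>u |dz|\<^sup>2\<close> of constant curvature.\<close>

lemma liouville_schwarzian_holomorphic:
  assumes B: "open B" and u: "smooth_on B u"
    and L: "\<And>\<zeta>. \<zeta> \<in> B \<Longrightarrow> (pd 1 (pd 1 u) \<zeta> + pd \<i> (pd \<i> u) \<zeta>) * (exp (u \<zeta>))\<^sup>2 = k"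
  shows "(\<lambda>\<zeta>. Complex ((pd 1 (pd 1 u) \<zeta> - pd \<i> (pd \<i> u) \<zeta> + (pd 1 u \<zeta>)\<^sup>2 - (pd \<i> u \<zeta>)\<^sup>2) / 4)
     (- (pd 1 (pd \<i> u) \<zeta> + pd 1 u \<zeta> * pd \<i> u \<zeta>) / 2)) holomorphic_on B"
proof -
  \<comment> \<open>X + iY = 4 (u_zz + (u_z)^2).\<close>
  define X Y where "X \<zeta> = pd 1 (pd 1 u) \<zeta> - pd \<i> (pd \<i> u) \<zeta> + (pd 1 u \<zeta> * pd 1 u \<zeta> - pd \<i> u \<zeta> * pd \<i> u \<zeta>)"
    and "Y \<zeta> = - 2 * (pd 1 (pd \<i> u) \<zeta> + pd 1 u \<zeta> * pd \<i> u \<zeta>)" for \<zeta>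
  note s1 = smooth_on_pd[OF u] and s2 = smooth_on_pd[OF smooth_on_pd[OF u]]
  have sX: "smooth_on B X" "smooth_on B Y" unfolding X_def Y_def
    by (intro smooth_on_add smooth_on_diff smooth_on_mult smooth_on_const s1 s2 B)+
  have hol: "(\<lambda>\<zeta>. Complex (X \<zeta>) (Y \<zeta>)) holomorphic_on B"
  proof (rule holomorphic_on_CR[OF B])
    show "(\<lambda>\<zeta>. Complex (X \<zeta>) (Y \<zeta>)) differentiable (at \<zeta>)" if "\<zeta> \<in> B" for \<zeta>
      by (rule smooth_onD[OF smooth_on_Complex[OF B sX] that])
  next
    fix \<zeta> assume z: "\<zeta> \<in> B"
    have dC: "pd v (\<lambda>\<zeta>. Complex (X \<zeta>) (Y \<zeta>)) \<zeta> = Complex (pd v X \<zeta>) (pd v Y \<zeta>)" for v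
    proof -
      note d = smooth_onD[OF smooth_on_Complex[OF B sX] z]
      show ?thesis using pd_bounded_linear[OF bounded_linear_Re d, of v] pd_bounded_linear[OF bounded_linear_Im d, of v]
        by (simp add: complex_eq_iff)
    qed
    define a b where "a = pd 1 u \<zeta>" and "b = pd \<i> u \<zeta>"
    define u11 u22 u12 where "u11 = pd 1 (pd 1 u) \<zeta>" and "u22 = pd \<i> (pd \<i> u) \<zeta>" and "u12 = pd 1 (pd \<i> u) \<zeta>"
    have u21: "pd \<i> (pd 1 u) \<zeta> = u12" unfolding u12_def by (rule pd_commute[OF u B z])
    define T where "T v = pd v (pd 1 (pd 1 u)) \<zeta>" for v
    define S where "S v = pd v (pd \<i> (pd \<i> u)) \<zeta>" for v
    define R where "R v = pd v (pd 1 (pd \<i> u)) \<zeta>" for v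
    have T\<i>: "T \<i> = R 1"
    proof -
      have "T \<i> = pd 1 (pd \<i> (pd 1 u)) \<zeta>" unfolding T_def by (rule pd_commute[OF s1 B z])
      also have "\<dots> = R 1" unfolding R_def by (rule pd_cong_open[OF B z]) (rule pd_commute[OF u B])
      finally show ?thesis .
    qed
    have S1: "S 1 = R \<i>" unfolding S_def R_def by (rule pd_commute[OF s1 B z])
    note dd = smooth_onD[OF s1 z] smooth_onD[OF s2 z]
    have dprod: "pd v (\<lambda>\<zeta>. pd x u \<zeta> * pd y u \<zeta>) \<zeta> = pd x u \<zeta> * pd v (pd y u) \<zeta> + pd v (pd x u) \<zeta> * pd y u \<zeta>" for v x y
      by (rule pd_mult[OF dd(1) dd(1)])
    note sp = smooth_on_mult[OF B s1 s1]
    have dX: "pd v X \<zeta> = T v - S v + (2 * a * pd v (pd 1 u) \<zeta> - 2 * b * pd v (pd \<i> u) \<zeta>)" for v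
    proof -
      have "pd v X \<zeta> = pd v (\<lambda>\<zeta>. pd 1 (pd 1 u) \<zeta> - pd \<i> (pd \<i> u) \<zeta>) \<zeta> + pd v (\<lambda>\<zeta>. pd 1 u \<zeta> * pd 1 u \<zeta> - pd \<i> u \<zeta> * pd \<i> u \<zeta>) \<zeta>"
        unfolding X_def by (intro pd_add smooth_onD[OF _ z] smooth_on_diff s2 sp B)
      also have "\<dots> = (T v - S v) + (pd v (\<lambda>\<zeta>. pd 1 u \<zeta> * pd 1 u \<zeta>) \<zeta> - pd v (\<lambda>\<zeta>. pd \<i> u \<zeta> * pd \<i> u \<zeta>) \<zeta>)"
        unfolding T_def S_def using pd_diff[OF dd(2) dd(2)] pd_diff[OF smooth_onD[OF sp z] smooth_onD[OF sp z]] by simp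
      finally show ?thesis unfolding dprod a_def b_def by simp
    qed
    have dY: "pd v Y \<zeta> = - 2 * (R v + (a * pd v (pd \<i> u) \<zeta> + pd v (pd 1 u) \<zeta> * b))" for v
    proof -
      have "pd v Y \<zeta> = - 2 * pd v (\<lambda>\<zeta>. pd 1 (pd \<i> u) \<zeta> + pd 1 u \<zeta> * pd \<i> u \<zeta>) \<zeta>"
        unfolding Y_def by (rule pd_bounded_linear[OF bounded_linear_mult_right smooth_onD[OF smooth_on_add[OF B s2 sp] z]])
      also have "pd v (\<lambda>\<zeta>. pd 1 (pd \<i> u) \<zeta> + pd 1 u \<zeta> * pd \<i> u \<zeta>) \<zeta> = R v + pd v (\<lambda>\<zeta>. pd 1 u \<zeta> * pd \<i> u \<zeta>) \<zeta>"
        unfolding R_def by (rule pd_add[OF dd(2) smooth_onD[OF sp z]])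
      finally show ?thesis unfolding dprod a_def b_def .
    qed
    \<comment> \<open>Differentiating e^(2u) Laplacian(u) = k shows that the derivative of the
      Laplacian is -2 Laplacian(u) du. This cancels the conjugate derivative of (u_z)^2 and is the
      only use of the equation.\<close>
    have Ld: "T v + S v = - 2 * pd v u \<zeta> * (u11 + u22)" for v
    proof -
      have sE: "smooth_on B (\<lambda>\<zeta>. exp (u \<zeta>))" by (rule smooth_on_exp[OF B u])
      have dE: "pd v (\<lambda>\<zeta>. exp (u \<zeta>)) \<zeta> = exp (u \<zeta>) * pd v u \<zeta>"
        using pd_eq[OF has_derivative_exp[OF has_derivative_pd[OF smooth_onD[OF u z]]]] by (simp add: mult.commute)
      have "pd v (\<lambda>\<zeta>. (pd 1 (pd 1 u) \<zeta> + pd \<i> (pd \<i> u) \<zeta>) * (exp (u \<zeta>))\<^sup>2) \<zeta> = pd v (\<lambda>\<zeta>. k) \<zeta>"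
        by (rule pd_cong_open[OF B z]) (rule L)
      also have "\<dots> = 0" by simp
      also have "pd v (\<lambda>\<zeta>. (pd 1 (pd 1 u) \<zeta> + pd \<i> (pd \<i> u) \<zeta>) * (exp (u \<zeta>))\<^sup>2) \<zeta> =
        (u11 + u22) * (2 * (exp (u \<zeta>) * pd v u \<zeta>) * exp (u \<zeta>)) + (T v + S v) * (exp (u \<zeta>))\<^sup>2"
      proof -
        have "pd v (\<lambda>\<zeta>. (pd 1 (pd 1 u) \<zeta> + pd \<i> (pd \<i> u) \<zeta>) * (exp (u \<zeta>))\<^sup>2) \<zeta> =
          (u11 + u22) * pd v (\<lambda>\<zeta>. (exp (u \<zeta>))\<^sup>2) \<zeta> + pd v (\<lambda>\<zeta>. pd 1 (pd 1 u) \<zeta> + pd \<i> (pd \<i> u) \<zeta>) \<zeta> * (exp (u \<zeta>))\<^sup>2"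
          unfolding u11_def u22_def
          by (rule pd_mult[OF smooth_onD[OF smooth_on_add[OF B s2 s2] z] smooth_onD[OF smooth_on_power[OF B sE] z]])
        also have "pd v (\<lambda>\<zeta>. pd 1 (pd 1 u) \<zeta> + pd \<i> (pd \<i> u) \<zeta>) \<zeta> = T v + S v"
          unfolding T_def S_def by (rule pd_add[OF dd(2) dd(2)])
        also have "pd v (\<lambda>\<zeta>. (exp (u \<zeta>))\<^sup>2) \<zeta> = 2 * (exp (u \<zeta>) * pd v u \<zeta>) * exp (u \<zeta>)"
          using pd_power[OF smooth_onD[OF sE z], of v 2] dE by simp
        finally show ?thesis .
      qed
      finally have "(exp (u \<zeta>))\<^sup>2 * (T v + S v + 2 * pd v u \<zeta> * (u11 + u22)) = 0"
        by (simp add: power2_eq_square algebra_simps)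
      then show ?thesis by simp
    qed
    have L1: "T 1 + R \<i> = - 2 * a * (u11 + u22)" using Ld[of 1] S1 by (simp add: a_def)
    have L2: "R 1 + S \<i> = - 2 * b * (u11 + u22)" using Ld[of \<i>] T\<i> by (simp add: b_def)
    show "pd \<i> (\<lambda>\<zeta>. Complex (X \<zeta>) (Y \<zeta>)) \<zeta> = \<i> * pd 1 (\<lambda>\<zeta>. Complex (X \<zeta>) (Y \<zeta>)) \<zeta>"
      unfolding dC complex_eq_iff
    proof
      show "Re (Complex (pd \<i> X \<zeta>) (pd \<i> Y \<zeta>)) = Re (\<i> * Complex (pd 1 X \<zeta>) (pd 1 Y \<zeta>))"
        using L2 unfolding dX dY u21 u12_def[symmetric] u11_def[symmetric] u22_def[symmetric] T\<i> S1 by (simp add: algebra_simps)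
      show "Im (Complex (pd \<i> X \<zeta>) (pd \<i> Y \<zeta>)) = Im (\<i> * Complex (pd 1 X \<zeta>) (pd 1 Y \<zeta>))"
        using L1 unfolding dX dY u21 u12_def[symmetric] u11_def[symmetric] u22_def[symmetric] T\<i> S1 by (simp add: algebra_simps)
    qed
  qed
  have "(\<lambda>\<zeta>. Complex (X \<zeta>) (Y \<zeta>) * (1/4)) holomorphic_on B" by (intro holomorphic_intros hol)
  moreover have "Complex (X \<zeta>) (Y \<zeta>) * (1/4) = Complex ((pd 1 (pd 1 u) \<zeta> - pd \<i> (pd \<i> u) \<zeta> + (pd 1 u \<zeta>)\<^sup>2 - (pd \<i> u \<zeta>)\<^sup>2) / 4)
     (- (pd 1 (pd \<i> u) \<zeta> + pd 1 u \<zeta> * pd \<i> u \<zeta>) / 2)" for \<zeta>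
    by (simp add: complex_eq_iff X_def Y_def power2_eq_square)
  ultimately show ?thesis by simp
qed

lemma bounded_bilinear_null_polar:
  "bounded_bilinear (\<lambda>x y. null_polar (fst x) (snd x) (fst y) (snd y))"
proof -
  have "bilinear (\<lambda>x y. null_polar (fst x) (snd x) (fst y) (snd y))"
    unfolding bilinear_def
    by (auto intro!: linearI simp: vec4_eq_iff null_polar_def algebra_simps)
  then show ?thesis by (simp add: bilinear_conv_bounded_bilinear)
qed

lemma pd_Pair:
  assumes "f differentiable (at x)" "g differentiable (at x)"
  shows "pd v (\<lambda>x. (f x, g x)) x = (pd v f x, pd v g x)" "(\<lambda>x. (f x, g x)) differentiable (at x)"
  using pd_eq[OF has_derivative_Pair[OF has_derivative_pd[OF assms(1)] has_derivative_pd[OF assms(2)]]]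
    has_derivative_Pair[OF has_derivative_pd[OF assms(1)] has_derivative_pd[OF assms(2)]]
  by (auto simp: differentiable_def)

lemma pd_null_polar:
  assumes "a differentiable (at \<zeta>)" "b differentiable (at \<zeta>)" "c differentiable (at \<zeta>)" "d differentiable (at \<zeta>)"
  shows "pd v (\<lambda>\<zeta>. null_polar (a \<zeta>) (b \<zeta>) (c \<zeta>) (d \<zeta>)) \<zeta> =
    null_polar (a \<zeta>) (b \<zeta>) (pd v c \<zeta>) (pd v d \<zeta>) + null_polar (pd v a \<zeta>) (pd v b \<zeta>) (c \<zeta>) (d \<zeta>)"
  using pd_bounded_bilinear[OF bounded_bilinear_null_polar pd_Pair(2)[OF assms(1,2)] pd_Pair(2)[OF assms(3,4)], of v]
  by (simp add: pd_Pair(1)[OF assms(1,2)] pd_Pair(1)[OF assms(3,4)])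

text \<open>Real and imaginary part of N_zz = h N: with N = psi psi^H and psi holomorphic, two
  z-derivatives fall on the first factor only and give psi'' psi^H.\<close>

lemma null_lift_second_derivatives:
  assumes B: "open B"
    and w1: "\<And>\<zeta>. \<zeta> \<in> B \<Longrightarrow> (w1 has_field_derivative w1' \<zeta>) (at \<zeta>) \<and> (w1' has_field_derivative h \<zeta> * w1 \<zeta>) (at \<zeta>)"
    and w2: "\<And>\<zeta>. \<zeta> \<in> B \<Longrightarrow> (w2 has_field_derivative w2' \<zeta>) (at \<zeta>) \<and> (w2' has_field_derivative h \<zeta> * w2 \<zeta>) (at \<zeta>)"
    and z: "\<zeta> \<in> B"
  defines "N \<equiv> \<lambda>\<zeta>. null_lift (w1 \<zeta>) (w2 \<zeta>)"
  shows "pd 1 (pd 1 N) \<zeta> - pd \<i> (pd \<i> N) \<zeta> = (4 * Re (h \<zeta>)) *\<^sub>R N \<zeta>" "pd 1 (pd \<i> N) \<zeta> = (- 2 * Im (h \<zeta>)) *\<^sub>R N \<zeta>"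
proof -
  have hol: "w1 holomorphic_on B" "w2 holomorphic_on B" using w1 w2 B holomorphic_on_open by blast+
  have dw: "deriv w1 \<xi> = w1' \<xi>" "deriv w2 \<xi> = w2' \<xi>" if "\<xi> \<in> B" for \<xi>
    using w1[OF that] w2[OF that] DERIV_imp_deriv by blast+
  have hd: "(g has_derivative (\<lambda>v. d * v)) (at \<zeta>)" if "(g has_field_derivative d) (at \<zeta>)" for g :: "complex \<Rightarrow> complex" and d
    using that by (simp add: has_field_derivative_def)
  have pg: "pd v g \<zeta> = d * v" "g differentiable (at \<zeta>)" if "(g has_field_derivative d) (at \<zeta>)" for g :: "complex \<Rightarrow> complex" and d v
    using pd_eq[OF hd[OF that]] hd[OF that] by (auto simp: differentiable_def)
  have pm: "pd v (\<lambda>\<zeta>. g \<zeta> * w) \<zeta> = d * w * v" "(\<lambda>\<zeta>. g \<zeta> * w) differentiable (at \<zeta>)"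
    if "(g has_field_derivative d) (at \<zeta>)" for g :: "complex \<Rightarrow> complex" and d v w
    using pg[OF DERIV_cmult_right[OF that]] by auto
  have pp: "pd v (pd w N) \<zeta> = null_polar (w1 \<zeta>) (w2 \<zeta>) (h \<zeta> * w1 \<zeta> * w * v) (h \<zeta> * w2 \<zeta> * w * v)
     + null_polar (w1' \<zeta> * v) (w2' \<zeta> * v) (w1' \<zeta> * w) (w2' \<zeta> * w)" for v w
  proof -
    have "pd v (pd w N) \<zeta> = pd v (\<lambda>\<zeta>. null_polar (w1 \<zeta>) (w2 \<zeta>) (w1' \<zeta> * w) (w2' \<zeta> * w)) \<zeta>"
      by (rule pd_cong_open[OF B z]) (simp add: N_def pd_null_lift[OF B _ hol] dw)
    then show ?thesis
      using pd_null_polar[OF pg(2)[OF conjunct1[OF w1[OF z]]] pg(2)[OF conjunct1[OF w2[OF z]]]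
          pm(2)[OF conjunct2[OF w1[OF z]]] pm(2)[OF conjunct2[OF w2[OF z]]]]
      by (simp add: pg(1)[OF conjunct1[OF w1[OF z]]] pg(1)[OF conjunct1[OF w2[OF z]]]
          pm(1)[OF conjunct2[OF w1[OF z]]] pm(1)[OF conjunct2[OF w2[OF z]]])
  qed
  show "pd 1 (pd 1 N) \<zeta> - pd \<i> (pd \<i> N) \<zeta> = (4 * Re (h \<zeta>)) *\<^sub>R N \<zeta>" "pd 1 (pd \<i> N) \<zeta> = (- 2 * Im (h \<zeta>)) *\<^sub>R N \<zeta>"
    unfolding pp by (simp_all add: vec4_eq_iff null_polar_def N_def null_lift_def algebra_simps)
qed

text \<open>The direction of the new immersion is the null lift of two solutions of w'' = h w, and
  its base point integrates X dx + Y dy. Since N and N_zbar span a totally null plane, X - iY = 2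
  e^u (N_zbar - u_zbar N) is null as well as holomorphic, so \<open>a0\<close> is the real part of a
  null curve.\<close>

lemma liouville_lift:
  assumes r: "r > 0" and u: "smooth_on (ball \<zeta>0 r) u"
    and L: "\<And>\<zeta>. \<zeta> \<in> ball \<zeta>0 r \<Longrightarrow> (pd 1 (pd 1 u) \<zeta> + pd \<i> (pd \<i> u) \<zeta>) * (exp (u \<zeta>))\<^sup>2 = k"
  obtains R A p1 p2 p3 q1 q2 where "R > 0" "R \<le> r"
    "mframe (ball \<zeta>0 R) A (\<lambda>\<zeta> w. exp (u \<zeta>) * Re w) (\<lambda>\<zeta> w. exp (u \<zeta>) * Im w) p1 p2 p3 q1 q2"
    "\<And>\<zeta>. \<zeta> \<in> ball \<zeta>0 R \<Longrightarrow> p1 \<zeta> + p3 \<zeta> = 0"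
proof -
  \<comment> \<open>h = u_zz + (u_z)^2, minus half the Schwarzian derivative of the quotient of two
    independent solutions.\<close>
  define h where "h \<zeta> = Complex ((pd 1 (pd 1 u) \<zeta> - pd \<i> (pd \<i> u) \<zeta> + (pd 1 u \<zeta>)\<^sup>2 - (pd \<i> u \<zeta>)\<^sup>2) / 4)
     (- (pd 1 (pd \<i> u) \<zeta> + pd 1 u \<zeta> * pd \<i> u \<zeta>) / 2)" for \<zeta>
  have "h holomorphic_on ball \<zeta>0 r" unfolding h_def[abs_def] by (rule liouville_schwarzian_holomorphic[OF open_ball u L])
  then obtain R where R: "R > 0" "R \<le> r" and
    sol: "\<And>a b. \<exists>w w'. w \<zeta>0 = a \<and> w' \<zeta>0 = b \<and> (\<forall>\<zeta>\<in>ball \<zeta>0 R. (w has_field_derivative w' \<zeta>) (at \<zeta>) \<and>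
       (w' has_field_derivative h \<zeta> * w \<zeta>) (at \<zeta>))" using linear_ode_solution r by metis
  define B where "B = ball \<zeta>0 R"
  have B: "open B" "convex B" "\<zeta>0 \<in> B" "B \<subseteq> ball \<zeta>0 r" using R by (auto simp: B_def)
  obtain w1 w1' where w1: "w1 \<zeta>0 = 0" "w1' \<zeta>0 = 1" "\<And>\<zeta>. \<zeta> \<in> B \<Longrightarrow> (w1 has_field_derivative w1' \<zeta>) (at \<zeta>) \<and>
       (w1' has_field_derivative h \<zeta> * w1 \<zeta>) (at \<zeta>)" using sol[of 0 1] unfolding B_def by blast
  obtain w2 w2' where w2: "w2 \<zeta>0 = 1" "w2' \<zeta>0 = 0" "\<And>\<zeta>. \<zeta> \<in> B \<Longrightarrow> (w2 has_field_derivative w2' \<zeta>) (at \<zeta>) \<and>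
       (w2' has_field_derivative h \<zeta> * w2 \<zeta>) (at \<zeta>)" using sol[of 1 0] unfolding B_def by blast
  have hol: "w1 holomorphic_on B" "w2 holomorphic_on B" using w1(3) w2(3) B(1) holomorphic_on_open by blast+
  have dw: "deriv w1 \<xi> = w1' \<xi>" "deriv w2 \<xi> = w2' \<xi>" if "\<xi> \<in> B" for \<xi>
    using w1(3)[OF that] w2(3)[OF that] DERIV_imp_deriv by blast+
  \<comment> \<open>The equation has no first-order term, so the Wronskian is constant; the initial
    values make it 1.\<close>
  have W: "deriv w1 \<zeta> * w2 \<zeta> - w1 \<zeta> * deriv w2 \<zeta> = 1" if z: "\<zeta> \<in> B" for \<zeta>
  proof -
    have "((\<lambda>\<zeta>. w1' \<zeta> * w2 \<zeta> - w1 \<zeta> * w2' \<zeta>) has_field_derivative 0) (at \<xi> within B)" if x: "\<xi> \<in> B" for \<xi>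
    proof (rule has_field_derivative_at_within)
      show "((\<lambda>\<zeta>. w1' \<zeta> * w2 \<zeta> - w1 \<zeta> * w2' \<zeta>) has_field_derivative 0) (at \<xi>)"
        using w1(3)[OF x] w2(3)[OF x] by (auto intro!: derivative_eq_intros simp: algebra_simps)
    qed
    from has_field_derivative_zero_constant[OF B(2) this]
    obtain c where c: "\<And>\<xi>. \<xi> \<in> B \<Longrightarrow> w1' \<xi> * w2 \<xi> - w1 \<xi> * w2' \<xi> = c" by blast
    have "c = 1" using c[OF B(3)] w1 w2 by simp
    then show ?thesis using c[OF z] dw[OF z] by simp
  qed
  define N where "N \<zeta> = null_lift (w1 \<zeta>) (w2 \<zeta>)" for \<zeta>
  have sN: "smooth_on B N" unfolding N_def
    by (rule smooth_on_null_lift[OF B(1)]) (use hol B smooth_on_holomorphic in auto)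
  have su: "smooth_on B u" by (rule smooth_on_subset[OF u B(4)])
  have se: "smooth_on B (\<lambda>\<zeta>. exp (u \<zeta>))" by (rule smooth_on_exp[OF B(1) su])
  have pe: "pd v (\<lambda>\<zeta>. exp (u \<zeta>)) \<zeta> = exp (u \<zeta>) * pd v u \<zeta>" if z: "\<zeta> \<in> B" for v \<zeta>
    using pd_eq[OF has_derivative_exp[OF has_derivative_pd[OF smooth_onD[OF su z]]]] by (simp add: mult.commute)
  \<comment> \<open>The second and third frame vectors are forced: with \<open>a1\<close> = e^u N
    and \<gamma> = 2 du, the equation for da1 leaves e^u (dN - N du) = \<alpha> \<open>a2\<close> -
    \<beta> \<open>a3\<close>.\<close>
  define E2 where "E2 \<zeta> = pd 1 N \<zeta> - pd 1 u \<zeta> *\<^sub>R N \<zeta>" for \<zeta>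
  define E3 where "E3 \<zeta> = pd \<i> u \<zeta> *\<^sub>R N \<zeta> - pd \<i> N \<zeta>" for \<zeta>
  note s1 = smooth_on_pd[OF sN] smooth_on_pd[OF su]
  note sc = smooth_on_scaleR[OF B(1) s1(2) sN]
  have sE: "smooth_on B E2" "smooth_on B E3" unfolding E2_def E3_def by (intro smooth_on_diff[OF B(1)] s1 sc)+
  have NZ: "pd 1 (pd 1 N) \<zeta> = pd \<i> (pd \<i> N) \<zeta> + (pd 1 (pd 1 u) \<zeta> - pd \<i> (pd \<i> u) \<zeta> + (pd 1 u \<zeta>)\<^sup>2 - (pd \<i> u \<zeta>)\<^sup>2) *\<^sub>R N \<zeta>"
    "pd 1 (pd \<i> N) \<zeta> = (pd 1 (pd \<i> u) \<zeta> + pd 1 u \<zeta> * pd \<i> u \<zeta>) *\<^sub>R N \<zeta>"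
    "pd \<i> (pd 1 N) \<zeta> = (pd 1 (pd \<i> u) \<zeta> + pd 1 u \<zeta> * pd \<i> u \<zeta>) *\<^sub>R N \<zeta>" if z: "\<zeta> \<in> B" for \<zeta>
  proof -
    note nd = null_lift_second_derivatives[OF B(1) w1(3) w2(3) z, folded N_def[abs_def]]
    show "pd 1 (pd 1 N) \<zeta> = pd \<i> (pd \<i> N) \<zeta> + (pd 1 (pd 1 u) \<zeta> - pd \<i> (pd \<i> u) \<zeta> + (pd 1 u \<zeta>)\<^sup>2 - (pd \<i> u \<zeta>)\<^sup>2) *\<^sub>R N \<zeta>"
      using nd(1) by (simp add: h_def N_def diff_eq_eq add.commute)
    show a: "pd 1 (pd \<i> N) \<zeta> = (pd 1 (pd \<i> u) \<zeta> + pd 1 u \<zeta> * pd \<i> u \<zeta>) *\<^sub>R N \<zeta>"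
      using nd(2) by (simp add: h_def N_def)
    show "pd \<i> (pd 1 N) \<zeta> = (pd 1 (pd \<i> u) \<zeta> + pd 1 u \<zeta> * pd \<i> u \<zeta>) *\<^sub>R N \<zeta>"
      using a pd_commute[OF sN B(1) z, of \<i> 1] by simp
  qed
  have pE: "pd v E2 \<zeta> = pd v (pd 1 N) \<zeta> - (pd 1 u \<zeta> *\<^sub>R pd v N \<zeta> + pd v (pd 1 u) \<zeta> *\<^sub>R N \<zeta>)"
    "pd v E3 \<zeta> = (pd \<i> u \<zeta> *\<^sub>R pd v N \<zeta> + pd v (pd \<i> u) \<zeta> *\<^sub>R N \<zeta>) - pd v (pd \<i> N) \<zeta>" if z: "\<zeta> \<in> B" for v \<zeta>
  proof -
    have "pd v (\<lambda>\<zeta>. pd w u \<zeta> *\<^sub>R N \<zeta>) \<zeta> = pd w u \<zeta> *\<^sub>R pd v N \<zeta> + pd v (pd w u) \<zeta> *\<^sub>R N \<zeta>" for w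
      by (rule pd_scaleR[OF smooth_onD[OF s1(2) z] smooth_onD[OF sN z]])
    then show "pd v E2 \<zeta> = pd v (pd 1 N) \<zeta> - (pd 1 u \<zeta> *\<^sub>R pd v N \<zeta> + pd v (pd 1 u) \<zeta> *\<^sub>R N \<zeta>)"
      "pd v E3 \<zeta> = (pd \<i> u \<zeta> *\<^sub>R pd v N \<zeta> + pd v (pd \<i> u) \<zeta> *\<^sub>R N \<zeta>) - pd v (pd \<i> N) \<zeta>"
      unfolding E2_def E3_def
      using pd_diff[OF smooth_onD[OF s1(1) z] smooth_onD[OF sc z]] pd_diff[OF smooth_onD[OF sc z] smooth_onD[OF s1(1) z]] by simp_all
  qed
  define X Y where "X \<zeta> = exp (u \<zeta>) *\<^sub>R E2 \<zeta>" and "Y \<zeta> = exp (u \<zeta>) *\<^sub>R E3 \<zeta>" for \<zeta>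
  have sXY: "smooth_on B X" "smooth_on B Y" unfolding X_def Y_def by (intro smooth_on_scaleR[OF B(1)] se sE)+
  have pXY: "pd v X \<zeta> = exp (u \<zeta>) *\<^sub>R (pd v E2 \<zeta> + pd v u \<zeta> *\<^sub>R E2 \<zeta>)"
    "pd v Y \<zeta> = exp (u \<zeta>) *\<^sub>R (pd v E3 \<zeta> + pd v u \<zeta> *\<^sub>R E3 \<zeta>)" if z: "\<zeta> \<in> B" for v \<zeta>
    unfolding X_def Y_def
    using pd_scaleR[OF smooth_onD[OF se z] smooth_onD[OF sE(1) z], of v] pd_scaleR[OF smooth_onD[OF se z] smooth_onD[OF sE(2) z], of v] pe[OF z, of v]
    by (simp_all add: scaleR_add_right)
  \<comment> \<open>\<open>c1\<close> says that X dx + Y dy is closed, \<open>c2\<close> that its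
    potential is harmonic. Together they are the Cauchy-Riemann equations of X - iY.\<close>
  have c1: "pd \<i> X \<zeta> = pd 1 Y \<zeta>" and c2: "pd \<i> Y \<zeta> = - pd 1 X \<zeta>" if z: "\<zeta> \<in> B" for \<zeta>
    unfolding pXY[OF z] pE[OF z] NZ[OF z] E2_def E3_def pd_commute[OF su B(1) z, of \<i> 1]
    by (simp_all add: vec4_eq_iff power2_eq_square algebra_simps)
  have "\<exists>g. \<forall>\<zeta>\<in>B. (g has_field_derivative Complex (X \<zeta> $ j) (- Y \<zeta> $ j)) (at \<zeta>)" for j
  proof -
    define f where "f \<zeta> = Complex (X \<zeta> $ j) (- Y \<zeta> $ j)" for \<zeta>
    note sj = smooth_on_nth[OF B(1) sXY(1), of j] smooth_on_nth[OF B(1) sXY(2), of j]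
    have sf: "smooth_on B f" unfolding f_def by (intro smooth_on_Complex B smooth_on_uminus sj)
    have df: "pd v f \<zeta> = Complex (pd v X \<zeta> $ j) (- pd v Y \<zeta> $ j)" if z: "\<zeta> \<in> B" for v \<zeta>
    proof -
      note d = smooth_onD[OF sf z]
      have "Re (pd v f \<zeta>) = pd v (\<lambda>\<zeta>. X \<zeta> $ j) \<zeta>" "Im (pd v f \<zeta>) = pd v (\<lambda>\<zeta>. - Y \<zeta> $ j) \<zeta>"
        using pd_bounded_linear[OF bounded_linear_Re d, of v] pd_bounded_linear[OF bounded_linear_Im d, of v] by (simp_all add: f_def)
      then show ?thesis using pd_uminus[OF smooth_onD[OF sj(2) z], of v]
        bounded_bilinear_nth_pd[OF smooth_onD[OF sXY(1) z], of v j] bounded_bilinear_nth_pd[OF smooth_onD[OF sXY(2) z], of v j]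
        by (simp add: complex_eq_iff)
    qed
    have "f holomorphic_on B"
    proof (rule holomorphic_on_CR[OF B(1) smooth_onD[OF sf]])
      fix \<zeta> assume z: "\<zeta> \<in> B"
      show "pd \<i> f \<zeta> = \<i> * pd 1 f \<zeta>" unfolding df[OF z] c1[OF z] c2[OF z] by (simp add: complex_eq_iff)
    qed
    then obtain g where "\<And>\<zeta>. \<zeta> \<in> B \<Longrightarrow> (g has_field_derivative f \<zeta>) (at \<zeta> within B)"
      using holomorphic_convex_primitive'[OF B(2,1)] by blast
    then show ?thesis using at_within_open[OF _ B(1)] unfolding f_def by (metis (no_types, lifting))
  qed
  then obtain G where G: "\<And>j \<zeta>. \<zeta> \<in> B \<Longrightarrow> (G j has_field_derivative Complex (X \<zeta> $ j) (- Y \<zeta> $ j)) (at \<zeta>)" by metis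
  have Ghol: "G j holomorphic_on B" for j using G B(1) holomorphic_on_open by blast
  define a0 :: "complex \<Rightarrow> real^4" where "a0 \<zeta> = (\<chi> j. Re (G j \<zeta>))" for \<zeta>
  have sa0: "smooth_on B a0"
    by (rule smooth_on_vec[OF B(1)]) (simp add: a0_def smooth_on_Re[OF B(1) smooth_on_holomorphic[OF B(1) Ghol]])
  have pa0: "pd v a0 \<zeta> = Re v *\<^sub>R X \<zeta> + Im v *\<^sub>R Y \<zeta>" if z: "\<zeta> \<in> B" for v \<zeta>
  proof -
    have "pd v a0 \<zeta> $ j = Re v * X \<zeta> $ j + Im v * Y \<zeta> $ j" for j
    proof -
      have "pd v a0 \<zeta> $ j = pd v (\<lambda>\<zeta>. Re (G j \<zeta>)) \<zeta>"
        using bounded_bilinear_nth_pd[OF smooth_onD[OF sa0 z], of v j] by (simp add: a0_def)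
      also have "\<dots> = Re (pd v (G j) \<zeta>)"
        by (rule pd_bounded_linear[OF bounded_linear_Re smooth_onD[OF smooth_on_holomorphic[OF B(1) Ghol] z]])
      also have "pd v (G j) \<zeta> = Complex (X \<zeta> $ j) (- Y \<zeta> $ j) * v"
        using pd_eq G[OF z, of j] unfolding has_field_derivative_def by blast
      finally show ?thesis by (simp add: algebra_simps)
    qed
    then show ?thesis by (simp add: vec_eq_iff)
  qed
  have pdN: "pd v N \<zeta> = null_polar (w1 \<zeta>) (w2 \<zeta>) (deriv w1 \<zeta> * v) (deriv w2 \<zeta> * v)" if "\<zeta> \<in> B" for v \<zeta>
    unfolding N_def by (rule pd_null_lift[OF B(1) that hol])
  have NN: "mink (N \<zeta>) (N \<zeta>) = 0" "mink (N \<zeta>) (pd v N \<zeta>) = 0" "mink (pd v N \<zeta>) (N \<zeta>) = 0" "mink (pd 1 N \<zeta>) (pd 1 N \<zeta>) = 1" "mink (pd 1 N \<zeta>) (pd \<i> N \<zeta>) = 0"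
    "mink (pd \<i> N \<zeta>) (pd 1 N \<zeta>) = 0" "mink (pd \<i> N \<zeta>) (pd \<i> N \<zeta>) = 1" if z: "\<zeta> \<in> B" for v \<zeta>
    unfolding pdN[OF z] unfolding N_def using null_lift_rel[OF W[OF z]] by (simp_all add: mink_commute)
  define l where "l \<zeta> = complex_of_real (exp (u \<zeta>))" for \<zeta>
  have sl: "smooth_on B l" unfolding l_def by (rule smooth_on_of_real[OF B(1) se])
  have lv: "norm (l \<zeta>) = exp (u \<zeta>)" "(l \<zeta>)\<^sup>2 = complex_of_real (exp (u \<zeta>) * exp (u \<zeta>))" "l \<zeta> \<noteq> 0" "Re (l \<zeta>) = exp (u \<zeta>)" "Im (l \<zeta>) = 0" for \<zeta>
    unfolding l_def power2_eq_square norm_of_real of_real_mult by simp_all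
  have p: "pd 1 a0 \<zeta> = X \<zeta>" "pd \<i> a0 \<zeta> = Y \<zeta>" if "\<zeta> \<in> B" for \<zeta> using pa0[OF that] by simp_all
  obtain A p1 p2 p3 q1 q2 where A: "mframe B A (\<lambda>\<zeta> w. Re (l \<zeta> * w)) (\<lambda>\<zeta> w. Im (l \<zeta> * w)) p1 p2 p3 q1 q2"
    "\<And>\<zeta>. column 2 (snd (A \<zeta>)) = (1 / (norm (l \<zeta>) * norm (l \<zeta>))) *\<^sub>R (Re (l \<zeta>) *\<^sub>R pd 1 a0 \<zeta> - Im (l \<zeta>) *\<^sub>R pd \<i> a0 \<zeta>)"
    "\<And>\<zeta>. column 3 (snd (A \<zeta>)) = (1 / (norm (l \<zeta>) * norm (l \<zeta>))) *\<^sub>R (Im (l \<zeta>) *\<^sub>R pd 1 a0 \<zeta> + Re (l \<zeta>) *\<^sub>R pd \<i> a0 \<zeta>)"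
  proof (rule middle_frame_of_null_lift[of B w1 w2 l a0, folded N_def[abs_def], folded N_def])
    show "mink (pd w a0 \<zeta>) (N \<zeta>) = 0" if "\<zeta> \<in> B" for w \<zeta>
      unfolding pa0[OF that] X_def Y_def E2_def E3_def by (simp add: mink_simps NN[OF that])
    show "norm (l \<zeta>) * mink (pd 1 a0 \<zeta>) (pd 1 N \<zeta>) = Re ((l \<zeta>)\<^sup>2)"
      "norm (l \<zeta>) * mink (pd 1 a0 \<zeta>) (pd \<i> N \<zeta>) = - Im ((l \<zeta>)\<^sup>2)"
      "norm (l \<zeta>) * mink (pd \<i> a0 \<zeta>) (pd 1 N \<zeta>) = - Im ((l \<zeta>)\<^sup>2)"
      "norm (l \<zeta>) * mink (pd \<i> a0 \<zeta>) (pd \<i> N \<zeta>) = - Re ((l \<zeta>)\<^sup>2)" if "\<zeta> \<in> B" for \<zeta>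
      unfolding lv p[OF that] X_def Y_def E2_def E3_def by (simp_all add: mink_simps NN[OF that])
  qed (use B hol W sl lv(3) sa0 in \<open>auto simp: N_def\<close>)
  have a2: "column 2 (snd (A \<zeta>)) = E2 \<zeta>" and a3: "column 3 (snd (A \<zeta>)) = E3 \<zeta>" if z: "\<zeta> \<in> B" for \<zeta>
    unfolding A lv p[OF z] X_def Y_def by simp_all
  interpret F: middle_coord_frame B A "\<lambda>\<zeta> w. Re (l \<zeta> * w)" "\<lambda>\<zeta> w. Im (l \<zeta> * w)" p1 p2 p3 q1 q2
    by (rule middle_coord_frame.intro[OF A(1)])
  have P0: "p1 \<zeta> + p3 \<zeta> = 0" if z: "\<zeta> \<in> B" for \<zeta>
  proof -
    define a4 where "a4 = column 4 (snd (A \<zeta>))"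
    note R = frame_relD[OF F.rel[OF z]]
    have q: "pd v (\<lambda>\<zeta>. column 2 (snd (A \<zeta>))) \<zeta> = pd v E2 \<zeta>" "pd v (\<lambda>\<zeta>. column 3 (snd (A \<zeta>))) \<zeta> = pd v E3 \<zeta>" for v
      by (rule pd_cong_open[OF B(1) z]; simp add: a2 a3)+
    have "mink (pd 1 E2 \<zeta>) a4 = - (p1 \<zeta> * exp (u \<zeta>))" "mink (pd \<i> E3 \<zeta>) a4 = - (p3 \<zeta> * exp (u \<zeta>))"
      using F.da2[OF z, of 1] F.da3[OF z, of \<i>] R unfolding q a4_def by (simp_all add: mink_simps lv)
    \<comment> \<open>The coefficients \<open>p1\<close> and \<open>p3\<close> appear only in the
      \<open>a1\<close> component of the derivatives of \<open>a2\<close> and \<open>a3\<close>.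
      Here the sum is a combination of \<open>E2\<close> and \<open>E3\<close>, so its pairing with
      \<open>a4\<close>, a multiple of \<open>p1 + p3\<close>, vanishes.\<close>
    moreover have "pd 1 E2 \<zeta> + pd \<i> E3 \<zeta> = - pd 1 u \<zeta> *\<^sub>R E2 \<zeta> - pd \<i> u \<zeta> *\<^sub>R E3 \<zeta>"
      unfolding pE[OF z] NZ[OF z] E2_def E3_def by (simp add: vec4_eq_iff power2_eq_square algebra_simps)
    then have "mink (pd 1 E2 \<zeta> + pd \<i> E3 \<zeta>) a4 = - pd 1 u \<zeta> * mink (E2 \<zeta>) a4 - pd \<i> u \<zeta> * mink (E3 \<zeta>) a4"
      by (simp add: mink_simps)
    moreover have "mink (E2 \<zeta>) a4 = 0" "mink (E3 \<zeta>) a4 = 0" using R a2[OF z] a3[OF z] unfolding a4_def by simp_all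
    ultimately have "(p1 \<zeta> + p3 \<zeta>) * exp (u \<zeta>) = 0" by (simp add: mink_simps algebra_simps)
    then show ?thesis by simp
  qed
  have "mframe B A (\<lambda>\<zeta> w. exp (u \<zeta>) * Re w) (\<lambda>\<zeta> w. exp (u \<zeta>) * Im w) p1 p2 p3 q1 q2"
    by (rule mframe_cong[THEN iffD1, OF B(1) _ A(1)]) (simp add: lv)
  then show thesis using that R P0 unfolding B_def by blast
qed

section \<open>Holomorphic quartic differentials\<close>

text \<open>By \<open>Q_CR_iff_P_CR\<close> the Cauchy-Riemann defects of Q l^4 and P l^2 are, up to
  conjugation, nonvanishing multiples of each other.\<close>

lemma mframe_conformal:
  assumes A: "mframe D A (\<lambda>\<zeta> w. Re (l \<zeta> * w)) (\<lambda>\<zeta> w. Im (l \<zeta> * w)) p1 p2 p3 q1 q2"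
  shows "smooth_on D l" "smooth_on D p1" "smooth_on D p2" "smooth_on D p3" "\<And>\<zeta>. \<zeta> \<in> D \<Longrightarrow> l \<zeta> \<noteq> 0"
    "(\<lambda>\<zeta>. Complex ((p1 \<zeta> - p3 \<zeta>) / 2) (- p2 \<zeta>) * l \<zeta> ^ 4) holomorphic_on D \<longleftrightarrow>
      (\<lambda>\<zeta>. of_real (p1 \<zeta> + p3 \<zeta>) * l \<zeta> ^ 2) holomorphic_on D"
proof -
  interpret F: middle_coord_frame D A "\<lambda>\<zeta> w. Re (l \<zeta> * w)" "\<lambda>\<zeta> w. Im (l \<zeta> * w)" p1 p2 p3 q1 q2
    by (rule middle_coord_frame.intro[OF A])
  note D = F.oD
  show sl: "smooth_on D l" by (rule F.smooth_l[OF refl refl])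
  show sp: "smooth_on D p1" "smooth_on D p2" "smooth_on D p3" by (rule F.smooth_p[OF refl refl])+
  show lnz: "l \<zeta> \<noteq> 0" if "\<zeta> \<in> D" for \<zeta> by (rule F.l_nz[OF refl refl that])
  have sPQ: "smooth_on D F.P" "smooth_on D F.Q" by (rule F.smooth_PQ[OF refl refl])+
  have sh: "smooth_on D (\<lambda>\<zeta>. F.Q \<zeta> * l \<zeta> ^ 4)" by (intro smooth_on_mult[OF D] smooth_on_power[OF D] sl sPQ)
  have sg: "smooth_on D (\<lambda>\<zeta>. of_real (F.P \<zeta>) * l \<zeta> ^ 2)" by (intro smooth_on_mult[OF D] smooth_on_power[OF D] smooth_on_of_real[OF D] sl sPQ)
  have CR: "cnj (l \<zeta>) * (\<i> * pd 1 (\<lambda>\<zeta>. F.Q \<zeta> * l \<zeta> ^ 4) \<zeta> - pd \<i> (\<lambda>\<zeta>. F.Q \<zeta> * l \<zeta> ^ 4) \<zeta>) =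
    l \<zeta> ^ 3 / 2 * cnj (pd \<i> (\<lambda>\<zeta>. of_real (F.P \<zeta>) * l \<zeta> ^ 2) \<zeta> - \<i> * pd 1 (\<lambda>\<zeta>. of_real (F.P \<zeta>) * l \<zeta> ^ 2) \<zeta>)" if "\<zeta> \<in> D" for \<zeta>
    by (rule F.Q_CR_iff_P_CR[OF refl refl that])
  have "(\<lambda>\<zeta>. F.Q \<zeta> * l \<zeta> ^ 4) holomorphic_on D \<longleftrightarrow> (\<lambda>\<zeta>. of_real (F.P \<zeta>) * l \<zeta> ^ 2) holomorphic_on D"
  proof
    assume h: "(\<lambda>\<zeta>. F.Q \<zeta> * l \<zeta> ^ 4) holomorphic_on D"
    show "(\<lambda>\<zeta>. of_real (F.P \<zeta>) * l \<zeta> ^ 2) holomorphic_on D"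
    proof (rule holomorphic_on_CR[OF D smooth_onD[OF sg]])
      fix \<zeta> assume z: "\<zeta> \<in> D"
      show "pd \<i> (\<lambda>\<zeta>. of_real (F.P \<zeta>) * l \<zeta> ^ 2) \<zeta> = \<i> * pd 1 (\<lambda>\<zeta>. of_real (F.P \<zeta>) * l \<zeta> ^ 2) \<zeta>"
      proof -
        define E where "E = pd \<i> (\<lambda>\<zeta>. of_real (F.P \<zeta>) * l \<zeta> ^ 2) \<zeta> - \<i> * pd 1 (\<lambda>\<zeta>. of_real (F.P \<zeta>) * l \<zeta> ^ 2) \<zeta>"
        have "cnj E = 0" using CR[OF z, folded E_def] holomorphic_on_imp_CR[OF h D z] lnz[OF z] by simp
        then have "E = 0" by simp
        then show ?thesis by (simp add: E_def)
      qed
    qed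
  next
    assume h: "(\<lambda>\<zeta>. of_real (F.P \<zeta>) * l \<zeta> ^ 2) holomorphic_on D"
    show "(\<lambda>\<zeta>. F.Q \<zeta> * l \<zeta> ^ 4) holomorphic_on D"
    proof (rule holomorphic_on_CR[OF D smooth_onD[OF sh]])
      fix \<zeta> assume z: "\<zeta> \<in> D"
      show "pd \<i> (\<lambda>\<zeta>. F.Q \<zeta> * l \<zeta> ^ 4) \<zeta> = \<i> * pd 1 (\<lambda>\<zeta>. F.Q \<zeta> * l \<zeta> ^ 4) \<zeta>"
        using CR[OF z] holomorphic_on_imp_CR[OF h D z] lnz[OF z] by simp
    qed
  qed
  then show "(\<lambda>\<zeta>. Complex ((p1 \<zeta> - p3 \<zeta>) / 2) (- p2 \<zeta>) * l \<zeta> ^ 4) holomorphic_on D \<longleftrightarrow>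
      (\<lambda>\<zeta>. of_real (p1 \<zeta> + p3 \<zeta>) * l \<zeta> ^ 2) holomorphic_on D"
    unfolding F.Q_def[abs_def] F.P_def[abs_def] .
qed

lemma mframe_isothermic:
  assumes A: "mframe D A \<alpha> \<beta> p1 p2 p3 q1 q2"
    and iso: "\<And>\<zeta> w. \<zeta> \<in> D \<Longrightarrow> \<alpha> \<zeta> w = exp (u \<zeta>) * Re w" "\<And>\<zeta> w. \<zeta> \<in> D \<Longrightarrow> \<beta> \<zeta> w = exp (u \<zeta>) * Im w"
  shows "smooth_on D u" "\<And>\<zeta>. \<zeta> \<in> D \<Longrightarrow> p2 \<zeta> = 0"
    "\<And>\<zeta>. \<zeta> \<in> D \<Longrightarrow> pd 1 (pd 1 u) \<zeta> + pd \<i> (pd \<i> u) \<zeta> = (p3 \<zeta> - p1 \<zeta>) * (exp (u \<zeta>))\<^sup>2"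
proof -
  interpret F: middle_coord_frame D A \<alpha> \<beta> p1 p2 p3 q1 q2
    by (rule middle_coord_frame.intro[OF A])
  show "smooth_on D u" by (rule F.smooth_u[OF iso])
  show "p2 \<zeta> = 0" if "\<zeta> \<in> D" for \<zeta> by (rule F.isothermic_p2[OF iso that])
  show "pd 1 (pd 1 u) \<zeta> + pd \<i> (pd \<i> u) \<zeta> = (p3 \<zeta> - p1 \<zeta>) * (exp (u \<zeta>))\<^sup>2" if "\<zeta> \<in> D" for \<zeta>
    by (rule F.isothermic_laplacian[OF iso that])
qed

text \<open>Near a zero of \<open>P\<close> the values of \<open>(P l\<^sup>2)\<^sup>2\<close> lie, up to a constant factor, in the right half-plane,
  so the maximum principle applies to \<open>exp (- (P l\<^sup>2)\<^sup>2)\<close>.\<close>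

lemma real_times_square_zero:
  fixes P :: "complex \<Rightarrow> real" and l :: "complex \<Rightarrow> complex"
  assumes D: "open D" and g: "(\<lambda>\<zeta>. of_real (P \<zeta>) * l \<zeta> ^ 2) holomorphic_on D" and l: "continuous_on D l" "\<And>\<zeta>. \<zeta> \<in> D \<Longrightarrow> l \<zeta> \<noteq> 0"
    and z0: "\<zeta>0 \<in> D" "P \<zeta>0 = 0"
  obtains e where "e > 0" "ball \<zeta>0 e \<subseteq> D" "\<And>\<zeta>. \<zeta> \<in> ball \<zeta>0 e \<Longrightarrow> P \<zeta> = 0"
proof -
  \<comment> \<open>Normalised to 1 at the zero, so its real part stays positive nearby; (P l^2)^2
    is P^2 k up to the constant l(\<zeta>0)^4.\<close>
  define k where "k \<zeta> = (l \<zeta> / l \<zeta>0) ^ 4" for \<zeta>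
  have l0: "l \<zeta>0 \<noteq> 0" using l(2) z0 by blast
  have "continuous_on D k" unfolding k_def by (intro continuous_intros l(1)) (use l0 in auto)
  then have "continuous (at \<zeta>0) k" using D z0 continuous_on_eq_continuous_at by blast
  then obtain d where d: "d > 0" "\<And>\<zeta>. dist \<zeta> \<zeta>0 < d \<Longrightarrow> dist (k \<zeta>) (k \<zeta>0) < 1"
    unfolding continuous_at_eps_delta by (meson zero_less_one)
  have k0: "k \<zeta>0 = 1" using l0 by (simp add: k_def)
  obtain d' where d': "d' > 0" "ball \<zeta>0 d' \<subseteq> D" using D z0 open_contains_ball by blast
  define e where "e = min d d'"
  define B where "B = ball \<zeta>0 e"
  have e: "e > 0" "B \<subseteq> D" using d d' by (auto simp: e_def B_def)
  have Rk: "Re (k \<zeta>) > 0" if "\<zeta> \<in> B" for \<zeta>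
  proof -
    have "dist \<zeta> \<zeta>0 < d" using that by (simp add: B_def e_def dist_commute)
    from d(2)[OF this] have "norm (k \<zeta> - 1) < 1" unfolding k0 by (simp add: dist_norm)
    then show ?thesis using abs_Re_le_cmod[of "k \<zeta> - 1"] by simp
  qed
  define H where "H \<zeta> = exp (- ((of_real (P \<zeta>) * l \<zeta> ^ 2) / (l \<zeta>0)\<^sup>2)\<^sup>2)" for \<zeta>
  define G where "G \<zeta> = of_real (P \<zeta>) * l \<zeta> ^ 2" for \<zeta>
  have "G holomorphic_on B" unfolding G_def by (rule holomorphic_on_subset[OF g e(2)])
  then have Hh: "H holomorphic_on B" unfolding H_def G_def[symmetric]
    by (intro holomorphic_intros) (use l0 in auto)
  have e4: "((of_real (P \<zeta>) * l \<zeta> ^ 2) / (l \<zeta>0)\<^sup>2)\<^sup>2 = of_real ((P \<zeta>)\<^sup>2) * k \<zeta>" for \<zeta>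
    by (simp add: k_def power_mult_distrib power_divide flip: power_mult)
  have nH: "norm (H \<zeta>) = exp (- ((P \<zeta>)\<^sup>2 * Re (k \<zeta>)))" for \<zeta> unfolding H_def e4 by (simp del: of_real_power)
  have "H constant_on B"
  proof (rule maximum_modulus_principle[OF Hh, of B \<zeta>0])
    show "norm (H \<zeta>) \<le> norm (H \<zeta>0)" if "\<zeta> \<in> B" for \<zeta>
      unfolding nH using z0 Rk[OF that] by simp
  qed (use e in \<open>auto simp: B_def\<close>)
  then obtain c where c: "\<And>\<zeta>. \<zeta> \<in> B \<Longrightarrow> H \<zeta> = c" by (auto simp: constant_on_def)
  have "P \<zeta> = 0" if z: "\<zeta> \<in> B" for \<zeta>
  proof -
    have "\<zeta>0 \<in> B" using e by (simp add: B_def)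
    then have "norm (H \<zeta>) = norm (H \<zeta>0)" using c[OF z] c[of \<zeta>0] by simp
    then show ?thesis unfolding nH using z0 Rk[OF z] by simp
  qed
  then show thesis using that e unfolding B_def by blast
qed

text \<open>The derivative f' and i f', the derivatives along 1 and \<open>\<i>\<close>, are both
  real, hence f' = 0.\<close>

lemma holomorphic_real_constant:
  assumes B: "open B" "convex B" and f: "f holomorphic_on B" and r: "\<And>\<zeta>. \<zeta> \<in> B \<Longrightarrow> Im (f \<zeta>) = 0"
  obtains c where "\<And>\<zeta>. \<zeta> \<in> B \<Longrightarrow> f \<zeta> = c"
proof -
  have "(f has_field_derivative 0) (at \<zeta> within B)" if z: "\<zeta> \<in> B" for \<zeta>
  proof -
    note d = smooth_onD[OF smooth_on_holomorphic[OF B(1) f] z]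
    have "Im (pd v f \<zeta>) = 0" for v
    proof -
      have "Im (pd v f \<zeta>) = pd v (\<lambda>\<zeta>. Im (f \<zeta>)) \<zeta>" by (rule pd_bounded_linear[OF bounded_linear_Im d, symmetric])
      also have "\<dots> = pd v (\<lambda>\<zeta>. 0) \<zeta>" by (rule pd_cong_open[OF B(1) z]) (rule r)
      finally show ?thesis by simp
    qed
    from this[of 1] this[of \<i>] have "deriv f \<zeta> = 0"
      unfolding pd_holomorphic[OF f B(1) z] by (simp add: complex_eq_iff)
    then show ?thesis using holomorphic_derivI[OF f B(1) z] has_field_derivative_at_within by fastforce
  qed
  then have "\<exists>c. \<forall>\<zeta>\<in>B. f \<zeta> = c" by (rule has_field_derivative_zero_constant[OF B(2)])
  then show thesis using that by blast
qed

section \<open>Passage to the surface\<close>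

context
  fixes \<A> :: "'m::topological_space chart set"
  assumes surf: "smooth_surface \<A>"
begin

lemma chart_continuous: "(U, z) \<in> charts \<A> \<Longrightarrow> continuous_on U z"
  using chartsD[OF surf, of U z] unfolding is_chart_def homeomorphism_def by simp

lemma chart_preimage:
  assumes c: "(U, z) \<in> charts \<A>" and W: "open W"
  shows "open (U \<inter> z -` W)"
  by (rule continuous_open_preimage[OF chart_continuous[OF c] charts_open[OF surf c] W])

lemma chart_restrict_image:
  assumes c: "(U, z) \<in> charts \<A>" and W: "open W" "W \<subseteq> z ` U"
  shows "(U \<inter> z -` W, z) \<in> charts \<A>" "z ` (U \<inter> z -` W) = W"
proof -
  show "(U \<inter> z -` W, z) \<in> charts \<A>" by (rule chart_restrict[OF surf c chart_preimage[OF c W(1)]]) simp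
  show "z ` (U \<inter> z -` W) = W" using W(2) by auto
qed

lemma chart_from_diffeo:
  assumes c: "(U, z0) \<in> charts \<A>" and W: "open W" "W \<subseteq> z0 ` U" and q: "q \<in> U" "z0 q \<in> W"
    and T: "smooth_on W T" and inj: "inj (\<lambda>v. pd v T (z0 q))"
  obtains V r where "q \<in> V" "V \<subseteq> U" "r > 0" "(V, T \<circ> z0) \<in> charts \<A>" "(T \<circ> z0) ` V = ball ((T \<circ> z0) q) r" "\<And>x. x \<in> V \<Longrightarrow> z0 x \<in> W"
proof -
  obtain U1 r g where U1: "open U1" "z0 q \<in> U1" "U1 \<subseteq> W" "r > 0" "homeomorphism U1 (ball (T (z0 q)) r) T g"
    "smooth_on (ball (T (z0 q)) r) g" by (rule local_diffeo[OF W(1) q(2) T inj])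
  define V where "V = U \<inter> z0 -` U1"
  have oV: "open V" unfolding V_def by (rule chart_preimage[OF c U1(1)])
  have zV: "z0 ` V = U1" using U1(3) W(2) unfolding V_def by auto
  have VU: "V \<subseteq> U" by (simp add: V_def)
  have h: "homeomorphism (z0 ` V) (ball (T (z0 q)) r) T g" unfolding zV by (rule U1(5))
  have sT: "smooth_on (z0 ` V) T" unfolding zV by (rule smooth_on_subset[OF T U1(3)])
  note nc = new_chart[OF surf c oV VU open_ball h sT U1(6)]
  show thesis
    by (rule that[OF _ VU U1(4) nc(1)]) (use nc(2) q U1 in \<open>auto simp: V_def\<close>)
qed

lemma middle_frame_of_mframe:
  assumes c: "(V, z) \<in> charts \<A>" and A: "mframe (z ` V) A \<alpha> \<beta> p1 p2 p3 q1 q2"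
    and ln: "\<And>x. x \<in> V \<Longrightarrow> lag_line (F x) = isotropic_line (fst (A (z x))) (column 1 (snd (A (z x))))"
  shows "middle_frame \<A> (V, z) F (\<lambda>x. A (z x)) (\<lambda>x. \<alpha> (z x)) (\<lambda>x. \<beta> (z x)) (\<lambda>x. p1 (z x)) (\<lambda>x. p2 (z x)) (\<lambda>x. p3 (z x)) (\<lambda>x. q1 (z x)) (\<lambda>x. q2 (z x))"
  unfolding middle_frame_iff[OF surf c]
proof
  have oz: "open (z ` V)" using A by (simp add: mframe_def)
  show "mframe (z ` V) (\<lambda>\<zeta>. A (z (inv_into V z \<zeta>))) (\<lambda>\<zeta>. \<alpha> (z (inv_into V z \<zeta>))) (\<lambda>\<zeta>. \<beta> (z (inv_into V z \<zeta>)))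
     (\<lambda>\<zeta>. p1 (z (inv_into V z \<zeta>))) (\<lambda>\<zeta>. p2 (z (inv_into V z \<zeta>))) (\<lambda>\<zeta>. p3 (z (inv_into V z \<zeta>))) (\<lambda>\<zeta>. q1 (z (inv_into V z \<zeta>))) (\<lambda>\<zeta>. q2 (z (inv_into V z \<zeta>)))"
    by (rule mframe_cong[THEN iffD1, OF oz _ A]) (simp add: f_inv_into_f)
qed (use ln in blast)

text \<open>Local existence of middle frames with \<phi> = l dz. In particular complex charts exist
  around every point, so that \<open>Q_holomorphic\<close> is never a vacuous condition.\<close>

lemma conformal_frame_exists:
  assumes leg: "legendre_immersion \<A> UNIV F" and nd: "nondegenerate \<A> UNIV F"
  obtains V z r A l p1 p2 p3 q1 q2 where "q \<in> V" "r > 0" "z ` V = ball (z q) r"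
    "middle_frame \<A> (V, z) F A (\<lambda>x w. Re (l x * w)) (\<lambda>x w. Im (l x * w)) p1 p2 p3 q1 q2"
proof -
  have sF: "smooth_fun_on \<A> UNIV F" using leg by (simp add: legendre_immersion_def)
  have sph: "snd (F x) \<in> sphere 0 1" for x
  proof -
    have "F x \<in> UNIV \<times> sphere 0 1" using leg by (auto simp: legendre_immersion_def)
    then show ?thesis by (simp add: mem_Times_iff)
  qed
  have coord: "smooth_on (z ` U) (\<lambda>\<zeta>. fst (F (inv_into U z \<zeta>)))" "smooth_on (z ` U) (\<lambda>\<zeta>. snd (F (inv_into U z \<zeta>)))"
    "\<And>\<zeta> w. \<zeta> \<in> z ` U \<Longrightarrow> pd w (\<lambda>\<zeta>. fst (F (inv_into U z \<zeta>))) \<zeta> \<bullet> snd (F (inv_into U z \<zeta>)) = 0"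
    "\<And>\<zeta> w. \<zeta> \<in> z ` U \<Longrightarrow> w \<noteq> 0 \<Longrightarrow> pd w (\<lambda>\<zeta>. snd (F (inv_into U z \<zeta>))) \<zeta> \<bullet> pd w (\<lambda>\<zeta>. snd (F (inv_into U z \<zeta>))) \<zeta> > 0"
    "\<And>\<zeta> r s. \<zeta> \<in> z ` U \<Longrightarrow> \<forall>w. r * (pd w (\<lambda>\<zeta>. fst (F (inv_into U z \<zeta>))) \<zeta> \<bullet> pd w (\<lambda>\<zeta>. snd (F (inv_into U z \<zeta>))) \<zeta>)
       + s * (pd w (\<lambda>\<zeta>. snd (F (inv_into U z \<zeta>))) \<zeta> \<bullet> pd w (\<lambda>\<zeta>. snd (F (inv_into U z \<zeta>))) \<zeta>) = 0 \<Longrightarrow> r = 0 \<and> s = 0"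
    if c: "(U, z) \<in> charts \<A>" for U z
  proof -
    have oz: "open (z ` U)" using charts_open_image[OF surf c charts_open[OF surf c]] by simp
    have s: "smooth_on (z ` U) (\<lambda>\<zeta>. F (inv_into U z \<zeta>))" using smooth_fun_onD[OF surf sF c] by simp
    show "smooth_on (z ` U) (\<lambda>\<zeta>. fst (F (inv_into U z \<zeta>)))" "smooth_on (z ` U) (\<lambda>\<zeta>. snd (F (inv_into U z \<zeta>)))"
      by (rule smooth_on_fst[OF oz s] smooth_on_snd[OF oz s])+
    have d: "dif (U, z) (fst \<circ> F) x w = pd w (\<lambda>\<zeta>. fst (F (inv_into U z \<zeta>))) (z x)"
      "dif (U, z) (snd \<circ> F) x w = pd w (\<lambda>\<zeta>. snd (F (inv_into U z \<zeta>))) (z x)" for x w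
      unfolding dif_pd[OF surf] by simp_all
    fix \<zeta> assume "\<zeta> \<in> z ` U"
    then obtain x where x: "x \<in> U" "\<zeta> = z x" by blast
    note iv = charts_inv[OF surf c x(1)]
    have l: "\<forall>w. dif (U, z) (fst \<circ> F) x w \<bullet> snd (F x) = 0" "\<forall>w. w \<noteq> 0 \<longrightarrow> dif (U, z) (snd \<circ> F) x w \<bullet> dif (U, z) (snd \<circ> F) x w > 0"
      using leg c x(1) unfolding legendre_immersion_def by fastforce+
    have xx: "x \<in> fst (U, z) \<inter> UNIV" using x(1) by simp
    have n: "\<forall>r s. (\<forall>w. r * (dif (U, z) (fst \<circ> F) x w \<bullet> dif (U, z) (snd \<circ> F) x w) + s * (dif (U, z) (snd \<circ> F) x w \<bullet> dif (U, z) (snd \<circ> F) x w) = 0)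
        \<longrightarrow> r = 0 \<and> s = 0" by (rule bspec[OF bspec[OF nd[unfolded nondegenerate_def] c] xx])
    show "pd w (\<lambda>\<zeta>. fst (F (inv_into U z \<zeta>))) \<zeta> \<bullet> snd (F (inv_into U z \<zeta>)) = 0" for w
      using l(1) unfolding d x(2) iv by blast
    show "pd w (\<lambda>\<zeta>. snd (F (inv_into U z \<zeta>))) \<zeta> \<bullet> pd w (\<lambda>\<zeta>. snd (F (inv_into U z \<zeta>))) \<zeta> > 0" if "w \<noteq> 0" for w
      using l(2) that unfolding d x(2) by blast
    show "r = 0 \<and> s = 0" if "\<forall>w. r * (pd w (\<lambda>\<zeta>. fst (F (inv_into U z \<zeta>))) \<zeta> \<bullet> pd w (\<lambda>\<zeta>. snd (F (inv_into U z \<zeta>))) \<zeta>)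
       + s * (pd w (\<lambda>\<zeta>. snd (F (inv_into U z \<zeta>))) \<zeta> \<bullet> pd w (\<lambda>\<zeta>. snd (F (inv_into U z \<zeta>))) \<zeta>) = 0" for r s
      using n that unfolding d x(2) by blast
  qed
  obtain U z0 where c0: "(U, z0) \<in> charts \<A>" "q \<in> U" using charts_cover[OF surf] by blast
  have oz: "open (z0 ` U)" using charts_open_image[OF surf c0(1) charts_open[OF surf c0(1)]] by simp
  have zq: "z0 q \<in> z0 ` U" using c0 by blast
  obtain W T c w1 w2 where W: "open W" "z0 q \<in> W" "W \<subseteq> z0 ` U" and T: "smooth_on W (T :: complex \<Rightarrow> complex)" and sc: "smooth_on W c"
    and w: "w1 holomorphic_on UNIV" "w2 holomorphic_on UNIV" "\<And>\<zeta>. deriv w1 \<zeta> * w2 \<zeta> - w1 \<zeta> * deriv w2 \<zeta> = 1"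
    and cN: "\<And>\<zeta>. \<zeta> \<in> W \<Longrightarrow> c \<zeta> \<noteq> 0 \<and> dir_of (snd (F (inv_into U z0 \<zeta>))) = c \<zeta> *\<^sub>R null_lift (w1 (T \<zeta>)) (w2 (T \<zeta>))"
    and inj: "\<And>\<zeta>. \<zeta> \<in> W \<Longrightarrow> inj (\<lambda>v. pd v T \<zeta>)"
    by (rule gauss_coordinate[OF oz coord(2)[OF c0(1)] sph coord(4)[OF c0(1)] zq]) blast+
  obtain V r where V: "q \<in> V" "V \<subseteq> U" "r > 0" "(V, T \<circ> z0) \<in> charts \<A>" "(T \<circ> z0) ` V = ball ((T \<circ> z0) q) r" "\<And>x. x \<in> V \<Longrightarrow> z0 x \<in> W"
    by (rule chart_from_diffeo[OF c0(1) W(1,3) c0(2) W(2) T inj[OF W(2)]]) blast+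
  \<comment> \<open>In this chart the Gauss coordinate is the identity, and the spinor is evaluated
    at the coordinate itself.\<close>
  define z where "z = T \<circ> z0"
  note V' = V(4,5)[folded z_def]
  note co = coord[OF V'(1), unfolded V'(2)]
  define c' where "c' \<zeta> = c (z0 (inv_into V z \<zeta>))" for \<zeta>
  have VU: "V \<inter> U = V" using V(2) by blast
  have iv: "inv_into V z (z x) = x" if "x \<in> V" for x using charts_inv[OF surf V'(1) that] .
  have sc': "smooth_on (ball (z q) r) c'" unfolding c'_def
  proof (rule smooth_on_compose[OF open_ball _ sc])
    show "smooth_on (ball (z q) r) (\<lambda>\<zeta>. z0 (inv_into V z \<zeta>))"
      using transition_smooth[OF surf V'(1) c0(1)] unfolding VU V'(2) .
    show "(\<lambda>\<zeta>. z0 (inv_into V z \<zeta>)) ` ball (z q) r \<subseteq> W" unfolding V'(2)[symmetric] using V(6) iv by auto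
  qed
  have cN': "c' \<zeta> \<noteq> 0 \<and> dir_of (snd (F (inv_into V z \<zeta>))) = c' \<zeta> *\<^sub>R null_lift (w1 \<zeta>) (w2 \<zeta>)" if zb: "\<zeta> \<in> ball (z q) r" for \<zeta>
  proof -
    obtain x where x: "x \<in> V" "\<zeta> = z x" using zb unfolding V'(2)[symmetric] by blast
    have "inv_into U z0 (z0 x) = x" by (rule charts_inv[OF surf c0(1)]) (use x V in blast)
    then show ?thesis using cN[OF V(6)[OF x(1)]] iv[OF x(1)] x by (simp add: c'_def z_def)
  qed
  have wB: "w1 holomorphic_on ball (z q) r" "w2 holomorphic_on ball (z q) r" using w holomorphic_on_subset by blast+
  obtain r' l A p1 p2 p3 q1 q2 where R: "r' > 0" "r' \<le> r"
    and A: "mframe (ball (z q) r') A (\<lambda>\<zeta> w. Re (l \<zeta> * w)) (\<lambda>\<zeta> w. Im (l \<zeta> * w)) p1 p2 p3 q1 q2"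
    and ln: "\<And>\<zeta>. \<zeta> \<in> ball (z q) r' \<Longrightarrow> isotropic_line (pt_of (fst (F (inv_into V z \<zeta>)))) (dir_of (snd (F (inv_into V z \<zeta>)))) = isotropic_line (fst (A \<zeta>)) (column 1 (snd (A \<zeta>)))"
    by (rule frame_of_gauss_coordinate[OF V(3) co(1,2,3,5) wB w(3) sc' cN']) blast+
  define V2 where "V2 = V \<inter> z -` ball (z q) r'"
  have sub: "ball (z q) r' \<subseteq> z ` V" unfolding V'(2) using R by auto
  note cV2 = chart_restrict_image[OF V'(1) open_ball sub, folded V2_def]
  have ln2: "lag_line (F x) = isotropic_line (fst (A (z x))) (column 1 (snd (A (z x))))" if "x \<in> V2" for x
    using ln[of "z x"] that iv[of x] by (simp add: V2_def lag_line_def case_prod_beta)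
  have "middle_frame \<A> (V2, z) F (\<lambda>x. A (z x)) (\<lambda>x w. Re (l (z x) * w)) (\<lambda>x w. Im (l (z x) * w)) (\<lambda>x. p1 (z x)) (\<lambda>x. p2 (z x)) (\<lambda>x. p3 (z x)) (\<lambda>x. q1 (z x)) (\<lambda>x. q2 (z x))"
    by (rule middle_frame_of_mframe[OF cV2(1), unfolded cV2(2), OF A]) (rule ln2)
  then show thesis by (rule that[OF _ R(1) cV2(2), rotated]) (use V R in \<open>auto simp: V2_def\<close>)
qed

lemma middle_frame_cong:
  assumes m: "middle_frame \<A> (U, z) F A \<alpha> \<beta> p1 p2 p3 q1 q2"
    and eq: "\<And>q w. q \<in> U \<Longrightarrow> \<alpha>' q w = \<alpha> q w \<and> \<beta>' q w = \<beta> q w"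
  shows "middle_frame \<A> (U, z) F A \<alpha>' \<beta>' p1 p2 p3 q1 q2"
proof -
  have c: "(U, z) \<in> charts \<A>" by (rule middle_frame_charts[OF surf m])
  have oz: "open (z ` U)" using charts_open_image[OF surf c charts_open[OF surf c]] by simp
  have iU: "inv_into U z \<zeta> \<in> U" if "\<zeta> \<in> z ` U" for \<zeta> by (rule inv_into_into[OF that])
  have e: "\<alpha>' q = \<alpha> q" "\<beta>' q = \<beta> q" if "q \<in> U" for q using eq[OF that] by (simp_all add: fun_eq_iff)
  note m' = m[unfolded middle_frame_iff[OF surf c]]
  show ?thesis unfolding middle_frame_iff[OF surf c]
    by (rule conjI[OF mframe_cong[THEN iffD1, OF oz _ conjunct1[OF m']] conjunct2[OF m']]) (use e iU in auto)
qed

lemma conformal_frame_complex_chart: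
  assumes "middle_frame \<A> (V, z) F A (\<lambda>x w. Re (l x * w)) (\<lambda>x w. Im (l x * w)) p1 p2 p3 q1 q2"
  shows "complex_chart \<A> F (V, z)"
  unfolding complex_chart_def prod.case
proof (intro conjI ballI)
  show "(V, z) \<in> charts \<A>" by (rule middle_frame_charts[OF surf assms])
  fix q assume "q \<in> V"
  then have "middle_at \<A> F z q (\<lambda>w. Complex (Re (l q * w)) (Im (l q * w))) (p1 q) (p2 q) (p3 q)"
    unfolding middle_at_def using assms by blast
  then show "\<exists>\<phi> r1 r2 r3 l. middle_at \<A> F z q \<phi> r1 r2 r3 \<and> (\<forall>w. \<phi> w = l * w)" unfolding complex_surj by blast
qed

lemma conformal_frame:
  assumes m: "middle_frame \<A> (V, z) F A (\<lambda>x w. Re (l x * w)) (\<lambda>x w. Im (l x * w)) p1 p2 p3 q1 q2"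
  shows "smooth_on (z ` V) (\<lambda>\<zeta>. l (inv_into V z \<zeta>))" "smooth_on (z ` V) (\<lambda>\<zeta>. p1 (inv_into V z \<zeta>))"
    "smooth_on (z ` V) (\<lambda>\<zeta>. p3 (inv_into V z \<zeta>))" "\<And>x. x \<in> V \<Longrightarrow> l x \<noteq> 0"
    "(\<lambda>\<zeta>. Q_diff \<A> F z (inv_into V z \<zeta>) 1) holomorphic_on z ` V \<longleftrightarrow>
      (\<lambda>\<zeta>. of_real (p1 (inv_into V z \<zeta>) + p3 (inv_into V z \<zeta>)) * l (inv_into V z \<zeta>) ^ 2) holomorphic_on z ` V"
proof -
  have c: "(V, z) \<in> charts \<A>" by (rule middle_frame_charts[OF surf m])
  note M = mframe_conformal[OF conjunct1[OF m[unfolded middle_frame_iff[OF surf c]]]]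
  show "smooth_on (z ` V) (\<lambda>\<zeta>. l (inv_into V z \<zeta>))" "smooth_on (z ` V) (\<lambda>\<zeta>. p1 (inv_into V z \<zeta>))"
    "smooth_on (z ` V) (\<lambda>\<zeta>. p3 (inv_into V z \<zeta>))" by (rule M(1) M(2) M(4))+
  show "l x \<noteq> 0" if "x \<in> V" for x using M(5)[of "z x"] that charts_inv[OF surf c that] by simp
  have "Q_diff \<A> F z (inv_into V z \<zeta>) 1 =
      Complex ((p1 (inv_into V z \<zeta>) - p3 (inv_into V z \<zeta>)) / 2) (- p2 (inv_into V z \<zeta>)) * l (inv_into V z \<zeta>) ^ 4" if "\<zeta> \<in> z ` V" for \<zeta>
    using invariants_eval(3)[OF surf m inv_into_into[OF that], of 1] by (simp only: complex_surj mult_1_right)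
  then show "(\<lambda>\<zeta>. Q_diff \<A> F z (inv_into V z \<zeta>) 1) holomorphic_on z ` V \<longleftrightarrow>
      (\<lambda>\<zeta>. of_real (p1 (inv_into V z \<zeta>) + p3 (inv_into V z \<zeta>)) * l (inv_into V z \<zeta>) ^ 2) holomorphic_on z ` V"
    unfolding M(6)[symmetric] by (intro holomorphic_cong) auto
qed

lemma Q_holomorphic_conformal:
  assumes Q: "Q_holomorphic \<A> F"
    and m: "middle_frame \<A> (V, z) F A (\<lambda>x w. Re (l x * w)) (\<lambda>x w. Im (l x * w)) p1 p2 p3 q1 q2"
  shows "(\<lambda>\<zeta>. Q_diff \<A> F z (inv_into V z \<zeta>) 1) holomorphic_on z ` V"
    "(\<lambda>\<zeta>. of_real (p1 (inv_into V z \<zeta>) + p3 (inv_into V z \<zeta>)) * l (inv_into V z \<zeta>) ^ 2) holomorphic_on z ` V"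
  using Q conformal_frame_complex_chart[OF m] conformal_frame(5)[OF m] unfolding Q_holomorphic_def by blast+

text \<open>The zero set of P is open because a zero of P forces P = 0 nearby, and its complement is
  open by continuity; connectedness decides.\<close>

lemma P_inv_zero_dichotomy:
  assumes con: "connected (UNIV :: 'm set)" and leg: "legendre_immersion \<A> UNIV F" and nd: "nondegenerate \<A> UNIV F"
    and Q: "Q_holomorphic \<A> F"
  shows "(\<forall>q. P_inv \<A> F q = 0) \<or> (\<forall>q. P_inv \<A> F q \<noteq> 0)"
proof -
  define Z where "Z = {q. P_inv \<A> F q = 0}"
  have loc: "\<exists>W. open W \<and> q \<in> W \<and> (W \<subseteq> Z \<or> W \<subseteq> - Z)" for q
  proof -
    obtain V z r A l p1 p2 p3 q1 q2 where V: "q \<in> V" "r > 0" "z ` V = ball (z q) r"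
      and m: "middle_frame \<A> (V, z) F A (\<lambda>x w. Re (l x * w)) (\<lambda>x w. Im (l x * w)) p1 p2 p3 q1 q2"
      by (rule conformal_frame_exists[OF leg nd])
    have c: "(V, z) \<in> charts \<A>" by (rule middle_frame_charts[OF surf m])
    have oz: "open (z ` V)" by (simp add: V(3))
    have iv: "inv_into V z (z x) = x" if "x \<in> V" for x using charts_inv[OF surf c that] .
    define P where "P \<zeta> = p1 (inv_into V z \<zeta>) + p3 (inv_into V z \<zeta>)" for \<zeta>
    have PP: "P_inv \<A> F x = P (z x)" if "x \<in> V" for x
      using invariants_eval(1)[OF surf m that] by (simp add: P_def iv[OF that])
    note cf = conformal_frame[OF m]
    have zq: "z q \<in> z ` V" using V(1) by blast
    show ?thesis
    proof (cases "P (z q) = 0")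
      case True
      have lnz: "l (inv_into V z \<zeta>) \<noteq> 0" if "\<zeta> \<in> z ` V" for \<zeta> by (rule cf(4)[OF inv_into_into[OF that]])
      obtain e where e: "e > 0" "ball (z q) e \<subseteq> z ` V" "\<And>\<zeta>. \<zeta> \<in> ball (z q) e \<Longrightarrow> P \<zeta> = 0"
        by (rule real_times_square_zero[OF oz Q_holomorphic_conformal(2)[OF Q m, folded P_def] smooth_on_continuous[OF cf(1)] lnz zq True]) blast+
      have "V \<inter> z -` ball (z q) e \<subseteq> Z" using PP e(3) by (auto simp: Z_def)
      then show ?thesis using chart_preimage[OF c open_ball[of "z q" e]] V(1) e(1)
        by (intro exI[of _ "V \<inter> z -` ball (z q) e"]) auto
    next
      case False
      have "continuous_on (z ` V) P" unfolding P_def by (intro continuous_intros smooth_on_continuous cf)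
      then have "continuous_on V (\<lambda>x. P (z x))" using continuous_on_compose2[OF _ chart_continuous[OF c]] by blast
      then have "open (V \<inter> (\<lambda>x. P (z x)) -` (- {0}))"
        by (rule continuous_open_preimage[OF _ charts_open[OF surf c]]) auto
      moreover have "V \<inter> (\<lambda>x. P (z x)) -` (- {0}) \<subseteq> - Z" using PP by (auto simp: Z_def)
      ultimately show ?thesis using V(1) False by (intro exI[of _ "V \<inter> (\<lambda>x. P (z x)) -` (- {0})"]) auto
    qed
  qed
  have "open Z" by (subst open_subopen) (use loc in blast)
  moreover have "open (- Z)" by (subst open_subopen) (use loc in blast)
  ultimately have "Z = {} \<or> - Z = {}" using connectedD[OF con, of Z "- Z"] by auto
  then show ?thesis by (auto simp: Z_def)
qed

text \<open>\<rho> is a smooth square root of P l^2 up to sign, and with T' = \<rho> one has l dz =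
  (l/\<rho>) dT, where l/\<rho> is the positive function |P|^(-1/2).\<close>

lemma isothermic_chart_exists:
  assumes leg: "legendre_immersion \<A> UNIV F" and nd: "nondegenerate \<A> UNIV F"
    and Q: "Q_holomorphic \<A> F" and nz: "\<And>q. P_inv \<A> F q \<noteq> 0"
  obtains S z r u where "q \<in> S" "r > 0" "z ` S = ball (z q) r" "isothermic_chart \<A> F (S, z) u"
proof -
  obtain V z r A l p1 p2 p3 q1 q2 where V: "q \<in> V" "r > 0" "z ` V = ball (z q) r"
    and m: "middle_frame \<A> (V, z) F A (\<lambda>x w. Re (l x * w)) (\<lambda>x w. Im (l x * w)) p1 p2 p3 q1 q2"
    by (rule conformal_frame_exists[OF leg nd])
  have c: "(V, z) \<in> charts \<A>" by (rule middle_frame_charts[OF surf m])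
  define B where "B = z ` V"
  have B: "open B" "convex B" "z q \<in> B" using V by (auto simp: B_def)
  have iv: "inv_into V z (z x) = x" if "x \<in> V" for x using charts_inv[OF surf c that] .
  define P where "P \<zeta> = p1 (inv_into V z \<zeta>) + p3 (inv_into V z \<zeta>)" for \<zeta>
  define L where "L \<zeta> = l (inv_into V z \<zeta>)" for \<zeta>
  note cf = conformal_frame[OF m, folded B_def L_def]
  have hol: "(\<lambda>\<zeta>. of_real (P \<zeta>) * L \<zeta> ^ 2) holomorphic_on B"
    using Q_holomorphic_conformal(2)[OF Q m] unfolding P_def L_def B_def .
  have sP: "smooth_on B P" unfolding P_def by (rule smooth_on_add[OF B(1) cf(2,3)])
  have Pnz: "P \<zeta> \<noteq> 0" if zB: "\<zeta> \<in> B" for \<zeta>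
  proof -
    obtain x where x: "x \<in> V" "\<zeta> = z x" using zB unfolding B_def by blast
    show ?thesis using nz[of x] invariants_eval(1)[OF surf m x(1)] x iv by (simp add: P_def)
  qed
  \<comment> \<open>The sign of P; it is constant on the ball because P has no zeros there.\<close>
  define \<sigma> where "\<sigma> = sgn (P (z q))"
  have pos: "\<sigma> * P \<zeta> > 0" if zB: "\<zeta> \<in> B" for \<zeta>
  proof (rule ccontr)
    assume n: "\<not> \<sigma> * P \<zeta> > 0"
    have "connected ((\<lambda>\<zeta>. \<sigma> * P \<zeta>) ` B)"
      by (intro connected_continuous_image continuous_intros smooth_on_continuous[OF sP] convex_connected[OF B(2)])
    moreover have "\<sigma> * P (z q) > 0" using Pnz[OF B(3)] by (simp add: \<sigma>_def sgn_mult_self_eq linorder_not_less abs_sgn[symmetric] mult.commute)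
    ultimately have "0 \<in> (\<lambda>\<zeta>. \<sigma> * P \<zeta>) ` B"
      using connectedD_interval[of "(\<lambda>\<zeta>. \<sigma> * P \<zeta>) ` B" "\<sigma> * P \<zeta>" "\<sigma> * P (z q)" 0] n imageI[OF zB, of "\<lambda>\<zeta>. \<sigma> * P \<zeta>"] imageI[OF B(3), of "\<lambda>\<zeta>. \<sigma> * P \<zeta>"] by auto
    then show False using Pnz B(3) by (auto simp: \<sigma>_def sgn_zero_iff)
  qed
  define \<rho> where "\<rho> \<zeta> = of_real (sqrt (\<sigma> * P \<zeta>)) * L \<zeta>" for \<zeta>
  have s\<rho>: "smooth_on B \<rho>" unfolding \<rho>_def
    by (intro smooth_on_mult[OF B(1)] smooth_on_of_real[OF B(1)] smooth_on_sqrt[OF B(1)] smooth_on_const sP cf(1) pos)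
  have Lnz: "L \<zeta> \<noteq> 0" if "\<zeta> \<in> B" for \<zeta> unfolding L_def using that by (intro cf(4) inv_into_into) (simp add: B_def)
  have \<rho>nz: "\<rho> \<zeta> \<noteq> 0" if "\<zeta> \<in> B" for \<zeta> using pos[OF that] Lnz[OF that] unfolding \<rho>_def by auto
  have \<rho>2: "\<rho> \<zeta> ^ 2 = of_real \<sigma> * (of_real (P \<zeta>) * L \<zeta> ^ 2)" if "\<zeta> \<in> B" for \<zeta>
  proof -
    have "of_real (sqrt (\<sigma> * P \<zeta>)) ^ 2 = (of_real (\<sigma> * P \<zeta>) :: complex)"
      using pos[OF that] by (simp only: of_real_power[symmetric]) (simp del: of_real_mult)
    then show ?thesis by (simp add: \<rho>_def power_mult_distrib)
  qed
  have h2: "(\<lambda>\<zeta>. \<rho> \<zeta> ^ 2) holomorphic_on B"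
    by (rule holomorphic_cong[THEN iffD2, OF refl \<rho>2 holomorphic_on_mult[OF holomorphic_on_const hol]])
  \<comment> \<open>The derivatives of \<rho>^2 are 2 \<rho> times those of \<rho>, so the
    Cauchy-Riemann equations descend to the root.\<close>
  have h\<rho>: "\<rho> holomorphic_on B"
  proof (rule holomorphic_on_CR[OF B(1) smooth_onD[OF s\<rho>]])
    fix \<zeta> assume z: "\<zeta> \<in> B"
    note d = pd_power[OF smooth_onD[OF s\<rho> z], of _ 2]
    show "pd \<i> \<rho> \<zeta> = \<i> * pd 1 \<rho> \<zeta>" using holomorphic_on_imp_CR[OF h2 B(1) z] \<rho>nz[OF z] unfolding d by simp
  qed
  then obtain T where T: "\<And>\<zeta>. \<zeta> \<in> B \<Longrightarrow> (T has_field_derivative \<rho> \<zeta>) (at \<zeta> within B)"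
    using holomorphic_convex_primitive'[OF B(2,1)] by blast
  have T': "(T has_field_derivative \<rho> \<zeta>) (at \<zeta>)" if "\<zeta> \<in> B" for \<zeta> using T[OF that] at_within_open[OF that B(1)] by simp
  have hT: "T holomorphic_on B" using T' B(1) holomorphic_on_open by blast
  have pT: "pd v T \<zeta> = \<rho> \<zeta> * v" if "\<zeta> \<in> B" for v \<zeta>
    unfolding pd_holomorphic[OF hT B(1) that] DERIV_imp_deriv[OF T'[OF that]] by simp
  have inj: "inj (\<lambda>v. pd v T (z q))" unfolding pT[OF B(3)] by (rule injI) (use \<rho>nz[OF B(3)] in simp)
  have BV: "B \<subseteq> z ` V" by (simp add: B_def)
  obtain V2 r2 where V2: "q \<in> V2" "V2 \<subseteq> V" "r2 > 0" "(V2, T \<circ> z) \<in> charts \<A>" "(T \<circ> z) ` V2 = ball ((T \<circ> z) q) r2"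
    by (rule chart_from_diffeo[OF c B(1) BV V(1) B(3) smooth_on_holomorphic[OF B(1) hT] inj]) blast+
  define u where "u x = - ln (sqrt (\<sigma> * (p1 x + p3 x)))" for x
  \<comment> \<open>The old coordinate as a function of the new one has derivative 1/T' =
    1/\<rho>.\<close>
  have td: "trans_d (V2, T \<circ> z) (V, z) x w = w / \<rho> (z x)" if x: "x \<in> V2" for x w
  proof -
    have xV: "x \<in> V" and zx: "z x \<in> B" using x V2(2) by (auto simp: B_def)
    have oz: "open (z ` (V \<inter> V2))" by (rule charts_open_image[OF surf c]) (use charts_open[OF surf c] charts_open[OF surf V2(4)] in auto)
    have "trans_d (V, z) (V2, T \<circ> z) x v = pd v T (z x)" for v
      unfolding trans_d_def[OF surf] prod.case by (rule pd_cong_open[OF oz]) (use x xV iv in auto)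
    then show ?thesis using trans_d_properties(3)[OF surf c V2(4) xV x, of w] \<rho>nz[OF zx] by (simp add: pT[OF zx] field_simps)
  qed
  have e: "l x * (w / \<rho> (z x)) = of_real (exp (u x)) * w" if x: "x \<in> V2" for x w
  proof -
    have xV: "x \<in> V" and zx: "z x \<in> B" using x V2(2) by (auto simp: B_def)
    define s where "s = sqrt (\<sigma> * (p1 x + p3 x))"
    have s: "s > 0" using pos[OF zx] by (simp add: s_def P_def iv[OF xV])
    have "\<rho> (z x) = of_real s * l x" by (simp add: \<rho>_def s_def P_def L_def iv[OF xV])
    moreover have "exp (u x) = inverse s" using s by (simp add: u_def s_def[symmetric] exp_minus)
    ultimately show ?thesis using s cf(4)[OF xV] by (simp add: divide_inverse)
  qed
  have "middle_frame \<A> (V2, T \<circ> z) F A (\<lambda>x w. exp (u x) * Re w) (\<lambda>x w. exp (u x) * Im w) p1 p2 p3 q1 q2"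
    by (rule middle_frame_cong[OF middle_frame_change[OF surf m V2(4,2)]]) (simp add: td e times_divide_eq_right[symmetric] del: times_divide_eq_right)
  then have "isothermic_chart \<A> F (V2, T \<circ> z) u" unfolding isothermic_chart_def by fastforce
  then show thesis by (rule that[OF V2(1,3,5)])
qed

lemma isothermic_frame:
  assumes "isothermic_chart \<A> F (S, z) u"
  obtains A p1 p2 p3 q1 q2 where "middle_frame \<A> (S, z) F A (\<lambda>x w. exp (u x) * Re w) (\<lambda>x w. exp (u x) * Im w) p1 p2 p3 q1 q2"
proof -
  obtain A \<alpha> \<beta> p1 p2 p3 q1 q2 where m: "middle_frame \<A> (S, z) F A \<alpha> \<beta> p1 p2 p3 q1 q2"
    and e: "\<forall>q\<in>S. \<forall>w. \<alpha> q w = exp (u q) * Re w \<and> \<beta> q w = exp (u q) * Im w"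
    using assms unfolding isothermic_chart_def by auto
  show thesis by (rule that[OF middle_frame_cong[OF m]]) (use e in auto)
qed

lemma isothermic_frame_invariants:
  assumes m: "middle_frame \<A> (S, z) F A (\<lambda>x w. exp (u x) * Re w) (\<lambda>x w. exp (u x) * Im w) p1 p2 p3 q1 q2"
  defines "v \<equiv> \<lambda>\<zeta>. u (inv_into S z \<zeta>)"
  shows "smooth_on (z ` S) v" "\<And>x. x \<in> S \<Longrightarrow> p2 x = 0"
    "\<And>x. x \<in> S \<Longrightarrow> pd 1 (pd 1 v) (z x) + pd \<i> (pd \<i> v) (z x) = (p3 x - p1 x) * (exp (u x))\<^sup>2"
proof -
  have c: "(S, z) \<in> charts \<A>" by (rule middle_frame_charts[OF surf m])
  note M = mframe_isothermic[OF conjunct1[OF m[unfolded middle_frame_iff[OF surf c]]] refl refl]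
  show "smooth_on (z ` S) v" unfolding v_def by (rule M(1))
  show "p2 x = 0" if "x \<in> S" for x using M(2)[of "z x"] that charts_inv[OF surf c that] by simp
  show "pd 1 (pd 1 v) (z x) + pd \<i> (pd \<i> v) (z x) = (p3 x - p1 x) * (exp (u x))\<^sup>2" if "x \<in> S" for x
    using M(3)[of "z x"] that unfolding charts_inv[OF surf c that] v_def by blast
qed

text \<open>Here \<open>p2 = 0\<close> and \<phi> = e^u dz, so the quartic differential has the real
  coefficient (p1 - p3)/2 e^(4u), which is -1/2 times e^(2u) Laplacian(u). Real and holomorphic, it
  is constant; this also explains the value -2 Re k.\<close>

lemma isothermic_liouville:
  assumes Q: "Q_holomorphic \<A> F" and i: "isothermic_chart \<A> F (S, z) u" and cv: "convex (z ` S)"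
  defines "v \<equiv> \<lambda>\<zeta>. u (inv_into S z \<zeta>)"
  obtains k where "\<And>\<zeta>. \<zeta> \<in> z ` S \<Longrightarrow> (pd 1 (pd 1 v) \<zeta> + pd \<i> (pd \<i> v) \<zeta>) * (exp (v \<zeta>))\<^sup>2 = k"
proof -
  obtain A p1 p2 p3 q1 q2 where m: "middle_frame \<A> (S, z) F A (\<lambda>x w. exp (u x) * Re w) (\<lambda>x w. exp (u x) * Im w) p1 p2 p3 q1 q2"
    by (rule isothermic_frame[OF i])
  have c: "(S, z) \<in> charts \<A>" by (rule middle_frame_charts[OF surf m])
  have iv: "inv_into S z (z x) = x" if "x \<in> S" for x using charts_inv[OF surf c that] .
  have oz: "open (z ` S)" using charts_open_image[OF surf c charts_open[OF surf c]] by simp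
  have m2: "middle_frame \<A> (S, z) F A (\<lambda>x w. Re (of_real (exp (u x)) * w)) (\<lambda>x w. Im (of_real (exp (u x)) * w)) p1 p2 p3 q1 q2"
    by (rule middle_frame_cong[OF m]) simp
  define h where "h \<zeta> = Q_diff \<A> F z (inv_into S z \<zeta>) 1" for \<zeta>
  have hol: "h holomorphic_on z ` S" using Q_holomorphic_conformal(1)[OF Q m2] unfolding h_def .
  have hx: "h (z x) = of_real ((p1 x - p3 x) / 2 * exp (u x) ^ 4)" if x: "x \<in> S" for x
  proof -
    have "Complex ((p1 x - p3 x) / 2) (- p2 x) = of_real ((p1 x - p3 x) / 2)"
      unfolding isothermic_frame_invariants(2)[OF m x] by (simp add: complex_eq_iff)
    moreover have "Complex (exp (u x) * Re 1) (exp (u x) * Im 1) = of_real (exp (u x))" by (simp add: complex_eq_iff)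
    ultimately show ?thesis unfolding h_def iv[OF x] invariants_eval(3)[OF surf m x] by (simp only: of_real_mult of_real_power)
  qed
  have im: "Im (h \<zeta>) = 0" if zS: "\<zeta> \<in> z ` S" for \<zeta>
  proof -
    obtain x where "x \<in> S" "\<zeta> = z x" using zS by blast
    then show ?thesis using hx by (simp only: Im_complex_of_real)
  qed
  obtain k where k: "\<And>\<zeta>. \<zeta> \<in> z ` S \<Longrightarrow> h \<zeta> = k" by (rule holomorphic_real_constant[OF oz cv hol im]) blast+
  show thesis
  proof (rule that)
    fix \<zeta> assume "\<zeta> \<in> z ` S"
    then obtain x where x: "x \<in> S" "\<zeta> = z x" by blast
    have "of_real ((p1 x - p3 x) / 2 * exp (u x) ^ 4) = k" using k[of "z x"] hx[OF x(1)] x by simp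
    then have k': "(p1 x - p3 x) / 2 * exp (u x) ^ 4 = Re k" using Re_complex_of_real by metis
    have "v \<zeta> = u x" by (simp add: v_def x(2) iv[OF x(1)])
    then have "(pd 1 (pd 1 v) \<zeta> + pd \<i> (pd \<i> v) \<zeta>) * (exp (v \<zeta>))\<^sup>2 = (p3 x - p1 x) * (exp (u x))\<^sup>2 * (exp (u x))\<^sup>2"
      using isothermic_frame_invariants(3)[OF m x(1)] unfolding v_def[symmetric] x(2) by metis
    also have "\<dots> = - 2 * ((p1 x - p3 x) / 2 * exp (u x) ^ 4)" by (simp add: field_simps power2_eq_square power4_eq_xxxx)
    finally show "(pd 1 (pd 1 v) \<zeta> + pd \<i> (pd \<i> v) \<zeta>) * (exp (v \<zeta>))\<^sup>2 = - 2 * Re k" unfolding k' .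
  qed
qed

text \<open>Both directions of the converse reduce to this: \<open>F'\<close> is \<open>F\<close>
  itself in the L-minimal case and the L-minimal immersion otherwise. The frames share \<alpha> and
  \<beta>, so a complex chart of \<open>F\<close> is one for \<open>F'\<close>; there P = 0 gives a
  holomorphic quartic differential, and Q is common.\<close>

lemma Q_diff_holomorphic_of_P_zero:
  assumes m: "middle_frame \<A> (V, z1) F A \<alpha> \<beta> p1 p2 p3 q1 q2"
    and m': "middle_frame \<A> (V, z1) F' A' \<alpha> \<beta> p1' p2' p3' q1' q2'"
    and Qeq: "\<And>x. x \<in> V \<Longrightarrow> p2' x = p2 x" "\<And>x. x \<in> V \<Longrightarrow> p1' x - p3' x = p1 x - p3 x"
    and P0: "\<And>x. x \<in> V \<Longrightarrow> p1' x + p3' x = 0"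
    and cc: "complex_chart \<A> F (U, z)"
  shows "(\<lambda>\<zeta>. Q_diff \<A> F z (inv_into U z \<zeta>) 1) holomorphic_on z ` (U \<inter> V)"
proof -
  have cU: "(U, z) \<in> charts \<A>" using cc by (simp add: complex_chart_def)
  have c1: "(V, z1) \<in> charts \<A>" by (rule middle_frame_charts[OF surf m])
  define X where "X = U \<inter> V"
  have oX: "open X" using charts_open[OF surf cU] charts_open[OF surf c1] by (auto simp: X_def)
  have cX: "(X, z) \<in> charts \<A>" by (rule chart_restrict[OF surf cU oX]) (simp add: X_def)
  have XV: "X \<subseteq> V" by (simp add: X_def)
  define a where "a x w = \<alpha> x (trans_d (X, z) (V, z1) x w)" for x w
  define b where "b x w = \<beta> x (trans_d (X, z) (V, z1) x w)" for x w
  define l where "l x = Complex (a x 1) (b x 1)" for x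
  note n = middle_frame_change[OF surf m cX XV, folded a_def b_def]
  note n' = middle_frame_change[OF surf m' cX XV, folded a_def b_def]
  \<comment> \<open>A complex chart supplies a possibly different middle frame at each point; up to
    a sign its \<phi> is that of the given frame, which is therefore complex linear.\<close>
  have lin: "Complex (a x w) (b x w) = l x * w" if x: "x \<in> X" for x w
  proof -
    obtain \<phi> r1 r2 r3 k where ma: "middle_at \<A> F z x \<phi> r1 r2 r3" and k: "\<And>w. \<phi> w = k * w"
      using cc x unfolding complex_chart_def X_def by blast
    obtain W B a' b' s1 s2 s3 t1 t2 where W: "x \<in> W" and mW: "middle_frame \<A> (W, z) F B a' b' s1 s2 s3 t1 t2"
      and \<phi>: "\<phi> = (\<lambda>w. Complex (a' x w) (b' x w))" using ma unfolding middle_at_def by blast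
    obtain \<sigma> where "\<And>w. Complex (a x w) (b x w) = of_real \<sigma> * Complex (a' x w) (b' x w)"
      by (rule middle_frame_unique_same[OF surf mW n W x refl]) blast
    then have e: "Complex (a x w) (b x w) = of_real \<sigma> * (k * w)" for w using k unfolding \<phi> by simp
    show ?thesis unfolding l_def e by simp
  qed
  have ab: "Re (l x * w) = a x w \<and> Im (l x * w) = b x w" if "x \<in> X" for x w
    using lin[OF that, of w, symmetric] by simp
  have N': "middle_frame \<A> (X, z) F' A' (\<lambda>x w. Re (l x * w)) (\<lambda>x w. Im (l x * w)) p1' p2' p3' q1' q2'"
    by (rule middle_frame_cong[OF n' ab])
  have N: "middle_frame \<A> (X, z) F A (\<lambda>x w. Re (l x * w)) (\<lambda>x w. Im (l x * w)) p1 p2 p3 q1 q2"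
    by (rule middle_frame_cong[OF n ab])
  have "(\<lambda>\<zeta>. of_real (p1' (inv_into X z \<zeta>) + p3' (inv_into X z \<zeta>)) * l (inv_into X z \<zeta>) ^ 2) holomorphic_on z ` X \<longleftrightarrow>
      (\<lambda>\<zeta>. 0) holomorphic_on z ` X"
  proof (rule holomorphic_cong[OF refl])
    fix \<zeta> assume "\<zeta> \<in> z ` X"
    from P0[of "inv_into X z \<zeta>"] inv_into_into[OF this] XV
    show "of_real (p1' (inv_into X z \<zeta>) + p3' (inv_into X z \<zeta>)) * l (inv_into X z \<zeta>) ^ 2 = 0" by (metis mult_zero_left of_real_0 subsetD)
  qed
  then have h: "(\<lambda>\<zeta>. Q_diff \<A> F' z (inv_into X z \<zeta>) 1) holomorphic_on z ` X"
    using conformal_frame(5)[OF N'] by simp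
  have "Q_diff \<A> F z (inv_into U z \<zeta>) 1 = Q_diff \<A> F' z (inv_into X z \<zeta>) 1" if zX: "\<zeta> \<in> z ` X" for \<zeta>
  proof -
    obtain x where x: "x \<in> X" "\<zeta> = z x" using zX by blast
    have "x \<in> U" "x \<in> V" using x by (auto simp: X_def)
    then show ?thesis unfolding x(2) charts_inv[OF surf cX x(1)] charts_inv[OF surf cU \<open>x \<in> U\<close>]
      invariants_eval(3)[OF surf N x(1)] invariants_eval(3)[OF surf N' x(1)] using Qeq by simp
  qed
  then show ?thesis using h unfolding X_def[symmetric] by (simp cong: holomorphic_cong)
qed

text \<open>The conditions are quantified over all charts. They are proved in the chart of the
  frame; any other chart changes the differentials by a linear bijection, the \<open>t\<close> in
  \<open>tr\<close>.\<close>

lemma legendre_of_middle_frame: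
  assumes m: "middle_frame \<A> (S, z) F A \<alpha> \<beta> p1 p2 p3 q1 q2" and sph: "F ` S \<subseteq> UNIV \<times> sphere 0 1"
    and sF: "smooth_fun_on \<A> S F"
  shows "legendre_immersion \<A> S F" "nondegenerate \<A> S F"
proof -
  have c: "(S, z) \<in> charts \<A>" by (rule middle_frame_charts[OF surf m])
  have oz: "open (z ` S)" using charts_open_image[OF surf c charts_open[OF surf c]] by simp
  note m' = m[unfolded middle_frame_iff[OF surf c]]
  have iv: "inv_into S z (z x) = x" if "x \<in> S" for x using charts_inv[OF surf c that] .
  have s: "smooth_on (z ` S) (\<lambda>\<zeta>. F (inv_into S z \<zeta>))" using smooth_fun_onD[OF surf sF c] by simp
  note sf = smooth_on_fst[OF oz s] and sn = smooth_on_snd[OF oz s]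
  have iS: "inv_into S z \<zeta> \<in> S" if "\<zeta> \<in> z ` S" for \<zeta> by (rule inv_into_into[OF that])
  have sph': "snd (F (inv_into S z \<zeta>)) \<in> sphere 0 1" if "\<zeta> \<in> z ` S" for \<zeta>
    using subsetD[OF sph imageI[OF iS[OF that]]] by (simp add: mem_Times_iff)
  have line: "isotropic_line (pt_of (fst (F (inv_into S z \<zeta>)))) (dir_of (snd (F (inv_into S z \<zeta>)))) =
      isotropic_line (fst (A (inv_into S z \<zeta>))) (column 1 (snd (A (inv_into S z \<zeta>))))" if "\<zeta> \<in> z ` S" for \<zeta>
    using bspec[OF conjunct2[OF m'] iS[OF that]] by (simp add: lag_line_def case_prod_beta)
  note L = legendre_of_mframe[OF conjunct1[OF m'] sf sn sph' line]
  have d: "dif (S, z) (fst \<circ> F) x w = pd w (\<lambda>\<zeta>. fst (F (inv_into S z \<zeta>))) (z x)"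
    "dif (S, z) (snd \<circ> F) x w = pd w (\<lambda>\<zeta>. snd (F (inv_into S z \<zeta>))) (z x)" for x w
    unfolding dif_pd[OF surf] by simp_all
  have base: "dif (S, z) (fst \<circ> F) x w \<bullet> snd (F x) = 0"
    "w \<noteq> 0 \<Longrightarrow> dif (S, z) (snd \<circ> F) x w \<bullet> dif (S, z) (snd \<circ> F) x w > 0"
    "\<forall>w. r * (dif (S, z) (fst \<circ> F) x w \<bullet> dif (S, z) (snd \<circ> F) x w) + t * (dif (S, z) (snd \<circ> F) x w \<bullet> dif (S, z) (snd \<circ> F) x w) = 0
      \<Longrightarrow> r = 0 \<and> t = 0" if x: "x \<in> S" for x w r t
    using L[OF _ _ imageI[OF x, of z], unfolded iv[OF x]] unfolding d by blast+
  have inj0: "inj (dif (S, z) F x)" if x: "x \<in> S" for x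
  proof -
    note df = smooth_onD[OF s imageI[OF x]]
    have l: "linear (dif (S, z) F x)" unfolding dif_pd[OF surf] by (rule pd_linear[OF df])
    have "w = 0" if w: "dif (S, z) F x w = 0" for w
    proof (rule ccontr)
      assume "w \<noteq> 0"
      have "dif (S, z) (snd \<circ> F) x w = snd (dif (S, z) F x w)"
        unfolding d unfolding dif_pd[OF surf] by (rule pd_bounded_linear[OF bounded_linear_snd df])
      then show False using base(2)[OF x \<open>w \<noteq> 0\<close>] w by simp
    qed
    then show ?thesis using linear_injective_0[OF l] by blast
  qed
  have tr: "\<exists>t. inj t \<and> surj t \<and> linear t \<and> dif c' F x = dif (S, z) F x \<circ> t \<and> (\<forall>w. dif c' (fst \<circ> F) x w = dif (S, z) (fst \<circ> F) x (t w))
      \<and> (\<forall>w. dif c' (snd \<circ> F) x w = dif (S, z) (snd \<circ> F) x (t w))"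
    if c': "c' \<in> charts \<A>" and x: "x \<in> fst c' \<inter> S" for c' x
  proof -
    obtain U' z' where cz: "c' = (U', z')" by (cases c')
    have x1: "x \<in> S" "x \<in> U'" using x cz by auto
    note tp = trans_d_properties[OF surf c c'[unfolded cz] x1]
    have su: "surj (trans_d (U', z') (S, z) x)" by (rule linear_injective_imp_surjective[OF tp(1,2)]) simp
    have "(\<lambda>\<zeta>. (fst \<circ> F) (inv_into S z \<zeta>)) differentiable (at (z x))" "(\<lambda>\<zeta>. (snd \<circ> F) (inv_into S z \<zeta>)) differentiable (at (z x))"
      using smooth_onD[OF sf imageI[OF x1(1)]] smooth_onD[OF sn imageI[OF x1(1)]] by simp_all
    note dc = dif_change[OF surf c c'[unfolded cz] x1 smooth_onD[OF s imageI[OF x1(1)]]]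
      dif_change[OF surf c c'[unfolded cz] x1 this(1)] dif_change[OF surf c c'[unfolded cz] x1 this(2)]
    show ?thesis unfolding cz
      by (intro exI[of _ "trans_d (U', z') (S, z) x"] conjI tp su allI dc(2,3)) (simp add: fun_eq_iff dc(1))
  qed
  show "legendre_immersion \<A> S F"
    unfolding legendre_immersion_def
  proof (intro conjI ballI sph sF)
    fix c' x assume h: "c' \<in> charts \<A>" "x \<in> fst c' \<inter> S"
    then have x: "x \<in> S" by blast
    obtain t where t: "inj t" "linear t" "dif c' F x = dif (S, z) F x \<circ> t" "\<And>w. dif c' (fst \<circ> F) x w = dif (S, z) (fst \<circ> F) x (t w)"
      "\<And>w. dif c' (snd \<circ> F) x w = dif (S, z) (snd \<circ> F) x (t w)" using tr[OF h] by blast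
    show "inj (dif c' F x)" unfolding t(3) by (rule inj_compose[OF inj0[OF x] t(1)])
    show "\<forall>w. dif c' (fst \<circ> F) x w \<bullet> snd (F x) = 0" unfolding t(4) using base(1)[OF x] by blast
    have "t w \<noteq> 0" if "w \<noteq> 0" for w using linear_injective_0[OF t(2)] t(1) that by blast
    then show "\<forall>w. w \<noteq> 0 \<longrightarrow> dif c' (snd \<circ> F) x w \<bullet> dif c' (snd \<circ> F) x w > 0" unfolding t(5) using base(2)[OF x] by blast
  qed
  show "nondegenerate \<A> S F"
    unfolding nondegenerate_def
  proof (intro ballI allI impI)
    fix c' x r k assume h: "c' \<in> charts \<A>" "x \<in> fst c' \<inter> S"
      and e: "\<forall>w. r * (dif c' (fst \<circ> F) x w \<bullet> dif c' (snd \<circ> F) x w) + k * (dif c' (snd \<circ> F) x w \<bullet> dif c' (snd \<circ> F) x w) = 0"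
    then have x: "x \<in> S" by blast
    obtain t where t: "surj t" "\<And>w. dif c' (fst \<circ> F) x w = dif (S, z) (fst \<circ> F) x (t w)"
      "\<And>w. dif c' (snd \<circ> F) x w = dif (S, z) (snd \<circ> F) x (t w)" using tr[OF h] by blast
    show "r = 0 \<and> k = 0"
    proof (rule base(3)[OF x], rule allI)
      fix w
      obtain v where w: "w = t v" using t(1) by (rule surjE)
      show "r * (dif (S, z) (fst \<circ> F) x w \<bullet> dif (S, z) (snd \<circ> F) x w) + k * (dif (S, z) (snd \<circ> F) x w \<bullet> dif (S, z) (snd \<circ> F) x w) = 0"
        unfolding w using spec[OF e, of v] unfolding t(2,3) .
    qed
  qed
qed

text \<open>The frame of \<open>F\<close> is moved by the group element and that of
  \<open>F'\<close> is pulled back along the diffeomorphism. Both then lie over the same lines, so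
  uniqueness identifies their coefficients, and \<open>y\<close> is the image of
  \<open>x\<close>.\<close>

lemma laguerre_equivalent_P_inv:
  assumes eq: "laguerre_equivalent \<A> S F \<A> S F'"
    and m: "middle_frame \<A> (S, z) F A \<alpha> \<beta> p1 p2 p3 q1 q2"
    and m': "middle_frame \<A> (S, z) F' A' \<alpha>' \<beta>' p1' p2' p3' q1' q2'"
    and x: "x \<in> S"
  shows "\<exists>y\<in>S. P_inv \<A> F' y = P_inv \<A> F x"
proof -
  obtain \<phi> g where df: "diffeo \<A> S \<A> S \<phi>" and g: "g \<in> laguerre_group"
    and ln: "\<And>q. q \<in> S \<Longrightarrow> lag_line (F' (\<phi> q)) = laguerre_act g (lag_line (F q))"
    using eq unfolding laguerre_equivalent_def by blast
  obtain b0 b where gb: "g = (b0, b)" by (cases g)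
  have bij: "bij_betw \<phi> S S" using df by (simp add: diffeo_def)
  have \<phi>S: "\<phi> q \<in> S" if "q \<in> S" for q using bij_betw_apply[OF bij that] .
  have \<psi>S: "inv_into S \<phi> q \<in> S" if "q \<in> S" for q using bij_betw_apply[OF bij_betw_inv_into[OF bij] that] .
  have c: "(S, z) \<in> charts \<A>" by (rule middle_frame_charts[OF surf m])
  have oz: "open (z ` S)" using charts_open_image[OF surf c charts_open[OF surf c]] by simp
  have iv: "inv_into S z (z x) = x" if "x \<in> S" for x using charts_inv[OF surf c that] .
  have iS: "inv_into S z \<zeta> \<in> S" if "\<zeta> \<in> z ` S" for \<zeta> by (rule inv_into_into[OF that])
  have smooth: "smooth_on (z ` S) (\<lambda>\<zeta>. z (h (inv_into S z \<zeta>)))" if h: "smooth_map_on \<A> S \<A> h" "\<And>q. q \<in> S \<Longrightarrow> h q \<in> S" for h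
  proof -
    have SS: "S \<inter> h -` S = S" using h(2) by auto
    have "smooth_fun_on \<A> (S \<inter> h -` S) (z \<circ> h)" using h(1) c unfolding smooth_map_on_def by blast
    from smooth_fun_onD[OF surf this[unfolded SS] c] show ?thesis by simp
  qed
  define \<theta> where "\<theta> \<zeta> = z (\<phi> (inv_into S z \<zeta>))" for \<zeta>
  define \<eta> where "\<eta> \<zeta> = z (inv_into S \<phi> (inv_into S z \<zeta>))" for \<zeta>
  have s\<theta>: "smooth_on (z ` S) \<theta>" unfolding \<theta>_def using df \<phi>S by (intro smooth) (auto simp: diffeo_def)
  have s\<eta>: "smooth_on (z ` S) \<eta>" unfolding \<eta>_def using df \<psi>S by (intro smooth) (auto simp: diffeo_def)
  have im: "\<theta> ` (z ` S) \<subseteq> z ` S" using \<phi>S iS by (auto simp: \<theta>_def)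
  have \<eta>\<theta>: "\<eta> (\<theta> \<zeta>) = \<zeta>" if "\<zeta> \<in> z ` S" for \<zeta>
    using iS[OF that] \<phi>S bij f_inv_into_f[OF that] by (simp add: \<eta>_def \<theta>_def iv bij_betw_inv_into_left)
  \<comment> \<open>The inverse diffeomorphism has a smooth coordinate expression \<eta>, whose
    derivative is a left inverse by the chain rule.\<close>
  have inj: "inj (\<lambda>w. pd w \<theta> \<zeta>)" if z: "\<zeta> \<in> z ` S" for \<zeta>
  proof (rule inj_on_inverseI)
    fix w
    have "pd (pd w \<theta> \<zeta>) \<eta> (\<theta> \<zeta>) = pd w (\<lambda>\<zeta>. \<eta> (\<theta> \<zeta>)) \<zeta>"
      by (rule pd_compose[symmetric, OF smooth_onD[OF s\<theta> z] smooth_onD[OF s\<eta>]]) (use im z in blast)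
    also have "\<dots> = pd w (\<lambda>\<zeta>. \<zeta>) \<zeta>" by (rule pd_cong_open[OF oz z \<eta>\<theta>])
    finally show "pd (pd w \<theta> \<zeta>) \<eta> (\<theta> \<zeta>) = w" using pd_eq[OF has_derivative_ident, of w \<zeta>] by simp
  qed
  note n = m[unfolded middle_frame_iff[OF surf c]]
  note n' = m'[unfolded middle_frame_iff[OF surf c]]
  note M = mframe_action[OF g[unfolded gb] conjunct1[OF n]]
  note M' = mframe_pullback[OF conjunct1[OF n'] oz s\<theta> im inj]
  have line: "isotropic_line (fst (b0 + b *v fst (A (inv_into S z \<zeta>)), b ** snd (A (inv_into S z \<zeta>))))
      (column 1 (snd (b0 + b *v fst (A (inv_into S z \<zeta>)), b ** snd (A (inv_into S z \<zeta>))))) =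
    isotropic_line (fst (A' (inv_into S z (\<theta> \<zeta>)))) (column 1 (snd (A' (inv_into S z (\<theta> \<zeta>)))))" if z: "\<zeta> \<in> z ` S" for \<zeta>
  proof -
    define q where "q = inv_into S z \<zeta>"
    have q: "q \<in> S" using iS[OF z] by (simp add: q_def)
    have e: "inv_into S z (\<theta> \<zeta>) = \<phi> q" unfolding \<theta>_def q_def[symmetric] by (rule iv[OF \<phi>S[OF q]])
    have "lag_line (F' (\<phi> q)) = laguerre_act (b0, b) (lag_line (F q))" using ln[OF q] gb by simp
    then show ?thesis
      unfolding e q_def[symmetric] using bspec[OF conjunct2[OF n] q] bspec[OF conjunct2[OF n'] \<phi>S[OF q]]
      by (simp add: laguerre_act_isotropic_line column_matrix_mult)
  qed
  obtain \<sigma> where "p1' (inv_into S z (\<theta> (z x))) = p1 (inv_into S z (z x))" "p3' (inv_into S z (\<theta> (z x))) = p3 (inv_into S z (z x))"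
    by (rule mframe_unique[OF M M' line imageI[OF x]])
  then have "p1' (\<phi> x) = p1 x" "p3' (\<phi> x) = p3 x" by (simp_all add: \<theta>_def iv x \<phi>S)
  then have "P_inv \<A> F' (\<phi> x) = P_inv \<A> F x"
    using invariants_eval(1)[OF surf m x] invariants_eval(1)[OF surf m' \<phi>S[OF x]] by simp
  then show ?thesis using \<phi>S[OF x] by blast
qed

section \<open>The L-minimal T-transform and the equivalence\<close>

lemma L_isothermic_of_chart:
  assumes i: "isothermic_chart \<A> F (S, z) u"
  shows "L_isothermic \<A> S F"
proof -
  obtain A p1 p2 p3 q1 q2 where m: "middle_frame \<A> (S, z) F A (\<lambda>x w. exp (u x) * Re w) (\<lambda>x w. exp (u x) * Im w) p1 p2 p3 q1 q2"
    by (rule isothermic_frame[OF i])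
  have "diagonal_form (\<lambda>w. (exp (u x) * Re w)\<^sup>2 + (exp (u x) * Im w)\<^sup>2) \<and> diagonal_form (\<lambda>w. (exp (u x) * Re w)\<^sup>2 - (exp (u x) * Im w)\<^sup>2)
    \<and> isothermal_form (\<lambda>w. (exp (u x) * Re w)\<^sup>2 + (exp (u x) * Im w)\<^sup>2)" for x
  proof (intro conjI)
    show "diagonal_form (\<lambda>w. (exp (u x) * Re w)\<^sup>2 + (exp (u x) * Im w)\<^sup>2)"
      unfolding diagonal_form_def by (intro exI[of _ "(exp (u x))\<^sup>2"]) (simp add: power_mult_distrib)
    show "diagonal_form (\<lambda>w. (exp (u x) * Re w)\<^sup>2 - (exp (u x) * Im w)\<^sup>2)"
      unfolding diagonal_form_def by (rule exI[of _ "(exp (u x))\<^sup>2"], rule exI[of _ "- (exp (u x))\<^sup>2"]) (simp add: power_mult_distrib)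
    show "isothermal_form (\<lambda>w. (exp (u x) * Re w)\<^sup>2 + (exp (u x) * Im w)\<^sup>2)"
      unfolding isothermal_form_def by (rule exI[of _ "(exp (u x))\<^sup>2"]) (simp add: power_mult_distrib distrib_left)
  qed
  then show ?thesis unfolding L_isothermic_def using m by blast
qed

lemma isothermic_chart_restrict:
  assumes i: "isothermic_chart \<A> F (S, z) u" and S': "open S'" "S' \<subseteq> S"
  shows "isothermic_chart \<A> F (S', z) u"
proof -
  obtain A p1 p2 p3 q1 q2 where m: "middle_frame \<A> (S, z) F A (\<lambda>x w. exp (u x) * Re w) (\<lambda>x w. exp (u x) * Im w) p1 p2 p3 q1 q2"
    by (rule isothermic_frame[OF i])
  note c = middle_frame_charts[OF surf m]
  have "middle_frame \<A> (S', z) F A (\<lambda>x w. exp (u x) * Re w) (\<lambda>x w. exp (u x) * Im w) p1 p2 p3 q1 q2"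
    by (rule middle_frame_cong[OF middle_frame_restrict[OF surf m S']])
      (simp add: trans_d_same[OF surf chart_restrict[OF surf c S'] c])
  then show ?thesis unfolding isothermic_chart_def by fastforce
qed

text \<open>\<open>liouville_lift\<close> yields a frame with the potential of \<open>F\<close>, and
  the maps \<open>f\<close>, \<open>n\<close> realise its lines; the domain shrinks to the ball on
  which the linear equation was solved.\<close>

lemma T_transform_of_liouville:
  assumes leg: "legendre_immersion \<A> UNIV F" and nd: "nondegenerate \<A> UNIV F" and nz: "P_inv \<A> F q \<noteq> 0"
    and q: "q \<in> S" "r > 0" "z ` S = ball (z q) r" and i: "isothermic_chart \<A> F (S, z) u"
    and k: "\<And>\<zeta>. \<zeta> \<in> z ` S \<Longrightarrow> (pd 1 (pd 1 (\<lambda>\<zeta>. u (inv_into S z \<zeta>))) \<zeta> + pd \<i> (pd \<i> (\<lambda>\<zeta>. u (inv_into S z \<zeta>))) \<zeta>) * (exp (u (inv_into S z \<zeta>)))\<^sup>2 = k"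
  shows "\<exists>S F'. q \<in> S \<and> open S \<and> connected S \<and> L_minimal \<A> S F' \<and> L_isothermic \<A> S F' \<and> T_transforms \<A> S F F'"
proof -
  obtain A0 p1 p2 p3 q1 q2 where m: "middle_frame \<A> (S, z) F A0 (\<lambda>x w. exp (u x) * Re w) (\<lambda>x w. exp (u x) * Im w) p1 p2 p3 q1 q2"
    by (rule isothermic_frame[OF i])
  have c: "(S, z) \<in> charts \<A>" by (rule middle_frame_charts[OF surf m])
  have iv: "inv_into S z (z x) = x" if "x \<in> S" for x using charts_inv[OF surf c that] .
  obtain R A P1 P2 P3 Q1 Q2 where R: "R > 0" "R \<le> r"
    and A: "mframe (ball (z q) R) A (\<lambda>\<zeta> w. exp (u (inv_into S z \<zeta>)) * Re w) (\<lambda>\<zeta> w. exp (u (inv_into S z \<zeta>)) * Im w) P1 P2 P3 Q1 Q2"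
    and P0: "\<And>\<zeta>. \<zeta> \<in> ball (z q) R \<Longrightarrow> P1 \<zeta> + P3 \<zeta> = 0"
    by (rule liouville_lift[OF q(2) isothermic_frame_invariants(1)[OF m, unfolded q(3)] k[unfolded q(3)]]) blast+
  define B where "B = ball (z q) R"
  have B: "open B" "B \<subseteq> z ` S" unfolding q(3) using R by (auto simp: B_def)
  note A = A[folded B_def] and P0 = P0[folded B_def]
  have sA: "smooth_on B A" using A by (simp add: mframe_def)
  have grp: "A \<zeta> \<in> laguerre_group" if "\<zeta> \<in> B" for \<zeta> by (rule mframe_group[OF A that])
  have lc: "column 1 (snd (A \<zeta>)) \<in> lightcone" if z: "\<zeta> \<in> B" for \<zeta>
  proof -
    obtain a M where aM: "A \<zeta> = (a, M)" by (cases "A \<zeta>")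
    show ?thesis using grp[OF z] unfolding aM laguerre_group_iff by simp
  qed
  obtain f n where sf: "smooth_on B f" and sn: "smooth_on B n" and sph: "\<And>\<zeta>. \<zeta> \<in> B \<Longrightarrow> n \<zeta> \<in> sphere 0 1"
    and ln: "\<And>\<zeta>. \<zeta> \<in> B \<Longrightarrow> isotropic_line (pt_of (f \<zeta>)) (dir_of (n \<zeta>)) = isotropic_line (fst (A \<zeta>)) (column 1 (snd (A \<zeta>)))"
    by (rule realise_line[OF B(1) smooth_on_fst[OF B(1) sA] smooth_on_bounded_linear[OF B(1) bounded_linear_column smooth_on_snd[OF B(1) sA]] lc]) blast+
  define S' where "S' = S \<inter> z -` B"
  note cS = chart_restrict_image[OF c B, folded S'_def]
  have oS: "open S'" "S' \<subseteq> S" using charts_open[OF surf cS(1)] by (auto simp: S'_def)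
  have iv': "inv_into S' z (z x) = x" if "x \<in> S'" for x using charts_inv[OF surf cS(1) that] .
  have qS: "q \<in> S'" using q(1) R(1) by (simp add: S'_def B_def)
  define F' where "F' x = (f (z x), n (z x))" for x
  have ln': "lag_line (F' x) = isotropic_line (fst (A (z x))) (column 1 (snd (A (z x))))" if "x \<in> S'" for x
    using ln[of "z x"] that by (simp add: F'_def lag_line_def S'_def)
  have M0: "middle_frame \<A> (S', z) F' (\<lambda>x. A (z x)) (\<lambda>x w. exp (u (inv_into S z (z x))) * Re w) (\<lambda>x w. exp (u (inv_into S z (z x))) * Im w)
      (\<lambda>x. P1 (z x)) (\<lambda>x. P2 (z x)) (\<lambda>x. P3 (z x)) (\<lambda>x. Q1 (z x)) (\<lambda>x. Q2 (z x))"
    by (rule middle_frame_of_mframe[OF cS(1), unfolded cS(2), OF A]) (rule ln')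
  have M: "middle_frame \<A> (S', z) F' (\<lambda>x. A (z x)) (\<lambda>x w. exp (u x) * Re w) (\<lambda>x w. exp (u x) * Im w)
      (\<lambda>x. P1 (z x)) (\<lambda>x. P2 (z x)) (\<lambda>x. P3 (z x)) (\<lambda>x. Q1 (z x)) (\<lambda>x. Q2 (z x))"
    by (rule middle_frame_cong[OF M0]) (use oS(2) iv in auto)
  have i': "isothermic_chart \<A> F' (S', z) u" unfolding isothermic_chart_def using M by fastforce
  have iF: "isothermic_chart \<A> F (S', z) u" by (rule isothermic_chart_restrict[OF i oS])
  have "smooth_on (z ` S') (\<lambda>\<zeta>. (f \<zeta>, n \<zeta>))" unfolding cS(2) by (rule smooth_on_Pair[OF B(1) sf sn])
  then have "smooth_on (z ` S') (\<lambda>\<zeta>. F' (inv_into S' z \<zeta>))"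
    using smooth_on_cong[of "z ` S'" "\<lambda>\<zeta>. F' (inv_into S' z \<zeta>)" "\<lambda>\<zeta>. (f \<zeta>, n \<zeta>)"] B(1)
    by (simp add: cS(2) F'_def f_inv_into_f)
  then have sF': "smooth_fun_on \<A> S' F'" by (rule smooth_fun_onI[OF surf cS(1) oS(1) subset_refl])
  have "F' ` S' \<subseteq> UNIV \<times> sphere 0 1" using sph by (auto simp: F'_def S'_def)
  note leg' = legendre_of_middle_frame[OF M this sF']
  have legS: "legendre_immersion \<A> S' F" 
    using leg smooth_fun_on_subset[OF surf, of UNIV F S'] unfolding legendre_immersion_def by blast
  have ndS: "nondegenerate \<A> S' F" using nd unfolding nondegenerate_def by blast
  have P0': "P_inv \<A> F' x = 0" if "x \<in> S'" for x
    using invariants_eval(1)[OF surf M that] P0[of "z x"] that by (simp add: S'_def)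
  have "continuous_on (z ` S') (inv_into S' z)" using chartsD[OF surf cS(1)] unfolding is_chart_def homeomorphism_def by simp
  then have "continuous_on B (inv_into S' z)" unfolding cS(2) .
  then have "connected (inv_into S' z ` B)" by (rule connected_continuous_image) (simp add: B_def)
  moreover have "inv_into S' z ` B = S'" unfolding cS(2)[symmetric] using iv' by force
  ultimately have con: "connected S'" by simp
  obtain A1 r1 r2 r3 s1 s2 where m1: "middle_frame \<A> (S', z) F A1 (\<lambda>x w. exp (u x) * Re w) (\<lambda>x w. exp (u x) * Im w) r1 r2 r3 s1 s2"
    by (rule isothermic_frame[OF iF])
  \<comment> \<open>An equivalence would carry the nonzero value of P at \<open>q\<close> to a value
    of P for \<open>F'\<close>, which is identically 0.\<close>
  have "\<not> laguerre_equivalent \<A> S' F \<A> S' F'"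
    using laguerre_equivalent_P_inv[OF _ m1 M qS] P0' nz by fastforce
  then have "T_transforms \<A> S' F F'"
    unfolding T_transforms_def using legS ndS leg' L_isothermic_of_chart[OF iF] L_isothermic_of_chart[OF i'] iF i' by blast
  moreover have "L_minimal \<A> S' F'" using P0' by (simp add: L_minimal_def)
  ultimately show ?thesis using qS oS(1) con L_isothermic_of_chart[OF i'] by blast
qed

text \<open>For the converse, holomorphy in a complex chart is a local property, so it is enough to
  find around each point one neighbourhood that serves all complex charts.\<close>

lemma Q_holomorphic_iff:
  assumes con: "connected (UNIV :: 'm set)" and leg: "legendre_immersion \<A> UNIV F" and nd: "nondegenerate \<A> UNIV F"
  shows "Q_holomorphic \<A> F \<longleftrightarrow> L_minimal \<A> UNIV F \<or> locally_T_transform_of_L_minimal_isothermic \<A> F"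
proof
  assume Q: "Q_holomorphic \<A> F"
  consider "\<forall>q. P_inv \<A> F q = 0" | "\<forall>q. P_inv \<A> F q \<noteq> 0" using P_inv_zero_dichotomy[OF con leg nd Q] by blast
  then show "L_minimal \<A> UNIV F \<or> locally_T_transform_of_L_minimal_isothermic \<A> F"
  proof cases
    case 1
    then show ?thesis by (simp add: L_minimal_def)
  next
    case nz: 2
    have "\<exists>S F'. q \<in> S \<and> open S \<and> connected S \<and> L_minimal \<A> S F' \<and> L_isothermic \<A> S F' \<and> T_transforms \<A> S F F'" for q
    proof -
      obtain S z r u where S: "q \<in> S" "r > 0" "z ` S = ball (z q) r" "isothermic_chart \<A> F (S, z) u"
        by (rule isothermic_chart_exists[OF leg nd Q spec[OF nz]])
      have cv: "convex (z ` S)" unfolding S(3) by simp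
      obtain k where k: "\<And>\<zeta>. \<zeta> \<in> z ` S \<Longrightarrow> (pd 1 (pd 1 (\<lambda>\<zeta>. u (inv_into S z \<zeta>))) \<zeta> + pd \<i> (pd \<i> (\<lambda>\<zeta>. u (inv_into S z \<zeta>))) \<zeta>) * (exp (u (inv_into S z \<zeta>)))\<^sup>2 = k"
        by (rule isothermic_liouville[OF Q S(4) cv]) blast
      show ?thesis by (rule T_transform_of_liouville[OF leg nd spec[OF nz] S k])
    qed
    then show ?thesis unfolding locally_T_transform_of_L_minimal_isothermic_def by blast
  qed
next
  assume h: "L_minimal \<A> UNIV F \<or> locally_T_transform_of_L_minimal_isothermic \<A> F"
  have loc: "\<exists>V. q \<in> V \<and> open V \<and> (\<forall>U z. complex_chart \<A> F (U, z) \<longrightarrow> (\<lambda>\<zeta>. Q_diff \<A> F z (inv_into U z \<zeta>) 1) holomorphic_on z ` (U \<inter> V))" for q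
    using h
  proof
    assume L: "L_minimal \<A> UNIV F"
    obtain V z r A l p1 p2 p3 q1 q2 where V: "q \<in> V"
      and m: "middle_frame \<A> (V, z) F A (\<lambda>x w. Re (l x * w)) (\<lambda>x w. Im (l x * w)) p1 p2 p3 q1 q2"
      by (rule conformal_frame_exists[OF leg nd])
    have "p1 x + p3 x = 0" if "x \<in> V" for x using invariants_eval(1)[OF surf m that] L by (simp add: L_minimal_def)
    then show ?thesis using Q_diff_holomorphic_of_P_zero[OF m m refl refl] V charts_open[OF surf middle_frame_charts[OF surf m]] by blast
  next
    assume "locally_T_transform_of_L_minimal_isothermic \<A> F"
    then obtain S F' z u where S: "q \<in> S" "open S" "L_minimal \<A> S F'" and i: "isothermic_chart \<A> F (S, z) u" "isothermic_chart \<A> F' (S, z) u"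
      unfolding locally_T_transform_of_L_minimal_isothermic_def T_transforms_def by blast
    obtain A p1 p2 p3 q1 q2 where m: "middle_frame \<A> (S, z) F A (\<lambda>x w. exp (u x) * Re w) (\<lambda>x w. exp (u x) * Im w) p1 p2 p3 q1 q2"
      by (rule isothermic_frame[OF i(1)])
    obtain A' p1' p2' p3' q1' q2' where m': "middle_frame \<A> (S, z) F' A' (\<lambda>x w. exp (u x) * Re w) (\<lambda>x w. exp (u x) * Im w) p1' p2' p3' q1' q2'"
      by (rule isothermic_frame[OF i(2)])
    note I = isothermic_frame_invariants[OF m] and I' = isothermic_frame_invariants[OF m']
    have "p2' x = p2 x" if "x \<in> S" for x using I(2)[OF that] I'(2)[OF that] by simp
    moreover have "p1' x - p3' x = p1 x - p3 x" if "x \<in> S" for x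
    proof -
      \<comment> \<open>Equal potentials have equal Laplacians, and these determine p3 - p1.\<close>
      have "(p3 x - p1 x) * (exp (u x))\<^sup>2 = (p3' x - p1' x) * (exp (u x))\<^sup>2" using I(3)[OF that] I'(3)[OF that] by (rule trans[OF sym])
      then show ?thesis by simp
    qed
    moreover have "p1' x + p3' x = 0" if "x \<in> S" for x using invariants_eval(1)[OF surf m' that] S(3) that by (simp add: L_minimal_def)
    ultimately show ?thesis using Q_diff_holomorphic_of_P_zero[OF m m'] S(1,2) by blast
  qed
  show "Q_holomorphic \<A> F"
    unfolding Q_holomorphic_def
  proof (intro allI impI)
    fix U z assume cc: "complex_chart \<A> F (U, z)"
    then have c: "(U, z) \<in> charts \<A>" by (simp add: complex_chart_def)
    have oz: "open (z ` U)" using charts_open_image[OF surf c charts_open[OF surf c]] by simp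
    show "(\<lambda>\<zeta>. Q_diff \<A> F z (inv_into U z \<zeta>) 1) holomorphic_on z ` U"
      unfolding holomorphic_on_def
    proof
      fix \<zeta> assume "\<zeta> \<in> z ` U"
      then obtain q where q: "q \<in> U" "\<zeta> = z q" by blast
      obtain V where V: "q \<in> V" "open V" "(\<lambda>\<zeta>. Q_diff \<A> F z (inv_into U z \<zeta>) 1) holomorphic_on z ` (U \<inter> V)" using loc cc by blast
      have oV: "open (z ` (U \<inter> V))" by (rule charts_open_image[OF surf c]) (use V(2) charts_open[OF surf c] in auto)
      have "(\<lambda>\<zeta>. Q_diff \<A> F z (inv_into U z \<zeta>) 1) field_differentiable (at \<zeta>)"
        by (rule holomorphic_on_imp_differentiable_at[OF V(3) oV]) (use q V(1) in blast)
      then show "(\<lambda>\<zeta>. Q_diff \<A> F z (inv_into U z \<zeta>) 1) field_differentiable (at \<zeta> within z ` U)"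
        by (rule field_differentiable_at_within)
    qed
  qed
qed

text \<open>The differential is a definite description in an arbitrary chart \<open>z\<close>, so a
  middle frame has to be rewritten in \<open>z\<close> before it can be evaluated.\<close>

lemma L_minimal_P_vanishes:
  assumes leg: "legendre_immersion \<A> UNIV F" and nd: "nondegenerate \<A> UNIV F" and L: "L_minimal \<A> UNIV F"
  shows "P_vanishes \<A> F"
  unfolding P_vanishes_def
proof (clarify)
  fix U z q w assume c: "(U, z) \<in> charts \<A>" and q: "q \<in> U"
  obtain V z' r A l p1 p2 p3 q1 q2 where V: "q \<in> V"
    and m: "middle_frame \<A> (V, z') F A (\<lambda>x w. Re (l x * w)) (\<lambda>x w. Im (l x * w)) p1 p2 p3 q1 q2"
    by (rule conformal_frame_exists[OF leg nd])
  have "open (U \<inter> V)" using charts_open[OF surf c] charts_open[OF surf middle_frame_charts[OF surf m]] by blast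
  then have cX: "(U \<inter> V, z) \<in> charts \<A>" by (rule chart_restrict[OF surf c]) simp
  have "q \<in> U \<inter> V" using q V by simp
  note e = invariants_eval[OF surf middle_frame_change[OF surf m cX Int_lower2] this]
  have "p1 q + p3 q = 0" using e(1) L by (simp add: L_minimal_def)
  then show "P_diff \<A> F z q w = 0" unfolding e(4) by (simp only: of_real_0 mult_zero_left)
qed

end

theorem theoremA:
  fixes \<A> :: "'m::{t2_space, second_countable_topology} chart set"
    and F :: "'m \<Rightarrow> (real^3) \<times> (real^3)"
  assumes "smooth_surface \<A>"
    and "connected (UNIV :: 'm set)"
    and "legendre_immersion \<A> UNIV F"
    and "nondegenerate \<A> UNIV F"
  shows "(Q_holomorphic \<A> F \<longleftrightarrow>
            L_minimal \<A> UNIV F \<or> locally_T_transform_of_L_minimal_isothermic \<A> F) \<and>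
         (L_minimal \<A> UNIV F \<longrightarrow> P_vanishes \<A> F)"
  using Q_holomorphic_iff[OF assms] L_minimal_P_vanishes[OF assms(1,3,4)] by blast

end
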